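(* Let $G=G(\mathcal V,\mathcal E)$ and $G'=G(\mathcal V',\mathcal E')$ be finite strongly connected directed graphs, not cycles, each of which satisfies the following two conditions (written for $G$): $\mathcal S(MD(G))$ is a Dyck inverse monoid (i.e. $G(\mathcal V,\mathcal F_G)$ is a tree), and there is an $e\in\mathcal E\setminus\mathcal F_G$ such that $$\Delta^{(e)}=\nu(MD(G))-1 .$$ If the Markov-Dyck shifts $MD(G)$ and $MD(G')$ are topologically conjugate, then the graphs $G$ and $G'$ are isomorphic.
   Context: Graphs are finite directed graphs $G=G(\mathcal V,\mathcal E)$ (loops and multiple edges allowed) with source map $s$ and target map $t$. $\mathbb N=\{1,2,\dots\}$. Graph inverse semigroup $\mathcal S(G)$: the semigroup with zero generated by $\mathbf 1_V$ ($V\in\mathcal V$), $e^-,e^+$ ($e\in\mathcal E$), with relations $\mathbf 1_V^2=\mathbf 1_V$, $\mathbf 1_U\mathbf 1_W=0$ for $U\ne W$, $f^-f^+=\mathbf 1_{s(f)}$, $f^-g^+=0$ for $f\neq g$, $\mathbf 1_{s(f)}f^-=f^-=f^-\mathbf 1_{t(f)}$, $\mathbf 1_{t(f)}f^+=f^+=f^+\mathbf 1_{s(f)}$. For the graph with one vertex and $N>1$ loops this is the Dyck inverse monoid $\mathcal D_N$. Markov-Dyck shift $MD(G)$: the subshift with alphabet $\{e^-,e^+:e\in\mathcal E\}$ in which a word is admissible precisely if its product in $\mathcal S(G)$ is not $0$. A topological conjugacy is a shift-commuting homeomorphism. $\mathcal F_G$ is the set of edges that are the only incoming edge of their target vertex;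 $\mathcal R_G$ is the set of vertices with at least two incoming edges. $G(\mathcal V,\mathcal F_G)$ is a disjoint union of directed trees with set of roots $\mathcal R_G$. $\widehat G$ is the graph with vertex set $\mathcal R_G$ obtained by contracting each of these trees to its root; its edges are $\widehat e$, $e\in\mathcal E\setminus\mathcal F_G$, with $t(\widehat e)=t(e)$ and $s(\widehat e)$ the root of the tree containing $s(e)$. The semigroup that is invariantly associated to $MD(G)$ is $\mathcal S(MD(G))=\mathcal S(\widehat G)$; it is a Dyck inverse monoid precisely if $G(\mathcal V,\mathcal F_G)$ is a tree, and then it is $\mathcal D_\nu$ with $\nu=\nu(MD(G))=\operatorname{card}(\mathcal E\setminus\mathcal F_G)$. Let $G(\mathcal V,\mathcal F_G)$ be a tree. For a symbol put $\widehat{e^\pm}=\widehat e^{\,\pm}\in\mathcal D_\nu$ if $e\in\mathcal E\setminus\mathcal F_G$, and $\widehat{f^{\pm}}=\mathbf 1$ if $f\in\mathcal F_G$. For $e\in\mathcal E\setminus\mathcal F_G$, a periodic point $p$ of $MD(G)$ of least period $k$ (and its orbit, of length $k$) has negative multiplier $\widehat e$ if $\prod_{i\le j<i+k}\widehat{p_j}=(\widehat e^{\,-})^M$ for some $i\in\mathbb Z$ and $M\in\mathbb N$. $I^{(e)}_k$ is the number of periodic orbits of length $k$ of $MD(G)$ with negative multiplier $\widehat e$, $\Lambda^{(e)}=\min\{k\in\mathbb N: I^{(e)}_k>0\}$, and $\Delta^{(e)}=I^{(e)}_{\Lambda^{(e)}+2}-\Lambda^{(e)}$. *)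

theory Defs
  imports
    "HOL-Analysis.Function_Topology"
    "Graph_Theory.Graph_Theory"
begin

text \<open>
  Finite directed graphs with loops and multiple edges are the locale \<^locale>\<open>fin_digraph\<close>;
  source and target maps are \<^const>\<open>tail\<close> and \<^const>\<open>head\<close>.
\<close>

definition is_cycle_graph :: "('v, 'e) pre_digraph \<Rightarrow> bool" where
  "is_cycle_graph G \<longleftrightarrow>
     (\<exists>p. pre_digraph.cycle G p \<and> arcs G = set p \<and> verts G = head G ` set p)"

definition rooted_directed_tree :: "('v, 'e) pre_digraph \<Rightarrow> bool" where
  "rooted_directed_tree T \<longleftrightarrow>
     wf_digraph T \<and> (\<exists>r\<in>verts T. \<forall>v\<in>verts T. \<exists>!p. pre_digraph.awalk T r p v)"


section \<open>Graph inverse semigroups\<close>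

datatype 'e signed_arc = Minus 'e | Plus 'e

definition signed_arcs :: "('v, 'e) pre_digraph \<Rightarrow> 'e signed_arc set" where
  "signed_arcs G = Minus ` arcs G \<union> Plus ` arcs G"

text \<open>
  \<open>S(G)\<close> is given by its presentation. Its elements are the classes of nonempty words over
  \<open>gis_generators G\<close> modulo \<open>gis_eq G\<close>, and its product is induced by concatenation. The zero is
  adjoined as an extra generator together with the absorption relations.
\<close>

datatype ('v, 'e) generator = Zero | Idem 'v | Arc "'e signed_arc"

definition gis_generators :: "('v, 'e) pre_digraph \<Rightarrow> ('v, 'e) generator set" where
  "gis_generators G = {Zero} \<union> Idem ` verts G \<union> Arc ` signed_arcs G"

inductive gis_relation ::
  "('v, 'e) pre_digraph \<Rightarrow> ('v, 'e) generator list \<Rightarrow> ('v, 'e) generator list \<Rightarrow> bool"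
  for G where
  zero_left:  "x \<in> gis_generators G \<Longrightarrow> gis_relation G [Zero, x] [Zero]"
| zero_right: "x \<in> gis_generators G \<Longrightarrow> gis_relation G [x, Zero] [Zero]"
| idem: "V \<in> verts G \<Longrightarrow> gis_relation G [Idem V, Idem V] [Idem V]"
| idem_orth: "U \<in> verts G \<Longrightarrow> W \<in> verts G \<Longrightarrow> U \<noteq> W \<Longrightarrow> gis_relation G [Idem U, Idem W] [Zero]"
| minus_plus: "f \<in> arcs G \<Longrightarrow>
    gis_relation G [Arc (Minus f), Arc (Plus f)] [Idem (tail G f)]"
| minus_plus_orth: "f \<in> arcs G \<Longrightarrow> g \<in> arcs G \<Longrightarrow> f \<noteq> g \<Longrightarrow>
    gis_relation G [Arc (Minus f), Arc (Plus g)] [Zero]"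
| idem_minus: "f \<in> arcs G \<Longrightarrow>
    gis_relation G [Idem (tail G f), Arc (Minus f)] [Arc (Minus f)]"
| minus_idem: "f \<in> arcs G \<Longrightarrow>
    gis_relation G [Arc (Minus f), Idem (head G f)] [Arc (Minus f)]"
| idem_plus: "f \<in> arcs G \<Longrightarrow>
    gis_relation G [Idem (head G f), Arc (Plus f)] [Arc (Plus f)]"
| plus_idem: "f \<in> arcs G \<Longrightarrow>
    gis_relation G [Arc (Plus f), Idem (tail G f)] [Arc (Plus f)]"

inductive gis_step ::
  "('v, 'e) pre_digraph \<Rightarrow> ('v, 'e) generator list \<Rightarrow> ('v, 'e) generator list \<Rightarrow> bool"
  for G where
  "gis_relation G l r \<Longrightarrow> gis_step G (x @ l @ y) (x @ r @ y)"

text \<open>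
  \<open>gis_eq G u v\<close>: the words \<open>u\<close> and \<open>v\<close> have the same product in \<open>S(G)\<close>. This is the congruence
  generated by the defining relations.
\<close>

definition gis_eq ::
  "('v, 'e) pre_digraph \<Rightarrow> ('v, 'e) generator list \<Rightarrow> ('v, 'e) generator list \<Rightarrow> bool" where
  "gis_eq G = equivclp (gis_step G)"


section \<open>Markov-Dyck shifts\<close>

definition shift :: "(int \<Rightarrow> 'a) \<Rightarrow> int \<Rightarrow> 'a" where
  "shift x = (\<lambda>i. x (i + 1))"

definition subshift_topology :: "(int \<Rightarrow> 'a) set \<Rightarrow> (int \<Rightarrow> 'a) topology" where
  "subshift_topology X = subtopology (product_topology (\<lambda>_. discrete_topology UNIV) UNIV) X"

definition topologically_conjugate :: "(int \<Rightarrow> 'a) set \<Rightarrow> (int \<Rightarrow> 'b) set \<Rightarrow> bool" where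
  "topologically_conjugate X Y \<longleftrightarrow>
     (\<exists>\<phi>. homeomorphic_map (subshift_topology X) (subshift_topology Y) \<phi> \<and>
          (\<forall>x\<in>X. \<phi> (shift x) = shift (\<phi> x)))"

definition admissible :: "('v, 'e) pre_digraph \<Rightarrow> 'e signed_arc list \<Rightarrow> bool" where
  "admissible G w \<longleftrightarrow> \<not> gis_eq G (map Arc w) [Zero]"

definition markov_dyck :: "('v, 'e) pre_digraph \<Rightarrow> (int \<Rightarrow> 'e signed_arc) set" where
  "markov_dyck G = {x. range x \<subseteq> signed_arcs G \<and> (\<forall>i j. admissible G (map x [i..j]))}"


section \<open>The contracted graph\<close>

definition sole_arcs :: "('v, 'e) pre_digraph \<Rightarrow> 'e set" (\<open>\<F>\<close>) where
  "\<F> G = {e \<in> arcs G. in_arcs G (head G e) = {e}}"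

definition branch_verts :: "('v, 'e) pre_digraph \<Rightarrow> 'v set" (\<open>\<R>\<close>) where
  "\<R> G = {v \<in> verts G. 2 \<le> in_degree G v}"

definition sole_subgraph :: "('v, 'e) pre_digraph \<Rightarrow> ('v, 'e) pre_digraph" where
  "sole_subgraph G = \<lparr>verts = verts G, arcs = \<F> G, tail = tail G, head = head G\<rparr>"

definition tree_root :: "('v, 'e) pre_digraph \<Rightarrow> 'v \<Rightarrow> 'v" where
  "tree_root G v = (THE r. r \<in> \<R> G \<and> r \<rightarrow>\<^sup>*\<^bsub>sole_subgraph G\<^esub> v)"

text \<open>The edge of the contracted graph that comes from \<open>e\<close> is again called \<open>e\<close>.\<close>

definition hat_graph :: "('v, 'e) pre_digraph \<Rightarrow> ('v, 'e) pre_digraph" where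
  "hat_graph G =
     \<lparr>verts = \<R> G, arcs = arcs G - \<F> G, tail = (\<lambda>e. tree_root G (tail G e)), head = head G\<rparr>"

definition nu :: "('v, 'e) pre_digraph \<Rightarrow> nat" where
  "nu G = card (arcs G - \<F> G)"


section \<open>Multipliers of periodic orbits\<close>

text \<open>
  If \<open>sole_subgraph G\<close> is a tree, then \<open>hat_graph G\<close> has a single vertex and \<open>nu G\<close> loops,
  \<open>S(hat_graph G)\<close> is the Dyck inverse monoid on \<open>nu G\<close> generators, and the idempotent at the
  single vertex, to which \<open>f\<^sup>\<plusminus>\<close> is sent for \<open>f \<in> \<F> G\<close>, is its unit.
\<close>

fun hat_symbol :: "('v, 'e) pre_digraph \<Rightarrow> 'e signed_arc \<Rightarrow> ('v, 'e) generator" where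
  "hat_symbol G (Minus e) = (if e \<in> \<F> G then Idem (tree_root G (tail G e)) else Arc (Minus e))"
| "hat_symbol G (Plus e) = (if e \<in> \<F> G then Idem (tree_root G (tail G e)) else Arc (Plus e))"

definition least_period :: "(int \<Rightarrow> 'a) \<Rightarrow> nat \<Rightarrow> bool" where
  "least_period p k \<longleftrightarrow>
     0 < k \<and> (shift ^^ k) p = p \<and> (\<forall>j. 0 < j \<and> j < k \<longrightarrow> (shift ^^ j) p \<noteq> p)"

text \<open>To be used for points \<open>p\<close> of least period \<open>k\<close>.\<close>

definition has_negative_multiplier ::
  "('v, 'e) pre_digraph \<Rightarrow> 'e \<Rightarrow> (int \<Rightarrow> 'e signed_arc) \<Rightarrow> nat \<Rightarrow> bool" where
  "has_negative_multiplier G e p k \<longleftrightarrow>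
     (\<exists>(i::int) (M::nat). 1 \<le> M \<and>
        gis_eq (hat_graph G) (map (\<lambda>j. hat_symbol G (p j)) [i..i + int k - 1])
          (replicate M (Arc (Minus e))))"

definition shift_orbit :: "(int \<Rightarrow> 'a) \<Rightarrow> (int \<Rightarrow> 'a) set" where
  "shift_orbit p = {(shift ^^ n) p | n. True}"

definition orbit_count :: "('v, 'e) pre_digraph \<Rightarrow> 'e \<Rightarrow> nat \<Rightarrow> nat" where
  "orbit_count G e k =
     card (shift_orbit ` {p \<in> markov_dyck G. least_period p k \<and> has_negative_multiplier G e p k})"

definition Lambda :: "('v, 'e) pre_digraph \<Rightarrow> 'e \<Rightarrow> nat" where
  "Lambda G e = (LEAST k. 1 \<le> k \<and> 0 < orbit_count G e k)"

definition Delta :: "('v, 'e) pre_digraph \<Rightarrow> 'e \<Rightarrow> int" where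
  "Delta G e = int (orbit_count G e (Lambda G e + 2)) - int (Lambda G e)"

end

theory Submission
  imports Defs "HOL-Computational_Algebra.Formal_Power_Series"
begin

text \<open>
  Reading \<open>Minus f\<close> as pushing and \<open>Plus f\<close> as popping \<open>f\<close>, a periodic point that pushes more than
  it pops leaves behind a periodic bi-infinite path of symbols that are never popped. There is a
  heteroclinic connection from such a point to the periodic point that pops a given path forever
  only if that path is the one left behind, up to a shift, whereas the other periodic points connect
  to all periodic points. Hence a conjugacy preserves the partition of the periodic points by these
  paths. The number of points of each period in a class determines the product, along the path, of the
  generating functions that count the balanced words (those with \<open>reduce w = Some ([], [])\<close>) at its
  vertices. When the sole arcs form a tree with root \<open>r\<close>, the closed paths are products of the circuits through \<open>r\<close>,
  one for each remaining arc, so the lengths and weights of these circuits are invariants.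

  The equation \<open>\<Delta> = \<nu> - 1\<close> says that every vertex off the circuit of \<open>e\<close> has out-degree one. Then \<open>G\<close> is
  determined by the length of each circuit and the level at which it leaves that of \<open>e\<close>. The
  weights determine these levels up to a common translation, and the number of arcs, which can be read
  off the points of period 2, fixes the translation.
\<close>

section \<open>Reduction of signed words\<close>

text \<open>A conjugacy need not respect symbols, so pushes and pops have to be recognised from the
  dynamics alone. A point that ends by popping \<open>z\<close> forever must, after finitely many
  symbols, pop what its left tail has stacked; as the popping never ends, \<open>z\<close> is that
  stack up to a shift. For the weights, a periodic point is cut at its pushes that are never popped;
  between them lie balanced words. A point whose stack runs \<open>M\<close> times through the path
  contributes to the \<open>M\<close>-th power of the path weight. At a given period the powers with
  \<open>M > 1\<close> involve only lower coefficients, so the coefficients are found one by one.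
  \<open>Delta\<close> is the sum of out-degree minus one along the circuit of \<open>e\<close>, and
  \<open>nu - 1\<close> is this sum over all vertices. A translation of the levels escapes the
  weights: one vertex more before the first branching and one less at the end of every circuit leave
  the factors of each weight unchanged, as vertices of out-degree one carry iterates of
  \<open>pass_fps\<close> in both places. The number of arcs does change, since the initial stretch
  is shared and the ends are not.\<close>

fun sym_tail :: "('v, 'e) pre_digraph \<Rightarrow> 'e signed_arc \<Rightarrow> 'v" where
  "sym_tail G (Minus f) = tail G f"
| "sym_tail G (Plus f) = head G f"

text \<open>A pop traverses its arc backwards, in accordance with the idempotents that the relations
  attach to the two sides of \<open>Plus f\<close>.\<close>

fun sym_head :: "('v, 'e) pre_digraph \<Rightarrow> 'e signed_arc \<Rightarrow> 'v" where
  "sym_head G (Minus f) = head G f"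
| "sym_head G (Plus f) = tail G f"

fun swalk :: "('v, 'e) pre_digraph \<Rightarrow> 'v \<Rightarrow> 'e signed_arc list \<Rightarrow> 'v \<Rightarrow> bool" where
  "swalk G u [] v \<longleftrightarrow> u = v"
| "swalk G u (a # w) v \<longleftrightarrow> sym_tail G a = u \<and> swalk G (sym_head G a) w v"

text \<open>
  A word is read as a sequence of stack operations: \<open>Minus f\<close> pushes \<open>f\<close> and \<open>Plus f\<close> pops \<open>f\<close>.
  If \<open>reduce w = Some (p, q)\<close>, then \<open>w\<close> pops \<open>p\<close> (top first) off the initial stack and leaves
  \<open>q\<close> (top first) in its place; in other words, its normal form is \<open>p\<^sup>+ (rev q)\<^sup>-\<close>.
\<close>

fun reduce :: "'e signed_arc list \<Rightarrow> ('e list \<times> 'e list) option" where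
  "reduce [] = Some ([], [])"
| "reduce (Plus f # w) = (case reduce w of None \<Rightarrow> None | Some (p, q) \<Rightarrow> Some (f # p, q))"
| "reduce (Minus f # w) = (case reduce w of None \<Rightarrow> None
     | Some ([], q) \<Rightarrow> Some ([], q @ [f])
     | Some (g # p, q) \<Rightarrow> if f = g then Some (p, q) else None)"

text \<open>Multiplication of normal forms: the stack of the first factor meets the demand of the
  second, and the product is nonzero only if one of the two is a prefix of the other.\<close>

definition push_red :: "'e list \<times> 'e list \<Rightarrow> 'e list \<times> 'e list \<Rightarrow> ('e list \<times> 'e list) option" where
  "push_red = (\<lambda>(p, q) (p', q').
     if length p' \<le> length q then (if take (length p') q = p' then Some (p, q' @ drop (length p') q) else None)
     else (if take (length q) p' = q then Some (p @ drop (length q) p', q') else None))"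

lemma swalk_append [simp]: "swalk G u (w @ w') v \<longleftrightarrow> (\<exists>m. swalk G u w m \<and> swalk G m w' v)"
  by (induction w arbitrary: u) auto

text \<open>\<open>reduce\<close> consumes a word from one side only; multiplicativity makes it
  independent of the way in which the word is cut, and all later arguments cut words.\<close>

lemma reduce_append:
  "reduce (w @ w') = (case reduce w of None \<Rightarrow> None | Some x \<Rightarrow>
      (case reduce w' of None \<Rightarrow> None | Some y \<Rightarrow> push_red x y))"
proof (induction w rule: reduce.induct)
  case 1
  then show ?case by (auto simp: push_red_def split: option.splits)
next
  case (2 f w)
  then show ?case by (auto simp: push_red_def split: option.splits)
next
  case (3 f w)
  show ?case
  proof (cases "reduce w'")
    case None
    then show ?thesis using 3 by (auto split: option.splits)
  next
    case w': (Some y)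
    obtain p' q' where y: "y = (p', q')" by (cases y)
    show ?thesis
    proof (cases "reduce w")
      case None
      then show ?thesis using 3 w' by (auto split: option.splits)
    next
      case (Some x)
      obtain p q where x: "x = (p, q)" by (cases x)
      show ?thesis
      proof (cases p)
        case (Cons g p1)
        then show ?thesis using 3 w' Some x y by (auto simp: push_red_def)
      next
        case Nil
        show ?thesis
        proof (cases "length p' \<le> length q")
          case True
          then show ?thesis using 3 w' Some x y Nil by (auto simp: push_red_def)
        next
          case False
          \<comment> \<open>The new push \<open>f\<close> lies at the bottom of the stack
            \<open>q @ [f]\<close>, so it meets the first demand \<open>g\<close> that
            \<open>q\<close> leaves open.\<close>
          then obtain g r where gr: "drop (length q) p' = g # r"
            by (metis drop_eq_Nil list.exhaust)
          then have len: "length p' = length q + Suc (length r)"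
            by (metis False add_diff_inverse_nat length_drop length_Cons less_or_eq_imp_le)
          have p': "p' = take (length q) p' @ g # r" using gr by (metis append_take_drop_id)
          have tk: "take (Suc (length q)) p' = take (length q) p' @ [g]"
            using p' len by (metis gr hd_drop_conv_nth list.sel(1)
                less_add_same_cancel1 take_Suc_conv_app_nth zero_less_Suc)
          have dr: "drop (Suc (length q)) p' = r" using gr
            by (metis drop_Suc list.sel(3) tl_drop)
          show ?thesis
            using 3 w' Some x y Nil False gr tk dr len
            by (auto simp: push_red_def)
        qed
      qed
    qed
  qed
qed

lemma reduce_append_eq_Some:
  assumes "reduce (w @ w') = Some z"
  obtains x y where "reduce w = Some x" "reduce w' = Some y" "push_red x y = Some z"
  using assms by (auto simp: reduce_append split: option.splits)

lemma reduce_append_NoneI: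
  "reduce w = None \<or> reduce w' = None \<Longrightarrow> reduce (w @ w') = None"
  by (auto simp: reduce_append split: option.splits)

lemma push_red_Nil_right [simp]: "push_red (p, q) ([], q') = Some (p, q' @ q)"
  by (simp add: push_red_def)

lemma push_red_Nil_left [simp]: "push_red (p, []) (p', q') = Some (p @ p', q')"
  by (auto simp: push_red_def)

lemma push_red_same [simp]: "push_red (p, q @ r) (q, q') = Some (p, q' @ r)"
  by (simp add: push_red_def)

lemma push_redE:
  assumes "push_red (p, q) (p', q') = Some z"
  obtains r where "q = p' @ r" "z = (p, q' @ r)" | r where "p' = q @ r" "z = (p @ r, q')"
  using assms that
  by (auto simp: push_red_def split: if_splits) (metis append_take_drop_id)+

lemma reduce_map_Minus [simp]: "reduce (map Minus y) = Some ([], rev y)"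
  by (induction y) auto

lemma reduce_map_Plus [simp]: "reduce (map Plus y) = Some (y, [])"
  by (induction y) auto

text \<open>Cut at the first pop that reaches below the initial stack. After an opening push of
  \<open>g\<close> the rest demands \<open>g\<close> before \<open>f\<close>, so two cuts are made,
  the second in a shorter suffix; hence the induction on the length.\<close>

lemma reduce_demand_split:
  assumes "reduce w = Some (f # p, q)"
  shows "\<exists>u w'. w = u @ Plus f # w' \<and> reduce u = Some ([], []) \<and> reduce w' = Some (p, q)"
  using assms
proof (induction "length w" arbitrary: w f p rule: less_induct)
  case less
  show ?case
  proof (cases w)
    case Nil
    then show ?thesis using less.prems by simp
  next
    case (Cons a w1)
    show ?thesis
    proof (cases a)
      case (Plus g)
      then have "g = f" "reduce w1 = Some (p, q)"
        using less.prems Cons by (auto split: option.splits)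
      then show ?thesis using Cons Plus by (intro exI[of _ "[]"] exI[of _ w1]) auto
    next
      case (Minus g)
      then have "reduce w1 = Some (g # f # p, q)"
        using less.prems Cons by (auto split: option.splits list.splits if_splits)
      then obtain u1 w2 where 1: "w1 = u1 @ Plus g # w2" "reduce u1 = Some ([], [])"
        "reduce w2 = Some (f # p, q)"
        using less.hyps[of w1] Cons by auto
      then obtain u2 w3 where 2: "w2 = u2 @ Plus f # w3" "reduce u2 = Some ([], [])"
        "reduce w3 = Some (p, q)"
        using less.hyps[of w2] Cons by auto
      show ?thesis using 1 2 Cons Minus
        by (intro exI[of _ "Minus g # u1 @ Plus g # u2"] exI[of _ w3]) (auto simp: reduce_append)
    qed
  qed
qed

text \<open>The bottom symbol of the final stack is the earliest surviving push: everything pushed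
  before it has been popped, and nothing after it reaches below it.\<close>

lemma reduce_stack_split:
  assumes "reduce w = Some (p, q @ [y])"
  shows "\<exists>u w'. w = u @ Minus y # w' \<and> reduce u = Some (p, []) \<and> reduce w' = Some ([], q)"
  using assms
proof (induction w arbitrary: p)
  case Nil
  then show ?case by simp
next
  case (Cons a w1)
  show ?case
  proof (cases a)
    case (Plus g)
    then obtain p' where "p = g # p'" "reduce w1 = Some (p', q @ [y])"
      using Cons.prems by (auto split: option.splits)
    then show ?thesis using Cons.IH[of p'] Plus
      by (metis append_Cons reduce.simps(2) option.simps(5) case_prod_conv)
  next
    case (Minus g)
    obtain p1 q1 where w1: "reduce w1 = Some (p1, q1)"
      using Cons.prems Minus by (auto split: option.splits)
    show ?thesis
    proof (cases p1)
      case Nil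
      then have "p = []" "q1 = q" "g = y" using Cons.prems Minus w1 by auto
      then show ?thesis using w1 Nil Minus by (intro exI[of _ "[]"] exI[of _ w1]) auto
    next
      case (Cons h p2)
      then have h: "h = g" "p2 = p" "q1 = q @ [y]" using Cons.prems Minus w1
        by (auto split: if_splits)
      obtain u w' where "w1 = u @ Minus y # w'" "reduce u = Some (g # p, [])" "reduce w' = Some ([], q)"
        using Cons.IH[of "g # p"] w1 Cons h by blast
      then show ?thesis using Minus by (intro exI[of _ "Minus g # u"] exI[of _ w']) auto
    qed
  qed
qed

text \<open>A word that leaves a path on the stack can be cut anywhere along this path. Stacks are
  listed from the top, paths from their start, which explains \<open>rev\<close> here and
  below.\<close>

lemma reduce_stack_split_list:
  assumes "reduce w = Some ([], rev (as @ bs))"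
  shows "\<exists>u w'. w = u @ w' \<and> reduce u = Some ([], rev as) \<and> reduce w' = Some ([], rev bs)"
  using assms
proof (induction as arbitrary: w)
  case Nil
  then show ?case by (intro exI[of _ "[]"] exI[of _ w]) auto
next
  case (Cons a as)
  then obtain u w' where 1: "w = u @ Minus a # w'" "reduce u = Some ([], [])"
    "reduce w' = Some ([], rev (as @ bs))"
    using reduce_stack_split[of w "[]" "rev (as @ bs)" a] by auto
  then obtain u' w'' where "w' = u' @ w''" "reduce u' = Some ([], rev as)" "reduce w'' = Some ([], rev bs)"
    using Cons.IH by blast
  then show ?case using 1 by (intro exI[of _ "u @ Minus a # u'"] exI[of _ w'']) (auto simp: reduce_append)
qed

lemma reduce_prefix_no_demand:
  assumes "reduce (w @ w') = Some ([], q)"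
  shows "\<exists>q'. reduce w = Some ([], q')"
  using assms by (auto elim!: reduce_append_eq_Some push_redE)

section \<open>Heights: pushes minus pops\<close>

definition height :: "'e signed_arc list \<Rightarrow> int" where
  "height w = sum_list (map (\<lambda>a. case a of Minus _ \<Rightarrow> 1 | Plus _ \<Rightarrow> -1) w)"

lemma height_simps [simp]:
  "height [] = 0" "height (Minus f # w) = 1 + height w" "height (Plus f # w) = height w - 1"
  "height (w @ w') = height w + height w'"
  by (auto simp: height_def)

lemma height_reduce: "reduce w = Some (p, q) \<Longrightarrow> height w = int (length q) - int (length p)"
  by (induction w arbitrary: p q rule: reduce.induct)
     (auto split: option.splits list.splits if_splits)

lemma height_parity: "even (height w + int (length w))"
  by (induction w rule: reduce.induct) auto

lemma height_le_length: "height w \<le> int (length w)"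
  by (induction w rule: reduce.induct) auto

lemma height_eq_length: "height w = int (length w) \<Longrightarrow> \<exists>y. w = map Minus y"
proof (induction w)
  case (Cons a w)
  show ?case
  proof (cases a)
    case (Minus f)
    then obtain y where "w = map Minus y" using Cons by auto
    then show ?thesis using Minus by (intro exI[of _ "f # y"]) auto
  next
    case (Plus f)
    then show ?thesis using Cons.prems height_le_length[of w] by simp
  qed
qed auto

text \<open>The first unmet pop would bring the height down to -1.\<close>

lemma reduce_no_demandI:
  assumes "reduce w \<noteq> None" "\<And>k. k \<le> length w \<Longrightarrow> height (take k w) \<ge> 0"
  shows "\<exists>q. reduce w = Some ([], q)"
proof (cases "reduce w")
  case (Some z)
  then obtain p q where pq: "reduce w = Some (p, q)" by (cases z) auto
  show ?thesis
  proof (cases p)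
    case (Cons f p')
    then obtain u w' where "w = u @ Plus f # w'" "reduce u = Some ([], [])"
      using reduce_demand_split[of w f p' q] pq by auto
    moreover from this have "height (take (Suc (length u)) w) = -1"
      by (simp add: height_reduce)
    ultimately show ?thesis using assms(2)[of "Suc (length u)"] by simp
  qed (use pq in auto)
qed (use assms in auto)

text \<open>A suffix that starts with a surviving push has positive height.\<close>

lemma reduce_no_stackI:
  assumes "reduce w \<noteq> None" "\<And>k. k \<le> length w \<Longrightarrow> height (drop k w) \<le> 0"
  shows "\<exists>p. reduce w = Some (p, [])"
proof (cases "reduce w")
  case (Some z)
  then obtain p q where pq: "reduce w = Some (p, q)" by (cases z) auto
  show ?thesis
  proof (cases q rule: rev_cases)
    case (snoc q' y)
    then obtain u w' where "w = u @ Minus y # w'" "reduce w' = Some ([], q')"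
      using reduce_stack_split[of w p q' y] pq by auto
    moreover from this have "height (drop (length u) w) > 0"
      by (simp add: height_reduce)
    ultimately show ?thesis using assms(2)[of "length u"] by simp
  qed (use pq in auto)
qed (use assms in auto)

text \<open>In normal form the walk retreats from \<open>v\<close> along \<open>p\<close> to
  \<open>u\<close> and then advances from \<open>u\<close> along \<open>rev q\<close>.\<close>

lemma reduce_paths:
  assumes "swalk G v w v'" "reduce w = Some (p, q)"
  shows "\<exists>u. pre_digraph.cas G u (rev p) v \<and> pre_digraph.cas G u (rev q) v'"
  using assms
proof (induction w arbitrary: v p q rule: reduce.induct)
  case 1
  then show ?case by (auto simp: pre_digraph.cas.simps)
next
  case (2 f w)
  then obtain p1 where p1: "p = f # p1" "reduce w = Some (p1, q)" by (auto split: option.splits)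
  then obtain u where u: "pre_digraph.cas G u (rev p1) (tail G f)" "pre_digraph.cas G u (rev q) v'"
    using 2 by auto
  have "pre_digraph.cas G u (r @ [f]) (head G f)" if "pre_digraph.cas G u r (tail G f)" for r
    using that by (induction r arbitrary: u) (auto simp: pre_digraph.cas.simps)
  then show ?case using 2 p1 u by auto
next
  case (3 f w)
  obtain p1 q1 where w: "reduce w = Some (p1, q1)" using 3 by (auto split: option.splits)
  then obtain u where u: "pre_digraph.cas G u (rev p1) (head G f)" "pre_digraph.cas G u (rev q1) v'"
    using 3 by auto
  show ?case
  proof (cases p1)
    case Nil
    then show ?thesis using 3 w u by (auto simp: pre_digraph.cas.simps)
  next
    case (Cons g p2)
    then have "g = f" "p2 = p" "q1 = q" using 3 w by (auto split: if_splits)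
    moreover have "pre_digraph.cas G u r (tail G f)" if "pre_digraph.cas G u (r @ [f]) (head G f)" for r
      using that by (induction r arbitrary: u) (auto simp: pre_digraph.cas.simps)
    ultimately show ?thesis using 3 u Cons by auto
  qed
qed

section \<open>Products in graph inverse semigroups\<close>

text \<open>A representation of the semigroup by partial maps on pairs of a vertex and a stack, with
  \<open>Zero\<close> nowhere defined. Its purpose is to separate words that are not equivalent, in
  particular from zero.\<close>

fun act_gen :: "('v, 'e) pre_digraph \<Rightarrow> ('v, 'e) generator \<Rightarrow> 'v \<times> 'e list \<Rightarrow> ('v \<times> 'e list) option" where
  "act_gen G Zero s = None"
| "act_gen G (Idem u) (v, S) = (if u = v then Some (v, S) else None)"
| "act_gen G (Arc (Minus f)) (v, S) = (if tail G f = v then Some (head G f, f # S) else None)"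
| "act_gen G (Arc (Plus f)) (v, S) =
     (case S of [] \<Rightarrow> None | g # S' \<Rightarrow> if f = g \<and> head G f = v then Some (tail G f, S') else None)"

fun act :: "('v, 'e) pre_digraph \<Rightarrow> ('v, 'e) generator list \<Rightarrow> 'v \<times> 'e list \<Rightarrow> ('v \<times> 'e list) option" where
  "act G [] s = Some s"
| "act G (a # w) s = (case act_gen G a s of None \<Rightarrow> None | Some s' \<Rightarrow> act G w s')"

lemma act_append: "act G (w @ w') s = (case act G w s of None \<Rightarrow> None | Some s' \<Rightarrow> act G w' s')"
  by (induction w arbitrary: s) (auto split: option.splits)

lemma act_gis_relation: "gis_relation G l r \<Longrightarrow> act G l s = act G r s"
proof (induction rule: gis_relation.induct)
  case (zero_right x)
  then show ?case by (auto split: option.splits)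
qed (cases s; auto split: option.splits list.splits)+

lemma act_gis_eq:
  assumes "gis_eq G u w" shows "act G u = act G w"
proof -
  have step: "act G u = act G w" if "gis_step G u w" for u w
    using that by (induction rule: gis_step.induct) (auto simp: fun_eq_iff act_append act_gis_relation split: option.split)
  have "equivclp (gis_step G) u w" using assms by (simp add: gis_eq_def)
  then show ?thesis
    by (induction rule: equivclp_induct) (auto dest: step)
qed

lemma act_swalk:
  assumes "swalk G v w v'" "reduce w = Some (p, q)"
  shows "act G (map Arc w) (v, p @ S) = Some (v', q @ S)"
  using assms
proof (induction w arbitrary: v p q S rule: reduce.induct)
  case (2 f w)
  then show ?case by (auto split: option.splits)
next
  case (3 f w)
  obtain p1 q1 where w: "reduce w = Some (p1, q1)" using 3 by (auto split: option.splits)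
  have run: "act G (map Arc w) (head G f, p1 @ S') = Some (v', q1 @ S')" for S'
    using 3 w by auto
  show ?case
  proof (cases p1)
    case Nil
    then show ?thesis using 3(2,3) w run[of "f # S"] by auto
  next
    case (Cons g p2)
    then show ?thesis using 3(2,3) w run[of S] by (auto split: if_splits)
  qed
qed auto

section \<open>Calculating with the congruence of the presentation\<close>

lemma gis_eq_refl [simp]: "gis_eq G u u"
  by (simp add: gis_eq_def)

lemma gis_eq_sym: "gis_eq G u v \<Longrightarrow> gis_eq G v u"
  by (simp add: gis_eq_def equivclp_sym)

lemma gis_eq_trans [trans]: "gis_eq G u v \<Longrightarrow> gis_eq G v w \<Longrightarrow> gis_eq G u w"
  unfolding gis_eq_def by (rule equivclp_trans)

lemma gis_eq_rel: "gis_relation G l r \<Longrightarrow> gis_eq G (x @ l @ y) (x @ r @ y)"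
  unfolding gis_eq_def by (intro r_into_equivclp gis_step.intros)

lemma gis_eq_context: "gis_eq G u v \<Longrightarrow> gis_eq G (x @ u @ y) (x @ v @ y)"
  unfolding gis_eq_def
proof (induction rule: equivclp_induct)
  case (step v w)
  have st: "gis_step G (x @ a @ y) (x @ b @ y)" if "gis_step G a b" for a b
    using that
  proof cases
    case (1 l r x' y')
    then show ?thesis using gis_step.intros[of G l r "x @ x'" "y' @ y"] by simp
  qed
  from step(2) have "equivclp (gis_step G) (x @ v @ y) (x @ w @ y)"
    by (metis r_into_equivclp converse_r_into_equivclp st)
  then show ?case using step(3) equivclp_trans by metis
qed simp

lemma gis_eq_append: "gis_eq G u u' \<Longrightarrow> gis_eq G v v' \<Longrightarrow> gis_eq G (u @ v) (u' @ v')"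
  by (metis append.right_neutral append_Nil gis_eq_context gis_eq_trans)

lemma gis_eq_Cons: "gis_eq G u v \<Longrightarrow> gis_eq G (a # u) (a # v)"
  using gis_eq_append[of G "[a]" "[a]"] by auto

lemma gis_eq_zero_left: "set x \<subseteq> gis_generators G \<Longrightarrow> gis_eq G (x @ [Zero]) [Zero]"
proof (induction x rule: rev_induct)
  case (snoc a x)
  have "gis_eq G (x @ [a, Zero] @ []) (x @ [Zero] @ [])"
    using snoc.prems by (intro gis_eq_rel zero_right) auto
  then show ?case using snoc gis_eq_trans by auto
qed auto

lemma gis_eq_zero_right: "set x \<subseteq> gis_generators G \<Longrightarrow> gis_eq G (Zero # x) [Zero]"
proof (induction x)
  case (Cons a x)
  have "gis_eq G ([] @ [Zero, a] @ x) ([] @ [Zero] @ x)"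
    using Cons.prems by (intro gis_eq_rel zero_left) auto
  then show ?case using Cons gis_eq_trans by auto
qed auto

lemma gis_eq_zero: "gis_eq G u [Zero] \<Longrightarrow> set x \<subseteq> gis_generators G \<Longrightarrow> set y \<subseteq> gis_generators G
    \<Longrightarrow> gis_eq G (x @ u @ y) [Zero]"
  using gis_eq_context[of G u "[Zero]" x y] gis_eq_zero_left[of x G] gis_eq_zero_right[of y G]
    gis_eq_append[of G "x @ [Zero]" "[Zero]" y y] gis_eq_trans
  by (metis append.assoc append_Cons append_Nil gis_eq_refl)

lemma Arc_in_generators: "set w \<subseteq> signed_arcs G \<Longrightarrow> set (map Arc w) \<subseteq> gis_generators G"
  by (auto simp: gis_generators_def)

lemma reduce_set:
  "reduce w = Some (p, q) \<Longrightarrow> set w \<subseteq> signed_arcs G \<Longrightarrow> set p \<subseteq> arcs G \<and> set q \<subseteq> arcs G"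
proof (induction w arbitrary: p q rule: reduce.induct)
  case (2 f w)
  then show ?case by (auto simp: signed_arcs_def split: option.splits)
next
  case (3 f w)
  then show ?case
    by (auto simp: signed_arcs_def split: option.splits list.splits if_splits) blast+
qed auto

text \<open>Elements are classes of nonempty words; the leading idempotent provides a nonempty word
  also for \<open>([], [])\<close>.\<close>

definition normal_form :: "'v \<Rightarrow> 'e list \<times> 'e list \<Rightarrow> ('v, 'e) generator list" where
  "normal_form v = (\<lambda>(p, q). Idem v # map (Arc \<circ> Plus) p @ map (Arc \<circ> Minus) (rev q))"

lemma sym_idem:
  assumes "a \<in> signed_arcs G"
  shows "gis_eq G (x @ [Arc a, Idem (sym_head G a)] @ y) (x @ [Arc a] @ y)"
    "gis_eq G (x @ [Idem (sym_tail G a), Arc a] @ y) (x @ [Arc a] @ y)"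
  using assms by (cases a; auto intro!: gis_eq_rel gis_relation.intros simp: signed_arcs_def
      simp del: append_Cons append_Nil)+

context wf_digraph
begin

lemma sym_in_verts: "a \<in> signed_arcs G \<Longrightarrow> sym_tail G a \<in> verts G \<and> sym_head G a \<in> verts G"
  by (auto simp: signed_arcs_def)

text \<open>The new symbol absorbs the idempotent of the rest and brings in its own. Only a push in
  front of a nonempty demand calls for the relations between \<open>Minus f\<close> and
  \<open>Plus g\<close>.\<close>

lemma gis_eq_normal_form:
  assumes "set w \<subseteq> signed_arcs G" "w \<noteq> []" "swalk G v w v'"
  shows "gis_eq G (map Arc w) (case reduce w of None \<Rightarrow> [Zero] | Some z \<Rightarrow> normal_form v z)"
  using assms
proof (induction w arbitrary: v)
  case Nil
  then show ?case by simp
next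
  case (Cons a w)
  have a: "a \<in> signed_arcs G" "sym_tail G a = v" using Cons.prems by auto
  let ?u = "case reduce w of None \<Rightarrow> [Zero] | Some z \<Rightarrow> normal_form (sym_head G a) z"
  have 1: "gis_eq G (map Arc (a # w)) (Arc a # ?u)"
  proof (cases "w = []")
    case True
    then show ?thesis using sym_idem(1)[OF a(1), of "[]" "[]"] by (auto simp: normal_form_def gis_eq_sym)
  next
    case False
    then show ?thesis using Cons by (auto intro!: gis_eq_Cons)
  qed
  show ?case
  proof (cases "reduce w")
    case None
    then have "gis_eq G (map Arc (a # w)) [Zero]"
      using 1 gis_eq_zero_left[of "[Arc a]" G] a gis_eq_trans by (auto simp: gis_generators_def)
    moreover have "reduce (a # w) = None" using None by (cases a) auto
    ultimately show ?thesis by simp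
  next
    case (Some z)
    obtain p q where z: "z = (p, q)" by (cases z)
    have pq: "set p \<subseteq> arcs G" "set q \<subseteq> arcs G" using Some z Cons.prems reduce_set[of w p q G] by auto
    let ?r = "map (Arc \<circ> Plus) p @ map (Arc \<circ> Minus) (rev q)"
    have 2: "gis_eq G (map Arc (a # w)) (Arc a # ?r)"
      using gis_eq_trans[OF 1] sym_idem(1)[OF a(1), of "[]" ?r] Some z by (auto simp: normal_form_def)
    have gens: "set (map (Arc \<circ> Plus) p) \<subseteq> gis_generators G" if "set p \<subseteq> arcs G" for p
      using that by (auto simp: gis_generators_def signed_arcs_def)
    have gens': "set (map (Arc \<circ> Minus) (rev q)) \<subseteq> gis_generators G" using pq
      by (auto simp: gis_generators_def signed_arcs_def)
    show ?thesis
    proof (cases a)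
      case (Plus f)
      then show ?thesis using gis_eq_trans[OF 2] gis_eq_sym[OF sym_idem(2)[OF a(1), of "[]" ?r]] Some z a
        by (auto simp: normal_form_def)
    next
      case (Minus f)
      show ?thesis
      proof (cases p)
        case Nil
        then show ?thesis
          using gis_eq_trans[OF 2] gis_eq_sym[OF sym_idem(2)[OF a(1), of "[]" ?r]] Some z a Minus
          by (auto simp: normal_form_def)
      next
        case p: (Cons g p')
        let ?r' = "map (Arc \<circ> Plus) p' @ map (Arc \<circ> Minus) (rev q)"
        have f: "f \<in> arcs G" using a Minus by (auto simp: signed_arcs_def)
        show ?thesis
        proof (cases "f = g")
          case True
          have "gis_eq G ([] @ [Arc (Minus f), Arc (Plus f)] @ ?r') ([] @ [Idem (tail G f)] @ ?r')"
            by (rule gis_eq_rel) (use f in \<open>auto intro: gis_relation.intros\<close>)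
          then show ?thesis using gis_eq_trans[OF 2] True p Minus Some z a by (auto simp: normal_form_def)
        next
          case False
          have "gis_eq G ([Arc (Minus f), Arc (Plus g)]) [Zero]"
            using gis_eq_rel[OF minus_plus_orth[of f G g], of "[]" "[]"] f False pq p by auto
          then have "gis_eq G ([] @ [Arc (Minus f), Arc (Plus g)] @ ?r') [Zero]"
            using gens[of p'] gens' pq p by (intro gis_eq_zero) auto
          then show ?thesis using gis_eq_trans[OF 2] False p Minus Some z by auto
        qed
      qed
    qed
  qed
qed

text \<open>A nonzero product forces adjacent symbols to be composable, because distinct idempotents
  are orthogonal, and the normal form excludes \<open>None\<close>. Conversely the word acts on a
  stack that supplies exactly its demand, whereas zero acts nowhere.\<close>

lemma admissible_iff:
  assumes "set w \<subseteq> signed_arcs G" "w \<noteq> []"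
  shows "admissible G w \<longleftrightarrow> (\<exists>u v. swalk G u w v) \<and> reduce w \<noteq> None"
proof
  assume adm: "admissible G w"
  have "\<exists>v. swalk G (sym_tail G (hd w)) w v" if "\<not> gis_eq G (map Arc w) [Zero]"
    using that assms
  proof (induction w)
    case (Cons a w)
    have a: "a \<in> signed_arcs G" using Cons.prems by auto
    have "\<not> gis_eq G (map Arc w) [Zero]"
      using gis_eq_zero[of G "map Arc w" "[Arc a]" "[]"] Cons.prems a by (auto simp: gis_generators_def)
    show ?case
    proof (cases w)
      case (Cons b w')
      have b: "b \<in> signed_arcs G" "set w' \<subseteq> signed_arcs G" using Cons Cons.prems by auto
      obtain v where v: "swalk G (sym_tail G b) w v"
        using Cons.IH Cons Cons.prems \<open>\<not> gis_eq G (map Arc w) [Zero]\<close> by auto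
      have "sym_head G a = sym_tail G b"
      proof (rule ccontr)
        assume ne: "sym_head G a \<noteq> sym_tail G b"
        have "gis_eq G [Arc a, Arc b] [Arc a, Idem (sym_head G a), Arc b]"
          using gis_eq_sym[OF sym_idem(1)[OF a, of "[]" "[Arc b]"]] by simp
        also have "gis_eq G \<dots> [Arc a, Idem (sym_head G a), Idem (sym_tail G b), Arc b]"
          using gis_eq_sym[OF sym_idem(2)[OF b(1), of "[Arc a, Idem (sym_head G a)]" "[]"]] by simp
        also have "gis_eq G \<dots> [Zero]"
          using gis_eq_zero[of G "[Idem (sym_head G a), Idem (sym_tail G b)]" "[Arc a]" "[Arc b]"]
            gis_eq_rel[OF idem_orth[of "sym_head G a" G "sym_tail G b"], of "[]" "[]"]
            a b(1) ne sym_in_verts[of a] sym_in_verts[of b] by (auto simp: gis_generators_def)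
        finally have "gis_eq G (map Arc (a # w)) [Zero]"
          using gis_eq_zero[of G "[Arc a, Arc b]" "[]" "map Arc w'"] b Cons Arc_in_generators[of w' G]
          by auto
        then show False using Cons.prems by blast
      qed
      then show ?thesis using v by auto
    qed auto
  qed auto
  then obtain v where v: "swalk G (sym_tail G (hd w)) w v" using adm by (auto simp: admissible_def)
  have "reduce w \<noteq> None"
  proof
    assume "reduce w = None"
    then show False using gis_eq_normal_form[OF assms v] adm by (simp add: admissible_def)
  qed
  then show "(\<exists>u v. swalk G u w v) \<and> reduce w \<noteq> None" using v by blast
next
  assume "(\<exists>u v. swalk G u w v) \<and> reduce w \<noteq> None"
  then obtain u v p q where "swalk G u w v" "reduce w = Some (p, q)" by auto
  then have "act G (map Arc w) (u, p @ []) = Some (v, q @ [])" by (rule act_swalk)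
  then show "admissible G w" unfolding admissible_def by (auto dest: act_gis_eq)
qed

end

section \<open>Counting words with a given stack\<close>

unbundle fps_syntax

definition stack_words :: "('v, 'e) pre_digraph \<Rightarrow> 'v \<Rightarrow> 'e list \<Rightarrow> nat \<Rightarrow> 'e signed_arc list set" where
  "stack_words G v ys n = {w. set w \<subseteq> signed_arcs G \<and> length w = n \<and>
     (\<exists>v'. swalk G v w v') \<and> reduce w = Some ([], rev ys)}"

text \<open>Balanced words have even length, so the variable marks half the length, that is, the
  number of push-pop pairs.\<close>

definition excursion_fps :: "('v, 'e) pre_digraph \<Rightarrow> 'v \<Rightarrow> real fps" where
  "excursion_fps G v = Abs_fps (\<lambda>j. real (card (stack_words G v [] (2 * j))))"

definition stack_fps :: "('v, 'e) pre_digraph \<Rightarrow> 'v \<Rightarrow> 'e list \<Rightarrow> real fps" where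
  "stack_fps G v ys = Abs_fps (\<lambda>j. real (card (stack_words G v ys (length ys + 2 * j))))"

lemma stack_words_end:
  assumes "w \<in> stack_words G v ys n" "swalk G v w v'"
  shows "pre_digraph.cas G v ys v'"
  using reduce_paths[OF assms(2), of "[]" "rev ys"] assms(1)
  by (auto simp: stack_words_def pre_digraph.cas.simps)

lemma stack_words_length:
  assumes "w \<in> stack_words G v ys n"
  shows "\<exists>j. n = length ys + 2 * j"
proof -
  have "height w = int (length ys)" "length w = n"
    using assms height_reduce[of w "[]" "rev ys"] by (auto simp: stack_words_def)
  then have "length ys \<le> n" "even (int (length ys) + int n)"
    using height_le_length[of w] height_parity[of w] by auto
  then have "even (n - length ys)" by presburger
  then obtain j where "n - length ys = 2 * j" by blast
  then show ?thesis using \<open>length ys \<le> n\<close> by (intro exI[of _ j]) simp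
qed

text \<open>Since \<open>t\<close> begins a word without demand, it cannot pop the \<open>y\<close>
  in front of it; so \<open>y\<close> is still on the stack after \<open>t\<close>.\<close>

lemma balanced_split_unique_aux:
  assumes "reduce u = Some ([], [])" "reduce (u @ Minus y # t) = Some ([], [])"
    "reduce (t @ s) = Some ([], q)"
  shows False
proof -
  obtain q' where "reduce t = Some ([], q')" using reduce_prefix_no_demand[OF assms(3)] by blast
  then have "reduce (u @ Minus y # t) = Some ([], q' @ [y])" using assms(1)
    by (simp add: reduce_append)
  then show False using assms(2) by simp
qed

lemma balanced_Minus_split_unique:
  assumes "u @ Minus y # w = u' @ Minus y # w'" "reduce u = Some ([], [])" "reduce u' = Some ([], [])"
    "reduce w = Some ([], q)" "reduce w' = Some ([], q')"
  shows "u = u' \<and> w = w'"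
proof -
  from assms(1) consider us where "u = u' @ us" "us @ Minus y # w = Minus y # w'"
    | us where "u @ us = u'" "Minus y # w = us @ Minus y # w'"
    by (auto simp: append_eq_append_conv2)
  then show ?thesis
  proof cases
    case 1
    show ?thesis
    proof (cases us)
      case (Cons a t)
      then show ?thesis using 1 assms balanced_split_unique_aux[of u' y t "Minus y # w" q'] by auto
    qed (use 1 in auto)
  next
    case 2
    show ?thesis
    proof (cases us)
      case (Cons a t)
      then show ?thesis using 2 assms balanced_split_unique_aux[of u y t "Minus y # w'" q] by auto
    qed (use 2 in auto)
  qed
qed

text \<open>A pop directly after a balanced prefix is an unmet demand, so it cannot occur inside a
  balanced word.\<close>

lemma balanced_Plus_split_unique:
  assumes "u @ Plus y # w = u' @ Plus y # w'" "reduce u = Some ([], [])" "reduce u' = Some ([], [])"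
  shows "u = u' \<and> w = w'"
proof -
  have no: False if "reduce u = Some ([], [])" "reduce (u @ Plus y # t) = Some ([], [])" for u t
    using that by (auto simp: reduce_append split: option.splits)
  from assms(1) consider us where "u = u' @ us" "us @ Plus y # w = Plus y # w'"
    | us where "u @ us = u'" "Plus y # w = us @ Plus y # w'"
    by (auto simp: append_eq_append_conv2)
  then show ?thesis
  proof cases
    case 1
    then show ?thesis using assms no[of u'] by (cases us) auto
  next
    case 2
    then show ?thesis using assms no[of u] by (cases us) auto
  qed
qed

context fin_digraph
begin

lemma finite_signed_arcs [simp]: "finite (signed_arcs G)"
  by (simp add: signed_arcs_def)

lemma finite_stack_words [simp]: "finite (stack_words G v ys n)"
  by (rule finite_subset[OF _ finite_lists_length_eq[of "signed_arcs G" n]])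
     (auto simp: stack_words_def)

text \<open>Cut at the surviving push of the bottom symbol \<open>y\<close>; before it only an
  excursion from \<open>v\<close> takes place.\<close>

lemma stack_words_Cons_bij:
  assumes "y \<in> arcs G" "tail G y = v"
  shows "bij_betw (\<lambda>(i, u, w). u @ Minus y # w)
    (SIGMA i:{..j}. stack_words G v [] (2 * i) \<times> stack_words G (head G y) ys (length ys + 2 * (j - i)))
    (stack_words G v (y # ys) (length (y # ys) + 2 * j))"
  unfolding bij_betw_def
proof
  show "inj_on (\<lambda>(i, u, w). u @ Minus y # w)
    (SIGMA i:{..j}. stack_words G v [] (2 * i) \<times> stack_words G (head G y) ys (length ys + 2 * (j - i)))"
    by (rule inj_onI) (auto simp: stack_words_def dest!: balanced_Minus_split_unique)
  show "(\<lambda>(i, u, w). u @ Minus y # w) `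
      (SIGMA i:{..j}. stack_words G v [] (2 * i) \<times> stack_words G (head G y) ys (length ys + 2 * (j - i))) =
      stack_words G v (y # ys) (length (y # ys) + 2 * j)" (is "?f ` ?A = ?B")
  proof
    show "?f ` ?A \<subseteq> ?B"
    proof
      fix x assume "x \<in> ?f ` ?A"
      then obtain i u w where x: "x = u @ Minus y # w" and i: "i \<in> {..j}"
        and u: "u \<in> stack_words G v [] (2 * i)"
        and w: "w \<in> stack_words G (head G y) ys (length ys + 2 * (j - i))" by auto
      obtain v' where v': "swalk G v u v'" using u by (auto simp: stack_words_def)
      then have "v' = v" using stack_words_end[OF u v'] by (simp add: pre_digraph.cas.simps)
      with x v' u w i assms show "x \<in> ?B"
        by (auto simp: stack_words_def reduce_append signed_arcs_def)
    qed
    show "?B \<subseteq> ?f ` ?A"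
    proof
      fix x assume x: "x \<in> ?B"
      then have red: "reduce x = Some ([], rev ys @ [y])" by (simp add: stack_words_def)
      from reduce_stack_split[OF this] obtain u w where uw: "x = u @ Minus y # w"
        "reduce u = Some ([], [])" "reduce w = Some ([], rev ys)" by blast
      obtain v' where v': "swalk G v x v'" using x by (auto simp: stack_words_def)
      then have sw: "swalk G v u (tail G y)" "swalk G (head G y) w v'" using uw by auto
      have u: "u \<in> stack_words G v [] (length u)" and w: "w \<in> stack_words G (head G y) ys (length w)"
        using x uw sw by (auto simp: stack_words_def)
      obtain i k where ik: "length u = 2 * i" "length w = length ys + 2 * k"
        using stack_words_length[OF u] stack_words_length[OF w] by auto
      have "length x = length (y # ys) + 2 * j" using x by (simp add: stack_words_def)
      then have "k = j - i" "i \<le> j" using uw ik by auto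
      then show "x \<in> ?f ` ?A" using u w ik uw by (intro image_eqI[of _ _ "(i, u, w)"]) auto
    qed
  qed
qed

text \<open>The Catalan decomposition at the pop that matches the opening push.\<close>

lemma balanced_words_bij:
  assumes "v \<in> verts G"
  shows "bij_betw (\<lambda>(f, i, u, w). Minus f # u @ Plus f # w)
    (SIGMA f:out_arcs G v. SIGMA i:{..j}. stack_words G (head G f) [] (2 * i) \<times> stack_words G v [] (2 * (j - i)))
    (stack_words G v [] (2 * Suc j))"
  unfolding bij_betw_def
proof
  show "inj_on (\<lambda>(f, i, u, w). Minus f # u @ Plus f # w)
    (SIGMA f:out_arcs G v. SIGMA i:{..j}. stack_words G (head G f) [] (2 * i) \<times> stack_words G v [] (2 * (j - i)))"
    by (rule inj_onI) (auto simp: stack_words_def dest!: balanced_Plus_split_unique)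
  show "(\<lambda>(f, i, u, w). Minus f # u @ Plus f # w) `
    (SIGMA f:out_arcs G v. SIGMA i:{..j}. stack_words G (head G f) [] (2 * i) \<times> stack_words G v [] (2 * (j - i)))
    = (stack_words G v [] (2 * Suc j))" (is "?f ` ?A = ?B")
  proof
    show "?f ` ?A \<subseteq> ?B"
    proof
      fix x assume "x \<in> ?f ` ?A"
      then obtain f i u w where x: "x = Minus f # u @ Plus f # w" and f: "f \<in> out_arcs G v"
        and i: "i \<in> {..j}" and u: "u \<in> stack_words G (head G f) [] (2 * i)"
        and w: "w \<in> stack_words G v [] (2 * (j - i))" by auto
      obtain v' where v': "swalk G (head G f) u v'" using u by (auto simp: stack_words_def)
      then have "v' = head G f" using stack_words_end[OF u v'] by (simp add: pre_digraph.cas.simps)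
      with x v' f u w i assms show "x \<in> ?B"
        by (auto simp: stack_words_def reduce_append signed_arcs_def)
    qed
    show "?B \<subseteq> ?f ` ?A"
    proof
      fix x assume x: "x \<in> ?B"
      then obtain a x' where ax: "x = a # x'" by (cases x) (auto simp: stack_words_def)
      obtain f where a: "a = Minus f"
        using x ax by (cases a) (auto simp: stack_words_def split: option.splits)
      have red: "reduce x' = Some ([f], [])"
        using x ax a by (auto simp: stack_words_def split: option.splits list.splits if_splits)
      from reduce_demand_split[OF this] obtain u w where uw: "x' = u @ Plus f # w"
        "reduce u = Some ([], [])" "reduce w = Some ([], [])" by blast
      obtain v' where v': "swalk G v x v'" using x by (auto simp: stack_words_def)
      then have sw: "swalk G (head G f) u (head G f)" "swalk G v w v'" "tail G f = v" using uw ax a by auto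
      have f: "f \<in> out_arcs G v" using x ax a sw by (auto simp: stack_words_def signed_arcs_def)
      have u: "u \<in> stack_words G (head G f) [] (length u)" and w: "w \<in> stack_words G v [] (length w)"
        using x ax uw sw by (auto simp: stack_words_def)
      obtain i k where ik: "length u = 2 * i" "length w = 2 * k"
        using stack_words_length[OF u] stack_words_length[OF w] by auto
      have "length x = 2 * Suc j" using x by (simp add: stack_words_def)
      then have "k = j - i" "i \<le> j" using ax uw ik by auto
      then show "x \<in> ?f ` ?A" using f u w ik uw ax a by (intro image_eqI[of _ _ "(f, i, u, w)"]) auto
    qed
  qed
qed

lemma stack_words_Nil_0: "stack_words G v [] 0 = {[]}"
  by (auto simp: stack_words_def)

lemma excursion_fps_nth_0 [simp]: "excursion_fps G v $ 0 = 1"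
  by (simp add: excursion_fps_def stack_words_Nil_0)

lemma excursion_fps_rec:
  assumes "v \<in> verts G"
  shows "excursion_fps G v = 1 + fps_X * ((\<Sum>f\<in>out_arcs G v. excursion_fps G (head G f)) * excursion_fps G v)"
proof (rule fps_ext)
  fix n
  show "excursion_fps G v $ n =
    (1 + fps_X * ((\<Sum>f\<in>out_arcs G v. excursion_fps G (head G f)) * excursion_fps G v)) $ n"
  proof (cases n)
    case 0
    then show ?thesis by simp
  next
    case (Suc j)
    have "card (stack_words G v [] (2 * Suc j)) = (\<Sum>f\<in>out_arcs G v. \<Sum>i\<le>j.
        card (stack_words G (head G f) [] (2 * i)) * card (stack_words G v [] (2 * (j - i))))"
      using bij_betw_same_card[OF balanced_words_bij[OF assms, of j]]
      by (simp add: card_SigmaI card_cartesian_product finite_out_arcs)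
    then have "excursion_fps G v $ Suc j = (\<Sum>f\<in>out_arcs G v. \<Sum>i\<le>j.
        excursion_fps G (head G f) $ i * excursion_fps G v $ (j - i))"
      by (simp add: excursion_fps_def)
    also have "\<dots> = (\<Sum>f\<in>out_arcs G v. (excursion_fps G (head G f) * excursion_fps G v) $ j)"
      by (simp add: fps_mult_nth atMost_atLeast0)
    also have "\<dots> = ((\<Sum>f\<in>out_arcs G v. excursion_fps G (head G f)) * excursion_fps G v) $ j"
      by (simp add: sum_distrib_right fps_sum_nth)
    finally show ?thesis using Suc by simp
  qed
qed

text \<open>The balanced words of length 2 at \<open>v\<close> push an arc that starts at
  \<open>v\<close> and pop it again.\<close>

lemma excursion_fps_nth_1:
  assumes "v \<in> verts G"
  shows "excursion_fps G v $ 1 = real (out_degree G v)"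
  by (subst excursion_fps_rec[OF assms]) (simp add: fps_sum_nth out_degree_def)

lemma stack_fps_eq:
  assumes "cas v ys v'" "set ys \<subseteq> arcs G"
  shows "stack_fps G v ys = excursion_fps G v * (\<Prod>y\<leftarrow>ys. excursion_fps G (head G y))"
  using assms
proof (induction ys arbitrary: v)
  case Nil
  then show ?case by (simp add: stack_fps_def excursion_fps_def)
next
  case (Cons y ys)
  have y: "y \<in> arcs G" "tail G y = v" using Cons.prems by auto
  have "stack_fps G v (y # ys) = excursion_fps G v * stack_fps G (head G y) ys"
  proof (rule fps_ext)
    fix j
    have "card (stack_words G v (y # ys) (length (y # ys) + 2 * j)) = (\<Sum>i\<le>j.
        card (stack_words G v [] (2 * i)) * card (stack_words G (head G y) ys (length ys + 2 * (j - i))))"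
      using bij_betw_same_card[OF stack_words_Cons_bij[OF y, where j = j and ys = ys]]
      by (simp add: card_SigmaI card_cartesian_product)
    then show "stack_fps G v (y # ys) $ j = (excursion_fps G v * stack_fps G (head G y) ys) $ j"
      by (simp add: stack_fps_def excursion_fps_def fps_mult_nth atMost_atLeast0)
  qed
  then show ?case using Cons by (auto simp: mult.assoc)
qed

text \<open>Opening with a surviving push removes the excursion at the initial vertex. One factor
  per arc remains, which is the right number for a word that will be closed up cyclically.\<close>

lemma card_marked_words:
  assumes "cas v (y # ys) v'" "set (y # ys) \<subseteq> arcs G"
  shows "card {w \<in> stack_words G v (y # ys) (length (y # ys) + 2 * j). hd w = Minus y \<and>
       reduce (tl w) = Some ([], rev ys)} = (\<Prod>z\<leftarrow>y # ys. excursion_fps G (head G z)) $ j"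
proof -
  have "bij_betw (\<lambda>w. Minus y # w) (stack_words G (head G y) ys (length ys + 2 * j))
      {w \<in> stack_words G v (y # ys) (length (y # ys) + 2 * j). hd w = Minus y \<and>
       reduce (tl w) = Some ([], rev ys)}" (is "bij_betw ?f ?A ?B")
    unfolding bij_betw_def
  proof
    show "inj_on ?f ?A" by (auto intro: inj_onI)
    show "?f ` ?A = ?B"
    proof
      show "?f ` ?A \<subseteq> ?B" using assms by (auto simp: stack_words_def signed_arcs_def)
      show "?B \<subseteq> ?f ` ?A"
      proof
        fix w assume w: "w \<in> ?B"
        then have "w \<noteq> []" by (auto simp: stack_words_def)
        then obtain w' where "w = Minus y # w'" using w by (cases w) auto
        then show "w \<in> ?f ` ?A" using w by (intro image_eqI[of _ _ w']) (auto simp: stack_words_def)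
      qed
    qed
  qed
  then have "real (card ?B) = stack_fps G (head G y) ys $ j"
    using bij_betw_same_card by (fastforce simp: stack_fps_def)
  then show ?thesis using stack_fps_eq[of "head G y" ys v'] assms by simp
qed

end

section \<open>Windows of bi-infinite sequences\<close>

definition shiftn :: "int \<Rightarrow> (int \<Rightarrow> 'a) \<Rightarrow> int \<Rightarrow> 'a" where
  "shiftn a x = (\<lambda>i. x (i + a))"

definition window :: "(int \<Rightarrow> 'a) \<Rightarrow> int \<Rightarrow> nat \<Rightarrow> 'a list" where
  "window x i n = map (\<lambda>k. x (i + int k)) [0..<n]"

definition periodic_ext :: "'a list \<Rightarrow> int \<Rightarrow> 'a" where
  "periodic_ext ys = (\<lambda>i. ys ! nat (i mod int (length ys)))"

lemma shiftn_apply [simp]: "shiftn a x i = x (i + a)"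
  by (simp add: shiftn_def)

lemma shiftn_shiftn [simp]: "shiftn a (shiftn b x) = shiftn (a + b) x"
  by (auto simp: shiftn_def algebra_simps)

lemma shiftn_0 [simp]: "shiftn 0 x = x"
  by (auto simp: shiftn_def)

lemma funpow_shift: "(shift ^^ n) x = shiftn (int n) x"
  by (induction n) (auto simp: shift_def shiftn_def algebra_simps)

lemma length_window [simp]: "length (window x i n) = n"
  by (simp add: window_def)

lemma nth_window [simp]: "k < n \<Longrightarrow> window x i n ! k = x (i + int k)"
  by (simp add: window_def)

lemma window_0 [simp]: "window x i 0 = []"
  by (simp add: window_def)

lemma window_add: "window x i (m + n) = window x i m @ window x (i + int m) n"
  by (rule nth_equalityI) (auto simp: nth_append algebra_simps)

lemma window_Suc: "window x i (Suc n) = x i # window x (i + 1) n"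
  using window_add[of x i 1 n] by (simp add: window_def)

lemma window_shiftn [simp]: "window (shiftn a x) i n = window x (i + a) n"
  by (rule nth_equalityI) (auto simp: algebra_simps)

lemma take_window: "k \<le> n \<Longrightarrow> take k (window x i n) = window x i k"
  by (rule nth_equalityI) auto

lemma drop_window: "k \<le> n \<Longrightarrow> drop k (window x i n) = window x (i + int k) (n - k)"
  by (rule nth_equalityI) (auto simp: algebra_simps)

lemma set_window: "set (window x i n) \<subseteq> range x"
  by (auto simp: window_def)

lemma map_upto_window: "map x [i..j] = window x i (nat (j - i + 1))"
proof (induction "nat (j - i + 1)" arbitrary: i)
  case 0
  then show ?case by (simp add: window_def)
next
  case (Suc n)
  then have "i \<le> j" "nat (j - (i + 1) + 1) = n" by auto
  then show ?case using Suc(1)[of "i + 1"] Suc(2) by (simp add: upto_rec1 window_Suc flip: Suc(2))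
qed

lemma window_cong: "(\<And>k. k < n \<Longrightarrow> x (i + int k) = y (j + int k)) \<Longrightarrow> window x i n = window y j n"
  by (rule nth_equalityI) auto

lemma window_comp: "window (f \<circ> x) i n = map f (window x i n)"
  by (simp add: window_def)

lemma window_eqD: "window x i n = window y j n \<Longrightarrow> k < n \<Longrightarrow> x (i + int k) = y (j + int k)"
  by (metis nth_window)

lemma shiftn_period: "shiftn n x = x \<Longrightarrow> x (i + n) = x i"
  by (metis shiftn_apply)

lemma shiftn_period_mult: "shiftn n x = x \<Longrightarrow> shiftn (k * n) x = x"
proof -
  assume n: "shiftn n x = x"
  have nat: "shiftn (int k * n) x = x" for k
  proof (induction k)
    case (Suc k)
    have "int (Suc k) * n = int k * n + n" by (simp add: algebra_simps)
    then have "shiftn (int (Suc k) * n) x = shiftn (int k * n) (shiftn n x)"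
      by (simp only: shiftn_shiftn)
    then show ?case using n Suc by metis
  qed simp
  show ?thesis
  proof (cases "k \<ge> 0")
    case True
    then show ?thesis using nat[of "nat k"] by simp
  next
    case False
    then have "shiftn (- k * n) x = x" using nat[of "nat (- k)"] by simp
    then have "shiftn (k * n) x = shiftn (k * n) (shiftn (- k * n) x)" by metis
    then show ?thesis by simp
  qed
qed

lemma shiftn_mod: "shiftn n x = x \<Longrightarrow> shiftn (a mod n) x = shiftn a x"
proof -
  assume "shiftn n x = x"
  then have "shiftn (a div n * n) x = x" by (rule shiftn_period_mult)
  then have "shiftn (a mod n) (shiftn (a div n * n) x) = shiftn (a mod n) x" by simp
  then show ?thesis by simp
qed

lemma apply_mod: "shiftn n x = x \<Longrightarrow> x (a mod n) = x a"
  using shiftn_mod[of n x a] by (metis add_0 shiftn_apply)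

lemma window_period: "shiftn n x = x \<Longrightarrow> window x (i + k * n) m = window x i m"
  by (metis shiftn_period_mult window_shiftn)

lemma window_period1: "shiftn n x = x \<Longrightarrow> window x (i + n) m = window x i m"
  using window_period[of n x i 1 m] by simp

lemma periodic_eqI:
  assumes "shiftn (int n) x = x" "shiftn (int n) y = y" "0 < n" "window x 0 n = window y 0 n"
  shows "x = y"
proof
  fix i
  have "x (i mod int n) = y (i mod int n)"
    using window_eqD[OF assms(4), of "nat (i mod int n)"] assms(3) by (simp add: nat_less_iff)
  then show "x i = y i" using apply_mod assms by metis
qed

text \<open>Translation by multiples of the common period \<open>n * m\<close> brings every index
  into the half-lines where agreement is known.\<close>

lemma periodic_eqI_far:
  assumes x: "shiftn (int n) x = x" and y: "shiftn (int m) y = y" and "0 < n" "0 < m"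
    and eq: "\<And>d. x (a - int d) = y (b - int d)"
  shows "x = shiftn (b - a) y"
proof
  fix i
  define N where "N = n * m"
  have N: "0 < N" using assms by (simp add: N_def)
  have px: "shiftn (int N) x = x" and py: "shiftn (int N) y = y"
    using shiftn_period_mult[OF x, of "int m"] shiftn_period_mult[OF y, of "int n"]
    by (auto simp: N_def mult.commute)
  define d where "d = nat ((a - i) mod int N)"
  have d: "int d = (a - i) mod int N" using N by (simp add: d_def)
  have 1: "(a - int d) mod int N = i mod int N" by (simp add: d mod_simps)
  have 2: "(b - int d) mod int N = (i + (b - a)) mod int N"
    unfolding d mod_diff_right_eq by (simp add: algebra_simps)
  show "x i = shiftn (b - a) y i"
    using eq[of d] 1 2 apply_mod[OF px] apply_mod[OF py] by (metis shiftn_apply)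
qed

lemma window_periodic_ext [simp]: "window (periodic_ext ys) 0 (length ys) = ys"
  by (rule nth_equalityI) (auto simp: periodic_ext_def)

lemma shiftn_periodic_ext [simp]: "shiftn (int (length ys)) (periodic_ext ys) = periodic_ext ys"
  by (auto simp: periodic_ext_def shiftn_def)

lemma periodic_ext_window:
  assumes "shiftn (int n) x = x" "0 < n"
  shows "periodic_ext (window x 0 n) = x"
  using assms periodic_eqI[of n "periodic_ext (window x 0 n)" x]
    shiftn_periodic_ext[of "window x 0 n"] window_periodic_ext[of "window x 0 n"] by simp

lemma height_window_period:
  assumes "shiftn (int n) x = x"
  shows "height (window x 0 (q * n + s)) = int q * height (window x 0 n) + height (window x 0 s)"
proof (induction q)
  case (Suc q)
  have "window x 0 (Suc q * n + s) = window x 0 n @ window x (0 + int n) (q * n + s)"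
    using window_add[of x 0 n "q * n + s"] by (simp add: add.assoc)
  also have "window x (0 + int n) (q * n + s) = window x 0 (q * n + s)"
    by (rule window_period1[OF assms])
  finally show ?case using Suc by (simp add: algebra_simps)
qed simp

lemma height_window_rotate:
  assumes "shiftn (int n) x = x"
  shows "height (window x i n) = height (window x 0 n)"
proof (cases "n = 0")
  case False
  define r where "r = nat (i mod int n)"
  have "window x i n = window (shiftn i x) 0 n" by simp
  also have "\<dots> = window (shiftn (int r) x) 0 n" using False shiftn_mod[OF assms, of i] by (simp add: r_def)
  also have "\<dots> = window x (int r) n" by simp
  finally have "height (window x i n) = height (window x (int r) n)" by simp
  also have "\<dots> = height (window x 0 n)"
    using window_add[of x 0 r n] window_add[of x 0 n r] window_period1[OF assms, of 0 r]
    by (simp add: add.commute) (metis add.commute add_right_cancel height_simps(4))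
  finally show ?thesis .
qed simp

lemma ex_lowest:
  assumes "0 < n"
  shows "\<exists>i<n. \<forall>s<n. height (window x 0 i) \<le> height (window x 0 s)"
proof -
  have "Min ((\<lambda>i. height (window x 0 i)) ` {..<n}) \<in> (\<lambda>i. height (window x 0 i)) ` {..<n}"
    using assms by (intro Min_in) auto
  then obtain i where "i < n" "height (window x 0 i) = Min ((\<lambda>i. height (window x 0 i)) ` {..<n})"
    by auto
  then show ?thesis by auto
qed

text \<open>The cycle lemma: start at a position of least height within a period. With nonnegative
  drift no later height is lower.\<close>

lemma ex_up_position:
  assumes "shiftn (int n) x = x" "0 < n" "height (window x 0 n) \<ge> 0"
  shows "\<exists>i. \<forall>m. height (window x i m) \<ge> 0"
proof -
  obtain i where i: "i < n" "\<And>s. s < n \<Longrightarrow> height (window x 0 i) \<le> height (window x 0 s)"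
    using ex_lowest[OF assms(2)] by blast
  have "height (window x (int i) m) \<ge> 0" for m
  proof -
    have "i + m = (i + m) div n * n + (i + m) mod n" by simp
    then have "height (window x 0 (i + m)) =
        int ((i + m) div n) * height (window x 0 n) + height (window x 0 ((i + m) mod n))"
      using height_window_period[OF assms(1)] by metis
    moreover have "height (window x 0 i) \<le> height (window x 0 ((i + m) mod n))"
      using i(2) assms(2) by simp
    moreover have "int ((i + m) div n) * height (window x 0 n) \<ge> 0" using assms(3) by simp
    ultimately show ?thesis using window_add[of x 0 i m] by simp
  qed
  then show ?thesis by blast
qed

text \<open>The same lowest position, seen from the left: with nonpositive drift all earlier heights
  are at least as large.\<close>

lemma ex_down_position:
  assumes "shiftn (int n) x = x" "0 < n" "height (window x 0 n) \<le> 0"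
  shows "\<exists>i. \<forall>m. height (window x (i - int m) m) \<le> 0"
proof -
  obtain i where i: "i < n" "\<And>s. s < n \<Longrightarrow> height (window x 0 i) \<le> height (window x 0 s)"
    using ex_lowest[OF assms(2)] by blast
  have "height (window x (int i - int m) m) \<le> 0" for m
  proof -
    \<comment> \<open>\<open>s\<close> is the residue of \<open>i - m\<close> and \<open>q\<close>
      the number of periods gone back; \<open>q\<close> is nonnegative because
      \<open>i < n\<close>.\<close>
    define s where "s = nat ((int i - int m) mod int n)"
    define q where "q = nat (- ((int i - int m) div int n))"
    have "(int i - int m) div int n \<le> 0"
      using i(1) assms(2) by (smt (verit) div_pos_pos_trivial of_nat_0_le_iff of_nat_0_less_iff
          of_nat_less_iff zdiv_mono1)
    then have q: "int q = - ((int i - int m) div int n)" by (simp add: q_def)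
    have s: "int s = (int i - int m) mod int n" "s < n"
      using assms(2) by (auto simp: s_def nat_less_iff)
    have sq: "int s = int i - int m + int q * int n"
      using s(1) q by (simp add: minus_div_mult_eq_mod [symmetric])
    then have "int (s + m) = int (q * n + i)" by simp
    then have *: "s + m = q * n + i" by (simp only: of_nat_eq_iff)
    have "window x (int i - int m) m = window x (int s) m"
      using window_period[OF assms(1), of "int i - int m" "int q" m] sq by simp
    moreover have "height (window x 0 (s + m)) =
        int q * height (window x 0 n) + height (window x 0 i)"
      unfolding * by (rule height_window_period[OF assms(1)])
    moreover have "height (window x 0 (s + m)) = height (window x 0 s) + height (window x (int s) m)"
      using window_add[of x 0 s m] by simp
    moreover have "int q * height (window x 0 n) \<le> 0" using assms(3) by (simp add: mult_nonneg_nonpos)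
    ultimately show ?thesis using i(2)[OF s(2)] by simp
  qed
  then show ?thesis by blast
qed

lemma all_Minus_if_full_height:
  assumes x: "shiftn (int n) x = x" "0 < n" and h: "height (window x 0 n) = int n"
  shows "\<exists>z. shiftn (int n) z = z \<and> x = Minus \<circ> z"
proof -
  obtain ys where ys: "window x 0 n = map Minus ys" using height_eq_length[of "window x 0 n"] h by auto
  have len: "length ys = n" using arg_cong[OF ys, of length] by simp
  let ?z = "periodic_ext ys"
  have z: "window ?z 0 n = ys" "shiftn (int n) ?z = ?z" unfolding len[symmetric]
    by (rule window_periodic_ext shiftn_periodic_ext)+
  have "x = Minus \<circ> ?z"
  proof (rule periodic_eqI[OF x(1) _ x(2)])
    have "shiftn (int n) (Minus \<circ> ?z) = Minus \<circ> shiftn (int n) ?z" by (auto simp: fun_eq_iff)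
    then show "shiftn (int n) (Minus \<circ> ?z) = Minus \<circ> ?z" unfolding z(2) .
    show "window x 0 n = window (Minus \<circ> ?z) 0 n" unfolding window_comp z(1) ys ..
  qed
  then show ?thesis using z(2) by blast
qed

section \<open>Stack classes of periodic points\<close>

text \<open>
  \<open>stack_class x y\<close>: the symbols of the periodic point \<open>x\<close> that are pushed and never popped
  form the bi-infinite path \<open>y\<close>.
\<close>

definition stack_class :: "(int \<Rightarrow> 'e signed_arc) \<Rightarrow> (int \<Rightarrow> 'e) \<Rightarrow> bool" where
  "stack_class x y \<longleftrightarrow> (\<exists>i n L. 0 < n \<and> 0 < L \<and> shiftn (int n) x = x \<and> shiftn (int L) y = y \<and>
     reduce (window x i n) = Some ([], rev (window y 0 L)))"

lemma reduce_window_power: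
  assumes "shiftn (int n) x = x" "shiftn (int L) y = y"
    "reduce (window x i n) = Some ([], rev (window y 0 L))"
  shows "reduce (window x i (k * n)) = Some ([], rev (window y 0 (k * L)))"
proof (induction k)
  case (Suc k)
  have "window x i (Suc k * n) = window x i n @ window x i (k * n)"
    using window_add[of x i n "k * n"] window_period1[OF assms(1), of i "k * n"] by simp
  moreover have "window y 0 (Suc k * L) = window y 0 L @ window y 0 (k * L)"
    using window_add[of y 0 L "k * L"] window_period1[OF assms(2), of 0 "k * L"] by simp
  ultimately show ?case using Suc assms(3) by (simp add: reduce_append)
qed simp

lemma reduce_window_no_demand:
  assumes "shiftn (int n) x = x" "0 < n" "reduce (window x i n) = Some ([], q)"
  shows "\<exists>q'. reduce (window x i m) = Some ([], q')"
proof -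
  have "q = rev (window (periodic_ext (rev q)) 0 (length (rev q)))"
    by (simp only: window_periodic_ext rev_rev_ident)
  then have "reduce (window x i (m * n)) =
      Some ([], rev (window (periodic_ext (rev q)) 0 (m * length (rev q))))"
    using assms shiftn_periodic_ext[of "rev q"] by (intro reduce_window_power) auto
  moreover have "window x i (m * n) = window x i m @ window x (i + int m) (m * n - m)"
    using window_add[of x i m "m * n - m"] assms(2) by (cases n) auto
  ultimately show ?thesis using reduce_prefix_no_demand by metis
qed

text \<open>A single starting position serves all periods of \<open>x\<close>: over
  \<open>n0 * n\<close> symbols the stack built from periods \<open>n\<close> equals the one built
  from periods \<open>n0\<close>, so both continue to the same periodic path.\<close>

lemma stack_class_window:
  assumes "stack_class x y"
  shows "\<exists>i. \<forall>n>0. shiftn (int n) x = x \<longrightarrow>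
    (\<exists>L>0. shiftn (int L) y = y \<and> reduce (window x i n) = Some ([], rev (window y 0 L)))"
proof -
  obtain i n0 L0 where *: "0 < n0" "0 < L0" "shiftn (int n0) x = x" "shiftn (int L0) y = y"
    "reduce (window x i n0) = Some ([], rev (window y 0 L0))"
    using assms by (auto simp: stack_class_def)
  have "\<exists>L>0. shiftn (int L) y = y \<and> reduce (window x i n) = Some ([], rev (window y 0 L))"
    if n: "0 < n" "shiftn (int n) x = x" for n
  proof -
    obtain q where q: "reduce (window x i n) = Some ([], q)"
      using reduce_window_no_demand[OF *(3,1,5)] by blast
    define z where "z = periodic_ext (rev q)"
    define L where "L = length (rev q)"
    have z: "window z 0 L = rev q" "shiftn (int L) z = z"
      unfolding z_def L_def by (rule window_periodic_ext shiftn_periodic_ext)+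
    have "reduce (window x i (n0 * n)) = Some ([], rev (window z 0 (n0 * L)))"
      using n q z by (intro reduce_window_power) auto
    moreover have "reduce (window x i (n * n0)) = Some ([], rev (window y 0 (n * L0)))"
      using * by (intro reduce_window_power) auto
    ultimately have eq: "window z 0 (n0 * L) = window y 0 (n * L0)" by (simp add: mult.commute)
    then have len: "n0 * L = n * L0" by (metis length_window)
    then have L: "0 < L" using n * by (cases L) auto
    have "z = y"
    proof (rule periodic_eqI)
      show "shiftn (int (n0 * L)) z = z" using shiftn_period_mult[OF z(2), of "int n0"] by simp
      show "shiftn (int (n0 * L)) y = y" unfolding len
        using shiftn_period_mult[OF *(4), of "int n"] by simp
    qed (use eq len L * n in auto)
    then show ?thesis using z L q by (intro exI[of _ L]) auto
  qed
  then show ?thesis by blast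
qed

text \<open>Going from one clean start to another pushes a finite list \<open>q\<close>. It
  intertwines the two periodic stacks, \<open>q @ rev y^k = rev z^k @ q\<close> in shorthand, and
  for long windows this reads \<open>z\<close> as \<open>y\<close> shifted by the length of
  \<open>q\<close>.\<close>

lemma stack_class_unique:
  assumes "stack_class x y" "stack_class x z"
  shows "\<exists>a. z = shiftn a y"
proof -
  obtain i n L where y: "0 < n" "0 < L" "shiftn (int n) x = x" "shiftn (int L) y = y"
    "reduce (window x i n) = Some ([], rev (window y 0 L))"
    using assms(1) by (auto simp: stack_class_def)
  obtain i0 L' where z: "0 < L'" "shiftn (int L') z = z"
    "reduce (window x i0 n) = Some ([], rev (window z 0 L'))"
    using stack_class_window[OF assms(2)] y by metis
  \<comment> \<open>A translate of \<open>i0\<close> by whole periods that does not lie to the left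
    of \<open>i\<close>.\<close>
  define j where "j = i0 + \<bar>i - i0\<bar> * int n"
  have "i - i0 \<le> \<bar>i - i0\<bar> * int n"
    using y(1) by (smt (verit) mult_le_cancel_left1 of_nat_0_less_iff zmult_zless_mono2)
  then have ij: "i \<le> j" by (simp add: j_def)
  define d where "d = nat (j - i)"
  have d: "j = i + int d" using ij by (simp add: d_def)
  have zj: "reduce (window x j n) = Some ([], rev (window z 0 L'))"
    using z window_period[OF y(3)] by (simp add: j_def)
  obtain q where q: "reduce (window x i d) = Some ([], q)"
    using reduce_window_no_demand[OF y(3,1,5)] by blast
  have eq: "q @ rev (window y 0 (k * L)) = rev (window z 0 (k * L')) @ q" for k
  proof -
    have "window x (i + int (k * n)) d = window x i d" using window_period[OF y(3), of i "int k"] by simp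
    then have "window x i (k * n) @ window x i d = window x i d @ window x j (k * n)"
      using window_add[of x i "k * n" d] window_add[of x i d "k * n"] d by (simp add: add.commute)
    moreover have "reduce (window x i (k * n) @ window x i d) = Some ([], q @ rev (window y 0 (k * L)))"
      using reduce_window_power[OF y(3,4,5), of k] q by (simp add: reduce_append)
    moreover have "reduce (window x i d @ window x j (k * n)) = Some ([], rev (window z 0 (k * L')) @ q)"
      using reduce_window_power[OF y(3) z(2) zj, of k] q by (simp add: reduce_append)
    ultimately show ?thesis by simp
  qed
  have "L = L'" using arg_cong[OF eq[of 1], of length] by simp
  \<comment> \<open>With \<open>l + 1\<close> periods a full period of \<open>z\<close> can be read
    off behind \<open>rev q\<close>.\<close>
  define l where "l = length q"
  have "window y 0 ((l + 1) * L) @ rev q = rev q @ window z 0 ((l + 1) * L)"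
    using arg_cong[OF eq[of "l + 1"], of rev] \<open>L = L'\<close> by simp
  note eql = this
  have yz: "y (int l + int h) = z (int h)" if h: "h < L" for h
  proof -
    have "l \<le> l * L" using y(2) by simp
    then have "l + h < l * L + L" using h by linarith
    then have lt: "l + h < (l + 1) * L" "h < (l + 1) * L" by auto
    have "window y 0 ((l + 1) * L) ! (l + h) = (window y 0 ((l + 1) * L) @ rev q) ! (l + h)"
      using lt by (simp only: nth_append length_window if_True)
    also have "\<dots> = (rev q @ window z 0 ((l + 1) * L)) ! (length (rev q) + h)"
      unfolding eql by (simp only: l_def length_rev)
    also have "\<dots> = window z 0 ((l + 1) * L) ! h" by (rule nth_append_length_plus)
    finally show ?thesis using nth_window[OF lt(1), of y 0] nth_window[OF lt(2), of z 0] by simp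
  qed
  have "z = shiftn (int l) y"
  proof (rule periodic_eqI)
    show "shiftn (int L) z = z" using z \<open>L = L'\<close> by simp
    show "shiftn (int L) (shiftn (int l) y) = shiftn (int l) y"
      using y(4) by (metis add.commute shiftn_shiftn)
    show "window z 0 L = window (shiftn (int l) y) 0 L"
      using yz by (intro nth_equalityI) (auto simp: add.commute)
  qed (use y in auto)
  then show ?thesis by blast
qed

lemma stack_class_shift_point: "stack_class x y \<Longrightarrow> stack_class (shiftn a x) y"
proof -
  assume "stack_class x y"
  then obtain i n L where y: "0 < n" "0 < L" "shiftn (int n) x = x" "shiftn (int L) y = y"
    "reduce (window x i n) = Some ([], rev (window y 0 L))"
    by (auto simp: stack_class_def)
  have "shiftn (int n) (shiftn a x) = shiftn a (shiftn (int n) x)" by (simp add: add.commute)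
  then show ?thesis using y unfolding stack_class_def
    by (intro exI[of _ "i - a"] exI[of _ n] exI[of _ L]) simp
qed

text \<open>Start later, after the part \<open>u\<close> of the period that builds the first
  \<open>a\<close> arcs of the path, and let \<open>u\<close> close the period instead.\<close>

lemma stack_class_shift_stack:
  assumes "stack_class x y"
  shows "stack_class x (shiftn b y)"
proof -
  obtain i n L where y: "0 < n" "0 < L" "shiftn (int n) x = x" "shiftn (int L) y = y"
    "reduce (window x i n) = Some ([], rev (window y 0 L))"
    using assms by (auto simp: stack_class_def)
  define a where "a = nat (b mod int L)"
  have a: "a < L" "shiftn (int a) y = shiftn b y"
    using y(2) shiftn_mod[OF y(4), of b] by (auto simp: a_def nat_less_iff)
  have "window y 0 L = window y 0 a @ window y (int a) (L - a)"
    using window_add[of y 0 a "L - a"] a by simp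
  then obtain u w where uw: "window x i n = u @ w" "reduce u = Some ([], rev (window y 0 a))"
    "reduce w = Some ([], rev (window y (int a) (L - a)))"
    using reduce_stack_split_list y(5) by metis
  define m where "m = length u"
  have m: "m \<le> n" using arg_cong[OF uw(1), of length] by (simp add: m_def)
  then have u: "u = window x i m" and w: "w = window x (i + int m) (n - m)"
    using uw(1) take_window[of m n x i] drop_window[of m n x i] by (auto simp: m_def)
  have "window x (i + int m + int (n - m)) m = u"
    using window_period1[OF y(3), of i m] m u by simp
  then have "window x (i + int m) n = w @ u"
    using window_add[of x "i + int m" "n - m" m] m w by simp
  then have "reduce (window x (i + int m) n) = Some ([], rev (window y 0 a) @ rev (window y (int a) (L - a)))"
    using uw by (simp add: reduce_append)
  moreover have "window (shiftn b y) 0 L = window y (int a) (L - a) @ window y 0 a"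
    using window_add[of y "int a" "L - a" a] window_period1[OF y(4), of 0 a] a
    by (simp flip: a(2))
  moreover have "shiftn (int L) (shiftn b y) = shiftn b (shiftn (int L) y)" by (simp add: add.commute)
  ultimately show ?thesis unfolding stack_class_def using y
    by (intro exI[of _ "i + int m"] exI[of _ n] exI[of _ L]) simp
qed

text \<open>From a lowest position no demand arises, and the positive drift leaves a nonempty stack
  per period; its periodic continuation is the path.\<close>

lemma ex_stack_class:
  assumes "shiftn (int n) x = x" "0 < n" "\<And>i m. reduce (window x i m) \<noteq> None"
    "0 < height (window x 0 n)"
  shows "\<exists>y. stack_class x y"
proof -
  obtain i where i: "\<And>m. height (window x i m) \<ge> 0" using ex_up_position[OF assms(1,2)] assms(4) by auto
  obtain q where q: "reduce (window x i n) = Some ([], q)"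
    using reduce_no_demandI[of "window x i n"] assms(3) i by (auto simp: take_window)
  then have "length q > 0"
    using height_reduce[OF q] height_window_rotate[OF assms(1), of i] assms(4) by simp
  moreover have "window (periodic_ext (rev q)) 0 (length (rev q)) = rev q"
    "shiftn (int (length (rev q))) (periodic_ext (rev q)) = periodic_ext (rev q)"
    by (rule window_periodic_ext shiftn_periodic_ext)+
  ultimately have "stack_class x (periodic_ext (rev q))"
    unfolding stack_class_def using assms q
    by (intro exI[of _ i] exI[of _ n] exI[of _ "length (rev q)"]) auto
  then show ?thesis by blast
qed

section \<open>Points of Markov-Dyck shifts\<close>

definition biinf_paths :: "('v, 'e) pre_digraph \<Rightarrow> (int \<Rightarrow> 'e) set" where
  "biinf_paths G = {y. range y \<subseteq> arcs G \<and> (\<forall>i. head G (y i) = tail G (y (i + 1)))}"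

text \<open>A stack is popped from its top, so the point that pops the path runs through it
  backwards.\<close>

definition rev_plus :: "(int \<Rightarrow> 'e) \<Rightarrow> int \<Rightarrow> 'e signed_arc" where
  "rev_plus y = (\<lambda>i. Plus (y (- i)))"

lemma swalk_window:
  assumes "\<And>i. sym_head G (x i) = sym_tail G (x (i + 1))"
  shows "swalk G (sym_tail G (x i)) (window x i n) (sym_tail G (x (i + int n)))"
proof (induction n arbitrary: i)
  case (Suc n)
  then show ?case using assms[of i] Suc[of "i + 1"] by (simp add: window_Suc add.assoc)
qed simp

lemma swalk_step:
  assumes "swalk G u w v" "Suc k < length w"
  shows "sym_head G (w ! k) = sym_tail G (w ! Suc k)"
  using assms
proof (induction w arbitrary: u k)
  case (Cons a w)
  then show ?case by (cases w; cases k) auto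
qed simp

lemma cas_step:
  assumes "pre_digraph.cas G u w v" "Suc k < length w"
  shows "head G (w ! k) = tail G (w ! Suc k)"
  using assms
proof (induction w arbitrary: u k)
  case (Cons a w)
  then show ?case by (cases w; cases k) (auto simp: pre_digraph.cas.simps)
qed simp

lemma cas_append_ex:
  "pre_digraph.cas G u (p @ q) v \<longleftrightarrow> (\<exists>m. pre_digraph.cas G u p m \<and> pre_digraph.cas G m q v)"
  by (induction p arbitrary: u) (auto simp: pre_digraph.cas.simps)

lemma cas_window:
  assumes "y \<in> biinf_paths G"
  shows "pre_digraph.cas G (tail G (y i)) (window y i n) (tail G (y (i + int n)))"
proof (induction n arbitrary: i)
  case (Suc n)
  then show ?case using assms Suc[of "i + 1"]
    by (simp add: window_Suc add.assoc pre_digraph.cas.simps biinf_paths_def)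
qed (simp add: pre_digraph.cas.simps)

lemma biinf_paths_shiftn [simp]: "shiftn a y \<in> biinf_paths G \<longleftrightarrow> y \<in> biinf_paths G"
proof -
  have "shiftn a y \<in> biinf_paths G" if "y \<in> biinf_paths G" for a y
    using that by (auto simp: biinf_paths_def add.assoc add.left_commute add.commute[of 1])
  from this[of y a] this[of "shiftn a y" "- a"] show ?thesis by auto
qed

lemma periodic_biinf_pathI:
  assumes "shiftn (int L) y = y" "0 < L" "pre_digraph.cas G v (window y 0 L) v"
    "set (window y 0 L) \<subseteq> arcs G"
  shows "y \<in> biinf_paths G"
proof -
  have "window y 0 (L + L) = window y 0 L @ window y 0 L"
    using window_add[of y 0 L L] window_period1[OF assms(1), of 0 L] by simp
  then have cas: "pre_digraph.cas G v (window y 0 (L + L)) v"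
    using assms(3) cas_append_ex by metis
  have "y i \<in> arcs G \<and> head G (y i) = tail G (y (i + 1))" for i
  proof -
    define k where "k = nat (i mod int L)"
    have k: "k < L" "int k = i mod int L" using assms(2) by (auto simp: k_def nat_less_iff)
    have 1: "y (int k) = y i" using k apply_mod[OF assms(1)] by simp
    have "(i + 1) mod int L = (int k + 1) mod int L" unfolding k(2) by (simp add: mod_simps)
    then have 2: "y (int k + 1) = y (i + 1)" using apply_mod[OF assms(1)] by metis
    have "window y 0 L ! k \<in> set (window y 0 L)" using k by (intro nth_mem) simp
    then have "y (int k) \<in> arcs G" using assms(4) k by auto
    moreover have "head G (y (int k)) = tail G (y (int k + 1))"
      using cas_step[OF cas, of k] k by (simp add: add.commute)
    ultimately show ?thesis using 1 2 by simp
  qed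
  then show ?thesis by (auto simp: biinf_paths_def)
qed

context wf_digraph
begin

lemma markov_dyck_iff:
  "x \<in> markov_dyck G \<longleftrightarrow> range x \<subseteq> signed_arcs G \<and>
     (\<forall>i. sym_head G (x i) = sym_tail G (x (i + 1))) \<and> (\<forall>i n. reduce (window x i n) \<noteq> None)"
proof (intro iffI conjI allI)
  assume x: "x \<in> markov_dyck G"
  then show r: "range x \<subseteq> signed_arcs G" by (simp add: markov_dyck_def)
  have adm: "admissible G (window x i n)" for i n
  proof -
    have "map x [i..i + int n - 1] = window x i n" by (simp add: map_upto_window)
    then show ?thesis using x by (auto simp: markov_dyck_def) metis
  qed
  have s: "set (window x i n) \<subseteq> signed_arcs G" for i n using r set_window[of x i n] by auto
  show "reduce (window x i n) \<noteq> None" for i n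
    using admissible_iff[OF s[of i n]] adm[of i n] by (cases "n = 0") (auto simp flip: length_0_conv)
  fix i
  obtain u v where "swalk G u (window x i 2) v"
    using admissible_iff[OF s[of i 2]] adm[of i 2] by (auto simp flip: length_0_conv)
  then show "sym_head G (x i) = sym_tail G (x (i + 1))"
    using swalk_step[of G u "window x i 2" v 0] by simp
next
  assume x: "range x \<subseteq> signed_arcs G \<and>
     (\<forall>i. sym_head G (x i) = sym_tail G (x (i + 1))) \<and> (\<forall>i n. reduce (window x i n) \<noteq> None)"
  have "admissible G (window x i n)" for i n
  proof (cases "n = 0")
    case True
    \<comment> \<open>The windows with \<open>j < i\<close> are empty and have to be admissible as
      well: the empty word acts as the identity, zero nowhere.\<close>
    have "act G (map Arc []) \<noteq> act G [Zero]" by (auto simp: fun_eq_iff)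
    then show ?thesis using True act_gis_eq unfolding admissible_def by fastforce
  next
    case False
    have "set (window x i n) \<subseteq> signed_arcs G" using x set_window[of x i n] by auto
    moreover have "\<exists>u v. swalk G u (window x i n) v" using swalk_window[of G x i n] x by blast
    ultimately show ?thesis using admissible_iff[of "window x i n"] x False
      by (auto simp flip: length_0_conv)
  qed
  then show "x \<in> markov_dyck G" using x by (simp add: markov_dyck_def map_upto_window)
qed

lemma markov_dyckD:
  assumes "x \<in> markov_dyck G"
  shows "range x \<subseteq> signed_arcs G" "sym_head G (x i) = sym_tail G (x (i + 1))"
    "reduce (window x i n) \<noteq> None"
  using assms by (auto simp: markov_dyck_iff)

lemma markov_dyck_shiftn [simp]: "shiftn a x \<in> markov_dyck G \<longleftrightarrow> x \<in> markov_dyck G"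
proof -
  have "shiftn a x \<in> markov_dyck G" if x: "x \<in> markov_dyck G" for a x
    unfolding markov_dyck_iff
  proof (intro conjI allI)
    show "range (shiftn a x) \<subseteq> signed_arcs G" using markov_dyckD(1)[OF x] by auto
    show "sym_head G (shiftn a x i) = sym_tail G (shiftn a x (i + 1))" for i
      using markov_dyckD(2)[OF x, of "i + a"] by (simp add: algebra_simps)
    show "reduce (window (shiftn a x) i n) \<noteq> None" for i n
      using markov_dyckD(3)[OF x] by simp
  qed
  from this[of x a] this[of "shiftn a x" "- a"] show ?thesis by auto
qed

lemma Minus_path_in_markov_dyck:
  assumes "y \<in> biinf_paths G" shows "Minus \<circ> y \<in> markov_dyck G"
  using assms by (auto simp: markov_dyck_iff window_comp biinf_paths_def signed_arcs_def)

lemma Minus_path_iff: "Minus \<circ> y \<in> markov_dyck G \<longleftrightarrow> y \<in> biinf_paths G"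
proof
  assume x: "Minus \<circ> y \<in> markov_dyck G"
  show "y \<in> biinf_paths G" using markov_dyckD(1)[OF x] markov_dyckD(2)[OF x]
    by (auto simp: biinf_paths_def signed_arcs_def)
qed (rule Minus_path_in_markov_dyck)

lemma window_rev_plus: "window (rev_plus y) i n = map Plus (rev (window y (1 - i - int n) n))"
proof (rule nth_equalityI)
  fix k assume "k < length (window (rev_plus y) i n)"
  then have k: "k < n" by simp
  then show "window (rev_plus y) i n ! k = map Plus (rev (window y (1 - i - int n) n)) ! k"
    by (simp add: rev_nth rev_plus_def of_nat_diff algebra_simps)
qed simp

lemma rev_plus_in_markov_dyck:
  assumes "y \<in> biinf_paths G" shows "rev_plus y \<in> markov_dyck G"
proof -
  have "reduce (window (rev_plus y) i n) \<noteq> None" for i n by (simp add: window_rev_plus)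
  moreover have "sym_head G (rev_plus y i) = sym_tail G (rev_plus y (i + 1))" for i
    using assms by (auto simp: rev_plus_def biinf_paths_def dest: spec[of _ "- i - 1"])
  moreover have "range (rev_plus y) \<subseteq> signed_arcs G"
    using assms by (auto simp: rev_plus_def biinf_paths_def signed_arcs_def image_subset_iff)
  ultimately show ?thesis by (simp add: markov_dyck_iff)
qed

lemma stack_class_Minus:
  assumes "0 < n" "shiftn (int n) y = y"
  shows "stack_class (Minus \<circ> y) y"
  unfolding stack_class_def
  by (intro exI[of _ 0] exI[of _ n])
    (use assms in \<open>auto simp: window_comp fun_eq_iff shiftn_def\<close>)

lemma stack_class_start:
  assumes x: "x \<in> markov_dyck G" and n: "0 < n" "shiftn (int n) x = x"
    and L: "0 < L" "shiftn (int L) y = y"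
    and red: "reduce (window x i n) = Some ([], rev (window y 0 L))"
  shows "y \<in> biinf_paths G" "tail G (y 0) = sym_tail G (x i)"
proof -
  let ?v = "sym_tail G (x i)"
  have "swalk G ?v (window x i n) (sym_tail G (x (i + int n)))"
    using markov_dyckD(2)[OF x] by (rule swalk_window)
  then have "swalk G ?v (window x i n) ?v" using shiftn_period[OF n(2)] by simp
  from reduce_paths[OF this red] have cas: "cas ?v (window y 0 L) ?v" by (auto simp: pre_digraph.cas.simps)
  have "set (window x i n) \<subseteq> signed_arcs G" using markov_dyckD(1)[OF x] set_window[of x i n] by auto
  then have "set (window y 0 L) \<subseteq> arcs G" using reduce_set[OF red] by auto
  then show "y \<in> biinf_paths G" using periodic_biinf_pathI L cas by metis
  show "tail G (y 0) = ?v" using cas L by (cases L) (auto simp: window_Suc)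
qed

lemma stack_class_path:
  assumes "x \<in> markov_dyck G" "stack_class x y"
  shows "y \<in> biinf_paths G"
  using assms unfolding stack_class_def using stack_class_start by metis

end

subsection \<open>Splicing\<close>

definition splice_at :: "(int \<Rightarrow> 'a) \<Rightarrow> int \<Rightarrow> (int \<Rightarrow> 'a) \<Rightarrow> int \<Rightarrow> int \<Rightarrow> 'a" where
  "splice_at x i z j = (\<lambda>k. if k < 0 then x (i + k) else z (j + k))"

lemma window_splice_at_right: "0 \<le> a \<Longrightarrow> window (splice_at x i z j) a n = window z (j + a) n"
  by (rule nth_equalityI) (auto simp: splice_at_def algebra_simps)

lemma window_splice_at_left: "a + int n \<le> 0 \<Longrightarrow> window (splice_at x i z j) a n = window x (i + a) n"
  by (rule nth_equalityI) (auto simp: splice_at_def algebra_simps)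

lemma window_splice_at_mid:
  "window (splice_at x i z j) (- int m) (m + n) = window x (i - int m) m @ window z j n"
  by (simp add: window_add window_splice_at_right window_splice_at_left)

text \<open>Only windows across the seam are new. Arbitrarily long left parts suffice, because a
  factor of a word with nonzero product has nonzero product; this lets the user choose whole
  periods.\<close>

lemma (in wf_digraph) splice_at_in_markov_dyck:
  assumes x: "x \<in> markov_dyck G" and z: "z \<in> markov_dyck G"
    and v: "sym_tail G (x i) = sym_tail G (z j)"
    and red: "\<And>m n. \<exists>m'\<ge>m. reduce (window x (i - int m') m' @ window z j n) \<noteq> None"
  shows "splice_at x i z j \<in> markov_dyck G"
  unfolding markov_dyck_iff
proof (intro conjI allI)
  let ?s = "splice_at x i z j"
  show "range ?s \<subseteq> signed_arcs G"
    using markov_dyckD(1)[OF x] markov_dyckD(1)[OF z] by (auto simp: splice_at_def)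
  show "sym_head G (?s k) = sym_tail G (?s (k + 1))" for k
  proof -
    consider "k + 1 < 0" | "k + 1 = 0" | "k \<ge> 0" by linarith
    then show ?thesis
    proof cases
      case 1
      then show ?thesis using markov_dyckD(2)[OF x, of "i + k"] by (simp add: splice_at_def add.assoc)
    next
      case 2
      then have "k = -1" by simp
      then show ?thesis using markov_dyckD(2)[OF x, of "i - 1"] v by (simp add: splice_at_def)
    next
      case 3
      then show ?thesis using markov_dyckD(2)[OF z, of "j + k"] by (simp add: splice_at_def add.assoc)
    qed
  qed
  show "reduce (window ?s a n) \<noteq> None" for a n
  proof -
    consider "0 \<le> a" | "a + int n \<le> 0" | "a < 0" "0 < a + int n" by linarith
    then show ?thesis
    proof cases
      case 1
      then show ?thesis using markov_dyckD(3)[OF z] by (simp add: window_splice_at_right)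
    next
      case 2
      then show ?thesis using markov_dyckD(3)[OF x] by (simp add: window_splice_at_left)
    next
      case 3
      define m where "m = nat (- a)"
      define r where "r = nat (a + int n)"
      have mr: "a = - int m" "n = m + r" using 3 by (auto simp: m_def r_def)
      have "window ?s a n = window x (i - int m) m @ window z j r"
        unfolding mr by (rule window_splice_at_mid)
      moreover obtain m' where m': "m' \<ge> m" "reduce (window x (i - int m') m' @ window z j r) \<noteq> None"
        using red by blast
      moreover have "window x (i - int m') m' =
          window x (i - int m') (m' - m) @ window x (i - int m) m"
        using window_add[of x "i - int m'" "m' - m" m] m' by (simp add: of_nat_diff)
      ultimately show ?thesis using reduce_append_NoneI by (metis append.assoc)
    qed
  qed
qed

section \<open>Heteroclinic connections\<close>

text \<open>The shifts \<open>a\<close> and \<open>b\<close> make this a relation between orbits: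
  some point is asymptotic to the orbit of \<open>p\<close> in the past and to that of
  \<open>q\<close> in the future.\<close>

definition connects :: "(int \<Rightarrow> 'a) set \<Rightarrow> (int \<Rightarrow> 'a) \<Rightarrow> (int \<Rightarrow> 'a) \<Rightarrow> bool" where
  "connects X p q \<longleftrightarrow> (\<exists>x\<in>X. \<exists>a b N. (\<forall>i\<le>-N. x i = p (i + a)) \<and> (\<forall>i\<ge>N. x i = q (i + b)))"

lemma connects_spliceI:
  assumes "splice_at x i z j \<in> X"
    and "\<And>k. k \<le> - N \<Longrightarrow> x k = p (k + a)" "\<And>k. k \<ge> N \<Longrightarrow> z k = q (k + b)"
  shows "connects X p q"
  unfolding connects_def
proof (intro bexI exI conjI allI impI)
  define M where "M = \<bar>N\<bar> + \<bar>i\<bar> + \<bar>j\<bar> + 1"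
  show "splice_at x i z j k = p (k + (i + a))" if "k \<le> - M" for k
  proof -
    have "k < 0" "i + k \<le> - N" using that by (auto simp: M_def)
    then show ?thesis using assms(2)[of "i + k"] by (simp add: splice_at_def algebra_simps)
  qed
  show "splice_at x i z j k = q (k + (j + b))" if "M \<le> k" for k
  proof -
    have "\<not> k < 0" "j + k \<ge> N" using that by (auto simp: M_def)
    then show ?thesis using assms(3)[of "j + k"] by (simp add: splice_at_def algebra_simps)
  qed
qed (rule assms)

locale strong_digraph = fin_digraph +
  assumes strong: "strongly_connected G" and arcs_nonempty: "arcs G \<noteq> {}"
begin

lemma awalk_exists: "u \<in> verts G \<Longrightarrow> v \<in> verts G \<Longrightarrow> \<exists>p. awalk u p v"
  using strong reachable_awalk by (auto simp: strongly_connected_def)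

lemma ex_closed_path:
  assumes "u \<in> verts G" "v \<in> verts G"
  shows "\<exists>y k n. y \<in> biinf_paths G \<and> 0 < n \<and> shiftn (int n) y = y \<and> tail G (y 0) = u \<and> tail G (y (int k)) = v"
proof -
  \<comment> \<open>Leading the way back through some arc \<open>f\<close> keeps the closed walk
    nonempty even if \<open>u = v\<close>.\<close>
  obtain f where f: "f \<in> arcs G" using arcs_nonempty by blast
  obtain p1 p2 p3 where p: "awalk u p1 v" "awalk v p2 (tail G f)" "awalk (head G f) p3 u"
    using awalk_exists assms f by (meson head_in_verts tail_in_verts)
  define L where "L = p1 @ p2 @ f # p3"
  have casL: "cas u L u" "set L \<subseteq> arcs G" using p f by (auto simp: L_def cas_append_ex awalk_def)
  define y where "y = periodic_ext L"
  have w: "window y 0 (length L) = L" "shiftn (int (length L)) y = y" unfolding y_def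
    by (rule window_periodic_ext shiftn_periodic_ext)+
  have "0 < length L" by (simp add: L_def)
  have y: "y \<in> biinf_paths G" using periodic_biinf_pathI[OF w(2) \<open>0 < length L\<close>] w(1) casL by simp
  have start: "tail G (y 0) = u" using w casL \<open>0 < length L\<close>
    by (metis cas.simps(2) gr0_implies_Suc window_Suc)
  have "p1 = window y 0 (length p1)"
    using take_window[of "length p1" "length L" y 0] w by (simp add: L_def)
  then have "cas u p1 (tail G (y (int (length p1))))"
    using cas_window[OF y, of 0 "length p1"] start by simp
  moreover have "cas u p1 v" using p by (auto simp: awalk_def)
  ultimately have "tail G (y (int (length p1))) = v"
    by (metis awlast_if_cas)
  then show ?thesis using y w \<open>0 < length L\<close> start by blast
qed

text \<open>Cut at a lowest position, the past of \<open>p\<close> leaves nothing on the stack. The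
  connecting stretch to the vertex of \<open>q\<close> consists of pops, which leave nothing either,
  so no demand of \<open>q\<close> can fail.\<close>

lemma connects_nonneg:
  assumes p: "p \<in> markov_dyck G" "shiftn (int n) p = p" "0 < n" "height (window p 0 n) \<le> 0"
    and q: "q \<in> markov_dyck G"
  shows "connects (markov_dyck G) p q"
proof -
  obtain i where i: "\<And>m. height (window p (i - int m) m) \<le> 0"
    using ex_down_position[OF p(2-4)] by blast
  have clean: "\<exists>P. reduce (window p (i - int m) m) = Some (P, [])" for m
  proof (rule reduce_no_stackI)
    show "reduce (window p (i - int m) m) \<noteq> None" using markov_dyckD(3)[OF p(1)] .
    fix k assume "k \<le> length (window p (i - int m) m)"
    then show "height (drop k (window p (i - int m) m)) \<le> 0"
      using i[of "m - k"] by (simp add: drop_window of_nat_diff algebra_simps)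
  qed
  let ?v = "sym_tail G (p i)" and ?w = "sym_tail G (q 0)"
  have "?v \<in> verts G" "?w \<in> verts G"
    using sym_in_verts markov_dyckD(1)[OF p(1)] markov_dyckD(1)[OF q] by blast+
  then obtain y k where y: "y \<in> biinf_paths G" "tail G (y 0) = ?w" "tail G (y (int k)) = ?v"
    using ex_closed_path[of ?w ?v] by blast
  define z where "z = rev_plus y"
  have z: "z \<in> markov_dyck G" unfolding z_def by (rule rev_plus_in_markov_dyck[OF y(1)])
  \<comment> \<open>At position \<open>1 - c\<close> the point \<open>z\<close> pops
    \<open>y (c - 1)\<close>, hence it starts there at the head of this arc.\<close>
  have zt: "sym_tail G (z (1 - c)) = tail G (y c)" for c
    using y(1) by (auto simp: z_def rev_plus_def biinf_paths_def dest: spec[of _ "c - 1"])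
  define x1 where "x1 = splice_at p i z (1 - int k)"
  have zred: "reduce (window z a m) = Some (rev (window y (1 - a - int m) m), [])" for a m
    by (simp add: z_def window_rev_plus)
  have x1: "x1 \<in> markov_dyck G" unfolding x1_def
  proof (rule splice_at_in_markov_dyck[OF p(1) z])
    show "sym_tail G (p i) = sym_tail G (z (1 - int k))" using zt y by simp
    fix m n
    show "\<exists>m'\<ge>m. reduce (window p (i - int m') m' @ window z (1 - int k) n) \<noteq> None"
      using clean[of m] zred by (intro exI[of _ m]) (auto simp: reduce_append)
  qed
  have "splice_at x1 (int k) q 0 \<in> markov_dyck G"
  proof (rule splice_at_in_markov_dyck[OF x1 q])
    show "sym_tail G (x1 (int k)) = sym_tail G (q 0)"
      using zt[of 0] y by (simp add: x1_def splice_at_def)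
    fix m n
    obtain Q R where q': "reduce (window q 0 n) = Some (Q, R)" using markov_dyckD(3)[OF q, of 0 n] by auto
    have "int k - int (m + k) = - int m" by simp
    then have "window x1 (int k - int (m + k)) (m + k) = window p (i - int m) m @ window z (1 - int k) k"
      using window_splice_at_mid[of p i z "1 - int k" m k] by (simp only: x1_def)
    then obtain P where "reduce (window x1 (int k - int (m + k)) (m + k)) = Some (P, [])"
      using clean[of m] zred[of "1 - int k" k] by (auto simp: reduce_append)
    then show "\<exists>m'\<ge>m. reduce (window x1 (int k - int m') m' @ window q 0 n) \<noteq> None"
      using q' by (intro exI[of _ "m + k"]) (auto simp: reduce_append)
  qed
  then show ?thesis
    by (rule connects_spliceI[where N = 1 and a = i and b = 0]) (auto simp: x1_def splice_at_def add.commute)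
qed

text \<open>Far to the left the connecting point repeats \<open>p\<close>. At a clean cut
  \<open>c\<close> there, its past has stacked any desired number of periods of \<open>y\<close>,
  and this is all that later arguments use of it.\<close>

lemma connects_left_tail:
  assumes "connects (markov_dyck G) p q" "stack_class p y"
  shows "\<exists>x\<in>markov_dyck G. \<exists>b N c n L. (\<forall>i\<ge>N. x i = q (i + b)) \<and> 0 < n \<and> 0 < L \<and> shiftn (int L) y = y \<and>
     (\<forall>k. reduce (window x (c - int (k * n)) (k * n)) = Some ([], rev (window y 0 (k * L)))) \<and>
     (\<exists>i. sym_tail G (x c) = sym_tail G (p i) \<and> reduce (window p i n) = Some ([], rev (window y 0 L)) \<and>
       shiftn (int n) p = p)"
proof -
  obtain x a b N where x: "x \<in> markov_dyck G" "\<And>i. i \<le> - N \<Longrightarrow> x i = p (i + a)" "\<forall>i\<ge>N. x i = q (i + b)"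
    using assms(1) by (auto simp: connects_def)
  obtain i n L where y: "0 < n" "0 < L" "shiftn (int n) p = p" "shiftn (int L) y = y"
    "reduce (window p i n) = Some ([], rev (window y 0 L))"
    using assms(2) by (auto simp: stack_class_def)
  \<comment> \<open>Going back \<open>t\<close> periods places the cut in the half-line where
    \<open>x\<close> follows \<open>p\<close>.\<close>
  define t where "t = \<bar>i - a + N\<bar>"
  define c where "c = i - a - t * int n"
  have "t \<le> t * int n" using y(1) by (simp add: t_def mult_le_cancel_left1)
  then have cN: "c \<le> - N" by (simp add: c_def t_def)
  have "reduce (window x (c - int (k * n)) (k * n)) = Some ([], rev (window y 0 (k * L)))" for k
  proof -
    have "window x (c - int (k * n)) (k * n) = window p (i + (- t - int k) * int n) (k * n)"
    proof (rule window_cong)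
      fix h assume "h < k * n"
      then have "c - int (k * n) + int h \<le> - N" using cN by linarith
      then show "x (c - int (k * n) + int h) = p (i + (- t - int k) * int n + int h)"
        using x(2) by (simp add: c_def algebra_simps)
    qed
    also have "\<dots> = window p i (k * n)" by (rule window_period[OF y(3)])
    finally show ?thesis using reduce_window_power[OF y(3-5)] by simp
  qed
  moreover have "sym_tail G (x c) = sym_tail G (p (i - t * int n))" using x(2)[OF cN] by (simp add: c_def)
  moreover have "p (i - t * int n) = p i"
    using shiftn_period_mult[OF y(3), of "- t"] shiftn_period[of "- t * int n" p i] by simp
  ultimately show ?thesis using x y by metis
qed

text \<open>What may follow a left tail depends only on the stack that it leaves. The tail of
  \<open>p\<close> is replaced by one of \<open>p'\<close> with the same stack.\<close>

lemma connects_same_class: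
  assumes "connects (markov_dyck G) p q" "stack_class p y" "stack_class p' y"
    "p \<in> markov_dyck G" "p' \<in> markov_dyck G"
  shows "connects (markov_dyck G) p' q"
proof -
  obtain x b N c n L i where x: "x \<in> markov_dyck G" "\<And>i. i \<ge> N \<Longrightarrow> x i = q (i + b)" "0 < n" "0 < L"
    "shiftn (int L) y = y"
    "\<And>k. reduce (window x (c - int (k * n)) (k * n)) = Some ([], rev (window y 0 (k * L)))"
    "sym_tail G (x c) = sym_tail G (p i)" "reduce (window p i n) = Some ([], rev (window y 0 L))"
    "shiftn (int n) p = p"
    using connects_left_tail[OF assms(1,2)] by metis
  obtain i' n' L' where p': "0 < n'" "0 < L'" "shiftn (int n') p' = p'" "shiftn (int L') y = y"
    "reduce (window p' i' n') = Some ([], rev (window y 0 L'))"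
    using assms(3) by (auto simp: stack_class_def)
  have "splice_at p' i' x c \<in> markov_dyck G"
  proof (rule splice_at_in_markov_dyck[OF assms(5) x(1)])
    show "sym_tail G (p' i') = sym_tail G (x c)"
      using stack_class_start(2)[OF assms(4) x(3,9,4,5,8)]
        stack_class_start(2)[OF assms(5) p'(1,3,2,4,5)] x(7) by simp
    fix m r :: nat
    \<comment> \<open>\<open>L * m\<close> periods of \<open>p'\<close> and \<open>L' * m\<close>
      periods of \<open>p\<close> stack the same number \<open>L * m * L'\<close> of arcs.\<close>
    define k where "k = L * m"
    have "reduce (window p' (i' - int (k * n')) (k * n')) = Some ([], rev (window y 0 (k * L')))"
      using reduce_window_power[OF p'(3-5), of k] window_period[OF p'(3), of i' "- int k"] by simp
    moreover have "reduce (window x (c - int (L' * m * n)) (L' * m * n)) = Some ([], rev (window y 0 (k * L')))"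
      using x(6)[of "L' * m"] by (simp add: k_def mult_ac)
    ultimately have "reduce (window p' (i' - int (k * n')) (k * n') @ window x c r) =
        reduce (window x (c - int (L' * m * n)) (L' * m * n) @ window x c r)"
      by (simp add: reduce_append)
    also have "\<dots> = reduce (window x (c - int (L' * m * n)) (L' * m * n + r))"
      by (simp add: window_add)
    also have "\<dots> \<noteq> None" using markov_dyckD(3)[OF x(1)] .
    finally have ne: "reduce (window p' (i' - int (k * n')) (k * n') @ window x c r) \<noteq> None" .
    have "m * 1 \<le> m * (L * n')" using x(4) p'(1) by (intro mult_le_mono2) simp
    then have "m \<le> k * n'" by (simp add: k_def mult_ac)
    with ne show "\<exists>m'\<ge>m. reduce (window p' (i' - int m') m' @ window x c r) \<noteq> None"
      by blast
  qed
  then show ?thesis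
    by (rule connects_spliceI[where N = N and a = 0 and b = b]) (use x(2) in auto)
qed

text \<open>At a clean cut the stack reads \<open>y (-1)\<close>, \<open>y (-2)\<close> and so on
  from the top, which is what \<open>rev_plus y\<close> pops from position 1 on.\<close>

lemma connects_rev_plus:
  assumes p: "p \<in> markov_dyck G" "stack_class p y"
  shows "connects (markov_dyck G) p (rev_plus y)"
proof -
  obtain i n L where y: "0 < n" "0 < L" "shiftn (int n) p = p" "shiftn (int L) y = y"
    "reduce (window p i n) = Some ([], rev (window y 0 L))"
    using p(2) by (auto simp: stack_class_def)
  note yp = stack_class_start[OF p(1) y(1,3,2,4,5)]
  have "splice_at p i (rev_plus y) 1 \<in> markov_dyck G"
  proof (rule splice_at_in_markov_dyck[OF p(1) rev_plus_in_markov_dyck[OF yp(1)]])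
    show "sym_tail G (p i) = sym_tail G (rev_plus y 1)"
      using yp by (auto simp: rev_plus_def biinf_paths_def dest: spec[of _ "-1"])
    fix m r :: nat
    define k where "k = m + r"
    have "reduce (window p (i - int (k * n)) (k * n)) = Some ([], rev (window y 0 (k * L)))"
      using reduce_window_power[OF y(3-5), of k] window_period[OF y(3), of i "- int k"] by simp
    moreover have "window y 0 (k * L) = window y (- int r - int (k * L - r)) (k * L - r) @ window y (- int r) r"
    proof -
      have "k * 1 \<le> k * L" using y(2) by (intro mult_le_mono2) simp
      moreover have "r \<le> k" by (simp add: k_def)
      ultimately have kL: "r \<le> k * L" by (metis le_trans mult_1_right)
      have "window y 0 (k * L) = window y (- int (k * L)) (k * L)"
        using window_period[OF y(4), of 0 "- int k"] by simp
      then show ?thesis using window_add[of y "- int (k * L)" "k * L - r" r] kL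
        by (simp add: of_nat_diff)
    qed
    ultimately have ne: "reduce (window p (i - int (k * n)) (k * n) @ window (rev_plus y) 1 r) \<noteq> None"
      by (simp add: reduce_append window_rev_plus)
    have "k * 1 \<le> k * n" using y(1) by (intro mult_le_mono2) simp
    moreover have "m \<le> k" by (simp add: k_def)
    ultimately have "m \<le> k * n" by (metis le_trans mult_1_right)
    with ne show "\<exists>m'\<ge>m. reduce (window p (i - int m') m' @ window (rev_plus y) 1 r) \<noteq> None"
      by blast
  qed
  then show ?thesis by (rule connects_spliceI[where N = 0 and a = 0 and b = 0]) auto
qed

text \<open>Between the past of \<open>p\<close> and the final pops lies a finite window with normal
  form \<open>(P, Q)\<close>. The pops first clear \<open>Q\<close>; then, below the part consumed
  by \<open>P\<close>, they have to follow the stack of \<open>y\<close> downwards. Thus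
  \<open>z\<close> and \<open>y\<close> agree on left half-lines.\<close>

lemma connects_rev_plusD:
  assumes conn: "connects (markov_dyck G) p (rev_plus z)" and p: "stack_class p y"
    and z: "shiftn (int M) z = z" "0 < M"
  shows "\<exists>a. z = shiftn a y"
proof -
  obtain x b N c n L where x: "x \<in> markov_dyck G" "\<And>i. i \<ge> N \<Longrightarrow> x i = rev_plus z (i + b)" "0 < n" "0 < L"
    "shiftn (int L) y = y"
    "\<And>k. reduce (window x (c - int (k * n)) (k * n)) = Some ([], rev (window y 0 (k * L)))"
    using connects_left_tail[OF conn p] by metis
  define n0 where "n0 = nat (N - c)"
  obtain P Q where PQ: "reduce (window x c n0) = Some (P, Q)"
    using markov_dyckD(3)[OF x(1), of c n0] by auto
  \<comment> \<open>The index in \<open>z\<close> of the arc that is popped at position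
    \<open>c + n0\<close>.\<close>
  define A where "A = - (c + int n0 + b)"
  have zz: "window x (c + int n0) t = map Plus (map (\<lambda>r. z (A - int r)) [0..<t])" for t
  proof (rule nth_equalityI)
    fix r assume "r < length (window x (c + int n0) t)"
    moreover have "c + int n0 + int r \<ge> N" by (simp add: n0_def)
    ultimately show "window x (c + int n0) t ! r = map Plus (map (\<lambda>r. z (A - int r)) [0..<t]) ! r"
      using x(2)[of "c + int n0 + int r"] by (simp add: rev_plus_def A_def algebra_simps)
  qed simp
  have key: "z (A - int (length Q) - int d) = y (- 1 - int (length P) - int d)" for d
  proof -
    \<comment> \<open>These \<open>t\<close> pops clear \<open>Q\<close> and reach depth
      \<open>d\<close> beyond it; \<open>k\<close> periods stack enough for \<open>P\<close> and all
      of them.\<close>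
    define t where "t = length Q + Suc d"
    define Z where "Z = map (\<lambda>r. z (A - int r)) [0..<t]"
    define k where "k = length P + t"
    have "window x (c - int (k * n)) (k * n + (n0 + t)) =
        window x (c - int (k * n)) (k * n) @ window x c n0 @ map Plus Z"
      using window_add[of x "c - int (k * n)" "k * n" "n0 + t"] window_add[of x c n0 t] zz[of t]
      by (simp add: Z_def)
    moreover have "reduce (window x (c - int (k * n)) (k * n + (n0 + t))) \<noteq> None"
      using markov_dyckD(3)[OF x(1)] .
    ultimately obtain u where "reduce (window x (c - int (k * n)) (k * n) @ window x c n0 @ map Plus Z) = Some u"
      by auto
    then obtain a v where av: "reduce (window x (c - int (k * n)) (k * n)) = Some a"
      and v1: "reduce (window x c n0 @ map Plus Z) = Some v" and v2: "push_red a v = Some u"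
      by (rule reduce_append_eq_Some)
    have a: "a = ([], rev (window y 0 (k * L)))" using av x(6)[of k] by simp
    note v = v1 v2[unfolded a]
    have len: "length Q < length Z" by (simp add: Z_def t_def)
    from v(1) PQ have "push_red (P, Q) (Z, []) = Some v"
      by (auto simp: reduce_append)
    then have vP: "v = (P @ drop (length Q) Z, [])"
      using len by (auto elim!: push_redE)
    define D where "D = P @ drop (length Q) Z"
    have "k * 1 \<le> k * L" using x(4) by (intro mult_le_mono2) simp
    then have kL: "length P + Suc d \<le> k * L" by (simp add: k_def t_def)
    have lenD: "length D = length P + Suc d" by (simp add: D_def Z_def t_def)
    have "D = take (length D) (rev (window y 0 (k * L)))"
      using v(2) vP kL lenD unfolding D_def[symmetric] by (auto simp: push_red_def split: if_splits)
    then have "D ! (length P + d) = rev (window y 0 (k * L)) ! (length P + d)"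
      using lenD kL by (metis add_Suc_right lessI nth_take)
    moreover have "rev (window y 0 (k * L)) ! (length P + d) = y (int (k * L) - 1 - int (length P) - int d)"
      using kL by (simp add: rev_nth of_nat_diff algebra_simps)
    moreover have "y (int (k * L) - 1 - int (length P) - int d) = y (- 1 - int (length P) - int d)"
      using shiftn_period[OF shiftn_period_mult[OF x(5), of "int k"], of "- 1 - int (length P) - int d"]
      by (simp add: algebra_simps)
    moreover have "D ! (length P + d) = z (A - int (length Q) - int d)"
      by (simp add: D_def Z_def t_def nth_append algebra_simps)
    ultimately show ?thesis by simp
  qed
  show ?thesis using periodic_eqI_far[OF z(1) x(5) z(2) x(4) key] by blast
qed

end

section \<open>Topological conjugacy\<close>

lemma topspace_subshift_topology [simp]: "topspace (subshift_topology X) = X"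
  by (simp add: subshift_topology_def)

lemma limitin_subshift_topology:
  assumes "\<And>k. f k \<in> X"
  shows "limitin (subshift_topology X) f l sequentially \<longleftrightarrow>
    l \<in> X \<and> (\<forall>j. \<forall>\<^sub>F k in sequentially. f k j = l j)"
proof -
  have "limitin (discrete_topology UNIV) (\<lambda>k. f k j) (l j) sequentially \<longleftrightarrow>
      (\<forall>\<^sub>F k in sequentially. f k j = l j)" for j
    unfolding limitin_def by (auto dest!: spec[of _ "{l j}"] elim: eventually_mono)
  then show ?thesis using assms
    by (simp add: subshift_topology_def limitin_subtopology limitin_componentwise)
qed

text \<open>Being asymptotic to a periodic orbit becomes convergence along multiples of the period,
  a form that continuous shift-commuting maps preserve.\<close>

lemma shiftn_right_limit_iff:
  assumes q: "shiftn (int n) q = q" "0 < n"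
  shows "(\<forall>j. \<forall>\<^sub>F k in sequentially. shiftn (int (k * n)) x j = q (j + b)) \<longleftrightarrow>
    (\<exists>N. \<forall>i\<ge>N. x i = q (i + b))" (is "?L \<longleftrightarrow> ?R")
proof
  assume ?L
  \<comment> \<open>Convergence is pointwise; the finitely many positions of one period are taken
    simultaneously and the shifts by \<open>k * n\<close> tile the half-line.\<close>
  then have "\<forall>\<^sub>F k in sequentially. \<forall>j\<in>{0..<int n}. shiftn (int (k * n)) x j = q (j + b)"
    by (simp add: eventually_ball_finite)
  then obtain K where "\<forall>k\<ge>K. \<forall>j\<in>{0..<int n}. shiftn (int (k * n)) x j = q (j + b)"
    unfolding eventually_sequentially by blast
  then have K: "x (j + int (k * n)) = q (j + b)" if "k \<ge> K" "0 \<le> j" "j < int n" for k j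
    using that by (metis atLeastLessThan_iff shiftn_apply)
  have "x i = q (i + b)" if "i \<ge> int (K * n)" for i
  proof -
    define k where "k = nat (i div int n)"
    have "int K \<le> i div int n" using that q(2) zdiv_mono1[of "int K * int n" i "int n"] by simp
    then have k: "k \<ge> K" "int k = i div int n" by (auto simp: k_def)
    have i: "i = i mod int n + int (k * n)" using k(2) by simp
    have "x i = q (i mod int n + b)" using K[of k "i mod int n"] k(1) q(2) i by simp
    also have "\<dots> = q (i + b)" using apply_mod[OF q(1)] by (metis mod_add_left_eq)
    finally show ?thesis .
  qed
  then show ?R by blast
next
  assume ?R
  then obtain N where N: "\<And>i. i \<ge> N \<Longrightarrow> x i = q (i + b)" by blast
  show ?L
  proof
    fix j
    have "shiftn (int (k * n)) x j = q (j + b)" if "k \<ge> nat (N - j)" for k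
    proof -
      have "N - j \<le> int k" using that by simp
      also have "int k \<le> int k * int n" using q(2) by (simp add: mult_le_cancel_left1)
      finally have "x (j + int (k * n)) = q (j + int (k * n) + b)" using N by simp
      also have "\<dots> = q (j + b)"
        using shiftn_period[OF shiftn_period_mult[OF q(1), of "int k"], of "j + b"]
        by (simp add: algebra_simps)
      finally show ?thesis by simp
    qed
    then show "\<forall>\<^sub>F k in sequentially. shiftn (int (k * n)) x j = q (j + b)"
      by (auto simp: eventually_sequentially)
  qed
qed

text \<open>The reflection \<open>i\<close> to \<open>- i\<close> reduces this to the right-hand
  case.\<close>

lemma shiftn_left_limit_iff:
  assumes q: "shiftn (int n) q = q" "0 < n"
  shows "(\<forall>j. \<forall>\<^sub>F k in sequentially. shiftn (- int (k * n)) x j = q (j + b)) \<longleftrightarrow>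
    (\<exists>N. \<forall>i\<le>-N. x i = q (i + b))"
proof -
  let ?r = "\<lambda>z i. z (- i)"
  have "shiftn (int n) (?r q) = ?r q"
  proof
    fix i show "shiftn (int n) (?r q) i = ?r q i"
      using shiftn_period[OF q(1), of "- i - int n"] by simp
  qed
  from shiftn_right_limit_iff[OF this q(2), of "?r x" "- b"]
  have "(\<forall>j. \<forall>\<^sub>F k in sequentially. x (- (j + int (k * n))) = q (- (j - b))) \<longleftrightarrow>
    (\<exists>N. \<forall>i\<ge>N. x (- i) = q (- (i - b)))" by simp
  moreover have "(\<forall>j. \<forall>\<^sub>F k in sequentially. x (- (j + int (k * n))) = q (- (j - b))) \<longleftrightarrow>
     (\<forall>j. \<forall>\<^sub>F k in sequentially. shiftn (- int (k * n)) x j = q (j + b))" (is "?A \<longleftrightarrow> ?B")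
  proof
    assume a: ?A
    show ?B
    proof
      fix j
      show "\<forall>\<^sub>F k in sequentially. shiftn (- int (k * n)) x j = q (j + b)"
        using a[rule_format, of "- j"] by (simp add: algebra_simps)
    qed
  next
    assume b: ?B
    show ?A
    proof
      fix j
      show "\<forall>\<^sub>F k in sequentially. x (- (j + int (k * n))) = q (- (j - b))"
        using b[rule_format, of "- j"] by (simp add: algebra_simps)
    qed
  qed
  moreover have "(\<exists>N. \<forall>i\<ge>N. x (- i) = q (- (i - b))) \<longleftrightarrow> (\<exists>N. \<forall>i\<le>-N. x i = q (i + b))"
  proof (intro iff_exI iffI allI impI)
    fix N i assume h: "\<forall>i\<ge>N. x (- i) = q (- (i - b))" "i \<le> - N"
    show "x i = q (i + b)" using h(1)[rule_format, of "- i"] h(2) by (simp add: algebra_simps)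
  next
    fix N i assume h: "\<forall>i\<le>-N. x i = q (i + b)" "N \<le> i"
    show "x (- i) = q (- (i - b))" using h(1)[rule_format, of "- i"] h(2) by (simp add: algebra_simps)
  qed
  ultimately show ?thesis by simp
qed

lemma connects_continuous_map:
  assumes f: "continuous_map (subshift_topology X) (subshift_topology Y) f"
    and comm: "\<And>x a. x \<in> X \<Longrightarrow> f (shiftn a x) = shiftn a (f x)"
    and inv: "\<And>x a. x \<in> X \<Longrightarrow> shiftn a x \<in> X"
    and p: "p \<in> X" "shiftn (int m) p = p" "0 < m"
    and q: "q \<in> X" "shiftn (int n) q = q" "0 < n"
    and conn: "connects X p q"
  shows "connects Y (f p) (f q)"
proof -
  obtain x a b N where x: "x \<in> X" "\<forall>i\<le>-N. x i = p (i + a)" "\<forall>i\<ge>N. x i = q (i + b)"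
    using conn by (auto simp: connects_def)
  have fX: "f z \<in> Y" if "z \<in> X" for z
    using f that by (metis continuous_map_image_subset_topspace image_subset_iff topspace_subshift_topology)
  have lim: "\<forall>j. \<forall>\<^sub>F k in sequentially. shiftn (g k) (f x) j = f r (j + c)"
    if "\<forall>j. \<forall>\<^sub>F k in sequentially. shiftn (g k) x j = r (j + c)" "r \<in> X" for g :: "nat \<Rightarrow> int" and r c
  proof -
    have "limitin (subshift_topology X) (\<lambda>k. shiftn (g k) x) (shiftn c r) sequentially"
      using that inv x(1) by (subst limitin_subshift_topology) auto
    then have "limitin (subshift_topology Y) (f \<circ> (\<lambda>k. shiftn (g k) x)) (f (shiftn c r)) sequentially"
      by (rule continuous_map_limit[OF f])
    then have "limitin (subshift_topology Y) (\<lambda>k. shiftn (g k) (f x)) (shiftn c (f r)) sequentially"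
      using comm x(1) that(2) by (simp add: o_def)
    moreover have "shiftn (g k) (f x) \<in> Y" for k
      using comm[OF x(1)] fX[OF inv[OF x(1)]] by metis
    ultimately show ?thesis by (subst (asm) limitin_subshift_topology) auto
  qed
  have fp: "shiftn (int m) (f p) = f p" using comm[OF p(1)] p(2) by metis
  have fq: "shiftn (int n) (f q) = f q" using comm[OF q(1)] q(2) by metis
  have "\<exists>N. \<forall>i\<ge>N. f x i = f q (i + b)"
  proof -
    have "\<forall>j. \<forall>\<^sub>F k in sequentially. shiftn (int (k * n)) x j = q (j + b)"
      unfolding shiftn_right_limit_iff[OF q(2,3)] using x by blast
    from lim[OF this q(1)] show ?thesis unfolding shiftn_right_limit_iff[OF fq q(3)] .
  qed
  then obtain N1 where N1: "\<And>i. i \<ge> N1 \<Longrightarrow> f x i = f q (i + b)" by blast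
  have "\<exists>N. \<forall>i\<le>-N. f x i = f p (i + a)"
  proof -
    have "\<forall>j. \<forall>\<^sub>F k in sequentially. shiftn (- int (k * m)) x j = p (j + a)"
      unfolding shiftn_left_limit_iff[OF p(2,3)] using x by blast
    from lim[OF this p(1)] show ?thesis unfolding shiftn_left_limit_iff[OF fp p(3)] .
  qed
  then obtain N2 where N2: "\<And>i. i \<le> - N2 \<Longrightarrow> f x i = f p (i + a)" by blast
  show ?thesis unfolding connects_def
    by (intro bexI[OF _ fX[OF x(1)]] exI[of _ a] exI[of _ b] exI[of _ "max N1 N2"])
      (auto intro: N1 N2)
qed

definition periodic_points :: "(int \<Rightarrow> 'a) set \<Rightarrow> (int \<Rightarrow> 'a) set" where
  "periodic_points X = {x \<in> X. \<exists>n>0. shiftn (int n) x = x}"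

definition targets :: "(int \<Rightarrow> 'a) set \<Rightarrow> (int \<Rightarrow> 'a) \<Rightarrow> (int \<Rightarrow> 'a) set" where
  "targets X p = {q \<in> periodic_points X. connects X p q}"

text \<open>What the rest of the proof retains of a conjugacy: a shift-commuting bijection that
  respects periodic points and connections among them.\<close>

lemma conjugacy_targets:
  assumes conj: "topologically_conjugate X Y"
    and X: "\<And>x a. x \<in> X \<Longrightarrow> shiftn a x \<in> X" and Y: "\<And>x a. x \<in> Y \<Longrightarrow> shiftn a x \<in> Y"
  obtains \<phi> where "bij_betw \<phi> X Y" "\<And>x a. x \<in> X \<Longrightarrow> \<phi> (shiftn a x) = shiftn a (\<phi> x)"
    "\<phi> ` periodic_points X = periodic_points Y"
    "\<And>p. p \<in> periodic_points X \<Longrightarrow> targets Y (\<phi> p) = \<phi> ` targets X p"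
proof -
  obtain \<phi> where \<phi>: "homeomorphic_map (subshift_topology X) (subshift_topology Y) \<phi>"
    "\<And>x. x \<in> X \<Longrightarrow> \<phi> (shift x) = shift (\<phi> x)"
    using conj by (auto simp: topologically_conjugate_def)
  obtain \<psi> where "homeomorphic_maps (subshift_topology X) (subshift_topology Y) \<phi> \<psi>"
    using \<phi>(1) homeomorphic_map_maps by blast
  then have cont: "continuous_map (subshift_topology X) (subshift_topology Y) \<phi>"
      "continuous_map (subshift_topology Y) (subshift_topology X) \<psi>"
    and inv: "\<And>x. x \<in> X \<Longrightarrow> \<psi> (\<phi> x) = x" "\<And>y. y \<in> Y \<Longrightarrow> \<phi> (\<psi> y) = y"
    by (auto simp: homeomorphic_maps_def)
  have mem: "\<phi> x \<in> Y" if "x \<in> X" for x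
    using cont(1) that by (metis continuous_map_image_subset_topspace image_subset_iff topspace_subshift_topology)
  have mem': "\<psi> x \<in> X" if "x \<in> Y" for x
    using cont(2) that by (metis continuous_map_image_subset_topspace image_subset_iff topspace_subshift_topology)
  have nat: "\<phi> (shiftn (int k) x) = shiftn (int k) (\<phi> x)" if "x \<in> X" for x k
  proof (induction k)
    case (Suc k)
    have s: "shiftn (int (Suc k)) z = shift (shiftn (int k) z)" for z :: "int \<Rightarrow> 'z"
      by (simp add: shift_def shiftn_def algebra_simps)
    have "\<phi> (shiftn (int (Suc k)) x) = shift (\<phi> (shiftn (int k) x))"
      unfolding s using \<phi>(2)[OF X[OF that]] .
    also have "\<dots> = shiftn (int (Suc k)) (\<phi> x)"
      unfolding Suc by (simp add: shift_def shiftn_def algebra_simps)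
    finally show ?case .
  qed simp
  have comm: "\<phi> (shiftn a x) = shiftn a (\<phi> x)" if "x \<in> X" for x a
  proof (cases "a \<ge> 0")
    case True
    then show ?thesis using nat[OF that, of "nat a"] by simp
  next
    case False
    then have "\<phi> (shiftn (- a) (shiftn a x)) = shiftn (- a) (\<phi> (shiftn a x))"
      using nat[OF X[OF that, of a], of "nat (- a)"] by simp
    then have "shiftn a (\<phi> x) = shiftn a (shiftn (- a) (\<phi> (shiftn a x)))" by simp
    then show ?thesis by simp
  qed
  have comm': "\<psi> (shiftn a y) = shiftn a (\<psi> y)" if "y \<in> Y" for y a
  proof -
    have "\<phi> (shiftn a (\<psi> y)) = shiftn a y" using comm mem' inv(2) that by metis
    then show ?thesis using inv(1) X mem' that by metis
  qed
  have per: "\<phi> x \<in> periodic_points Y" if "x \<in> periodic_points X" for x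
    using that comm mem by (auto simp: periodic_points_def) metis
  have per': "\<psi> x \<in> periodic_points X" if "x \<in> periodic_points Y" for x
    using that comm' mem' by (auto simp: periodic_points_def) metis
  have bij: "bij_betw \<phi> X Y"
    by (rule bij_betw_byWitness[where f' = \<psi>]) (use inv mem mem' in auto)
  have im: "\<phi> ` periodic_points X = periodic_points Y"
  proof
    show "periodic_points Y \<subseteq> \<phi> ` periodic_points X"
    proof
      fix y assume y: "y \<in> periodic_points Y"
      then have "y = \<phi> (\<psi> y)" using inv(2) by (simp add: periodic_points_def)
      then show "y \<in> \<phi> ` periodic_points X" using per'[OF y] by blast
    qed
  qed (use per in auto)
  have c1: "connects Y (\<phi> p) (\<phi> q)" if "p \<in> periodic_points X" "q \<in> periodic_points X" "connects X p q" for p q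
    using that connects_continuous_map[OF cont(1) comm X] by (auto simp: periodic_points_def)
  have c2: "connects X (\<psi> p) (\<psi> q)" if "p \<in> periodic_points Y" "q \<in> periodic_points Y" "connects Y p q" for p q
    using that connects_continuous_map[OF cont(2) comm' Y] by (auto simp: periodic_points_def)
  have "targets Y (\<phi> p) = \<phi> ` targets X p" if p: "p \<in> periodic_points X" for p
  proof
    show "\<phi> ` targets X p \<subseteq> targets Y (\<phi> p)" using c1 p per by (auto simp: targets_def)
    show "targets Y (\<phi> p) \<subseteq> \<phi> ` targets X p"
    proof
      fix y assume y: "y \<in> targets Y (\<phi> p)"
      then have yp: "y \<in> periodic_points Y" "connects Y (\<phi> p) y" by (auto simp: targets_def)
      then have "connects X (\<psi> (\<phi> p)) (\<psi> y)" using c2 per p by blast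
      then have "\<psi> y \<in> targets X p" using inv(1) p per'[OF yp(1)] by (simp add: targets_def periodic_points_def)
      moreover have "y = \<phi> (\<psi> y)" using inv(2) yp by (simp add: periodic_points_def)
      ultimately show "y \<in> \<phi> ` targets X p" by blast
    qed
  qed
  then show ?thesis using that bij comm im by blast
qed

section \<open>Dynamical characterization of stack classes\<close>

definition class_points :: "('v, 'e) pre_digraph \<Rightarrow> nat \<Rightarrow> (int \<Rightarrow> 'e) \<Rightarrow> (int \<Rightarrow> 'e signed_arc) set" where
  "class_points G n y = {x \<in> markov_dyck G. shiftn (int n) x = x \<and> stack_class x y}"

definition periodic_paths :: "('v, 'e) pre_digraph \<Rightarrow> nat \<Rightarrow> (int \<Rightarrow> 'e) set" where
  "periodic_paths G n = {y \<in> biinf_paths G. shiftn (int n) y = y}"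

text \<open>Two closed paths that are not shifts of each other prevent a point with a stack class
  from connecting to every periodic point.\<close>

locale branched_digraph = strong_digraph +
  assumes two_cycles: "\<exists>y n z m. 0 < n \<and> 0 < m \<and> y \<in> periodic_paths G n \<and> z \<in> periodic_paths G m \<and>
    (\<forall>a. z \<noteq> shiftn a y)"
begin

lemma stack_class_periodic: "stack_class x y \<Longrightarrow> \<exists>n>0. shiftn (int n) x = x"
  by (auto simp: stack_class_def)

lemma stack_class_periodic_stack: "stack_class x y \<Longrightarrow> \<exists>n>0. shiftn (int n) y = y"
  by (auto simp: stack_class_def)

lemma rev_plus_periodic_point:
  assumes "y \<in> periodic_paths G n" "0 < n"
  shows "rev_plus y \<in> periodic_points (markov_dyck G)"
proof -
  have "shiftn (int n) (rev_plus y) = rev_plus y"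
  proof
    fix i
    show "shiftn (int n) (rev_plus y) i = rev_plus y i"
      using shiftn_period[of "int n" y "- i - int n"] assms by (simp add: rev_plus_def periodic_paths_def)
  qed
  then show ?thesis using rev_plus_in_markov_dyck assms by (auto simp: periodic_points_def periodic_paths_def)
qed

lemma targets_rev_plus:
  assumes "p \<in> markov_dyck G" "stack_class p y" "z \<in> periodic_paths G m" "0 < m"
  shows "rev_plus z \<in> targets (markov_dyck G) p \<longleftrightarrow> (\<exists>a. z = shiftn a y)"
proof
  assume "rev_plus z \<in> targets (markov_dyck G) p"
  then show "\<exists>a. z = shiftn a y"
    using connects_rev_plusD[OF _ assms(2), of z m] assms by (auto simp: targets_def periodic_paths_def)
next
  assume "\<exists>a. z = shiftn a y"
  then show "rev_plus z \<in> targets (markov_dyck G) p"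
    using connects_rev_plus[OF assms(1) stack_class_shift_stack[OF assms(2)]]
      rev_plus_periodic_point[OF assms(3,4)] by (auto simp: targets_def)
qed

text \<open>A point with path \<open>y\<close> misses \<open>rev_plus\<close> of at least one of two
  inequivalent closed paths. A point without a class has nonpositive drift and reaches
  everything.\<close>

lemma stack_class_iff_targets:
  assumes "p \<in> periodic_points (markov_dyck G)"
  shows "(\<exists>y. stack_class p y) \<longleftrightarrow> targets (markov_dyck G) p \<noteq> periodic_points (markov_dyck G)"
proof
  have p: "p \<in> markov_dyck G" using assms by (simp add: periodic_points_def)
  assume "\<exists>y. stack_class p y"
  then obtain y where y: "stack_class p y" by blast
  obtain z1 n z2 m where z: "0 < n" "0 < m" "z1 \<in> periodic_paths G n" "z2 \<in> periodic_paths G m"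
    "\<And>a. z2 \<noteq> shiftn a z1" using two_cycles by blast
  have "\<not> (\<exists>a. z1 = shiftn a y) \<or> \<not> (\<exists>a. z2 = shiftn a y)"
  proof (rule ccontr)
    assume "\<not> (\<not> (\<exists>a. z1 = shiftn a y) \<or> \<not> (\<exists>a. z2 = shiftn a y))"
    then obtain a b where "z1 = shiftn a y" "z2 = shiftn b y" by blast
    then have "z2 = shiftn (b - a) z1" by simp
    then show False using z(5) by blast
  qed
  then show "targets (markov_dyck G) p \<noteq> periodic_points (markov_dyck G)"
    using targets_rev_plus[OF p y z(3,1)] targets_rev_plus[OF p y z(4,2)]
      rev_plus_periodic_point z by metis
next
  assume ne: "targets (markov_dyck G) p \<noteq> periodic_points (markov_dyck G)"
  obtain n where n: "p \<in> markov_dyck G" "0 < n" "shiftn (int n) p = p"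
    using assms by (auto simp: periodic_points_def)
  have "0 < height (window p 0 n)"
  proof (rule ccontr)
    assume "\<not> 0 < height (window p 0 n)"
    then have "targets (markov_dyck G) p = periodic_points (markov_dyck G)"
      using connects_nonneg[OF n(1,3,2)] by (auto simp: targets_def periodic_points_def)
    then show False using ne by blast
  qed
  then show "\<exists>y. stack_class p y" using ex_stack_class[OF n(3,2)] markov_dyckD(3)[OF n(1)] by blast
qed

lemma targets_eq_iff:
  assumes p: "p \<in> markov_dyck G" "stack_class p y" and p': "p' \<in> markov_dyck G" "stack_class p' y'"
  shows "targets (markov_dyck G) p = targets (markov_dyck G) p' \<longleftrightarrow> (\<exists>a. y' = shiftn a y)"
proof
  obtain n where n: "0 < n" "shiftn (int n) y' = y'" using stack_class_periodic_stack[OF p'(2)] by blast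
  then have y': "y' \<in> periodic_paths G n" using stack_class_path[OF p'] by (simp add: periodic_paths_def)
  assume "targets (markov_dyck G) p = targets (markov_dyck G) p'"
  then show "\<exists>a. y' = shiftn a y"
    using targets_rev_plus[OF p y' n(1)] targets_rev_plus[OF p' y' n(1)] shiftn_0[of y'] by metis
next
  assume "\<exists>a. y' = shiftn a y"
  then have "stack_class p y'" using stack_class_shift_stack[OF p(2)] by blast
  then show "targets (markov_dyck G) p = targets (markov_dyck G) p'"
    using connects_same_class p p' by (auto simp: targets_def)
qed

text \<open>The right-hand side speaks only of periods and connections, so a conjugacy carries it
  over.\<close>

lemma class_points_eq:
  assumes "p \<in> markov_dyck G" "stack_class p y" "0 < n"
  shows "class_points G n y =
    {x \<in> markov_dyck G. shiftn (int n) x = x \<and> targets (markov_dyck G) x = targets (markov_dyck G) p}"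
proof (intro set_eqI iffI)
  fix x assume "x \<in> class_points G n y"
  then have x: "x \<in> markov_dyck G" "shiftn (int n) x = x" "stack_class x y"
    by (auto simp: class_points_def)
  have "\<exists>a. y = shiftn a y" by (rule exI[of _ 0]) simp
  then have "targets (markov_dyck G) x = targets (markov_dyck G) p"
    using targets_eq_iff[OF x(1,3) assms(1,2)] by blast
  then show "x \<in> {x \<in> markov_dyck G. shiftn (int n) x = x \<and>
      targets (markov_dyck G) x = targets (markov_dyck G) p}"
    using x by simp
next
  fix x assume "x \<in> {x \<in> markov_dyck G. shiftn (int n) x = x \<and>
      targets (markov_dyck G) x = targets (markov_dyck G) p}"
  then have x: "x \<in> markov_dyck G" "shiftn (int n) x = x"
    "targets (markov_dyck G) x = targets (markov_dyck G) p" by auto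
  have "p \<in> periodic_points (markov_dyck G)" "x \<in> periodic_points (markov_dyck G)"
    using assms x stack_class_periodic by (auto simp: periodic_points_def)
  then obtain y' where y': "stack_class x y'" using stack_class_iff_targets x(3) assms(2) by metis
  then obtain a where "y = shiftn a y'" using targets_eq_iff[OF x(1) y' assms(1,2)] x(3) by blast
  then have "stack_class x y" using stack_class_shift_stack[OF y'] by blast
  then show "x \<in> class_points G n y" using x by (simp add: class_points_def)
qed

end

section \<open>Counting the points of a stack class\<close>

text \<open>The push at \<open>t\<close> survives forever: however long one waits, nothing reaches
  below it.\<close>

definition marked_at :: "(int \<Rightarrow> 'e signed_arc) \<Rightarrow> int \<Rightarrow> bool" where
  "marked_at x t \<longleftrightarrow> (\<exists>f. x t = Minus f) \<and> (\<forall>m. \<exists>q. reduce (window x (t + 1) m) = Some ([], q))"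

definition path_weight :: "('v, 'e) pre_digraph \<Rightarrow> (int \<Rightarrow> 'e) \<Rightarrow> nat \<Rightarrow> real fps" where
  "path_weight G y n = (\<Prod>i<n. excursion_fps G (tail G (y (int i))))"

definition minimal_period :: "(int \<Rightarrow> 'a) \<Rightarrow> nat \<Rightarrow> bool" where
  "minimal_period y \<Lambda> \<longleftrightarrow> 0 < \<Lambda> \<and> (\<forall>m. shiftn (int m) y = y \<longleftrightarrow> \<Lambda> dvd m)"

lemma ex_minimal_period:
  assumes "0 < n" "shiftn (int n) y = y"
  shows "\<exists>\<Lambda>. minimal_period y \<Lambda>"
proof -
  define \<Lambda> where "\<Lambda> = (LEAST m. 0 < m \<and> shiftn (int m) y = y)"
  have \<Lambda>: "0 < \<Lambda>" "shiftn (int \<Lambda>) y = y"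
    using LeastI[of "\<lambda>m. 0 < m \<and> shiftn (int m) y = y" n] assms by (auto simp: \<Lambda>_def)
  have least: "\<Lambda> \<le> m" if "0 < m" "shiftn (int m) y = y" for m
    unfolding \<Lambda>_def using that by (intro Least_le) auto
  have "\<Lambda> dvd m" if "shiftn (int m) y = y" for m
  proof (rule ccontr)
    assume "\<not> \<Lambda> dvd m"
    then have "0 < m mod \<Lambda>" by (simp add: mod_greater_zero_iff_not_dvd)
    moreover have "shiftn (int (m mod \<Lambda>)) y = y"
      using shiftn_mod[OF \<Lambda>(2), of "int m"] that by (simp add: zmod_int)
    ultimately have "\<Lambda> \<le> m mod \<Lambda>" using least by blast
    then show False using mod_less_divisor[OF \<Lambda>(1), of m] by simp
  qed
  moreover have "shiftn (int m) y = y" if "\<Lambda> dvd m" for m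
    using that shiftn_period_mult[OF \<Lambda>(2)] by (metis dvd_def mult.commute of_nat_mult)
  ultimately show ?thesis using \<Lambda>(1) by (auto simp: minimal_period_def)
qed

text \<open>Every symbol of the final stack stems from exactly one surviving push, and a push
  survives if the rest of the word has no demand.\<close>

lemma card_marks_list:
  assumes "reduce w = Some (p, q)"
  shows "card {k. k < length w \<and> (\<exists>f. w ! k = Minus f) \<and> (\<exists>q'. reduce (drop (Suc k) w) = Some ([], q'))} = length q"
  using assms
proof (induction w arbitrary: p q)
  case (Cons a w)
  let ?S = "\<lambda>w. {k. k < length w \<and> (\<exists>f. w ! k = Minus f) \<and> (\<exists>q'. reduce (drop (Suc k) w) = Some ([], q'))}"
  have S: "?S (a # w) = (if (\<exists>f. a = Minus f) \<and> (\<exists>q'. reduce w = Some ([], q')) then {0} else {}) \<union> Suc ` ?S w"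
  proof (intro set_eqI iffI)
    fix k assume "k \<in> ?S (a # w)"
    then show "k \<in> (if (\<exists>f. a = Minus f) \<and> (\<exists>q'. reduce w = Some ([], q')) then {0} else {}) \<union> Suc ` ?S w"
      by (cases k) auto
  qed (auto split: if_splits)
  have fin: "finite (?S w)" by simp
  obtain p1 q1 where w: "reduce w = Some (p1, q1)"
    using Cons.prems by (cases a) (auto split: option.splits)
  have "card (?S (a # w)) = (if (\<exists>f. a = Minus f) \<and> p1 = [] then 1 else 0) + card (?S w)"
    unfolding S using w fin by (auto simp: card_image)
  also have "card (?S w) = length q1" using Cons.IH w by blast
  finally show ?case using Cons.prems w by (cases a; cases p1) (auto split: if_splits)
qed simp

lemma marked_at_period: "shiftn n x = x \<Longrightarrow> marked_at x (t + k * n) \<longleftrightarrow> marked_at x t"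
proof -
  assume x: "shiftn n x = x"
  have "window x (t + k * n + 1) m = window x (t + 1) m" for m
    using window_period[OF x, of "t + 1" k m] by (simp add: add_ac)
  moreover have "x (t + k * n) = x t" using shiftn_period[OF shiftn_period_mult[OF x]] .
  ultimately show ?thesis by (simp add: marked_at_def)
qed

lemma marked_at_shiftn [simp]: "marked_at (shiftn a x) t \<longleftrightarrow> marked_at x (t + a)"
  by (simp add: marked_at_def add_ac)

lemma bij_betw_mod_interval:
  assumes "0 < (n::int)"
  shows "bij_betw (\<lambda>t. t mod n) {i..<i + n} {0..<n}"
proof (rule bij_betw_byWitness[where f' = "\<lambda>t. i + (t - i) mod n"])
  show "\<forall>t\<in>{i..<i + n}. i + (t mod n - i) mod n = t"
  proof
    fix t assume t: "t \<in> {i..<i + n}"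
    have "(t mod n - i) mod n = (t - i) mod n" by (simp add: mod_simps)
    also have "\<dots> = t - i" using t by (intro mod_pos_pos_trivial) auto
    finally show "i + (t mod n - i) mod n = t" by simp
  qed
  show "\<forall>t\<in>{0..<n}. (i + (t - i) mod n) mod n = t"
    by (auto simp: mod_simps)
qed (use assms in auto)

text \<open>Counted over a period that starts clean, survival up to the end of the period is
  survival forever, since the next period has no demand. Residues modulo \<open>n\<close> then move
  the count to the standard period.\<close>

lemma card_marks:
  assumes x: "shiftn (int n) x = x" "0 < n" and y: "stack_class x y"
  shows "int (card {t \<in> {0..<int n}. marked_at x t}) = height (window x 0 n)"
proof -
  obtain i L where iL: "reduce (window x i n) = Some ([], rev (window y 0 L))"
    using stack_class_window[OF y] x by metis
  have nd: "\<exists>q. reduce (window x i m) = Some ([], q)" for m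
    using reduce_window_no_demand[OF x iL] .
  define S where "S = {k. k < length (window x i n) \<and> (\<exists>f. window x i n ! k = Minus f) \<and>
    (\<exists>q'. reduce (drop (Suc k) (window x i n)) = Some ([], q'))}"
  have "card S = L" unfolding S_def card_marks_list[OF iL] by simp
  have S_iff: "k \<in> S \<longleftrightarrow> k < n \<and> marked_at x (i + int k)" for k
  proof
    assume k: "k \<in> S"
    then have kn: "k < n" by (simp add: S_def)
    obtain q' where q': "reduce (window x (i + 1 + int k) (n - Suc k)) = Some ([], q')"
      using k kn by (auto simp: S_def drop_window algebra_simps)
    have "\<exists>q. reduce (window x (i + int k + 1) m) = Some ([], q)" for m
    proof -
      obtain q where q: "reduce (window x i m) = Some ([], q)" using nd by blast
      have "i + 1 + int k + int (n - Suc k) = i + int n" using kn by (simp add: of_nat_diff)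
      then have "window x (i + 1 + int k) (n - Suc k + m) = window x (i + 1 + int k) (n - Suc k) @ window x i m"
        using window_add[of x "i + 1 + int k" "n - Suc k" m] window_period1[OF x(1), of i m] by simp
      then have "reduce (window x (i + 1 + int k) (n - Suc k + m)) = Some ([], q @ q')"
        using q q' by (simp add: reduce_append)
      then have "reduce (window x (i + 1 + int k) m @ window x (i + 1 + int k + int m) (n - Suc k)) = Some ([], q @ q')"
        using window_add[of x "i + 1 + int k" m "n - Suc k"] by (simp only: add.commute[of m])
      from reduce_prefix_no_demand[OF this] show ?thesis by (simp add: add_ac)
    qed
    moreover have "\<exists>f. x (i + int k) = Minus f" using k kn by (auto simp: S_def)
    ultimately show "k < n \<and> marked_at x (i + int k)" using kn by (simp add: marked_at_def)
  next
    assume k: "k < n \<and> marked_at x (i + int k)"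
    then obtain q' f where q': "reduce (window x (i + int k + 1) (n - Suc k)) = Some ([], q')"
      and f: "x (i + int k) = Minus f"
      unfolding marked_at_def by blast
    have "drop (Suc k) (window x i n) = window x (i + int k + 1) (n - Suc k)"
      using k drop_window[of "Suc k" n x i] by (simp add: add_ac)
    then show "k \<in> S" using k q' f by (simp add: S_def)
  qed
  have "inj_on (\<lambda>k. i + int k) S" by (auto intro: inj_onI)
  moreover have "(\<lambda>k. i + int k) ` S = {t \<in> {i..<i + int n}. marked_at x t}"
  proof (intro set_eqI iffI)
    fix t assume t: "t \<in> {t \<in> {i..<i + int n}. marked_at x t}"
    then have "t = i + int (nat (t - i))" by simp
    moreover have "nat (t - i) \<in> S" unfolding S_iff using t by (simp add: nat_less_iff)
    ultimately show "t \<in> (\<lambda>k. i + int k) ` S" by blast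
  next
    fix t assume "t \<in> (\<lambda>k. i + int k) ` S"
    then obtain k where "t = i + int k" "k < n \<and> marked_at x (i + int k)"
      unfolding image_iff Bex_def S_iff by blast
    then show "t \<in> {t \<in> {i..<i + int n}. marked_at x t}" by simp
  qed
  ultimately have "bij_betw (\<lambda>k. i + int k) S {t \<in> {i..<i + int n}. marked_at x t}"
    by (simp only: bij_betw_def)
  then have 1: "card {t \<in> {i..<i + int n}. marked_at x t} = L"
    using bij_betw_same_card[of _ S] \<open>card S = L\<close> by metis
  have mm: "marked_at x (t mod int n) \<longleftrightarrow> marked_at x t" for t
    using marked_at_period[OF x(1), of "t mod int n" "t div int n"] by simp
  have bm: "bij_betw (\<lambda>t. t mod int n) {i..<i + int n} {0..<int n}"
    using x(2) by (intro bij_betw_mod_interval) simp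
  have "bij_betw (\<lambda>t. t mod int n) {t \<in> {i..<i + int n}. marked_at x t} {t \<in> {0..<int n}. marked_at x t}"
    unfolding bij_betw_def
  proof
    show "inj_on (\<lambda>t. t mod int n) {t \<in> {i..<i + int n}. marked_at x t}"
      using bij_betw_imp_inj_on[OF bm] by (rule inj_on_subset) auto
    show "(\<lambda>t. t mod int n) ` {t \<in> {i..<i + int n}. marked_at x t} = {t \<in> {0..<int n}. marked_at x t}"
    proof (intro set_eqI iffI)
      fix t assume t: "t \<in> {t \<in> {0..<int n}. marked_at x t}"
      then obtain s where "s \<in> {i..<i + int n}" "t = s mod int n"
        using bij_betw_imp_surj_on[OF bm] by blast
      then show "t \<in> (\<lambda>t. t mod int n) ` {t \<in> {i..<i + int n}. marked_at x t}" using t mm by auto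
    next
      fix t assume "t \<in> (\<lambda>t. t mod int n) ` {t \<in> {i..<i + int n}. marked_at x t}"
      then obtain s where "t = s mod int n" "marked_at x s" by blast
      then show "t \<in> {t \<in> {0..<int n}. marked_at x t}" using mm x(2) by simp
    qed
  qed
  then have "card {t \<in> {0..<int n}. marked_at x t} = L" using 1 bij_betw_same_card by metis
  moreover have "height (window x 0 n) = int L"
    using height_reduce[OF iL] height_window_rotate[OF x(1), of i] by simp
  ultimately show ?thesis by simp
qed

lemma prod_list_window: "prod_list (map f (window y a n)) = (\<Prod>i<n. f (y (a + int i)))"
  by (simp add: window_def prod.list_conv_set_nth atLeast0LessThan)

lemma prod_periodic_shift:
  fixes f :: "int \<Rightarrow> 'b::comm_monoid_mult"
  assumes "\<And>i. f (i + int n) = f i"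
  shows "(\<Prod>i<n. f (a + int i)) = (\<Prod>i<n. f (int i))"
proof (cases "n = 0")
  case False
  have per: "f (i + k * int n) = f i" for i k
    using shiftn_period[OF shiftn_period_mult[of "int n" f k]] assms by (metis ext shiftn_apply)
  have "(\<Prod>i<n. f (a + int i)) = (\<Prod>t\<in>{a..<a + int n}. f t)"
    by (rule prod.reindex_bij_witness[of _ "\<lambda>t. nat (t - a)" "\<lambda>i. a + int i"]) auto
  also have "\<dots> = (\<Prod>t\<in>{a..<a + int n}. f (t mod int n))"
  proof (rule prod.cong)
    show "f t = f (t mod int n)" for t using per[of "t mod int n" "t div int n"] by simp
  qed simp
  also have "\<dots> = (\<Prod>t\<in>{0..<int n}. f t)"
    using False by (intro prod.reindex_bij_betw bij_betw_mod_interval) simp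
  also have "\<dots> = (\<Prod>i<n. f (int i))"
    by (rule prod.reindex_bij_witness[of _ int nat]) auto
  finally show ?thesis .
qed simp

lemma path_weight_shift:
  assumes "shiftn (int n) y = y"
  shows "path_weight G (shiftn a y) n = path_weight G y n"
  unfolding path_weight_def
  using prod_periodic_shift[of "\<lambda>i. excursion_fps G (tail G (y i))" n a] shiftn_period[OF assms]
  by (simp add: add.commute)

lemma prod_lessThan_add:
  fixes f :: "nat \<Rightarrow> 'b::comm_monoid_mult"
  shows "(\<Prod>i<n + m. f i) = (\<Prod>i<n. f i) * (\<Prod>i<m. f (n + i))"
  by (induction m) (auto simp: mult.assoc)

lemma path_weight_mult:
  assumes "shiftn (int n) y = y"
  shows "path_weight G y (M * n) = path_weight G y n ^ M"
proof (induction M)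
  case (Suc M)
  have "(\<Prod>i<n + M * n. excursion_fps G (tail G (y (int i)))) =
     (\<Prod>i<n. excursion_fps G (tail G (y (int i)))) * (\<Prod>i<M * n. excursion_fps G (tail G (y (int (n + i)))))"
    by (rule prod_lessThan_add)
  moreover have "y (int (n + i)) = y (int i)" for i
    using shiftn_period[OF assms, of "int i"] by (simp add: add.commute)
  ultimately show ?case using Suc by (simp add: path_weight_def)
qed (simp add: path_weight_def)

lemma fps_power_cong:
  fixes a b :: "real fps"
  assumes "\<And>k. k \<le> i \<Longrightarrow> fps_nth a k = fps_nth b k" "k \<le> i"
  shows "fps_nth (a ^ M) k = fps_nth (b ^ M) k"
  using assms(2)
proof (induction M arbitrary: k)
  case (Suc M)
  then show ?case using assms(1) by (auto simp: fps_mult_nth intro!: sum.cong)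
qed simp

section \<open>Points of a class sorted by their drift\<close>

context fin_digraph
begin

lemma finite_periodic_markov_dyck: "0 < n \<Longrightarrow> finite {x \<in> markov_dyck G. shiftn (int n) x = x}"
proof (rule finite_imageD[of "\<lambda>x. window x 0 n"])
  have "(\<lambda>x. window x 0 n) ` {x \<in> markov_dyck G. shiftn (int n) x = x} \<subseteq>
      {w. set w \<subseteq> signed_arcs G \<and> length w = n}"
    using markov_dyckD(1) set_window by fastforce
  then show "finite ((\<lambda>x. window x 0 n) ` {x \<in> markov_dyck G. shiftn (int n) x = x})"
    by (rule finite_subset) (simp add: finite_lists_length_eq)
qed (auto intro!: inj_onI intro: periodic_eqI)

lemma finite_class_points [simp]: "0 < n \<Longrightarrow> finite (class_points G n y)"
  by (rule finite_subset[OF _ finite_periodic_markov_dyck]) (auto simp: class_points_def)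

lemma class_points_shiftn: "x \<in> class_points G n y \<Longrightarrow> shiftn a x \<in> class_points G n y"
  unfolding class_points_def using stack_class_shift_point[of x y a]
  by (auto simp: add.commute) (metis add.commute shiftn_shiftn)

definition drift_points :: "nat \<Rightarrow> (int \<Rightarrow> 'b) \<Rightarrow> nat \<Rightarrow> (int \<Rightarrow> 'b signed_arc) set" where
  "drift_points n y L = {x \<in> class_points G n y. height (window x 0 n) = int L}"

lemma drift_points_shiftn: "x \<in> drift_points n y L \<Longrightarrow> shiftn a x \<in> drift_points n y L"
  using class_points_shiftn[of x n y a] height_window_rotate[of n x a]
  by (auto simp: drift_points_def class_points_def)

text \<open>Pairs of a point and a surviving push in a period are counted twice over: by points,
  with \<open>L\<close> pushes each, and after shifting the push to position 0.\<close>

lemma drift_points_double_count: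
  assumes "0 < n"
  shows "L * card (drift_points n y L) = n * card {x \<in> drift_points n y L. marked_at x 0}"
proof -
  let ?S = "drift_points n y L"
  have fin: "finite ?S" using finite_class_points[OF assms] by (auto simp: drift_points_def)
  have "card {t \<in> {0..<int n}. marked_at x t} = L" if "x \<in> ?S" for x
    using card_marks[of n x y] that assms by (auto simp: drift_points_def class_points_def)
  note cT = this
  have "finite {t \<in> {0..<int n}. marked_at x t}" for x :: "int \<Rightarrow> 'b signed_arc"
    by (rule finite_subset[of _ "{0..<int n}"]) auto
  then have "card (SIGMA x:?S. {t \<in> {0..<int n}. marked_at x t}) =
      (\<Sum>x\<in>?S. card {t \<in> {0..<int n}. marked_at x t})"
    using fin by (intro card_SigmaI) auto
  also have "\<dots> = (\<Sum>x\<in>?S. L)" using cT by (rule sum.cong[OF refl])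
  finally have 1: "card (SIGMA x:?S. {t \<in> {0..<int n}. marked_at x t}) = L * card ?S"
    by simp
  have "bij_betw (\<lambda>(x, t). (shiftn t x, t)) (SIGMA x:?S. {t \<in> {0..<int n}. marked_at x t})
      ({x \<in> ?S. marked_at x 0} \<times> {0..<int n})"
    by (rule bij_betw_byWitness[where f' = "\<lambda>(z, t). (shiftn (- t) z, t)"])
      (auto simp: drift_points_shiftn)
  from bij_betw_same_card[OF this] 1 show ?thesis by (simp add: card_cartesian_product mult.commute)
qed

text \<open>Powers of a word without demand have nonzero product, and up to whole periods every
  window is a factor of such a power.\<close>

lemma periodic_ext_in_markov_dyck:
  assumes w: "set w \<subseteq> signed_arcs G" "swalk G v w v" "reduce w = Some ([], q)" "w \<noteq> []"
  shows "periodic_ext w \<in> markov_dyck G"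
  unfolding markov_dyck_iff
proof (intro conjI allI)
  define n where "n = length w"
  let ?z = "periodic_ext w"
  have n: "0 < n" using w by (simp add: n_def)
  have zw: "window ?z 0 n = w" and zp: "shiftn (int n) ?z = ?z"
    unfolding n_def by (rule window_periodic_ext shiftn_periodic_ext)+
  have ww: "window ?z 0 (n + n) = w @ w"
    using window_add[of ?z 0 n n] window_period1[OF zp, of 0 n] zw by simp
  have sww: "swalk G v (w @ w) v" using w(2) by auto
  show "range ?z \<subseteq> signed_arcs G"
  proof clarify
    fix i
    have "?z i = w ! nat (i mod int n)" by (simp add: periodic_ext_def n_def)
    moreover have "nat (i mod int n) < n" using n by (simp add: nat_less_iff)
    ultimately show "?z i \<in> signed_arcs G" using w(1) nth_mem by (auto simp: n_def)
  qed
  show "sym_head G (?z i) = sym_tail G (?z (i + 1))" for i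
  proof -
    define k where "k = nat (i mod int n)"
    have k: "k < n" "int k = i mod int n" using n by (auto simp: k_def nat_less_iff)
    have 1: "?z (int k) = ?z i" using k apply_mod[OF zp] by simp
    have "(i + 1) mod int n = (int k + 1) mod int n" unfolding k(2) by (simp add: mod_simps)
    then have 2: "?z (int k + 1) = ?z (i + 1)" using apply_mod[OF zp] by metis
    have "Suc k < length (w @ w)" using k by (simp add: n_def)
    from swalk_step[OF sww this]
    have "sym_head G (window ?z 0 (n + n) ! k) = sym_tail G (window ?z 0 (n + n) ! Suc k)"
      unfolding ww .
    then show ?thesis using 1 2 k by (simp add: add.commute)
  qed
  show "reduce (window ?z i m) \<noteq> None" for i m
  proof -
    define s where "s = nat (i mod int n)"
    have "int s = i mod int n" using n by (simp add: s_def)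
    then have "window ?z i m = window ?z (int s) m"
      using window_period[OF zp, of "i mod int n" "i div int n" m] by simp
    moreover have "reduce (window ?z 0 ((s + m) * n)) \<noteq> None"
    proof -
      have "q = rev (window (periodic_ext (rev q)) 0 (length (rev q)))"
        by (simp only: window_periodic_ext rev_rev_ident)
      then have "reduce (window ?z 0 n) = Some ([], rev (window (periodic_ext (rev q)) 0 (length (rev q))))"
        using w(3) zw by simp
      from reduce_window_power[OF zp shiftn_periodic_ext this] show ?thesis by simp
    qed
    moreover have "s + m \<le> (s + m) * n" using n by simp
    then have "window ?z 0 ((s + m) * n) =
        window ?z 0 s @ window ?z (int s) m @ window ?z (int (s + m)) ((s + m) * n - (s + m))"
      using window_add[of ?z 0 "s + m" "(s + m) * n - (s + m)"] window_add[of ?z 0 s m] by simp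
    ultimately show ?thesis using reduce_append_NoneI by metis
  qed
qed

text \<open>A surviving push at position 0 makes one period a marked word along \<open>M\<close>
  turns of the path. It may be any of the \<Lambda> arcs of a turn, and each choice gives the same
  count because the weight is cyclic.\<close>

lemma card_marked_drift_points:
  assumes n: "0 < n" and y: "y \<in> biinf_paths G" "minimal_period y \<Lambda>" and M: "0 < M"
    and nj: "n = M * \<Lambda> + 2 * j"
  shows "real (card {x \<in> drift_points n y (M * \<Lambda>). marked_at x 0}) =
    real \<Lambda> * fps_nth (path_weight G y \<Lambda> ^ M) j"
proof -
  define L where "L = M * \<Lambda>"
  have \<Lambda>: "0 < \<Lambda>" "shiftn (int \<Lambda>) y = y" using y(2) by (auto simp: minimal_period_def)
  have L: "0 < L" "shiftn (int L) y = y"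
    using \<Lambda>(1) M shiftn_period_mult[OF \<Lambda>(2), of "int M"] by (simp_all add: L_def)
  obtain L1 where L1: "L = Suc L1" using L by (cases L) auto
  obtain n1 where n1: "n = Suc n1" using n by (cases n) auto
  have La: "shiftn (int L) (shiftn a y) = shiftn a y" for a
    using L(2) by (metis add.commute shiftn_shiftn)
  \<comment> \<open>The points whose surviving push at position 0 is the arc
    \<open>y a\<close>.\<close>
  define Mk where "Mk a = {z \<in> markov_dyck G. shiftn (int n) z = z \<and>
     window z 0 n \<in> {w \<in> stack_words G (tail G (y a)) (window (shiftn a y) 0 L) n.
        hd w = Minus (y a) \<and> reduce (tl w) = Some ([], rev (window (shiftn a y) 1 L1))}}" for a
  have ys: "window (shiftn a y) 0 L = y a # window (shiftn a y) 1 L1" for a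
    by (simp only: L1 window_Suc shiftn_apply) simp
  have card_Mk: "real (card (Mk a)) = fps_nth (path_weight G y \<Lambda> ^ M) j" for a
  proof -
    have path: "cas (tail G (y a)) (y a # window (shiftn a y) 1 L1) (tail G (y a))"
    proof -
      have "tail G (shiftn a y (int L)) = tail G (y a)"
        using shiftn_period[OF L(2), of a] by (simp add: add.commute)
      then show ?thesis using cas_window[of "shiftn a y" G 0 L] y(1) unfolding ys by simp
    qed
    have arcs: "set (y a # window (shiftn a y) 1 L1) \<subseteq> arcs G"
    proof -
      have "range (shiftn a y) \<subseteq> arcs G" using y(1) by (auto simp: biinf_paths_def)
      then show ?thesis using set_window[of "shiftn a y" 0 L] unfolding ys by (rule subset_trans[rotated])
    qed
    let ?W = "{w \<in> stack_words G (tail G (y a)) (window (shiftn a y) 0 L) n.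
        hd w = Minus (y a) \<and> reduce (tl w) = Some ([], rev (window (shiftn a y) 1 L1))}"
    have "bij_betw (\<lambda>z. window z 0 n) (Mk a) ?W"
      unfolding bij_betw_def
    proof
      show "inj_on (\<lambda>z. window z 0 n) (Mk a)"
      proof (rule inj_onI)
        fix x z assume "x \<in> Mk a" "z \<in> Mk a" "window x 0 n = window z 0 n"
        then show "x = z" using n by (intro periodic_eqI[of n x z]) (simp_all add: Mk_def)
      qed
      show "(\<lambda>z. window z 0 n) ` Mk a = ?W"
      proof
        show "?W \<subseteq> (\<lambda>z. window z 0 n) ` Mk a"
        proof
          fix w assume w: "w \<in> ?W"
          define z where "z = periodic_ext w"
          have lw: "length w = n" and red: "reduce w = Some ([], rev (window (shiftn a y) 0 L))"
            and sw: "set w \<subseteq> signed_arcs G" using w by (auto simp: stack_words_def)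
          have zw: "window z 0 n = w" and zp: "shiftn (int n) z = z"
            using window_periodic_ext[of w] shiftn_periodic_ext[of w] lw by (auto simp: z_def)
          obtain v' where v': "swalk G (tail G (y a)) w v'" using w by (auto simp: stack_words_def)
          have "cas (tail G (y a)) (window (shiftn a y) 0 L) v'"
            using stack_words_end[OF _ v'] w by blast
          then have "v' = tail G (y a)" using path unfolding ys by (metis awlast_if_cas)
          then have swv: "swalk G (tail G (y a)) w (tail G (y a))" using v' by simp
          have "z \<in> markov_dyck G" unfolding z_def
            using periodic_ext_in_markov_dyck[of w] sw swv red n lw by auto
          then have "z \<in> Mk a" using zp zw w by (simp add: Mk_def)
          then show "w \<in> (\<lambda>z. window z 0 n) ` Mk a" using zw by blast
        qed
      qed (auto simp: Mk_def)
    qed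
    then have "card (Mk a) = card ?W" by (rule bij_betw_same_card)
    also have "real (card ?W) =
        fps_nth (\<Prod>z\<leftarrow>window (shiftn a y) 0 L. excursion_fps G (head G z)) j"
    proof -
      have "n = length (y a # window (shiftn a y) 1 L1) + 2 * j" using nj L1 by (simp add: L_def)
      then show ?thesis using card_marked_words[OF path arcs, of j] unfolding ys by simp
    qed
    also have "(\<Prod>z\<leftarrow>window (shiftn a y) 0 L. excursion_fps G (head G z)) =
        (\<Prod>i<L. excursion_fps G (tail G (y (a + 1 + int i))))"
      using y(1) by (simp add: prod_list_window biinf_paths_def add_ac)
    also have "\<dots> = path_weight G y L"
      using prod_periodic_shift[of "\<lambda>i. excursion_fps G (tail G (y i))" L "a + 1"] shiftn_period[OF L(2)]
      by (simp add: path_weight_def)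
    also have "\<dots> = path_weight G y \<Lambda> ^ M" unfolding L_def by (rule path_weight_mult[OF \<Lambda>(2)])
    finally show ?thesis .
  qed
  have eq: "{x \<in> drift_points n y L. marked_at x 0} = (\<Union>a<\<Lambda>. Mk (int a))"
  proof (intro set_eqI iffI)
    fix z assume z: "z \<in> {x \<in> drift_points n y L. marked_at x 0}"
    then have z: "z \<in> markov_dyck G" "shiftn (int n) z = z" "stack_class z y"
      "height (window z 0 n) = int L" "marked_at z 0"
      by (auto simp: drift_points_def class_points_def)
    obtain f q where f: "z 0 = Minus f" "reduce (window z 1 n1) = Some ([], q)"
      using z(5) unfolding marked_at_def by (metis add_0)
    have w: "window z 0 n = Minus f # window z 1 n1" using n1 f by (simp add: window_Suc)
    have red: "reduce (window z 0 n) = Some ([], q @ [f])" using w f by simp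
    define y2 where "y2 = periodic_ext (f # rev q)"
    have len: "length (f # rev q) = L" using height_reduce[OF red] z(4) by simp
    have y2: "window y2 0 L = f # rev q" "shiftn (int L) y2 = y2"
      using window_periodic_ext[of "f # rev q"] shiftn_periodic_ext[of "f # rev q"] len by (auto simp: y2_def)
    have "stack_class z y2" unfolding stack_class_def
      using n L z y2 red by (intro exI[of _ 0] exI[of _ n] exI[of _ L]) simp
    then obtain b where b: "y2 = shiftn b y" using stack_class_unique z(3) by blast
    define a where "a = nat (b mod int \<Lambda>)"
    have a: "a < \<Lambda>" "y2 = shiftn (int a) y"
      using \<Lambda>(1) shiftn_mod[OF \<Lambda>(2), of b] b by (auto simp: a_def nat_less_iff)
    have y2': "y (int a) = f" "window (shiftn (int a) y) 1 L1 = rev q"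
      using y2(1) ys[of "int a"] unfolding a(2) by auto
    have tf: "sym_tail G (z 0) = tail G (y (int a))" using f y2' by simp
    have "swalk G (sym_tail G (z 0)) (window z 0 n) (sym_tail G (z (0 + int n)))"
      by (rule swalk_window) (rule markov_dyckD(2)[OF z(1)])
    moreover have "set (window z 0 n) \<subseteq> signed_arcs G"
      using markov_dyckD(1)[OF z(1)] set_window[of z 0 n] by auto
    ultimately have "window z 0 n \<in> stack_words G (tail G (y (int a))) (window (shiftn (int a) y) 0 L) n"
      using red y2(1) a(2) tf by (auto simp: stack_words_def)
    then have "z \<in> Mk (int a)" unfolding Mk_def using z w f y2' by auto
    then show "z \<in> (\<Union>a<\<Lambda>. Mk (int a))" using a by blast
  next
    fix z assume "z \<in> (\<Union>a<\<Lambda>. Mk (int a))"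
    then obtain a where a: "z \<in> Mk (int a)" by blast
    then have z: "z \<in> markov_dyck G" "shiftn (int n) z = z"
      and red: "reduce (window z 0 n) = Some ([], rev (window (shiftn (int a) y) 0 L))"
      and hd: "hd (window z 0 n) = Minus (y (int a))"
      and tl: "reduce (tl (window z 0 n)) = Some ([], rev (window (shiftn (int a) y) 1 L1))"
      by (auto simp: Mk_def stack_words_def)
    have z0: "z 0 = Minus (y (int a))" and z1: "reduce (window z 1 n1) = Some ([], rev (window (shiftn (int a) y) 1 L1))"
      using hd tl n1 by (auto simp: window_Suc)
    have "stack_class z (shiftn (int a) y)" unfolding stack_class_def
      using n L(1) z La red by (intro exI[of _ 0] exI[of _ n] exI[of _ L]) auto
    from stack_class_shift_stack[OF this, of "- int a"] have "stack_class z y" by simp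
    moreover have "height (window z 0 n) = int L" using height_reduce[OF red] by simp
    moreover have "marked_at z 0"
    proof -
      have "window z 1 n = window z 1 n1 @ [z (1 + int n1)]"
        using window_add[of z 1 n1 1] n1 by (simp add: window_Suc)
      moreover have "z (1 + int n1) = Minus (y (int a))"
        using shiftn_period[OF z(2), of 0] z0 n1 by (simp add: add.commute)
      ultimately have "reduce (window z 1 n) = Some ([], y (int a) # rev (window (shiftn (int a) y) 1 L1))"
        using z1 by (simp add: reduce_append)
      from reduce_window_no_demand[OF z(2) n this] show ?thesis using z0 by (auto simp: marked_at_def)
    qed
    ultimately show "z \<in> {x \<in> drift_points n y L. marked_at x 0}"
      using z by (simp add: drift_points_def class_points_def)
  qed
  have fin: "finite (Mk a)" for a
    by (rule finite_subset[OF _ finite_periodic_markov_dyck[OF n]]) (auto simp: Mk_def)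
  have disj: "Mk (int a) \<inter> Mk (int b) = {}" if "a < \<Lambda>" "b < \<Lambda>" "a \<noteq> b" for a b
  proof (rule ccontr)
    assume "Mk (int a) \<inter> Mk (int b) \<noteq> {}"
    then have "window (shiftn (int a) y) 0 L = window (shiftn (int b) y) 0 L"
      by (auto simp: Mk_def stack_words_def)
    then have ab: "shiftn (int a) y = shiftn (int b) y" using periodic_eqI[OF La La L(1)] by blast
    have "a = b" if "a \<le> b" "b < \<Lambda>" "shiftn (int a) y = shiftn (int b) y" for a b
    proof -
      have "shiftn (- int a) (shiftn (int b) y) = shiftn (- int a) (shiftn (int a) y)"
        using that(3) by (simp only:)
      then have "shiftn (int (b - a)) y = y" using that(1) unfolding shiftn_shiftn
        by (simp add: of_nat_diff del: shiftn_apply)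
      then have "\<Lambda> dvd b - a" using y(2) by (simp add: minimal_period_def)
      then show ?thesis using that by (auto dest: dvd_imp_le)
    qed
    then show False using that ab by (metis nat_le_linear)
  qed
  have "card (\<Union>a<\<Lambda>. Mk (int a)) = (\<Sum>a<\<Lambda>. card (Mk (int a)))"
    using fin disj by (intro card_UN_disjoint) auto
  then show ?thesis using card_Mk eq by (simp add: L_def)
qed

lemma card_drift_points:
  assumes n: "0 < n" and y: "y \<in> biinf_paths G" "minimal_period y \<Lambda>" and M: "0 < M"
    and nj: "n = M * \<Lambda> + 2 * j"
  shows "real M * real (card (drift_points n y (M * \<Lambda>))) = real n * fps_nth (path_weight G y \<Lambda> ^ M) j"
proof -
  have "real (M * \<Lambda>) * real (card (drift_points n y (M * \<Lambda>))) =
     real n * (real \<Lambda> * fps_nth (path_weight G y \<Lambda> ^ M) j)"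
    using arg_cong[OF drift_points_double_count[OF n, of "M * \<Lambda>" y], of real]
    unfolding of_nat_mult card_marked_drift_points[OF assms] .
  moreover have "0 < real \<Lambda>" using y(2) by (simp add: minimal_period_def)
  ultimately show ?thesis by (simp add: mult.assoc mult.left_commute[of _ "real \<Lambda>"])
qed

lemma drift_points_empty:
  assumes "x \<in> drift_points n y L"
  shows "\<exists>j. n = L + 2 * j"
proof -
  have "height (window x 0 n) = int L" using assms by (simp add: drift_points_def)
  then have "L \<le> n" "even (n - L)"
    using height_le_length[of "window x 0 n"] height_parity[of "window x 0 n"] by auto
  then show ?thesis by (metis add_diff_cancel_left' dvdE le_add_diff_inverse)
qed

text \<open>What a period of \<open>x\<close> stacks is a period of \<open>y\<close>, hence a number
  of full turns.\<close>

lemma class_points_drift: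
  assumes "x \<in> class_points G n y" "0 < n" "minimal_period y \<Lambda>"
  shows "\<exists>M>0. M \<le> n \<and> M * \<Lambda> \<le> n \<and> x \<in> drift_points n y (M * \<Lambda>)"
proof -
  have x: "shiftn (int n) x = x" "stack_class x y" using assms by (auto simp: class_points_def)
  obtain i L where L: "0 < L" "shiftn (int L) y = y" "reduce (window x i n) = Some ([], rev (window y 0 L))"
    using stack_class_window[OF x(2)] x(1) assms(2) by metis
  have h: "height (window x 0 n) = int L"
    using height_reduce[OF L(3)] height_window_rotate[OF x(1), of i] by simp
  have "L \<le> n" using height_le_length[of "window x 0 n"] h by simp
  obtain M where M: "L = M * \<Lambda>" using L(2) assms(3) by (auto simp: minimal_period_def mult.commute)
  then have "0 < M" "M \<le> L" using L(1) using assms(3) by (auto simp: minimal_period_def)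
  moreover have "M \<le> n" using \<open>M \<le> L\<close> \<open>L \<le> n\<close> by (rule le_trans)
  ultimately show ?thesis using \<open>L \<le> n\<close> M h assms(1)
    by (intro exI[of _ M]) (auto simp: drift_points_def)
qed

lemma class_points_eq_Union:
  assumes "0 < n" "minimal_period y \<Lambda>"
  shows "card (class_points G n y) = (\<Sum>M\<in>{1..n}. card (drift_points n y (M * \<Lambda>)))"
proof -
  have "class_points G n y = (\<Union>M\<in>{1..n}. drift_points n y (M * \<Lambda>))"
    using class_points_drift[OF _ assms] by (fastforce simp: drift_points_def)
  also have "card \<dots> = (\<Sum>M\<in>{1..n}. card (drift_points n y (M * \<Lambda>)))"
    using finite_class_points[OF assms(1)] assms(2)
    by (intro card_UN_disjoint) (auto simp: drift_points_def minimal_period_def)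
  finally show ?thesis .
qed

lemma class_points_period_ge:
  assumes "x \<in> class_points G n y" "0 < n" "minimal_period y \<Lambda>"
  shows "\<Lambda> \<le> n"
proof -
  obtain M where M: "0 < M" "M * \<Lambda> \<le> n" using class_points_drift[OF assms] by blast
  then have "1 * \<Lambda> \<le> M * \<Lambda>" by (intro mult_le_mono1) simp
  then show ?thesis using M(2) by linarith
qed

text \<open>At period \<Lambda> there is room for one turn only, and one turn already takes
  \<Lambda> pushes; no pop is left.\<close>

lemma class_points_minimal:
  assumes "x \<in> class_points G \<Lambda> y" "minimal_period y \<Lambda>"
  shows "\<exists>z\<in>periodic_paths G \<Lambda>. x = Minus \<circ> z"
proof -
  have \<Lambda>: "0 < \<Lambda>" using assms(2) by (simp add: minimal_period_def)
  have x: "x \<in> markov_dyck G" "shiftn (int \<Lambda>) x = x" using assms(1) by (auto simp: class_points_def)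
  obtain M where "0 < M" "M * \<Lambda> \<le> \<Lambda>" "x \<in> drift_points \<Lambda> y (M * \<Lambda>)"
    using class_points_drift[OF assms(1) \<Lambda> assms(2)] by blast
  moreover from this have "M = 1" using \<Lambda> by (cases M) auto
  ultimately have "height (window x 0 \<Lambda>) = int (length (window x 0 \<Lambda>))" by (simp add: drift_points_def)
  then obtain z where "shiftn (int \<Lambda>) z = z" "x = Minus \<circ> z"
    using all_Minus_if_full_height[OF x(2) \<Lambda>] by auto
  then show ?thesis using x Minus_path_iff by (auto simp: periodic_paths_def)
qed

end

lemma path_weight_eqI:
  assumes G: "fin_digraph G" "fin_digraph G'"
    and y: "y \<in> biinf_paths G" "minimal_period y \<Lambda>" and y': "y' \<in> biinf_paths G'" "minimal_period y' \<Lambda>"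
    and card: "\<And>n. 0 < n \<Longrightarrow> card (class_points G n y) = card (class_points G' n y')"
  shows "path_weight G y \<Lambda> = path_weight G' y' \<Lambda>"
proof (rule fps_ext)
  fix j
  have \<Lambda>: "0 < \<Lambda>" using y(2) by (simp add: minimal_period_def)
  show "fps_nth (path_weight G y \<Lambda>) j = fps_nth (path_weight G' y' \<Lambda>) j"
  proof (induction j rule: less_induct)
    case (less j)
    \<comment> \<open>At this period the coefficient of index \<open>j\<close> enters through
      \<open>M = 1\<close> only; for \<open>M \<ge> 2\<close> the index \<open>i\<close> with
      \<open>n = M * \<Lambda> + 2 * i\<close> is smaller than \<open>j\<close>.\<close>
    define n where "n = \<Lambda> + 2 * j"
    have n: "0 < n" using \<Lambda> by (simp add: n_def)
    let ?d = "\<lambda>M. real (card (fin_digraph.drift_points G n y (M * \<Lambda>)))"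
    let ?d' = "\<lambda>M. real (card (fin_digraph.drift_points G' n y' (M * \<Lambda>)))"
    have eq: "?d M = ?d' M" if M: "2 \<le> M" for M
    proof (cases "\<exists>i. n = M * \<Lambda> + 2 * i")
      case True
      then obtain i where i: "n = M * \<Lambda> + 2 * i" by blast
      have "2 * \<Lambda> \<le> M * \<Lambda>" using M by (intro mult_le_mono1)
      then have "i < j" using i \<Lambda> unfolding n_def by linarith
      have "fps_nth (path_weight G y \<Lambda> ^ M) i = fps_nth (path_weight G' y' \<Lambda> ^ M) i"
        by (rule fps_power_cong[of i]) (use less \<open>i < j\<close> in auto)
      then have "real M * ?d M = real M * ?d' M"
        using fin_digraph.card_drift_points[OF G(1) n y _ i] fin_digraph.card_drift_points[OF G(2) n y' _ i] M
        by simp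
      then show ?thesis using M by simp
    next
      case False
      then have "fin_digraph.drift_points G n y (M * \<Lambda>) = {}" "fin_digraph.drift_points G' n y' (M * \<Lambda>) = {}"
        using fin_digraph.drift_points_empty[OF G(1)] fin_digraph.drift_points_empty[OF G(2)] by blast+
      then show ?thesis by simp
    qed
    have "(\<Sum>M\<in>{1..n}. ?d M) = (\<Sum>M\<in>{1..n}. ?d' M)"
      using fin_digraph.class_points_eq_Union[OF G(1) n y(2)] fin_digraph.class_points_eq_Union[OF G(2) n y'(2)]
        card[OF n] by (metis of_nat_sum)
    moreover have "{1..n} = insert 1 {2..n}" using n by auto
    moreover have "(\<Sum>M\<in>{2..n}. ?d M) = (\<Sum>M\<in>{2..n}. ?d' M)" using eq by (intro sum.cong) auto
    ultimately have "?d 1 = ?d' 1" by simp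
    moreover have nj: "n = 1 * \<Lambda> + 2 * j" by (simp add: n_def)
    ultimately show ?case
      using fin_digraph.card_drift_points[OF G(1) n y _ nj] fin_digraph.card_drift_points[OF G(2) n y' _ nj] n
      by simp
  qed
qed

section \<open>Conjugacy and closed paths\<close>

definition target_iso :: "(int \<Rightarrow> 'a) set \<Rightarrow> (int \<Rightarrow> 'b) set \<Rightarrow> ((int \<Rightarrow> 'a) \<Rightarrow> int \<Rightarrow> 'b) \<Rightarrow> bool" where
  "target_iso X Y \<phi> \<longleftrightarrow> bij_betw \<phi> X Y \<and> (\<forall>x\<in>X. \<forall>a. \<phi> (shiftn a x) = shiftn a (\<phi> x)) \<and>
     \<phi> ` periodic_points X = periodic_points Y \<and>
     (\<forall>p\<in>periodic_points X. targets Y (\<phi> p) = \<phi> ` targets X p)"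

lemma target_isoD:
  assumes "target_iso X Y \<phi>"
  shows "bij_betw \<phi> X Y" "\<And>x a. x \<in> X \<Longrightarrow> \<phi> (shiftn a x) = shiftn a (\<phi> x)"
    "\<phi> ` periodic_points X = periodic_points Y"
    "\<And>p. p \<in> periodic_points X \<Longrightarrow> targets Y (\<phi> p) = \<phi> ` targets X p"
  using assms by (auto simp only: target_iso_def)

lemma target_iso_inv_into:
  assumes iso: "target_iso X Y \<phi>" and X: "\<And>x a. x \<in> X \<Longrightarrow> shiftn a x \<in> X"
  shows "target_iso Y X (inv_into X \<phi>)"
proof -
  note d = target_isoD[OF iso]
  let ?\<psi> = "inv_into X \<phi>"
  have inj: "inj_on \<phi> X" using d(1) by (rule bij_betw_imp_inj_on)
  have inv: "?\<psi> (\<phi> x) = x" if "x \<in> X" for x using inj that by (rule inv_into_f_f)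
  have sub: "periodic_points X \<subseteq> X" "targets X p \<subseteq> X" for p
    by (auto simp: periodic_points_def targets_def)
  have inv_im: "?\<psi> ` \<phi> ` A = A" if "A \<subseteq> X" for A
    using inj that by (rule inv_into_image_cancel)
  show ?thesis unfolding target_iso_def
  proof (intro conjI ballI allI)
    show "bij_betw ?\<psi> Y X" using d(1) by (rule bij_betw_inv_into)
    show "?\<psi> (shiftn a y) = shiftn a (?\<psi> y)" if y: "y \<in> Y" for y a
    proof -
      obtain x where x: "x \<in> X" "y = \<phi> x" using d(1) y unfolding bij_betw_def by blast
      then show ?thesis using d(2)[OF x(1), of a] inv X by metis
    qed
    show "?\<psi> ` periodic_points Y = periodic_points X" using d(3) inv_im sub(1) by metis
    show "targets X (?\<psi> p) = ?\<psi> ` targets Y p" if p: "p \<in> periodic_points Y" for p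
    proof -
      obtain x where x: "x \<in> periodic_points X" "p = \<phi> x" using d(3) p by blast
      then show ?thesis using d(4)[OF x(1)] inv sub(1) inv_im[OF sub(2)] by (metis subsetD)
    qed
  qed
qed

lemma target_iso_period:
  assumes iso: "target_iso X Y \<phi>" and X: "\<And>x a. x \<in> X \<Longrightarrow> shiftn a x \<in> X" and x: "x \<in> X"
  shows "shiftn a (\<phi> x) = \<phi> x \<longleftrightarrow> shiftn a x = x"
  using target_isoD(2)[OF iso x, of a] bij_betw_imp_inj_on[OF target_isoD(1)[OF iso]] X[OF x] x
  by (metis inj_onD)

text \<open>The least period in a stack class is the length of its path, and it is attained by pure
  pushes alone. A map that preserves classes and periods therefore sends pure pushes to pure pushes
  and preserves the path weight.\<close>

lemma target_iso_Minus:
  assumes G: "branched_digraph G" and G': "branched_digraph G'"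
    and iso: "target_iso (markov_dyck G) (markov_dyck G') \<phi>"
    and y: "y \<in> periodic_paths G n" and n: "0 < n"
  shows "\<exists>z\<in>periodic_paths G' n. \<phi> (Minus \<circ> y) = Minus \<circ> z \<and> path_weight G' z n = path_weight G y n"
proof -
  interpret G: branched_digraph G by (rule G)
  interpret G': branched_digraph G' by (rule G')
  let ?X = "markov_dyck G" and ?Y = "markov_dyck G'"
  note d = target_isoD[OF iso]
  have per: "shiftn a (\<phi> x) = \<phi> x \<longleftrightarrow> shiftn a x = x" if "x \<in> ?X" for a x
    by (rule target_iso_period[OF iso _ that]) simp
  have inj: "inj_on \<phi> ?X" using d(1) by (rule bij_betw_imp_inj_on)
  define p where "p = Minus \<circ> y"
  have yp: "y \<in> biinf_paths G" "shiftn (int n) y = y" using y by (auto simp: periodic_paths_def)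
  have pX: "p \<in> ?X" unfolding p_def by (rule G.Minus_path_in_markov_dyck[OF yp(1)])
  have cp: "stack_class p y" unfolding p_def by (rule G.stack_class_Minus[OF n yp(2)])
  obtain \<Lambda> where \<Lambda>: "minimal_period y \<Lambda>" using ex_minimal_period[OF n yp(2)] by blast
  then have \<Lambda>0: "0 < \<Lambda>" "shiftn (int \<Lambda>) y = y" "\<Lambda> dvd n"
    using yp(2) by (auto simp: minimal_period_def)
  have p\<Lambda>: "shiftn (int \<Lambda>) p = p"
  proof
    fix i show "shiftn (int \<Lambda>) p i = p i" using shiftn_period[OF \<Lambda>0(2), of i] by (simp add: p_def)
  qed
  have pper: "p \<in> periodic_points ?X" using pX p\<Lambda> \<Lambda>0 by (auto simp: periodic_points_def)
  have sub: "periodic_points ?X \<subseteq> ?X" "targets ?X q \<subseteq> ?X" for q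
    by (auto simp: periodic_points_def targets_def)
  have teq: "targets ?Y (\<phi> x) = targets ?Y (\<phi> p) \<longleftrightarrow> targets ?X x = targets ?X p"
    if "x \<in> periodic_points ?X" for x
    unfolding d(4)[OF that] d(4)[OF pper] by (rule inj_on_image_eq_iff[OF inj sub(2) sub(2)])
  have p'per: "\<phi> p \<in> periodic_points ?Y" using d(3) pper by blast
  have "targets ?X p \<noteq> periodic_points ?X" using G.stack_class_iff_targets[OF pper] cp by blast
  then have "\<phi> ` targets ?X p \<noteq> \<phi> ` periodic_points ?X"
    using inj_on_image_eq_iff[OF inj sub(2) sub(1)] by blast
  then have "targets ?Y (\<phi> p) \<noteq> periodic_points ?Y" using d(3,4) pper by simp
  then obtain y' where y': "stack_class (\<phi> p) y'" using G'.stack_class_iff_targets[OF p'per] by blast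
  have p'Y: "\<phi> p \<in> ?Y" using p'per by (simp add: periodic_points_def)
  have im: "\<phi> ` class_points G m y = class_points G' m y'" if m: "0 < m" for m
  proof -
    have "\<phi> ` class_points G m y = {x \<in> ?Y. shiftn (int m) x = x \<and> targets ?Y x = targets ?Y (\<phi> p)}"
      unfolding G.class_points_eq[OF pX cp m]
    proof (intro set_eqI iffI)
      fix x assume "x \<in> \<phi> ` {x \<in> ?X. shiftn (int m) x = x \<and> targets ?X x = targets ?X p}"
      then obtain x0 where x0: "x0 \<in> ?X" "shiftn (int m) x0 = x0" "targets ?X x0 = targets ?X p" "x = \<phi> x0"
        by blast
      then have "x0 \<in> periodic_points ?X" using m by (auto simp: periodic_points_def)
      then show "x \<in> {x \<in> ?Y. shiftn (int m) x = x \<and> targets ?Y x = targets ?Y (\<phi> p)}"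
        using x0 teq per[OF x0(1)] d(1) by (auto simp: bij_betw_def)
    next
      fix x assume x: "x \<in> {x \<in> ?Y. shiftn (int m) x = x \<and> targets ?Y x = targets ?Y (\<phi> p)}"
      then obtain x0 where x0: "x0 \<in> ?X" "x = \<phi> x0" using d(1) by (auto simp: bij_betw_def)
      then have x1: "shiftn (int m) x0 = x0" using per[OF x0(1)] x by simp
      then have "x0 \<in> periodic_points ?X" using m x0 by (auto simp: periodic_points_def)
      then have "targets ?X x0 = targets ?X p" using teq x x0 by blast
      then show "x \<in> \<phi> ` {x \<in> ?X. shiftn (int m) x = x \<and> targets ?X x = targets ?X p}"
        using x0 x1 by blast
    qed
    then show ?thesis using G'.class_points_eq[OF p'Y y' m] by simp
  qed
  have inj_cp: "inj_on \<phi> (class_points G m y)" for m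
    using inj by (rule inj_on_subset) (auto simp: class_points_def)
  have card: "card (class_points G m y) = card (class_points G' m y')" if "0 < m" for m
    using im[OF that] card_image[OF inj_cp] by metis
  obtain \<Lambda>' where \<Lambda>': "minimal_period y' \<Lambda>'"
    using G'.stack_class_periodic_stack[OF y'] ex_minimal_period by blast
  then have \<Lambda>'0: "0 < \<Lambda>'" "shiftn (int \<Lambda>') y' = y'" by (auto simp: minimal_period_def)
  have y'path: "y' \<in> biinf_paths G'" by (rule G'.stack_class_path[OF p'Y y'])
  have pc: "p \<in> class_points G \<Lambda> y" using pX p\<Lambda> cp by (simp add: class_points_def)
  have p'c: "\<phi> p \<in> class_points G' \<Lambda> y'" using im[OF \<Lambda>0(1)] pc by blast
  have "\<Lambda>' \<le> \<Lambda>" by (rule G'.class_points_period_ge[OF p'c \<Lambda>0(1) \<Lambda>'])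
  moreover have "\<Lambda> \<le> \<Lambda>'"
  \<comment> \<open>The pure push point of \<open>y'\<close> has period \<Lambda>', so its preimage
    is a point of the class of \<open>y\<close> with this period.\<close>
  proof -
    have "shiftn (int \<Lambda>') (Minus \<circ> y') = Minus \<circ> y'"
    proof
      fix i show "shiftn (int \<Lambda>') (Minus \<circ> y') i = (Minus \<circ> y') i" using shiftn_period[OF \<Lambda>'0(2), of i] by simp
    qed
    then have "Minus \<circ> y' \<in> class_points G' \<Lambda>' y'"
      using G'.Minus_path_in_markov_dyck[OF y'path] G'.stack_class_Minus[OF \<Lambda>'0] by (simp add: class_points_def)
    then obtain x where "x \<in> class_points G \<Lambda>' y" using im[OF \<Lambda>'0(1)] by blast
    then show ?thesis using G.class_points_period_ge[OF _ \<Lambda>'0(1) \<Lambda>] by blast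
  qed
  ultimately have \<Lambda>eq: "\<Lambda>' = \<Lambda>" by simp
  obtain z where z: "z \<in> periodic_paths G' \<Lambda>" "\<phi> p = Minus \<circ> z"
    using G'.class_points_minimal[OF p'c] \<Lambda>' \<Lambda>eq by blast
  have zp: "z \<in> biinf_paths G'" "shiftn (int \<Lambda>) z = z" using z by (auto simp: periodic_paths_def)
  have "stack_class (\<phi> p) z" unfolding z(2) by (rule G'.stack_class_Minus[OF \<Lambda>0(1) zp(2)])
  then obtain a where a: "z = shiftn a y'" using stack_class_unique[OF y'] by blast
  have "path_weight G y \<Lambda> = path_weight G' y' \<Lambda>"
    using path_weight_eqI[OF G.fin_digraph_axioms G'.fin_digraph_axioms yp(1) \<Lambda> y'path _ card] \<Lambda>' \<Lambda>eq by simp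
  also have "\<dots> = path_weight G' z \<Lambda>"
    unfolding a using path_weight_shift \<Lambda>'0(2) \<Lambda>eq by metis
  finally have w: "path_weight G y \<Lambda> = path_weight G' z \<Lambda>" .
  obtain M where M: "n = M * \<Lambda>" using \<Lambda>0(3) by (metis dvd_def mult.commute)
  have "z \<in> periodic_paths G' n"
    using zp shiftn_period_mult[OF zp(2), of "int M"] M by (simp add: periodic_paths_def)
  moreover have "path_weight G' z n = path_weight G y n"
    unfolding M path_weight_mult[OF zp(2)] path_weight_mult[OF \<Lambda>0(2)] w ..
  ultimately show ?thesis using z(2) unfolding p_def by blast
qed

lemma finite_periodic_paths:
  assumes "fin_digraph G" "0 < n"
  shows "finite (periodic_paths G n)"
proof -
  interpret fin_digraph G by (rule assms)
  have "(\<lambda>y. window y 0 n) ` periodic_paths G n \<subseteq> {w. set w \<subseteq> arcs G \<and> length w = n}"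
    using set_window by (fastforce simp: periodic_paths_def biinf_paths_def)
  then have "finite ((\<lambda>y. window y 0 n) ` periodic_paths G n)"
    by (rule finite_subset) (simp add: finite_lists_length_eq)
  moreover have "inj_on (\<lambda>y. window y 0 n) (periodic_paths G n)"
    by (rule inj_onI) (use assms(2) in \<open>auto simp: periodic_paths_def intro: periodic_eqI[of n]\<close>)
  ultimately show ?thesis by (rule finite_imageD)
qed

lemma inj_Minus_comp: "Minus \<circ> y = Minus \<circ> z \<Longrightarrow> y = z"
  by (auto simp: fun_eq_iff)

lemma conjugate_path_counts:
  assumes G: "branched_digraph G" and G': "branched_digraph G'"
    and conj: "topologically_conjugate (markov_dyck G) (markov_dyck G')" and n: "0 < n"
  shows "card {y \<in> periodic_paths G n. path_weight G y n = W} =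
      card {y \<in> periodic_paths G' n. path_weight G' y n = W}"
    and "card {x \<in> markov_dyck G. shiftn (int n) x = x} = card {x \<in> markov_dyck G'. shiftn (int n) x = x}"
proof -
  interpret G: branched_digraph G by (rule G)
  interpret G': branched_digraph G' by (rule G')
  let ?X = "markov_dyck G" and ?Y = "markov_dyck G'"
  obtain \<phi> where iso: "target_iso ?X ?Y \<phi>"
  proof (rule conjugacy_targets[OF conj])
    fix \<phi> assume "bij_betw \<phi> ?X ?Y" "\<And>x a. x \<in> ?X \<Longrightarrow> \<phi> (shiftn a x) = shiftn a (\<phi> x)"
      "\<phi> ` periodic_points ?X = periodic_points ?Y"
      "\<And>p. p \<in> periodic_points ?X \<Longrightarrow> targets ?Y (\<phi> p) = \<phi> ` targets ?X p"
    then show thesis using that[of \<phi>] unfolding target_iso_def by blast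
  qed simp_all
  have iso': "target_iso ?Y ?X (inv_into ?X \<phi>)"
    by (rule target_iso_inv_into[OF iso]) simp
  have per: "shiftn a (\<phi> x) = \<phi> x \<longleftrightarrow> shiftn a x = x" if "x \<in> ?X" for a x
    by (rule target_iso_period[OF iso _ that]) simp
  have bij: "bij_betw \<phi> ?X ?Y" by (rule target_isoD(1)[OF iso])
  let ?A = "{y \<in> periodic_paths G n. path_weight G y n = W}"
  let ?B = "{y \<in> periodic_paths G' n. path_weight G' y n = W}"
  have fA: "finite ?A" using finite_periodic_paths[OF G.fin_digraph_axioms n] by simp
  have fB: "finite ?B" using finite_periodic_paths[OF G'.fin_digraph_axioms n] by simp
  \<comment> \<open>Stated for arbitrary graphs and types so that it applies to the map and to its
    inverse.\<close>
  have le: "card {y \<in> periodic_paths H n. path_weight H y n = W} \<le>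
      card {y \<in> periodic_paths H' n. path_weight H' y n = W}"
    if H: "branched_digraph H" "branched_digraph H'" and \<psi>: "target_iso (markov_dyck H) (markov_dyck H') \<psi>"
    for H :: "('z, 'x) pre_digraph" and H' :: "('u, 't) pre_digraph" and \<psi>
  proof -
    interpret H: branched_digraph H by (rule H)
    interpret H': branched_digraph H' by (rule H)
    have "\<forall>y. \<exists>z. y \<in> periodic_paths H n \<longrightarrow>
        z \<in> periodic_paths H' n \<and> \<psi> (Minus \<circ> y) = Minus \<circ> z \<and> path_weight H' z n = path_weight H y n"
      using target_iso_Minus[OF H \<psi> _ n] by blast
    then obtain \<theta> where \<theta>: "\<And>y. y \<in> periodic_paths H n \<Longrightarrow> \<theta> y \<in> periodic_paths H' n \<and>
        \<psi> (Minus \<circ> y) = Minus \<circ> \<theta> y \<and> path_weight H' (\<theta> y) n = path_weight H y n"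
      by metis
    have "inj_on \<theta> (periodic_paths H n)"
    proof (rule inj_onI)
      fix y z assume yz: "y \<in> periodic_paths H n" "z \<in> periodic_paths H n" "\<theta> y = \<theta> z"
      then have "\<psi> (Minus \<circ> y) = \<psi> (Minus \<circ> z)" using \<theta> by metis
      moreover have "Minus \<circ> y \<in> markov_dyck H" "Minus \<circ> z \<in> markov_dyck H"
        using yz H.Minus_path_in_markov_dyck by (auto simp: periodic_paths_def)
      ultimately have "Minus \<circ> y = Minus \<circ> z"
        using bij_betw_imp_inj_on[OF target_isoD(1)[OF \<psi>]] by (meson inj_onD)
      then show "y = z" by (rule inj_Minus_comp)
    qed
    then have "inj_on \<theta> {y \<in> periodic_paths H n. path_weight H y n = W}" by (rule inj_on_subset) auto
    then show ?thesis
      using finite_periodic_paths[OF H'.fin_digraph_axioms n] \<theta> by (intro card_inj_on_le) auto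
  qed
  show "card ?A = card ?B" using le[OF G G' iso] le[OF G' G iso'] by simp
  have "bij_betw \<phi> {x \<in> ?X. shiftn (int n) x = x} {x \<in> ?Y. shiftn (int n) x = x}"
    unfolding bij_betw_def
  proof
    show "inj_on \<phi> {x \<in> ?X. shiftn (int n) x = x}"
      using bij_betw_imp_inj_on[OF bij] by (rule inj_on_subset) auto
    show "\<phi> ` {x \<in> ?X. shiftn (int n) x = x} = {x \<in> ?Y. shiftn (int n) x = x}"
    proof (intro set_eqI iffI)
      fix x assume "x \<in> \<phi> ` {x \<in> ?X. shiftn (int n) x = x}"
      then show "x \<in> {x \<in> ?Y. shiftn (int n) x = x}" using per bij by (auto simp only: bij_betw_def)
    next
      fix x assume x: "x \<in> {x \<in> ?Y. shiftn (int n) x = x}"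
      then obtain x0 where x0: "x0 \<in> ?X" "x = \<phi> x0" using bij by (auto simp only: bij_betw_def)
      then have "shiftn (int n) x0 = x0" using per[OF x0(1), of "int n"] x by simp
      then show "x \<in> \<phi> ` {x \<in> ?X. shiftn (int n) x = x}" using x0 by blast
    qed
  qed
  then show "card {x \<in> ?X. shiftn (int n) x = x} = card {x \<in> ?Y. shiftn (int n) x = x}"
    by (rule bij_betw_same_card)
qed

lemma bij_betw_from_fibres:
  assumes "finite A" "finite B" "\<And>c. card {a \<in> A. f a = c} = card {b \<in> B. h b = c}"
  shows "\<exists>\<sigma>. bij_betw \<sigma> A B \<and> (\<forall>a\<in>A. h (\<sigma> a) = f a)"
proof -
  have "\<forall>c. \<exists>\<beta>. bij_betw \<beta> {a \<in> A. f a = c} {b \<in> B. h b = c}"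
    using assms by (intro allI finite_same_card_bij) auto
  then obtain \<beta> where \<beta>: "\<And>c. bij_betw (\<beta> c) {a \<in> A. f a = c} {b \<in> B. h b = c}" by metis
  define \<sigma> where "\<sigma> a = \<beta> (f a) a" for a
  have \<sigma>: "\<sigma> a \<in> B \<and> h (\<sigma> a) = f a" if "a \<in> A" for a
    using bij_betwE[OF \<beta>[of "f a"]] that by (auto simp: \<sigma>_def)
  have "inj_on \<sigma> A"
  proof (rule inj_onI)
    fix a b assume ab: "a \<in> A" "b \<in> A" "\<sigma> a = \<sigma> b"
    then have "f a = f b" using \<sigma> by metis
    then have "\<beta> (f a) a = \<beta> (f a) b" using ab(3) by (simp add: \<sigma>_def)
    moreover have "a \<in> {a' \<in> A. f a' = f a}" "b \<in> {a' \<in> A. f a' = f a}"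
      using ab \<open>f a = f b\<close> by auto
    ultimately show "a = b" using bij_betw_imp_inj_on[OF \<beta>[of "f a"]] by (meson inj_onD)
  qed
  moreover have "\<sigma> ` A = B"
  proof
    show "B \<subseteq> \<sigma> ` A"
    proof
      fix b assume "b \<in> B"
      then have "b \<in> \<beta> (h b) ` {a \<in> A. f a = h b}"
        unfolding bij_betw_imp_surj_on[OF \<beta>[of "h b"]] by simp
      then obtain a where a: "a \<in> A" "f a = h b" "\<beta> (h b) a = b" by force
      then have "\<sigma> a = b" by (simp add: \<sigma>_def)
      then show "b \<in> \<sigma> ` A" using a(1) by blast
    qed
    show "\<sigma> ` A \<subseteq> B" using \<sigma> by blast
  qed
  ultimately show ?thesis using \<sigma> unfolding bij_betw_def by blast
qed

section \<open>Graphs whose sole arcs form a tree\<close>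

lemma cas_sole_subgraph: "pre_digraph.cas (sole_subgraph G) u p v \<longleftrightarrow> pre_digraph.cas G u p v"
  by (induction p arbitrary: u) (auto simp: pre_digraph.cas.simps sole_subgraph_def)

locale tree_digraph = fin_digraph +
  fixes r
  assumes strong: "strongly_connected G" and root: "r \<in> verts G"
    and tree: "\<And>v. v \<in> verts G \<Longrightarrow> \<exists>!p. set p \<subseteq> \<F> G \<and> cas r p v"
    and back_arcs: "arcs G - \<F> G \<noteq> {}"
begin

definition tree_path :: "'a \<Rightarrow> 'b list" where
  "tree_path v = (THE p. set p \<subseteq> \<F> G \<and> cas r p v)"

definition circuit :: "'b \<Rightarrow> 'b list" where
  "circuit g = tree_path (tail G g) @ [g]"

definition circuit_weight :: "'b \<Rightarrow> real fps" where
  "circuit_weight g = prod_list (map (\<lambda>f. excursion_fps G (tail G f)) (circuit g))"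

lemma sole_arc_in_arcs: "f \<in> \<F> G \<Longrightarrow> f \<in> arcs G"
  by (simp add: sole_arcs_def)

lemma tree_path: "v \<in> verts G \<Longrightarrow> set (tree_path v) \<subseteq> \<F> G" "v \<in> verts G \<Longrightarrow> cas r (tree_path v) v"
  using theI'[OF tree] by (auto simp: tree_path_def)

lemma tree_path_eqI: "v \<in> verts G \<Longrightarrow> set p \<subseteq> \<F> G \<Longrightarrow> cas r p v \<Longrightarrow> tree_path v = p"
  unfolding tree_path_def by (rule the1_equality[OF tree]) auto

lemma tree_path_root [simp]: "tree_path r = []"
  by (rule tree_path_eqI) (auto simp: root)

lemma tree_path_head:
  assumes "f \<in> \<F> G" shows "tree_path (head G f) = tree_path (tail G f) @ [f]"
proof (rule tree_path_eqI)
  have f: "f \<in> arcs G" using assms by (rule sole_arc_in_arcs)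
  then show "head G f \<in> verts G" by simp
  show "set (tree_path (tail G f) @ [f]) \<subseteq> \<F> G" using tree_path(1)[of "tail G f"] f assms by auto
  show "cas r (tree_path (tail G f) @ [f]) (head G f)"
    using tree_path(2)[of "tail G f"] f by (auto simp: cas_append_ex)
qed

lemma head_sole_arc: "f \<in> \<F> G \<Longrightarrow> head G f \<noteq> r"
  using tree_path_head[of f] by (metis snoc_eq_iff_butlast tree_path_root)

lemma tree_path_eq_Nil: "v \<in> verts G \<Longrightarrow> tree_path v = [] \<longleftrightarrow> v = r"
  using tree_path(2)[of v] by auto

text \<open>Any vertex other than \<open>r\<close> is entered by the last arc of its tree path, and
  this arc is its sole incoming one.\<close>

lemma head_back_arc:
  assumes "e \<in> arcs G" "e \<notin> \<F> G" shows "head G e = r"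
proof (rule ccontr)
  assume ne: "head G e \<noteq> r"
  have v: "head G e \<in> verts G" using assms by simp
  then obtain p f where p: "tree_path (head G e) = p @ [f]"
    using tree_path_eq_Nil[OF v] ne by (cases "tree_path (head G e)" rule: rev_cases) auto
  then have f: "f \<in> \<F> G" using tree_path(1)[OF v] by simp
  have "head G f = head G e" using tree_path(2)[OF v] p by (auto simp: cas_append_ex)
  then have "e \<in> in_arcs G (head G f)" using assms by simp
  moreover have "in_arcs G (head G f) = {f}" using f by (simp add: sole_arcs_def)
  ultimately have "e = f" by blast
  then show False using f assms by simp
qed

text \<open>If \<open>e\<close> were the only arc into \<open>r\<close>, it would itself be a sole
  arc.\<close>

lemma two_back_arcs:
  assumes "e \<in> arcs G - \<F> G" shows "\<exists>e'\<in>arcs G - \<F> G. e' \<noteq> e"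
proof -
  have "in_arcs G r \<noteq> {e}" using assms head_back_arc[of e] by (auto simp: sole_arcs_def)
  moreover have "e \<in> in_arcs G r" using assms head_back_arc[of e] by simp
  ultimately obtain e' where e': "e' \<in> in_arcs G r" "e' \<noteq> e" by blast
  then have "e' \<in> arcs G - \<F> G" using head_sole_arc by auto
  then show ?thesis using e' by blast
qed

lemma circuit_ne [simp]: "circuit g \<noteq> []"
  by (simp add: circuit_def)

lemma circuit_pos [simp]: "0 < length (circuit g)"
  by (simp add: circuit_def)

lemma last_circuit [simp]: "last (circuit g) = g"
  by (simp add: circuit_def)

lemma set_circuit: "g \<in> arcs G \<Longrightarrow> set (circuit g) \<subseteq> arcs G"
  using tree_path(1)[of "tail G g"] sole_arc_in_arcs by (auto simp: circuit_def)

lemma cas_circuit: "g \<in> arcs G - \<F> G \<Longrightarrow> cas r (circuit g) r"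
  using tree_path(2)[of "tail G g"] head_back_arc[of g] by (auto simp: circuit_def cas_append_ex)

lemma filter_circuit: "g \<in> arcs G - \<F> G \<Longrightarrow> filter (\<lambda>f. f \<notin> \<F> G) (circuit g) = [g]"
  using tree_path(1)[of "tail G g"] by (auto simp: circuit_def filter_empty_conv)

lemma nth_circuit_sole:
  assumes "g \<in> arcs G" "Suc a < length (circuit g)" shows "circuit g ! a \<in> \<F> G"
  using assms tree_path(1)[of "tail G g"] by (auto simp: circuit_def nth_append)

text \<open>Each arc outside \<open>\<F> G\<close> leads back to \<open>r\<close> and completes a
  circuit; what follows the last of them is a tree path. The circuits are thus free generators of
  the closed walks at \<open>r\<close>.\<close>

lemma walk_from_root:
  assumes "set L \<subseteq> arcs G" "cas r L v"
  shows "L = concat (map circuit (filter (\<lambda>f. f \<notin> \<F> G) L)) @ tree_path v"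
  using assms
proof (induction L arbitrary: v rule: rev_induct)
  case Nil
  then show ?case using tree_path_root by auto
next
  case (snoc f L)
  have f: "f \<in> arcs G" "head G f = v" and "cas r L (tail G f)" using snoc.prems by (auto simp: cas_append_ex)
  then have IH: "L = concat (map circuit (filter (\<lambda>f. f \<notin> \<F> G) L)) @ tree_path (tail G f)"
    using snoc by auto
  define gs where "gs = filter (\<lambda>f. f \<notin> \<F> G) L"
  have eq: "L @ [f] = concat (map circuit gs) @ tree_path (tail G f) @ [f]"
    using arg_cong[OF IH[folded gs_def], of "\<lambda>l. l @ [f]"] by (simp only: append_assoc)
  show ?case
  proof (cases "f \<in> \<F> G")
    case True
    then have fl: "filter (\<lambda>f. f \<notin> \<F> G) (L @ [f]) = gs" by (simp add: gs_def)
    show ?thesis unfolding fl using eq tree_path_head[OF True] f(2) by simp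
  next
    case False
    then have fl: "filter (\<lambda>f. f \<notin> \<F> G) (L @ [f]) = gs @ [f]" by (simp add: gs_def)
    have "head G f = r" using head_back_arc f(1) False by blast
    then have "tree_path (head G f) = []" by simp
    then have "tree_path v = []" by (simp only: f(2))
    then show ?thesis unfolding fl using eq by (simp add: circuit_def[of f])
  qed
qed

lemma closed_walk_from_root:
  "set L \<subseteq> arcs G \<Longrightarrow> cas r L r \<Longrightarrow> L = concat (map circuit (filter (\<lambda>f. f \<notin> \<F> G) L))"
  using walk_from_root[of L r] by simp

lemma concat_circuits:
  assumes "set gs \<subseteq> arcs G - \<F> G"
  shows "set (concat (map circuit gs)) \<subseteq> arcs G" "cas r (concat (map circuit gs)) r"
    "filter (\<lambda>f. f \<notin> \<F> G) (concat (map circuit gs)) = gs"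
proof -
  show "set (concat (map circuit gs)) \<subseteq> arcs G" using assms set_circuit by fastforce
  show "cas r (concat (map circuit gs)) r"
    using assms by (induction gs) (use cas_circuit in \<open>auto simp: cas_append_ex\<close>)
  show "filter (\<lambda>f. f \<notin> \<F> G) (concat (map circuit gs)) = gs"
    using assms by (induction gs) (use filter_circuit in auto)
qed

lemma tail_circuit_nth:
  assumes "g \<in> arcs G - \<F> G" "a < length (circuit g)"
  shows "tail G (circuit g ! a) = r \<longleftrightarrow> a = 0"
proof (cases a)
  case 0
  have "tail G (circuit g ! 0) = r" using cas_circuit[OF assms(1)] by (cases "circuit g") auto
  then show ?thesis using 0 by simp
next
  case (Suc b)
  then have "tail G (circuit g ! a) = head G (circuit g ! b)"
    using cas_step[OF cas_circuit[OF assms(1)], of b] assms(2) by simp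
  moreover have "circuit g ! b \<in> \<F> G" using nth_circuit_sole assms Suc by simp
  ultimately show ?thesis using head_sole_arc Suc by simp
qed

lemma root_walk_path:
  assumes "set L \<subseteq> arcs G" "cas r L r" "L \<noteq> []"
  shows "periodic_ext L \<in> periodic_paths G (length L)"
proof -
  have "periodic_ext L \<in> biinf_paths G"
  proof (rule periodic_biinf_pathI)
    show "shiftn (int (length L)) (periodic_ext L) = periodic_ext L" by (rule shiftn_periodic_ext)
  qed (use assms window_periodic_ext[of L] in auto)
  then show ?thesis by (simp add: periodic_paths_def del: shiftn_apply)
qed

text \<open>The circuits of two back arcs serve as the two closed paths: each contains only its own
  back arc, so neither is a shift of the other.\<close>

sublocale branched_digraph
proof
  show "strongly_connected G" by (rule strong)
  show "arcs G \<noteq> {}" using back_arcs by blast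
  obtain e where e: "e \<in> arcs G - \<F> G" using back_arcs by blast
  obtain e' where e': "e' \<in> arcs G - \<F> G" "e' \<noteq> e" using two_back_arcs[OF e] by blast
  let ?y = "periodic_ext (circuit e)" and ?z = "periodic_ext (circuit e')"
  have y: "?y \<in> periodic_paths G (length (circuit e))" and z: "?z \<in> periodic_paths G (length (circuit e'))"
    using e e' set_circuit cas_circuit by (auto intro!: root_walk_path simp del: set_append)
  have "e' \<in> range ?z"
  proof -
    have "?z (int (length (circuit e') - 1)) = window ?z 0 (length (circuit e')) ! (length (circuit e') - 1)"
      using circuit_pos[of e'] by (subst nth_window) auto
    also have "\<dots> = last (circuit e')" by (simp only: window_periodic_ext last_conv_nth[OF circuit_ne])
    finally show ?thesis by (metis last_circuit rangeI)
  qed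
  moreover have "e' \<notin> range (shiftn a ?y)" for a
  proof
    assume "e' \<in> range (shiftn a ?y)"
    then obtain i where "e' = ?y (i + a)" by auto
    then have "e' = circuit e ! nat ((i + a) mod int (length (circuit e)))"
      by (simp only: periodic_ext_def)
    moreover have "nat ((i + a) mod int (length (circuit e))) < length (circuit e)"
      by (simp add: nat_less_iff)
    ultimately have "e' \<in> set (circuit e)" by simp
    then have "e' \<in> set (filter (\<lambda>f. f \<notin> \<F> G) (circuit e))" using e' by simp
    then show False using filter_circuit[OF e] e' by simp
  qed
  ultimately have "?z \<noteq> shiftn a ?y" for a by metis
  then show "\<exists>y n z m. 0 < n \<and> 0 < m \<and> y \<in> periodic_paths G n \<and> z \<in> periodic_paths G m \<and>
      (\<forall>a. z \<noteq> shiftn a y)"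
    using y z circuit_pos by blast
qed

end

section \<open>Conjugacy determines the circuit weights\<close>

lemma shiftn_period_shiftn: "shiftn n x = x \<Longrightarrow> shiftn n (shiftn a x) = shiftn a x"
  by (metis add.commute shiftn_shiftn)

lemma path_weight_periodic_ext:
  "path_weight G (periodic_ext L) (length L) = prod_list (map (\<lambda>f. excursion_fps G (tail G f)) L)"
  using prod_list_window[of "\<lambda>f. excursion_fps G (tail G f)" "periodic_ext L" 0 "length L"]
  by (simp add: path_weight_def del: window_periodic_ext) (metis window_periodic_ext)

context tree_digraph
begin

text \<open>Coordinates for periodic paths: position 0 lies \<open>s\<close> arcs inside the circuit
  of \<open>g\<close>, and the circuits of \<open>gs\<close> complete the period.\<close>

definition pointed_circuits :: "nat \<Rightarrow> real fps \<Rightarrow> (nat \<times> 'b \<times> 'b list) set" where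
  "pointed_circuits n W = {(s, g, gs). g \<in> arcs G - \<F> G \<and> set gs \<subseteq> arcs G - \<F> G \<and> s < length (circuit g) \<and>
     length (concat (map circuit (g # gs))) = n \<and> prod_list (map circuit_weight (g # gs)) = W}"

lemma prod_list_concat_circuits:
  "prod_list (map (\<lambda>f. excursion_fps G (tail G f)) (concat (map circuit gs))) = prod_list (map circuit_weight gs)"
  by (induction gs) (auto simp: circuit_weight_def)

text \<open>On a path of sole arcs the tree paths of the vertices would grow with every step,
  against periodicity.\<close>

lemma ex_root_visit:
  assumes y: "y \<in> periodic_paths G n" and n: "0 < n"
  shows "\<exists>k::nat. tail G (y (- int k)) = r"
proof -
  have yp: "y \<in> biinf_paths G" "shiftn (int n) y = y" using y by (auto simp: periodic_paths_def)
  have step: "head G (y i) = tail G (y (i + 1))" and arc: "y i \<in> arcs G" for i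
    using yp(1) by (auto simp: biinf_paths_def)
  have "\<exists>i. y i \<notin> \<F> G"
  proof (rule ccontr)
    assume "\<nexists>i. y i \<notin> \<F> G"
    then have F: "y i \<in> \<F> G" for i by blast
    have "length (tree_path (tail G (y (int k)))) = length (tree_path (tail G (y 0))) + k" for k
    proof (induction k)
      case (Suc k)
      have "tree_path (tail G (y (int (Suc k)))) = tree_path (head G (y (int k)))"
        using step[of "int k"] by (simp add: add.commute)
      then show ?case using Suc tree_path_head[OF F[of "int k"]] by simp
    qed simp
    from this[of n] have "length (tree_path (tail G (y (int n)))) = length (tree_path (tail G (y 0))) + n" .
    moreover have "y (int n) = y 0" using shiftn_period[OF yp(2), of 0] by simp
    ultimately show False using n by simp
  qed
  then obtain i where "y i \<notin> \<F> G" by blast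
  then have r: "tail G (y (i + 1)) = r" using head_back_arc[OF arc] step by metis
  define k where "k = nat ((- (i + 1)) mod int n)"
  have k: "int k = (- (i + 1)) mod int n" using n by (simp add: k_def)
  have "(- int k) mod int n = (i + 1) mod int n" unfolding k by (simp add: mod_simps add.commute)
  then have "y (- int k) = y (i + 1)" using apply_mod[OF yp(2)] by metis
  then show ?thesis using r by metis
qed

text \<open>\<open>s\<close> is recovered as the distance back to the latest visit to
  \<open>r\<close>, because a circuit meets \<open>r\<close> only at its start; the closed walk from
  there has a unique factorisation.\<close>

lemma pointed_circuits_bij:
  assumes n: "0 < n"
  shows "bij_betw (\<lambda>(s, g, gs). shiftn (int s) (periodic_ext (concat (map circuit (g # gs)))))
    (pointed_circuits n W) {y \<in> periodic_paths G n. path_weight G y n = W}"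
proof -
  define f where "f = (\<lambda>(s, g, gs). shiftn (int s) (periodic_ext (concat (map circuit (g # gs)))) :: int \<Rightarrow> 'b)"
  have f_apply: "f (s, g, gs) = shiftn (int s) (periodic_ext (concat (map circuit (g # gs))))" for s g gs
    by (simp add: f_def del: shiftn_apply)
  have first: "tail G (f (s, g, gs) (- int k)) = r \<longleftrightarrow> k = s"
    if "g \<in> arcs G - \<F> G" "s < length (circuit g)" "k \<le> s" for s g gs k
  proof -
    let ?L = "concat (map circuit (g # gs))"
    have lt: "s - k < length (circuit g)" using that(2) by simp
    have "f (s, g, gs) (- int k) = window (periodic_ext ?L) 0 (length ?L) ! (s - k)"
      using that unfolding f_apply by (subst nth_window) (auto simp: of_nat_diff algebra_simps)
    also have "\<dots> = circuit g ! (s - k)" using lt by (simp only: window_periodic_ext) (simp add: nth_append)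
    finally have "tail G (f (s, g, gs) (- int k)) = r \<longleftrightarrow> s - k = 0"
      using tail_circuit_nth[OF that(1), of "s - k"] that by simp
    then show ?thesis using that(3) by auto
  qed
  have inj: "inj_on f (pointed_circuits n W)"
  proof (rule inj_onI)
    fix x x' assume x: "x \<in> pointed_circuits n W" "x' \<in> pointed_circuits n W" "f x = f x'"
    obtain s g gs where p: "x = (s, g, gs)" by (cases x)
    obtain s' g' gs' where p': "x' = (s', g', gs')" by (cases x')
    have g: "g \<in> arcs G - \<F> G" "set (g # gs) \<subseteq> arcs G - \<F> G" "s < length (circuit g)"
        "length (concat (map circuit (g # gs))) = n"
      and g': "g' \<in> arcs G - \<F> G" "set (g' # gs') \<subseteq> arcs G - \<F> G" "s' < length (circuit g')"
        "length (concat (map circuit (g' # gs'))) = n"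
      using x p p' by (auto simp: pointed_circuits_def)
    have eq: "f (s, g, gs) = f (s', g', gs')" using x p p' by simp
    have "s = s'"
    proof (cases "s \<le> s'")
      case True
      have "tail G (f (s, g, gs) (- int s)) = r" using first[OF g(1,3)] by simp
      then show ?thesis using first[OF g'(1,3) True] eq by metis
    next
      case False
      then have "s' \<le> s" by simp
      have "tail G (f (s', g', gs') (- int s')) = r" using first[OF g'(1,3)] by simp
      then show ?thesis using first[OF g(1,3) \<open>s' \<le> s\<close>] eq by metis
    qed
    then have "shiftn (- int s) (f (s, g, gs)) = shiftn (- int s) (f (s, g', gs'))" using eq by simp
    then have "periodic_ext (concat (map circuit (g # gs))) = periodic_ext (concat (map circuit (g' # gs')))"
      unfolding f_apply shiftn_shiftn by (simp del: shiftn_apply)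
    then have "concat (map circuit (g # gs)) = concat (map circuit (g' # gs'))"
      using g(4) g'(4) by (metis window_periodic_ext)
    then have "g # gs = g' # gs'" using concat_circuits(3)[OF g(2)] concat_circuits(3)[OF g'(2)] by metis
    then show "x = x'" using p p' \<open>s = s'\<close> by simp
  qed
  have "f ` pointed_circuits n W = {y \<in> periodic_paths G n. path_weight G y n = W}"
  proof (intro set_eqI iffI)
    fix y assume "y \<in> f ` pointed_circuits n W"
    then obtain s g gs where x: "(s, g, gs) \<in> pointed_circuits n W" "y = f (s, g, gs)" by auto
    let ?L = "concat (map circuit (g # gs))"
    have g: "set (g # gs) \<subseteq> arcs G - \<F> G" "length ?L = n" "prod_list (map circuit_weight (g # gs)) = W"
      using x by (auto simp: pointed_circuits_def)
    have L: "periodic_ext ?L \<in> periodic_paths G n"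
      using root_walk_path[OF concat_circuits(1,2)[OF g(1)]] g(2) n by fastforce
    have per: "shiftn (int n) (periodic_ext ?L) = periodic_ext ?L" using L by (simp add: periodic_paths_def)
    have "periodic_ext ?L \<in> biinf_paths G" using L by (simp add: periodic_paths_def)
    then have "y \<in> periodic_paths G n" using shiftn_period_shiftn[OF per, of "int s"]
      unfolding x(2) f_apply periodic_paths_def by (simp only: biinf_paths_shiftn mem_Collect_eq simp_thms)
    moreover have "path_weight G y n = path_weight G (periodic_ext ?L) n"
      unfolding x(2) f_apply by (rule path_weight_shift[OF per])
    moreover have "path_weight G (periodic_ext ?L) n = W"
      using path_weight_periodic_ext[of G ?L] prod_list_concat_circuits[of "g # gs"] g by metis
    ultimately show "y \<in> {y \<in> periodic_paths G n. path_weight G y n = W}" by simp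
  next
    fix y assume "y \<in> {y \<in> periodic_paths G n. path_weight G y n = W}"
    then have y: "y \<in> periodic_paths G n" "path_weight G y n = W" by auto
    have yp: "y \<in> biinf_paths G" "shiftn (int n) y = y" using y by (auto simp: periodic_paths_def)
    define s where "s = (LEAST k::nat. tail G (y (- int k)) = r)"
    have s: "tail G (y (- int s)) = r" unfolding s_def using ex_root_visit[OF y(1) n] by (rule LeastI_ex)
    have least: "s \<le> k" if "tail G (y (- int k)) = r" for k
      unfolding s_def using that by (rule Least_le)
    define z where "z = shiftn (- int s) y"
    have zp: "z \<in> biinf_paths G" "shiftn (int n) z = z"
    proof -
      show "z \<in> biinf_paths G" unfolding z_def using yp(1) by simp
      have "shiftn (int n) (shiftn (- int s) y) = shiftn (- int s) (shiftn (int n) y)"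
        by (simp only: shiftn_shiftn add.commute)
      then show "shiftn (int n) z = z" unfolding z_def yp(2) .
    qed
    define L where "L = window z 0 n"
    have lenL: "length L = n" by (simp add: L_def)
    have z0: "tail G (z 0) = r" using s by (simp add: z_def)
    have zn: "z (int n) = z 0" using shiftn_period[OF zp(2), of 0] by simp
    have cas: "cas r L r" using cas_window[OF zp(1), of 0 n] z0 zn by (simp add: L_def)
    have arcsL: "set L \<subseteq> arcs G" using zp(1) set_window[of z 0 n] by (auto simp: L_def biinf_paths_def)
    define hs where "hs = filter (\<lambda>f. f \<notin> \<F> G) L"
    have Lhs: "L = concat (map circuit hs)" unfolding hs_def by (rule closed_walk_from_root[OF arcsL cas])
    have "hs \<noteq> []" using Lhs lenL n by auto
    then obtain g gs where gs: "hs = g # gs" by (cases hs) auto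
    have sub: "set (g # gs) \<subseteq> arcs G - \<F> G" using arcsL unfolding gs[symmetric] hs_def by auto
    have "s < length (circuit g)"
    proof (rule ccontr)
      assume "\<not> s < length (circuit g)"
      then have le: "length (circuit g) \<le> s" by simp
      have "length (circuit g) \<le> n" using lenL Lhs gs by simp
      then have "window z 0 (length (circuit g)) = take (length (circuit g)) L"
        unfolding L_def by (rule take_window[symmetric])
      also have "\<dots> = circuit g" using Lhs gs by simp
      finally have "cas r (circuit g) (tail G (z (int (length (circuit g)))))"
        using cas_window[OF zp(1), of 0 "length (circuit g)"] z0 by simp
      moreover have "cas r (circuit g) r" using cas_circuit sub by simp
      ultimately have "tail G (z (int (length (circuit g)))) = r" using awlast_if_cas by metis
      then have "tail G (y (- int (s - length (circuit g)))) = r"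
        using le by (simp add: z_def of_nat_diff algebra_simps)
      then have "s \<le> s - length (circuit g)" by (rule least)
      then show False using circuit_pos[of g] le by linarith
    qed
    moreover have "periodic_ext L = z" unfolding L_def by (rule periodic_ext_window[OF zp(2) n])
    moreover have "prod_list (map circuit_weight (g # gs)) = W"
    proof -
      have "prod_list (map circuit_weight (g # gs)) = path_weight G (periodic_ext L) n"
        using path_weight_periodic_ext[of G L] prod_list_concat_circuits[of hs] gs Lhs lenL by metis
      also have "\<dots> = path_weight G y n"
        unfolding \<open>periodic_ext L = z\<close> z_def by (rule path_weight_shift[OF yp(2)])
      finally show ?thesis using y(2) by simp
    qed
    ultimately have "(s, g, gs) \<in> pointed_circuits n W"
      using sub lenL Lhs gs by (auto simp: pointed_circuits_def)
    moreover have "y = f (s, g, gs)"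
      unfolding f_apply gs[symmetric] Lhs[symmetric] \<open>periodic_ext L = z\<close> z_def by simp
    ultimately show "y \<in> f ` pointed_circuits n W" by blast
  qed
  then show ?thesis using inj unfolding f_def[symmetric] bij_betw_def by blast
qed

lemma finite_pointed_circuits: "0 < n \<Longrightarrow> finite (pointed_circuits n W)"
  using bij_betw_finite[OF pointed_circuits_bij] finite_periodic_paths[OF fin_digraph_axioms] by simp

definition composite_circuits :: "nat \<Rightarrow> real fps \<Rightarrow> (nat \<times> 'b \<times> 'b list) set" where
  "composite_circuits n W = {(s, g, gs) \<in> pointed_circuits n W. gs \<noteq> []}"

lemma card_pointed_circuits:
  assumes "0 < n"
  shows "card (pointed_circuits n W) =
    n * card {g \<in> arcs G - \<F> G. length (circuit g) = n \<and> circuit_weight g = W} + card (composite_circuits n W)"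
proof -
  let ?S = "{g \<in> arcs G - \<F> G. length (circuit g) = n \<and> circuit_weight g = W}"
  let ?i = "\<lambda>(s, g). (s, g, []) :: nat \<times> 'b \<times> 'b list"
  have eq: "pointed_circuits n W = ?i ` ({..<n} \<times> ?S) \<union> composite_circuits n W"
  proof (intro set_eqI iffI)
    fix x assume x: "x \<in> pointed_circuits n W"
    obtain s g gs where p: "x = (s, g, gs)" by (cases x)
    show "x \<in> ?i ` ({..<n} \<times> ?S) \<union> composite_circuits n W"
    proof (cases "gs = []")
      case True
      then have "(s, g) \<in> {..<n} \<times> ?S" using x p by (auto simp: pointed_circuits_def)
      then show ?thesis using True p by force
    qed (use x p in \<open>simp add: composite_circuits_def\<close>)
  qed (auto simp: composite_circuits_def pointed_circuits_def)
  have "card (?i ` ({..<n} \<times> ?S)) = n * card ?S"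
    by (subst card_image) (auto simp: inj_on_def card_cartesian_product)
  moreover have "finite (?i ` ({..<n} \<times> ?S))" "finite (composite_circuits n W)"
    using finite_pointed_circuits[OF assms, of W] unfolding eq by simp_all
  moreover have "?i ` ({..<n} \<times> ?S) \<inter> composite_circuits n W = {}"
    by (auto simp: composite_circuits_def)
  ultimately show ?thesis unfolding eq by (simp only: card_Un_disjoint)
qed

lemma composite_circuits_short:
  assumes "(s, g, gs) \<in> composite_circuits n W" "h \<in> set (g # gs)"
  shows "length (circuit h) < n"
proof -
  have len: "length (concat (map circuit (g # gs))) = n" and "gs \<noteq> []"
    using assms(1) by (auto simp: composite_circuits_def pointed_circuits_def)
  have le: "length (circuit h) \<le> length (concat (map circuit hs))" if "h \<in> set hs" for hs
    using that by (induction hs) auto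
  obtain g' gs' where gs: "gs = g' # gs'" using \<open>gs \<noteq> []\<close> by (cases gs) auto
  show ?thesis
  proof (cases "h = g")
    case True
    have "length (circuit g) + (length (circuit g') + length (concat (map circuit gs'))) = n"
      using len gs by simp
    then show ?thesis using circuit_pos[of g'] unfolding True by linarith
  next
    case False
    then have "h \<in> set gs" using assms(2) by simp
    have "length (circuit g) + length (concat (map circuit gs)) = n" using len by simp
    then show ?thesis using le[OF \<open>h \<in> set gs\<close>] circuit_pos[of g] by linarith
  qed
qed

end

lemma card_composite_circuits_le:
  assumes G: "tree_digraph G r" and G': "tree_digraph G' r'" and n: "0 < n"
    and \<sigma>: "inj_on \<sigma> {g \<in> arcs G - \<F> G. length (tree_digraph.circuit G r g) < n}"
    "\<And>g. g \<in> arcs G - \<F> G \<Longrightarrow> length (tree_digraph.circuit G r g) < n \<Longrightarrow> \<sigma> g \<in> arcs G' - \<F> G' \<and>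
      length (tree_digraph.circuit G' r' (\<sigma> g)) = length (tree_digraph.circuit G r g) \<and>
      tree_digraph.circuit_weight G' r' (\<sigma> g) = tree_digraph.circuit_weight G r g"
  shows "card (tree_digraph.composite_circuits G r n W) \<le> card (tree_digraph.composite_circuits G' r' n W)"
proof -
  interpret G: tree_digraph G r by (rule G)
  interpret G': tree_digraph G' r' by (rule G')
  define m where "m = (\<lambda>(s :: nat, g, gs). (s, \<sigma> g, map \<sigma> gs))"
  have short: "set (g # gs) \<subseteq> {g \<in> arcs G - \<F> G. length (G.circuit g) < n}"
    if x: "(s, g, gs) \<in> G.composite_circuits n W" for s g gs
  proof
    fix h assume h: "h \<in> set (g # gs)"
    have "set (g # gs) \<subseteq> arcs G - \<F> G" using x by (auto simp: G.composite_circuits_def G.pointed_circuits_def)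
    then show "h \<in> {g \<in> arcs G - \<F> G. length (G.circuit g) < n}"
      using h G.composite_circuits_short[OF x h] by blast
  qed
  have "inj_on m (G.composite_circuits n W)"
  proof (rule inj_onI)
    fix x x' assume x: "x \<in> G.composite_circuits n W" "x' \<in> G.composite_circuits n W" "m x = m x'"
    obtain s g gs where p: "x = (s, g, gs)" by (cases x)
    obtain s' g' gs' where p': "x' = (s', g', gs')" by (cases x')
    have "s = s'" and eq: "map \<sigma> (g # gs) = map \<sigma> (g' # gs')" using x(3) by (auto simp: m_def p p')
    have "set (g # gs) \<union> set (g' # gs') \<subseteq> {g \<in> arcs G - \<F> G. length (G.circuit g) < n}"
      using short x(1,2) p p' by blast
    then have "inj_on \<sigma> (set (g # gs) \<union> set (g' # gs'))" using \<sigma>(1) inj_on_subset by blast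
    then have "g # gs = g' # gs'" using eq by (rule map_inj_on[rotated])
    then show "x = x'" using p p' \<open>s = s'\<close> by simp
  qed
  moreover have "m ` G.composite_circuits n W \<subseteq> G'.composite_circuits n W"
  proof
    fix x' assume "x' \<in> m ` G.composite_circuits n W"
    then obtain s g gs where x: "(s, g, gs) \<in> G.composite_circuits n W" "x' = (s, \<sigma> g, map \<sigma> gs)"
      by (auto simp: m_def)
    have sh: "\<sigma> h \<in> arcs G' - \<F> G' \<and> length (G'.circuit (\<sigma> h)) = length (G.circuit h) \<and>
        G'.circuit_weight (\<sigma> h) = G.circuit_weight h" if "h \<in> set (g # gs)" for h
      using \<sigma>(2) short[OF x(1)] that by blast
    have len: "length (concat (map G'.circuit (map \<sigma> hs))) = length (concat (map G.circuit hs))"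
      if "set hs \<subseteq> set (g # gs)" for hs
      using that by (induction hs) (use sh in auto)
    have wt: "prod_list (map G'.circuit_weight (map \<sigma> hs)) = prod_list (map G.circuit_weight hs)"
      if "set hs \<subseteq> set (g # gs)" for hs
      using that by (induction hs) (use sh in auto)
    have "set (map \<sigma> gs) \<subseteq> arcs G' - \<F> G'" using sh by auto
    then show "x' \<in> G'.composite_circuits n W"
      using x sh[of g] len[of "g # gs"] wt[of "g # gs"]
      by (auto simp: G'.composite_circuits_def G'.pointed_circuits_def G.composite_circuits_def G.pointed_circuits_def)
  qed
  moreover have "finite (G'.composite_circuits n W)"
    using G'.finite_pointed_circuits[OF n, of W] by (rule finite_subset[rotated]) (auto simp: G'.composite_circuits_def)
  ultimately show ?thesis by (rule card_inj_on_le)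
qed

text \<open>Induction on the length. Closed paths of length \<open>n\<close> made of several
  circuits involve only shorter circuits, which are matched already. Once they are subtracted, each
  circuit of length \<open>n\<close> is counted \<open>n\<close> times, once per offset.\<close>

theorem circuit_bijection:
  assumes G: "tree_digraph G r" and G': "tree_digraph G' r'"
    and cards: "\<And>n W. 0 < n \<Longrightarrow> card {y \<in> periodic_paths G n. path_weight G y n = W} =
      card {y \<in> periodic_paths G' n. path_weight G' y n = W}"
  shows "\<exists>\<sigma>. bij_betw \<sigma> (arcs G - \<F> G) (arcs G' - \<F> G') \<and> (\<forall>g\<in>arcs G - \<F> G.
      length (tree_digraph.circuit G' r' (\<sigma> g)) = length (tree_digraph.circuit G r g) \<and>
      tree_digraph.circuit_weight G' r' (\<sigma> g) = tree_digraph.circuit_weight G r g)"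
proof -
  interpret G: tree_digraph G r by (rule G)
  interpret G': tree_digraph G' r' by (rule G')
  let ?k = "\<lambda>g. (length (G.circuit g), G.circuit_weight g)"
  let ?k' = "\<lambda>g. (length (G'.circuit g), G'.circuit_weight g)"
  let ?N = "arcs G - \<F> G" and ?N' = "arcs G' - \<F> G'"
  have fin: "finite ?N" "finite ?N'" by auto
  have eq: "card {g \<in> ?N. ?k g = (n, W)} = card {g \<in> ?N'. ?k' g = (n, W)}" for n W
  proof (induction n arbitrary: W rule: less_induct)
    case (less n)
    show ?case
    proof (cases "n = 0")
      case True
      have "{g \<in> ?N. ?k g = (n, W)} = {}" "{g \<in> ?N'. ?k' g = (n, W)} = {}" using True by auto
      then show ?thesis by (simp only: card.empty)
    next
      case False
      then have n: "0 < n" by simp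
      let ?M = "{g \<in> ?N. length (G.circuit g) < n}" and ?M' = "{g \<in> ?N'. length (G'.circuit g) < n}"
      have fib: "card {g \<in> ?M. ?k g = c} = card {g \<in> ?M'. ?k' g = c}" for c
      proof -
        obtain m V where c: "c = (m, V)" by (cases c)
        show ?thesis
        proof (cases "m < n")
          case True
          then have "{g \<in> ?M. ?k g = c} = {g \<in> ?N. ?k g = (m, V)}" "{g \<in> ?M'. ?k' g = c} = {g \<in> ?N'. ?k' g = (m, V)}"
            using c by auto
          then show ?thesis using less.IH[OF True] by simp
        next
          case False
          then have "{g \<in> ?M. ?k g = c} = {}" "{g \<in> ?M'. ?k' g = c} = {}" using c by auto
          then show ?thesis by (simp only: card.empty)
        qed
      qed
      have finM: "finite ?M" "finite ?M'" using fin by auto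
      have fib': "card {g \<in> ?M'. ?k' g = c} = card {g \<in> ?M. ?k g = c}" for c
        by (rule fib[symmetric])
      obtain \<sigma> where \<sigma>: "bij_betw \<sigma> ?M ?M'" "\<forall>g\<in>?M. ?k' (\<sigma> g) = ?k g"
        using bij_betw_from_fibres[OF finM fib] by (elim exE conjE) (rule that)
      obtain \<tau> where \<tau>: "bij_betw \<tau> ?M' ?M" "\<forall>g\<in>?M'. ?k (\<tau> g) = ?k' g"
        using bij_betw_from_fibres[OF finM(2,1) fib'] by (elim exE conjE) (rule that)
      have "card (G.composite_circuits n W) \<le> card (G'.composite_circuits n W)"
      proof (rule card_composite_circuits_le[OF G G' n bij_betw_imp_inj_on[OF \<sigma>(1)]])
        fix g assume "g \<in> ?N" "length (G.circuit g) < n"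
        then have g: "g \<in> ?M" by simp
        show "\<sigma> g \<in> ?N' \<and> length (G'.circuit (\<sigma> g)) = length (G.circuit g) \<and>
            G'.circuit_weight (\<sigma> g) = G.circuit_weight g"
          using bij_betw_apply[OF \<sigma>(1) g] bspec[OF \<sigma>(2) g] by simp
      qed
      moreover have "card (G'.composite_circuits n W) \<le> card (G.composite_circuits n W)"
      proof (rule card_composite_circuits_le[OF G' G n bij_betw_imp_inj_on[OF \<tau>(1)]])
        fix g assume "g \<in> ?N'" "length (G'.circuit g) < n"
        then have g: "g \<in> ?M'" by simp
        show "\<tau> g \<in> ?N \<and> length (G.circuit (\<tau> g)) = length (G'.circuit g) \<and>
            G.circuit_weight (\<tau> g) = G'.circuit_weight g"
          using bij_betw_apply[OF \<tau>(1) g] bspec[OF \<tau>(2) g] by simp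
      qed
      moreover have "card (G.pointed_circuits n W) = card (G'.pointed_circuits n W)"
        using bij_betw_same_card[OF G.pointed_circuits_bij[OF n, of W]]
          bij_betw_same_card[OF G'.pointed_circuits_bij[OF n, of W]] cards[OF n, of W] by simp
      ultimately have "n * card {g \<in> ?N. length (G.circuit g) = n \<and> G.circuit_weight g = W} =
          n * card {g \<in> ?N'. length (G'.circuit g) = n \<and> G'.circuit_weight g = W}"
        using G.card_pointed_circuits[OF n, of W] G'.card_pointed_circuits[OF n, of W] by linarith
      then show ?thesis using n by simp
    qed
  qed
  have "card {g \<in> ?N. ?k g = c} = card {g \<in> ?N'. ?k' g = c}" for c
    by (cases c) (simp only: eq)
  from bij_betw_from_fibres[OF fin this]
  obtain \<sigma> where "bij_betw \<sigma> ?N ?N'" "\<forall>g\<in>?N. ?k' (\<sigma> g) = ?k g"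
    by (elim exE conjE) (rule that)
  then show ?thesis by (intro exI[of _ \<sigma>]) simp
qed

section \<open>Multipliers and stack classes\<close>

lemma tree_digraph_if_rooted_directed_tree:
  assumes "fin_digraph G" "strongly_connected G" "rooted_directed_tree (sole_subgraph G)"
    "arcs G - \<F> G \<noteq> {}"
  shows "\<exists>r. tree_digraph G r"
proof -
  obtain r where r: "r \<in> verts G" "\<And>v. v \<in> verts G \<Longrightarrow> \<exists>!p. pre_digraph.awalk (sole_subgraph G) r p v"
    using assms(3) by (auto simp: rooted_directed_tree_def sole_subgraph_def)
  have "pre_digraph.awalk (sole_subgraph G) r p v \<longleftrightarrow> set p \<subseteq> \<F> G \<and> pre_digraph.cas G r p v" for p v
    using r(1) by (simp add: pre_digraph.awalk_def cas_sole_subgraph) (simp add: sole_subgraph_def)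
  then have "tree_digraph G r" using assms r
    by (intro tree_digraph.intro tree_digraph_axioms.intro) auto
  then show ?thesis by blast
qed

fun arc_of :: "'e signed_arc \<Rightarrow> 'e" where
  "arc_of (Minus f) = f"
| "arc_of (Plus f) = f"

text \<open>Symbols cancel in pairs over the same arc, and such a pair is kept or erased as a
  whole.\<close>

lemma reduce_filter:
  assumes "reduce w = Some (p, q)"
  shows "reduce (filter (\<lambda>a. P (arc_of a)) w) = Some (filter P p, filter P q)"
  using assms
proof (induction w arbitrary: p q rule: reduce.induct)
  case (3 f w)
  obtain p1 q1 where w: "reduce w = Some (p1, q1)" using 3 by (auto split: option.splits)
  then have IH: "reduce (filter (\<lambda>a. P (arc_of a)) w) = Some (filter P p1, filter P q1)" using 3(1) by blast
  show ?case using 3(2) w IH by (cases p1) (auto split: if_splits)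
qed (auto split: option.splits)

context tree_digraph
begin

lemma branch_verts_eq: "\<R> G = {r}"
proof -
  obtain e where e: "e \<in> arcs G - \<F> G" using back_arcs by blast
  obtain e' where e': "e' \<in> arcs G - \<F> G" "e' \<noteq> e" using two_back_arcs[OF e] by blast
  have "{e, e'} \<subseteq> in_arcs G r" using e e' head_back_arc by auto
  then have "card {e, e'} \<le> in_degree G r" unfolding in_degree_def by (intro card_mono) auto
  then have "r \<in> \<R> G" using e' root by (simp add: branch_verts_def)
  moreover have "v = r" if "v \<in> \<R> G" for v
  proof (rule ccontr)
    assume ne: "v \<noteq> r"
    have v: "v \<in> verts G" "2 \<le> in_degree G v" using that by (auto simp: branch_verts_def)
    obtain p f where p: "tree_path v = p @ [f]"
      using tree_path_eq_Nil[OF v(1)] ne by (cases "tree_path v" rule: rev_cases) auto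
    then have f: "f \<in> \<F> G" using tree_path(1)[OF v(1)] by simp
    have "head G f = v" using tree_path(2)[OF v(1)] p by (auto simp: cas_append_ex)
    then have "in_arcs G v = {f}" using f by (simp add: sole_arcs_def)
    then show False using v(2) by (simp add: in_degree_def)
  qed
  ultimately show ?thesis by blast
qed

lemma tree_root_eq:
  assumes "v \<in> verts G" shows "tree_root G v = r"
  unfolding tree_root_def
proof (rule the_equality)
  have wf: "wf_digraph (sole_subgraph G)"
    by unfold_locales (auto simp: sole_subgraph_def sole_arcs_def)
  have "pre_digraph.awalk (sole_subgraph G) r (tree_path v) v"
    using tree_path[OF assms] root
    by (simp add: pre_digraph.awalk_def cas_sole_subgraph) (simp add: sole_subgraph_def)
  then have "r \<rightarrow>\<^sup>*\<^bsub>sole_subgraph G\<^esub> v" using wf_digraph.reachable_awalk[OF wf] by blast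
  then show "r \<in> \<R> G \<and> r \<rightarrow>\<^sup>*\<^bsub>sole_subgraph G\<^esub> v" by (simp add: branch_verts_eq)
qed (simp add: branch_verts_eq)

definition hat_word :: "'b signed_arc list \<Rightarrow> 'b signed_arc list" where
  "hat_word w = filter (\<lambda>a. arc_of a \<notin> \<F> G) w"

lemma hat_graph_simps:
  "verts (hat_graph G) = {r}" "arcs (hat_graph G) = arcs G - \<F> G"
  "e \<in> arcs G - \<F> G \<Longrightarrow> tail (hat_graph G) e = r" "e \<in> arcs G - \<F> G \<Longrightarrow> head (hat_graph G) e = r"
  by (auto simp: hat_graph_def branch_verts_eq tree_root_eq head_back_arc)

lemma wf_hat_graph: "wf_digraph (hat_graph G)"
  by unfold_locales (auto simp: hat_graph_simps)

lemma hat_symbol_eq: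
  assumes "a \<in> signed_arcs G"
  shows "hat_symbol G a = (if arc_of a \<in> \<F> G then Idem r else Arc a)"
  using assms by (cases a) (auto simp: signed_arcs_def tree_root_eq)

lemma hat_signed_arcs:
  assumes "a \<in> signed_arcs G" "arc_of a \<notin> \<F> G"
  shows "a \<in> signed_arcs (hat_graph G)" "sym_tail (hat_graph G) a = r" "sym_head (hat_graph G) a = r"
  using assms by (cases a; auto simp: signed_arcs_def hat_graph_simps)+

lemma hat_word_signed:
  assumes "set w \<subseteq> signed_arcs G"
  shows "set (hat_word w) \<subseteq> signed_arcs (hat_graph G)" "swalk (hat_graph G) r (hat_word w) r"
  using assms by (induction w) (auto simp: hat_word_def hat_signed_arcs)

lemma act_hat_symbols:
  assumes "set w \<subseteq> signed_arcs G"
  shows "act (hat_graph G) (map (hat_symbol G) w) (r, S) = act (hat_graph G) (map Arc (hat_word w)) (r, S)"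
  using assms
proof (induction w arbitrary: S)
  case (Cons a w)
  have a: "a \<in> signed_arcs G" using Cons.prems by simp
  show ?case
  proof (cases "arc_of a \<in> \<F> G")
    case True
    then show ?thesis using Cons a by (simp add: hat_word_def hat_symbol_eq)
  next
    case False
    have *: "act_gen (hat_graph G) (Arc a) (r, S) = None \<or> (\<exists>S'. act_gen (hat_graph G) (Arc a) (r, S) = Some (r, S'))"
      using hat_signed_arcs(2,3)[OF a False] by (cases a; cases S) auto
    have IH: "act (hat_graph G) (map (hat_symbol G) w) (r, S') = act (hat_graph G) (map Arc (hat_word w)) (r, S')" for S'
      using Cons by simp
    have hw: "hat_word (a # w) = a # hat_word w" using False by (simp add: hat_word_def)
    have hs: "hat_symbol G a = Arc a" using False a by (simp add: hat_symbol_eq)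
    from * show ?thesis
    proof
      assume "act_gen (hat_graph G) (Arc a) (r, S) = None"
      then show ?thesis unfolding hw list.map hs act.simps by simp
    next
      assume "\<exists>S'. act_gen (hat_graph G) (Arc a) (r, S) = Some (r, S')"
      then obtain S' where "act_gen (hat_graph G) (Arc a) (r, S) = Some (r, S')" by blast
      then show ?thesis unfolding hw list.map hs act.simps using IH by simp
    qed
  qed
qed (simp add: hat_word_def)

lemma hat_Idem_absorb: "gis_eq (hat_graph G) (Idem r # Idem r # x) (Idem r # x)"
  using gis_eq_rel[OF gis_relation.idem[of r "hat_graph G"], of "[]" x] by (simp add: hat_graph_simps)

lemma gis_eq_Idem_Arc:
  assumes "a \<in> signed_arcs G" "arc_of a \<notin> \<F> G"
  shows "gis_eq (hat_graph G) (Idem r # Arc a # x) (Arc a # x)"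
    "gis_eq (hat_graph G) (Arc a # Idem r # x) (Arc a # x)"
  using sym_idem[OF hat_signed_arcs(1)[OF assms], of "[]" x] hat_signed_arcs(2,3)[OF assms] by simp_all

text \<open>The leading idempotent keeps the right-hand side nonempty in case all symbols of
  \<open>w\<close> are erased.\<close>

lemma gis_eq_hat_word:
  assumes "set w \<subseteq> signed_arcs G"
  shows "gis_eq (hat_graph G) (Idem r # map (hat_symbol G) w) (Idem r # map Arc (hat_word w))"
  using assms
proof (induction w)
  case (Cons a w)
  have a: "a \<in> signed_arcs G" and IH: "gis_eq (hat_graph G) (Idem r # map (hat_symbol G) w) (Idem r # map Arc (hat_word w))"
    using Cons by auto
  show ?case
  proof (cases "arc_of a \<in> \<F> G")
    case True
    then show ?thesis using gis_eq_trans[OF hat_Idem_absorb IH] a by (simp add: hat_word_def hat_symbol_eq)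
  next
    case False
    have "gis_eq (hat_graph G) (Idem r # Arc a # map (hat_symbol G) w) (Arc a # Idem r # map (hat_symbol G) w)"
      using gis_eq_trans[OF gis_eq_Idem_Arc(1)[OF a False] gis_eq_sym[OF gis_eq_Idem_Arc(2)[OF a False]]] .
    also have "gis_eq (hat_graph G) \<dots> (Arc a # Idem r # map Arc (hat_word w))" using IH by (rule gis_eq_Cons)
    also have "gis_eq (hat_graph G) \<dots> (Idem r # Arc a # map Arc (hat_word w))"
      using gis_eq_trans[OF gis_eq_Idem_Arc(2)[OF a False] gis_eq_sym[OF gis_eq_Idem_Arc(1)[OF a False]]] .
    finally show ?thesis using False a by (simp add: hat_word_def hat_symbol_eq)
  qed
qed (simp add: hat_word_def)

text \<open>On the empty stack at \<open>r\<close> the right-hand side leaves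
  \<open>replicate M e\<close>, which excludes zero and any demand for the left-hand side.
  Conversely, the normal form is the required power up to idempotents.\<close>

lemma gis_eq_hat_iff:
  assumes w: "set w \<subseteq> signed_arcs G" "w \<noteq> []" and e: "e \<in> arcs G - \<F> G" and M: "1 \<le> M"
  shows "gis_eq (hat_graph G) (map (hat_symbol G) w) (replicate M (Arc (Minus e))) \<longleftrightarrow>
    reduce (hat_word w) = Some ([], replicate M e)"
proof
  let ?H = "hat_graph G"
  note sw = hat_word_signed[OF w(1)]
  have eM: "act ?H (replicate M (Arc (Minus e))) (r, []) = Some (r, replicate M e)"
  proof -
    have "swalk ?H r (map Minus (replicate M e)) r" using e by (induction M) (auto simp: hat_graph_simps)
    from act_swalk[OF this reduce_map_Minus, of "[]"] show ?thesis by simp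
  qed
  {
    assume "gis_eq ?H (map (hat_symbol G) w) (replicate M (Arc (Minus e)))"
    then have act: "act ?H (map Arc (hat_word w)) (r, []) = Some (r, replicate M e)"
      using act_hat_symbols[OF w(1), of "[]"] act_gis_eq eM by metis
    have ne: "hat_word w \<noteq> []" using act M by auto
    note nf = wf_digraph.gis_eq_normal_form[OF wf_hat_graph sw(1) ne sw(2)]
    show "reduce (hat_word w) = Some ([], replicate M e)"
    proof (cases "reduce (hat_word w)")
      case None
      then have "act ?H (map Arc (hat_word w)) = act ?H [Zero]" using act_gis_eq[OF nf] by simp
      then show ?thesis using act by simp
    next
      case (Some z)
      obtain P Q where z: "z = (P, Q)" by (cases z)
      have *: "act ?H (normal_form r (P, Q)) (r, []) = Some (r, replicate M e)"
        using act_gis_eq[OF nf] act Some z by simp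
      then have P: "P = []" by (cases P) (auto simp: normal_form_def)
      have "act ?H (map Arc (hat_word w)) (r, P @ []) = Some (r, Q @ [])"
        using act_swalk[OF sw(2)] Some z by blast
      then show ?thesis using act Some z P by simp
    qed
  }
  {
    assume red: "reduce (hat_word w) = Some ([], replicate M e)"
    have ne: "hat_word w \<noteq> []" using red M by auto
    obtain a w' where aw: "w = a # w'" "a \<in> signed_arcs G" using w by (cases w) auto
    have "gis_eq ?H (Idem r # map (hat_symbol G) w) (map (hat_symbol G) w)"
      using hat_Idem_absorb gis_eq_Idem_Arc(1)[OF aw(2)] aw by (auto simp: hat_symbol_eq)
    from gis_eq_trans[OF gis_eq_sym[OF this] gis_eq_hat_word[OF w(1)]]
    have 1: "gis_eq ?H (map (hat_symbol G) w) (Idem r # map Arc (hat_word w))" .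
    have "gis_eq ?H (Idem r # map Arc (hat_word w)) (Idem r # normal_form r ([], replicate M e))"
      using wf_digraph.gis_eq_normal_form[OF wf_hat_graph sw(1) ne sw(2)] red by (auto intro!: gis_eq_Cons)
    from gis_eq_trans[OF 1 this]
    have "gis_eq ?H (map (hat_symbol G) w) (Idem r # Idem r # replicate M (Arc (Minus e)))"
      by (simp add: normal_form_def)
    also have "gis_eq ?H \<dots> (Idem r # replicate M (Arc (Minus e)))" by (rule hat_Idem_absorb)
    also have "gis_eq ?H \<dots> (replicate M (Arc (Minus e)))"
      using M gis_eq_Idem_Arc(1)[of "Minus e"] e by (cases M) (auto simp: signed_arcs_def)
    finally show "gis_eq ?H (map (hat_symbol G) w) (replicate M (Arc (Minus e)))" .
  }
qed

abbreviation circuit_path :: "'b \<Rightarrow> int \<Rightarrow> 'b" where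
  "circuit_path e \<equiv> periodic_ext (circuit e)"

lemma circuit_path_periodic:
  assumes "e \<in> arcs G - \<F> G"
  shows "circuit_path e \<in> biinf_paths G"
    "shiftn (int (length (circuit e))) (circuit_path e) = circuit_path e"
  using root_walk_path[OF set_circuit cas_circuit[OF assms] circuit_ne] assms
  by (auto simp: periodic_paths_def simp del: shiftn_apply)

lemma circuit_path_nth: "circuit_path e i = circuit e ! nat (i mod int (length (circuit e)))"
  by (simp add: periodic_ext_def)

lemma circuit_path_in_set: "circuit_path e i \<in> set (circuit e)"
  unfolding circuit_path_nth by (intro nth_mem) (simp add: nat_less_iff)

lemma circuit_path_tail:
  assumes "e \<in> arcs G - \<F> G"
  shows "tail G (circuit_path e i) = r \<longleftrightarrow> int (length (circuit e)) dvd i"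
proof -
  have "nat (i mod int (length (circuit e))) < length (circuit e)" by (simp add: nat_less_iff)
  from tail_circuit_nth[OF assms this]
  have "tail G (circuit_path e i) = r \<longleftrightarrow> nat (i mod int (length (circuit e))) = 0"
    by (simp add: circuit_path_nth)
  moreover have "0 \<le> i mod int (length (circuit e))" by (intro pos_mod_sign) simp
  ultimately show ?thesis by (auto simp: dvd_eq_mod_eq_0)
qed

lemma circuit_path_minimal_period:
  assumes "e \<in> arcs G - \<F> G"
  shows "minimal_period (circuit_path e) (length (circuit e))"
  unfolding minimal_period_def
proof (intro conjI allI iffI)
  fix m assume m: "shiftn (int m) (circuit_path e) = circuit_path e"
  have "tail G (circuit_path e (int m)) = tail G (circuit_path e 0)" using shiftn_period[OF m, of 0] by simp
  then have "int (length (circuit e)) dvd int m"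
    using circuit_path_tail[OF assms, of 0] circuit_path_tail[OF assms, of "int m"] by simp
  then show "length (circuit e) dvd m" by simp
next
  fix m assume "length (circuit e) dvd m"
  then obtain k where "m = k * length (circuit e)" by (metis dvd_def mult.commute)
  then show "shiftn (int m) (circuit_path e) = circuit_path e"
    using shiftn_period_mult[OF circuit_path_periodic(2)[OF assms], of "int k"] by simp
qed simp

lemma back_arc_in_circuit: "e \<in> arcs G - \<F> G \<Longrightarrow> f \<in> set (circuit e) \<Longrightarrow> f \<notin> \<F> G \<Longrightarrow> f = e"
  using tree_path(1)[of "tail G e"] by (auto simp: circuit_def)

text \<open>Read from a visit to \<open>r\<close>, the path factors into circuits, all of which are
  the circuit of \<open>e\<close>.\<close>

lemma path_with_single_back_arc:
  assumes y: "y \<in> periodic_paths G L" "0 < L" and e: "e \<in> arcs G - \<F> G"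
    and single: "\<And>i. y i \<notin> \<F> G \<Longrightarrow> y i = e"
  shows "\<exists>a. circuit_path e = shiftn a y"
proof -
  obtain k where k: "tail G (y (- int k)) = r" using ex_root_visit[OF y] by blast
  define z where "z = shiftn (- int k) y"
  have yp: "y \<in> biinf_paths G" "shiftn (int L) y = y" using y by (auto simp: periodic_paths_def)
  have zp: "z \<in> biinf_paths G" "shiftn (int L) z = z"
    unfolding z_def using yp shiftn_period_shiftn[OF yp(2), of "- int k"] by (simp_all del: shiftn_apply)
  have z0: "tail G (z 0) = r" using k by (simp add: z_def)
  have zL: "z (int L) = z 0" using shiftn_period[OF zp(2), of 0] by simp
  define hs where "hs = filter (\<lambda>f. f \<notin> \<F> G) (window z 0 L)"
  have "set (window z 0 L) \<subseteq> arcs G" using zp(1) set_window[of z 0 L] by (auto simp: biinf_paths_def)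
  moreover have "cas r (window z 0 L) r" using cas_window[OF zp(1), of 0 L] z0 zL by simp
  ultimately have L: "window z 0 L = concat (map circuit hs)" unfolding hs_def by (rule closed_walk_from_root)
  have "h = e" if h: "h \<in> set hs" for h
  proof -
    have "h \<in> set (window z 0 L)" "h \<notin> \<F> G" using h by (auto simp: hs_def)
    then obtain i where "h = z i" using subsetD[OF set_window] by (metis rangeE)
    then show ?thesis using single[of "i - int k"] \<open>h \<notin> \<F> G\<close> by (simp add: z_def)
  qed
  then have hs: "hs = replicate (length hs) e" by (simp add: list_eq_iff_nth_eq)
  define m where "m = length hs"
  have pow: "window (circuit_path e) 0 (k * length (circuit e)) = concat (replicate k (circuit e))" for k
  proof (induction k)
    case (Suc k)
    have "window (circuit_path e) 0 (Suc k * length (circuit e)) =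
        window (circuit_path e) 0 (length (circuit e)) @ window (circuit_path e) (0 + int (length (circuit e))) (k * length (circuit e))"
      using window_add[of "circuit_path e" 0 "length (circuit e)" "k * length (circuit e)"] by simp
    then show ?case using Suc window_period1[OF circuit_path_periodic(2)[OF e], of 0] by simp
  qed simp
  have wz: "window z 0 L = concat (replicate m (circuit e))"
    using L hs unfolding m_def by (metis map_replicate)
  have len: "L = m * length (circuit e)" using arg_cong[OF wz, of length] arg_cong[OF pow[of m], of length] by simp
  have "circuit_path e = z"
  proof (rule periodic_eqI)
    show "shiftn (int L) (circuit_path e) = circuit_path e"
      unfolding len using shiftn_period_mult[OF circuit_path_periodic(2)[OF e], of "int m"] by simp
    show "window (circuit_path e) 0 L = window z 0 L" unfolding wz unfolding len by (rule pow)
  qed (use zp y in auto)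
  then show ?thesis unfolding z_def by blast
qed

text \<open>If the stack of a word carries its own demand \<open>P\<close> on top, each further copy
  consumes this \<open>P\<close>; the demand stays the same and no new symbols appear.\<close>

lemma window_power_reduce:
  assumes "shiftn (int k) p = p" "reduce (window p i k) = Some (P, P @ R)"
  shows "\<exists>D. reduce (window p i (Suc m * k)) = Some (P, D) \<and> set D \<subseteq> set (P @ R)"
proof (induction m)
  case 0
  then show ?case using assms(2) by simp
next
  case (Suc m)
  then obtain D where D: "reduce (window p i (Suc m * k)) = Some (P, D)" "set D \<subseteq> set (P @ R)" by blast
  have "window p i (Suc (Suc m) * k) = window p i k @ window p i (Suc m * k)"
    using window_add[of p i k "Suc m * k"] window_period1[OF assms(1), of i "Suc m * k"] by simp
  then have "reduce (window p i (Suc (Suc m) * k)) = Some (P, D @ R)"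
    using D assms(2) by (simp add: reduce_append del: append_assoc)
  then show ?case using D by auto
qed

text \<open>Erasing the sole arcs turns the stack of the class into a power of \<open>e\<close>.
  Conversely, a power of \<open>e\<close> gives positive drift and hence a class; its path consists
  of symbols from the stack of a window, among which \<open>e\<close> is the only back arc.\<close>

lemma has_negative_multiplier_iff:
  assumes p: "p \<in> markov_dyck G" "shiftn (int k) p = p" "0 < k" and e: "e \<in> arcs G - \<F> G"
  shows "has_negative_multiplier G e p k \<longleftrightarrow> stack_class p (circuit_path e)"
proof -
  have w: "set (window p i k) \<subseteq> signed_arcs G" "window p i k \<noteq> []" for i
    using markov_dyckD(1)[OF p(1)] set_window[of p i k] p(3) by (auto simp flip: length_0_conv)
  have "map (\<lambda>j. hat_symbol G (p j)) [i..i + int k - 1] = map (hat_symbol G) (window p i k)" for i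
  proof -
    have "map (\<lambda>j. hat_symbol G (p j)) [i..i + int k - 1] = map (hat_symbol G) (map p [i..i + int k - 1])"
      by simp
    also have "map p [i..i + int k - 1] = window p i k" by (simp add: map_upto_window)
    finally show ?thesis .
  qed
  then have iff: "has_negative_multiplier G e p k \<longleftrightarrow>
      (\<exists>i M. 1 \<le> M \<and> reduce (hat_word (window p i k)) = Some ([], replicate M e))"
    unfolding has_negative_multiplier_def using gis_eq_hat_iff[OF w e] by metis
  show ?thesis
  proof
    assume "stack_class p (circuit_path e)"
    then obtain i L where L: "0 < L" "shiftn (int L) (circuit_path e) = circuit_path e"
      "reduce (window p i k) = Some ([], rev (window (circuit_path e) 0 L))"
      using stack_class_window p(2,3) by metis
    let ?W = "window (circuit_path e) 0 L"
    let ?h = "filter (\<lambda>f. f \<notin> \<F> G) ?W"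
    have red: "reduce (hat_word (window p i k)) = Some ([], rev ?h)"
      using reduce_filter[OF L(3), of "\<lambda>f. f \<notin> \<F> G"] by (simp add: hat_word_def rev_filter)
    have "f = e" if "f \<in> set ?h" for f
    proof -
      have "f \<in> range (circuit_path e)" "f \<notin> \<F> G" using that set_window[of "circuit_path e" 0 L] by auto
      then show ?thesis using back_arc_in_circuit[OF e] circuit_path_in_set by blast
    qed
    then have h: "?h = replicate (length ?h) e" by (intro replicate_length_same[symmetric]) blast
    have r0: "tail G (circuit_path e 0) = r" using circuit_path_tail[OF e] by simp
    have "circuit_path e (int L) = circuit_path e 0" using shiftn_period[OF L(2), of 0] by simp
    then have "cas r ?W r" using cas_window[OF circuit_path_periodic(1)[OF e], of 0 L] r0 by simp
    moreover have "set ?W \<subseteq> arcs G"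
      using set_window[of "circuit_path e" 0 L] circuit_path_periodic(1)[OF e] by (auto simp: biinf_paths_def)
    ultimately have "?W = concat (map circuit ?h)" using closed_walk_from_root by blast
    moreover have "?W \<noteq> []" using L(1) by (simp flip: length_0_conv)
    ultimately have "?h \<noteq> []" by force
    then have "1 \<le> length ?h" by (simp add: Suc_le_eq)
    moreover have "rev ?h = replicate (length ?h) e" by (subst h) (rule rev_replicate)
    ultimately show "has_negative_multiplier G e p k" unfolding iff using red by metis
  next
    assume "has_negative_multiplier G e p k"
    then obtain i M where M: "1 \<le> M" "reduce (hat_word (window p i k)) = Some ([], replicate M e)"
      unfolding iff by blast
    obtain P Q where PQ: "reduce (window p i k) = Some (P, Q)" using markov_dyckD(3)[OF p(1), of i k] by auto
    have fP: "filter (\<lambda>f. f \<notin> \<F> G) P = []" and fQ: "filter (\<lambda>f. f \<notin> \<F> G) Q = replicate M e"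
      using reduce_filter[OF PQ, of "\<lambda>f. f \<notin> \<F> G"] M(2) by (auto simp: hat_word_def)
    have neQ: "filter (\<lambda>f. f \<notin> \<F> G) Q \<noteq> []" unfolding fQ using M(1) by auto
    have "window p i (k + k) = window p i k @ window p i k"
      using window_add[of p i k k] window_period1[OF p(2), of i k] by simp
    then have "push_red (P, Q) (P, Q) \<noteq> None"
      using markov_dyckD(3)[OF p(1), of i "k + k"] PQ by (simp add: reduce_append del: not_None_eq)
    then obtain z where "push_red (P, Q) (P, Q) = Some z" by blast
    \<comment> \<open>Two consecutive periods have nonzero product, so \<open>P\<close> and
      \<open>Q\<close> are comparable. As \<open>Q\<close> contains back arcs and \<open>P\<close>
      none, \<open>P\<close> is a prefix of \<open>Q\<close>.\<close>
    then obtain R where R: "Q = P @ R"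
    proof (rule push_redE)
      fix r' assume "P = Q @ r'"
      then show thesis using fP neQ by simp
    qed
    have "R \<noteq> []" using R fP neQ by auto
    then have "0 < height (window p i k)" using height_reduce[OF PQ] R by simp
    then have "0 < height (window p 0 k)" using height_window_rotate[OF p(2), of i] by simp
    then obtain y where y: "stack_class p y" using ex_stack_class[OF p(2,3)] markov_dyckD(3)[OF p(1)] by blast
    obtain i0 L where L: "0 < L" "shiftn (int L) y = y" "reduce (window p i0 k) = Some ([], rev (window y 0 L))"
      using stack_class_window[OF y] p(2,3) by metis
    define j where "j = i0 + \<bar>i - i0\<bar> * int k"
    have "i - i0 \<le> \<bar>i - i0\<bar> * int k"
      using p(3) by (smt (verit) mult_le_cancel_left1 of_nat_0_less_iff zmult_zless_mono2)
    then have ij: "i \<le> j" by (simp add: j_def)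
    define d where "d = nat (j - i)"
    have d: "j = i + int d" using ij by (simp add: d_def)
    have Lj: "reduce (window p j k) = Some ([], rev (window y 0 L))"
      using L window_period[OF p(2)] by (simp add: j_def)
    obtain A B where AB: "reduce (window p i d) = Some (A, B)" using markov_dyckD(3)[OF p(1), of i d] by auto
    \<comment> \<open>So many periods that the stack outgrows what the stretch from \<open>i\<close>
      to \<open>j\<close> leaves on it.\<close>
    define m where "m = length A + length B"
    obtain D where D: "reduce (window p i (Suc m * k)) = Some (P, D)" "set D \<subseteq> set (P @ R)"
      using window_power_reduce[OF p(2)] PQ R by blast
    have W: "window p i (Suc m * k) @ window p i d = window p i d @ window p j (Suc m * k)"
    proof -
      have "window p (i + int (Suc m * k)) d = window p i d"
        using window_period[OF p(2), of i "int (Suc m)"] by (simp only: of_nat_mult)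
      then show ?thesis using window_add[of p i "Suc m * k" d] window_add[of p i d "Suc m * k"] d
        by (simp only: add.commute)
    qed
    have "reduce (window p i d @ window p j (Suc m * k)) = Some (A, rev (window y 0 (Suc m * L)) @ B)"
      unfolding reduce_append reduce_window_power[OF p(2) L(2) Lj, of "Suc m"] AB
      by (simp only: option.case push_red_Nil_right)
    moreover have "reduce (window p i (Suc m * k) @ window p i d) = push_red (P, D) (A, B)"
      unfolding reduce_append D(1) AB by (simp only: option.case)
    ultimately have "push_red (P, D) (A, B) = Some (A, rev (window y 0 (Suc m * L)) @ B)"
      unfolding W by (metis (no_types))
    \<comment> \<open>The same word is cut in two ways; above the trace \<open>B\<close> of the
      stretch, comparison of the stacks shows symbols from \<open>P @ R\<close> only.\<close>
    then obtain D' where D': "rev (window y 0 (Suc m * L)) @ B = B @ D'" "set D' \<subseteq> set (P @ R)"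
    proof (rule push_redE)
      fix r' assume "D = A @ r'" "(A, rev (window y 0 (Suc m * L)) @ B) = (P, B @ r')"
      then show thesis using that[of r'] D(2) by auto
    next
      fix r' assume "A = D @ r'" "(A, rev (window y 0 (Suc m * L)) @ B) = (P @ r', B)"
      then have "rev (window y 0 (Suc m * L)) @ B = B" by (simp only: prod.inject)
      from arg_cong[OF this, of length] have "length (window y 0 (Suc m * L)) = 0" by (simp del: length_window)
      then show thesis using L(1) by (simp only: length_window) simp
    qed
    have yh: "y (int h) \<in> set (P @ R)" if h: "h < L" for h
    proof -
      define c where "c = Suc m * L - 1 - h"
      have "m * 1 \<le> m * L" using L(1) by (intro mult_le_mono2) simp
      moreover have "length B \<le> m" by (simp add: m_def)
      moreover have "Suc m * L = L + m * L" by simp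
      ultimately have c: "length B \<le> c" "c < Suc m * L" unfolding c_def using h by linarith+
      have "rev (window y 0 (Suc m * L)) ! c = y (int h)"
        using c h by (simp add: rev_nth c_def of_nat_diff)
      moreover have "rev (window y 0 (Suc m * L)) ! c = (rev (window y 0 (Suc m * L)) @ B) ! c"
        using c by (simp only: nth_append length_rev length_window if_True)
      moreover have "\<dots> = D' ! (c - length B)" unfolding D'(1) using c by (simp add: nth_append)
      moreover have "c - length B < length D'" using arg_cong[OF D'(1), of length] c by simp
      ultimately show ?thesis using D'(2) nth_mem by (metis subsetD)
    qed
    have yP: "y \<in> biinf_paths G" by (rule stack_class_path[OF p(1) y])
    have single: "y t = e" if t: "y t \<notin> \<F> G" for t
    proof -
      define h where "h = nat (t mod int L)"
      have "h < L" "y (int h) = y t" using L(1) apply_mod[OF L(2)] by (auto simp: h_def nat_less_iff)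
      then have "y t \<in> set Q" using yh[of h] R by simp
      then have "y t \<in> set (filter (\<lambda>f. f \<notin> \<F> G) Q)" using t by simp
      then show ?thesis unfolding fQ by simp
    qed
    have yL: "y \<in> periodic_paths G L" using yP L(2) by (simp add: periodic_paths_def del: shiftn_apply)
    obtain a where "circuit_path e = shiftn a y"
      using path_with_single_back_arc[where y = y, OF yL L(1) e] single by blast
    then show "stack_class p (circuit_path e)" using stack_class_shift_stack[OF y] by simp
  qed
qed

end

section \<open>The invariant \<open>\<Delta>\<close>\<close>

lemma least_period_iff: "least_period p k \<longleftrightarrow>
    0 < k \<and> shiftn (int k) p = p \<and> (\<forall>j. 0 < j \<and> j < k \<longrightarrow> shiftn (int j) p \<noteq> p)"
  by (simp add: least_period_def funpow_shift del: shiftn_apply)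

lemma shift_orbit_eq: "shift_orbit p = range (\<lambda>n::nat. shiftn (int n) p)"
  by (auto simp: shift_orbit_def funpow_shift simp del: shiftn_apply)

lemma shift_orbit_least_period:
  assumes "least_period p k"
  shows "shift_orbit p = (\<lambda>a. shiftn (int a) p) ` {..<k}" "card (shift_orbit p) = k"
proof -
  have k: "0 < k" "shiftn (int k) p = p" "\<And>j. 0 < j \<Longrightarrow> j < k \<Longrightarrow> shiftn (int j) p \<noteq> p"
    using assms by (auto simp: least_period_iff simp del: shiftn_apply)
  show eq: "shift_orbit p = (\<lambda>a. shiftn (int a) p) ` {..<k}"
  proof (intro set_eqI iffI)
    fix z assume "z \<in> shift_orbit p"
    then obtain n :: nat where n: "z = shiftn (int n) p" unfolding shift_orbit_eq by blast
    have "z = shiftn (int (n mod k)) p" unfolding n using shiftn_mod[OF k(2), of "int n"] by (simp add: zmod_int)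
    moreover have "n mod k \<in> {..<k}" using k(1) by simp
    ultimately show "z \<in> (\<lambda>a. shiftn (int a) p) ` {..<k}" by blast
  next
    fix z assume "z \<in> (\<lambda>a. shiftn (int a) p) ` {..<k}"
    then show "z \<in> shift_orbit p" unfolding shift_orbit_eq by blast
  qed
  have *: False if "a < b" "b < k" "shiftn (int a) p = shiftn (int b) p" for a b
  proof -
    have "shiftn (- int a) (shiftn (int b) p) = shiftn (- int a) (shiftn (int a) p)"
      using that(3) by (simp only:)
    then have "shiftn (int (b - a)) p = p" using that(1) unfolding shiftn_shiftn
      by (simp add: of_nat_diff del: shiftn_apply)
    moreover have "0 < b - a" "b - a < k" using that(1,2) by linarith+
    ultimately show False using k(3) by blast
  qed
  have "inj_on (\<lambda>a. shiftn (int a) p) {..<k}"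
  proof (rule inj_onI)
    fix a b assume ab: "a \<in> {..<k}" "b \<in> {..<k}" "shiftn (int a) p = shiftn (int b) p"
    show "a = b"
      using *[of a b, OF _ _ ab(3)] *[of b a, OF _ _ ab(3)[symmetric]] ab(1,2) by (meson lessThan_iff linorder_neqE_nat)
  qed
  then show "card (shift_orbit p) = k" unfolding eq by (simp add: card_image)
qed

lemma shift_orbit_eqI:
  assumes "least_period p k" "z \<in> shift_orbit p"
  shows "shift_orbit z = shift_orbit p"
proof -
  obtain a where a: "a < k" "z = shiftn (int a) p" using assms shift_orbit_least_period(1) by blast
  have k: "shiftn (int k) p = p" "0 < k" using assms(1) by (auto simp: least_period_iff simp del: shiftn_apply)
  have "shift_orbit z \<subseteq> shift_orbit p"
  proof
    fix w assume "w \<in> shift_orbit z"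
    then obtain n :: nat where "w = shiftn (int n) z" unfolding shift_orbit_eq by blast
    then have "w = shiftn (int (n + a)) p" using a by simp
    then show "w \<in> shift_orbit p" unfolding shift_orbit_eq by blast
  qed
  moreover have "shift_orbit p \<subseteq> shift_orbit z"
  proof
    fix w assume "w \<in> shift_orbit p"
    then obtain n :: nat where n: "w = shiftn (int n) p" unfolding shift_orbit_eq by blast
    have "p = shiftn (int (k - a)) z" using a k by (simp add: of_nat_diff del: shiftn_apply)
    then have "w = shiftn (int (n + (k - a))) z" unfolding n by simp
    then show "w \<in> shift_orbit z" unfolding shift_orbit_eq by blast
  qed
  ultimately show ?thesis by blast
qed

lemma card_shift_orbits:
  assumes fin: "finite S" and lp: "\<And>p. p \<in> S \<Longrightarrow> least_period p k" and inv: "\<And>p a. p \<in> S \<Longrightarrow> shiftn a p \<in> S"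
  shows "k * card (shift_orbit ` S) = card S"
proof -
  have "card S = (\<Sum>q\<in>shift_orbit ` S. card {p \<in> S. shift_orbit p = q})"
    using sum.group[OF fin finite_imageI[OF fin] subset_refl, of "\<lambda>_. 1::nat" shift_orbit] by simp
  also have "\<dots> = (\<Sum>q\<in>shift_orbit ` S. k)"
  proof (rule sum.cong[OF refl])
    fix q assume "q \<in> shift_orbit ` S"
    then obtain p where p: "p \<in> S" "q = shift_orbit p" by blast
    have "{p' \<in> S. shift_orbit p' = q} = shift_orbit p"
    proof (intro set_eqI iffI)
      fix z assume "z \<in> {p' \<in> S. shift_orbit p' = q}"
      then have "shift_orbit z = shift_orbit p" using p by simp
      moreover have "z \<in> shift_orbit z" unfolding shift_orbit_eq by (rule range_eqI[of _ _ 0]) simp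
      ultimately show "z \<in> shift_orbit p" by blast
    next
      fix z assume z: "z \<in> shift_orbit p"
      then obtain n :: nat where "z = shiftn (int n) p" unfolding shift_orbit_eq by blast
      then show "z \<in> {p' \<in> S. shift_orbit p' = q}" using inv[OF p(1)] shift_orbit_eqI[OF lp[OF p(1)] z] p by simp
    qed
    then show "card {p' \<in> S. shift_orbit p' = q} = k" using shift_orbit_least_period(2)[OF lp[OF p(1)]] by simp
  qed
  finally show ?thesis by (simp add: mult.commute)
qed

lemma fps_prod_nth_1:
  fixes f :: "nat \<Rightarrow> real fps"
  assumes "\<And>i. fps_nth (f i) 0 = 1"
  shows "fps_nth (\<Prod>i<n. f i) 0 = 1 \<and> fps_nth (\<Prod>i<n. f i) 1 = (\<Sum>i<n. fps_nth (f i) 1)"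
  by (induction n) (auto simp: fps_mult_nth assms)

context tree_digraph
begin

lemma circuit_weight_eq:
  "circuit_weight e = (\<Prod>i<length (circuit e). excursion_fps G (tail G (circuit e ! i)))"
  by (simp add: circuit_weight_def prod.list_conv_set_nth atLeast0LessThan)

lemma path_weight_circuit_path: "path_weight G (circuit_path e) (length (circuit e)) = circuit_weight e"
  using path_weight_periodic_ext[of G "circuit e"] by (simp add: circuit_weight_def)

lemma circuit_weight_nth_1:
  assumes "e \<in> arcs G"
  shows "fps_nth (circuit_weight e) 1 = (\<Sum>i<length (circuit e). real (out_degree G (tail G (circuit e ! i))))"
proof -
  have "fps_nth (circuit_weight e) 1 = (\<Sum>i<length (circuit e). fps_nth (excursion_fps G (tail G (circuit e ! i))) 1)"
    unfolding circuit_weight_eq by (rule fps_prod_nth_1[THEN conjunct2]) simp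
  also have "\<dots> = (\<Sum>i<length (circuit e). real (out_degree G (tail G (circuit e ! i))))"
  proof (rule sum.cong[OF refl])
    fix i assume "i \<in> {..<length (circuit e)}"
    then have "circuit e ! i \<in> arcs G" using set_circuit[OF assms] nth_mem by blast
    then show "fps_nth (excursion_fps G (tail G (circuit e ! i))) 1 = real (out_degree G (tail G (circuit e ! i)))"
      by (intro excursion_fps_nth_1) simp
  qed
  finally show ?thesis .
qed

lemma orbit_count_eq:
  assumes e: "e \<in> arcs G - \<F> G"
  shows "orbit_count G e k = card (shift_orbit ` {p \<in> class_points G k (circuit_path e). least_period p k})"
proof -
  have "p \<in> markov_dyck G \<and> least_period p k \<and> has_negative_multiplier G e p k \<longleftrightarrow>
      p \<in> class_points G k (circuit_path e) \<and> least_period p k" for p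
  proof -
    have "has_negative_multiplier G e p k \<longleftrightarrow> stack_class p (circuit_path e)" "shiftn (int k) p = p"
      if "p \<in> markov_dyck G" "least_period p k"
    proof -
      have "0 < k" "shiftn (int k) p = p" using that(2) by (auto simp: least_period_iff simp del: shiftn_apply)
      then show "has_negative_multiplier G e p k \<longleftrightarrow> stack_class p (circuit_path e)" "shiftn (int k) p = p"
        using has_negative_multiplier_iff[OF that(1) _ _ e] by blast+
    qed
    then show ?thesis unfolding class_points_def by blast
  qed
  then show ?thesis unfolding orbit_count_def by presburger
qed

text \<open>The orbit that only pushes the circuit attains the lower bound for periods in its
  class.\<close>

lemma Lambda_eq:
  assumes e: "e \<in> arcs G - \<F> G"
  shows "Lambda G e = length (circuit e)"
  unfolding Lambda_def
proof (rule Least_equality)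
  let ?\<Lambda> = "length (circuit e)"
  have \<Lambda>: "0 < ?\<Lambda>" by simp
  note per = circuit_path_periodic[OF e]
  note mp = circuit_path_minimal_period[OF e]
  let ?p = "Minus \<circ> circuit_path e"
  have shp: "shiftn (int j) ?p = ?p \<longleftrightarrow> shiftn (int j) (circuit_path e) = circuit_path e" for j
  proof -
    have "shiftn (int j) ?p = Minus \<circ> shiftn (int j) (circuit_path e)" by (auto simp: fun_eq_iff)
    then show ?thesis using inj_Minus_comp by metis
  qed
  have "?p \<in> class_points G ?\<Lambda> (circuit_path e)"
    unfolding class_points_def using Minus_path_in_markov_dyck[OF per(1)] stack_class_Minus[OF \<Lambda> per(2)]
      per(2) shp by blast
  moreover have "least_period ?p ?\<Lambda>" unfolding least_period_iff shp
    using mp \<Lambda> by (auto simp: minimal_period_def dest: dvd_imp_le simp del: shiftn_apply)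
  ultimately have "{p \<in> class_points G ?\<Lambda> (circuit_path e). least_period p ?\<Lambda>} \<noteq> {}" by blast
  moreover have "finite {p \<in> class_points G ?\<Lambda> (circuit_path e). least_period p ?\<Lambda>}"
    using finite_class_points[OF \<Lambda>] by simp
  ultimately show "1 \<le> ?\<Lambda> \<and> 0 < orbit_count G e ?\<Lambda>"
    unfolding orbit_count_eq[OF e] using \<Lambda> by (simp add: card_gt_0_iff Suc_le_eq)
  fix k assume k: "1 \<le> k \<and> 0 < orbit_count G e k"
  then have "shift_orbit ` {p \<in> class_points G k (circuit_path e). least_period p k} \<noteq> {}"
    unfolding orbit_count_eq[OF e] by (metis card.empty less_irrefl)
  then obtain p where "p \<in> class_points G k (circuit_path e)" by blast
  then show "?\<Lambda> \<le> k" using class_points_period_ge[OF _ _ mp] k by auto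
qed

text \<open>With two symbols more than one turn, a point of this least period makes one turn with a
  single push-pop pair inserted; these are counted by the linear coefficient of the weight.\<close>

lemma orbit_count_Lambda_2:
  assumes e: "e \<in> arcs G - \<F> G"
  shows "real (orbit_count G e (length (circuit e) + 2)) = fps_nth (circuit_weight e) 1"
proof -
  define \<Lambda> where "\<Lambda> = length (circuit e)"
  define n where "n = \<Lambda> + 2"
  let ?y = "circuit_path e"
  have \<Lambda>: "0 < \<Lambda>" and n: "0 < n" by (simp_all add: \<Lambda>_def n_def)
  have mp: "minimal_period ?y \<Lambda>" unfolding \<Lambda>_def by (rule circuit_path_minimal_period[OF e])
  have yp: "?y \<in> biinf_paths G" "shiftn (int \<Lambda>) ?y = ?y" unfolding \<Lambda>_def by (rule circuit_path_periodic[OF e])+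
  let ?S = "{p \<in> class_points G n ?y. least_period p n}"
  have S: "?S = drift_points n ?y \<Lambda>"
  proof (intro set_eqI iffI)
    fix p assume p: "p \<in> ?S"
    then have pc: "p \<in> class_points G n ?y" and lp: "least_period p n" by auto
    obtain M where M: "0 < M" "M * \<Lambda> \<le> n" "p \<in> drift_points n ?y (M * \<Lambda>)"
      using class_points_drift[OF pc n mp] by blast
    obtain i where i: "n = M * \<Lambda> + 2 * i" using drift_points_empty[OF M(3)] by blast
    have "M = 1"
    \<comment> \<open>Without pops the point is a shift of the pure circuit and has the shorter
      period \<Lambda>, so the case cannot occur at least period \<open>n\<close>.\<close>
    proof (cases "i = 0")
      case True
      have pX: "p \<in> markov_dyck G" "shiftn (int n) p = p" "stack_class p ?y"
        using pc by (auto simp: class_points_def simp del: shiftn_apply)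
      have "height (window p 0 n) = int n" using M(3) i True by (simp add: drift_points_def)
      from all_Minus_if_full_height[OF pX(2) n this]
      obtain z where z: "shiftn (int n) z = z" and pz: "p = Minus \<circ> z" by blast
      have shm: "shiftn a (Minus \<circ> z) = Minus \<circ> shiftn a z" for a :: int by (auto simp: fun_eq_iff)
      have "stack_class p z" unfolding pz by (rule stack_class_Minus[OF n z])
      then obtain a where a: "z = shiftn a ?y" using stack_class_unique[OF pX(3)] by blast
      have "shiftn (int \<Lambda>) z = z" unfolding a by (rule shiftn_period_shiftn[OF yp(2)])
      then have "shiftn (int \<Lambda>) p = p" unfolding pz shm by (simp only:)
      then show ?thesis using lp \<Lambda> by (auto simp: least_period_iff n_def simp del: shiftn_apply)
    next
      case False
      then have "M * \<Lambda> \<le> \<Lambda>" using i unfolding n_def by linarith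
      then show ?thesis using \<Lambda> M(1) by (cases M) auto
    qed
    then show "p \<in> drift_points n ?y \<Lambda>" using M(3) by simp
  next
    fix p assume p: "p \<in> drift_points n ?y \<Lambda>"
    then have pc: "p \<in> class_points G n ?y" and h: "height (window p 0 n) = int \<Lambda>" by (auto simp: drift_points_def)
    have pp: "shiftn (int n) p = p" using pc by (simp add: class_points_def del: shiftn_apply)
    obtain j0 where j0: "minimal_period p j0" using ex_minimal_period[OF n pp] by blast
    then have j: "0 < j0" "shiftn (int j0) p = p" "j0 dvd n"
      using pp by (auto simp: minimal_period_def simp del: shiftn_apply)
    obtain q where q: "n = q * j0" using j(3) by (metis dvd_def mult.commute)
    have "p \<in> class_points G j0 ?y" using pc j(2) by (simp add: class_points_def del: shiftn_apply)
    then obtain M where M: "0 < M" "p \<in> drift_points j0 ?y (M * \<Lambda>)" using class_points_drift[OF _ j(1) mp] by blast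
    \<comment> \<open>One turn is the least possible drift, so it cannot be distributed over several
      shorter periods.\<close>
    have "height (window p 0 n) = int q * height (window p 0 j0)"
      using height_window_period[OF j(2), of q 0] q by simp
    then have "int \<Lambda> = int (q * (M * \<Lambda>))" using h M(2) by (simp add: drift_points_def)
    then have "\<Lambda> = q * (M * \<Lambda>)" by (simp only: of_nat_eq_iff)
    then have "\<Lambda> * 1 = \<Lambda> * (q * M)" by (simp only: mult_ac mult_1_right)
    then have "1 = q * M" using \<Lambda> by (simp only: nat_mult_eq_cancel1)
    then have "q = 1" by simp
    then have "j0 = n" using q by simp
    have "least_period p n" unfolding least_period_iff
    proof (intro conjI allI impI)
      fix j assume "0 < j \<and> j < n"
      then show "shiftn (int j) p \<noteq> p"
        using j0 \<open>j0 = n\<close> by (auto simp: minimal_period_def dest: dvd_imp_le simp del: shiftn_apply)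
    qed (use n pp in auto)
    then show "p \<in> ?S" using pc by simp
  qed
  have "n * card (shift_orbit ` ?S) = card ?S"
  proof (rule card_shift_orbits)
    show "finite ?S" using finite_class_points[OF n] by simp
    show "shiftn a p \<in> ?S" if "p \<in> ?S" for p a using that drift_points_shiftn unfolding S by blast
  qed auto
  then have "n * orbit_count G e n = card (drift_points n ?y (1 * \<Lambda>))"
    using orbit_count_eq[OF e, of n] S by simp
  moreover have "real 1 * real (card (drift_points n ?y (1 * \<Lambda>))) =
      real n * fps_nth (path_weight G ?y \<Lambda> ^ 1) 1"
    by (rule card_drift_points[OF n yp(1) mp]) (simp_all add: n_def)
  ultimately have "real n * real (orbit_count G e n) = real n * fps_nth (path_weight G ?y \<Lambda>) 1"
    by (simp flip: of_nat_mult)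
  then have "real (orbit_count G e n) = fps_nth (path_weight G ?y \<Lambda>) 1" using n by simp
  then show ?thesis using path_weight_circuit_path[of e] by (simp add: \<Lambda>_def n_def)
qed

lemma Delta_eq:
  assumes e: "e \<in> arcs G - \<F> G"
  shows "real_of_int (Delta G e) = (\<Sum>i<length (circuit e). real (out_degree G (tail G (circuit e ! i))) - 1)"
  using orbit_count_Lambda_2[OF e] circuit_weight_nth_1[of e] e
  by (simp add: Delta_def Lambda_eq[OF e] sum_subtractf)

section \<open>Circuits as a cover of the graph, and its out-degrees\<close>

lemma tree_path_circuit_nth:
  assumes "g \<in> arcs G" "a < length (circuit g)"
  shows "tree_path (tail G (circuit g ! a)) = take a (circuit g)"
  using assms(2)
proof (induction a)
  case 0
  have "tail G (circuit g ! 0) = r"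
  proof (cases "tree_path (tail G g)")
    case Nil
    then show ?thesis using assms tree_path_eq_Nil[of "tail G g"] by (simp add: circuit_def)
  next
    case (Cons f fs)
    then show ?thesis using tree_path(2)[of "tail G g"] assms by (simp add: circuit_def)
  qed
  then show ?case by simp
next
  case (Suc a)
  have f: "circuit g ! a \<in> \<F> G" using nth_circuit_sole[OF assms(1)] Suc.prems by simp
  have "cas r (circuit g) (head G g)" using tree_path(2)[of "tail G g"] assms(1)
    by (auto simp: circuit_def cas_append_ex)
  then have "head G (circuit g ! a) = tail G (circuit g ! Suc a)" using cas_step Suc.prems by metis
  then have "tree_path (tail G (circuit g ! Suc a)) = tree_path (tail G (circuit g ! a)) @ [circuit g ! a]"
    using tree_path_head[OF f] by simp
  then show ?case using Suc by (simp add: take_Suc_conv_app_nth)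
qed

text \<open>The tree path to \<open>v\<close>, continued by a walk to some back arc, is a closed
  walk at \<open>r\<close>; one of its circuits passes through \<open>v\<close>.\<close>

lemma ex_out_arc:
  assumes "v \<in> verts G" shows "\<exists>g\<in>arcs G - \<F> G. \<exists>a<length (circuit g). tail G (circuit g ! a) = v"
proof -
  obtain g where g: "g \<in> arcs G - \<F> G" using back_arcs by blast
  obtain p where p: "awalk v p (tail G g)" using awalk_exists[of v "tail G g"] assms g by auto
  define L where "L = tree_path v @ p @ [g]"
  have arcsL: "set L \<subseteq> arcs G" using tree_path(1)[OF assms] sole_arc_in_arcs p g by (auto simp: L_def awalk_def)
  have casL: "cas r L r"
    using tree_path(2)[OF assms] p g head_back_arc by (auto simp: L_def awalk_def cas_append_ex)
  define hs where "hs = filter (\<lambda>f. f \<notin> \<F> G) L"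
  have L: "L = concat (map circuit hs)" unfolding hs_def by (rule closed_walk_from_root[OF arcsL casL])
  obtain f q where fq: "p @ [g] = f # q" by (cases p) auto
  have "tail G f = v"
  proof -
    have "cas v (p @ [g]) r" using p g head_back_arc by (auto simp: awalk_def cas_append_ex)
    then show ?thesis using fq by simp
  qed
  have "f \<in> set L" using fq by (simp add: L_def)
  then obtain h where h: "h \<in> set hs" "f \<in> set (circuit h)" using L by auto
  then obtain a where "a < length (circuit h)" "circuit h ! a = f" by (auto simp: in_set_conv_nth)
  moreover have "h \<in> arcs G - \<F> G" using h(1) arcsL by (auto simp: hs_def)
  ultimately show ?thesis using \<open>tail G f = v\<close> by blast
qed

lemma ex_circuit_through:
  assumes "f \<in> arcs G" shows "\<exists>g\<in>arcs G - \<F> G. \<exists>a<length (circuit g). circuit g ! a = f"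
proof -
  obtain g where g: "g \<in> arcs G - \<F> G" using back_arcs by blast
  obtain p where p: "awalk (head G f) p (tail G g)" using awalk_exists[of "head G f" "tail G g"] assms g by auto
  define L where "L = tree_path (tail G f) @ f # p @ [g]"
  have v: "tail G f \<in> verts G" using assms by simp
  have arcsL: "set L \<subseteq> arcs G" using tree_path(1)[OF v] sole_arc_in_arcs p g assms by (auto simp: L_def awalk_def)
  have casL: "cas r L r"
    using tree_path(2)[OF v] p g head_back_arc by (auto simp: L_def awalk_def cas_append_ex)
  define hs where "hs = filter (\<lambda>f. f \<notin> \<F> G) L"
  have L: "L = concat (map circuit hs)" unfolding hs_def by (rule closed_walk_from_root[OF arcsL casL])
  have "f \<in> set L" by (simp add: L_def)
  then obtain h where h: "h \<in> set hs" "f \<in> set (circuit h)" using L by auto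
  then obtain a where "a < length (circuit h)" "circuit h ! a = f" by (auto simp: in_set_conv_nth)
  moreover have "h \<in> arcs G - \<F> G" using h(1) arcsL by (auto simp: hs_def)
  ultimately show ?thesis by blast
qed

lemma out_degree_pos:
  assumes "v \<in> verts G" shows "0 < out_degree G v"
proof -
  obtain g a where g: "g \<in> arcs G - \<F> G" "a < length (circuit g)" "tail G (circuit g ! a) = v"
    using ex_out_arc[OF assms] by blast
  then have "circuit g ! a \<in> arcs G" using set_circuit[of g] nth_mem by blast
  then have "circuit g ! a \<in> out_arcs G v" using g(3) by simp
  then show ?thesis unfolding out_degree_def by (auto simp: card_gt_0_iff)
qed

lemma card_sole_arcs: "card (\<F> G) + 1 = card (verts G)"
proof -
  have "bij_betw (head G) (\<F> G) (verts G - {r})"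
    unfolding bij_betw_def
  proof
    show "inj_on (head G) (\<F> G)"
    proof (rule inj_onI)
      fix f f' assume "f \<in> \<F> G" "f' \<in> \<F> G" "head G f = head G f'"
      then have "tree_path (tail G f) @ [f] = tree_path (tail G f') @ [f']" using tree_path_head by metis
      then show "f = f'" by simp
    qed
    show "head G ` \<F> G = verts G - {r}"
    proof
      show "head G ` \<F> G \<subseteq> verts G - {r}" using head_sole_arc sole_arc_in_arcs by auto
      show "verts G - {r} \<subseteq> head G ` \<F> G"
      proof
        fix v assume v: "v \<in> verts G - {r}"
        then obtain p f where p: "tree_path v = p @ [f]"
          using tree_path_eq_Nil[of v] by (cases "tree_path v" rule: rev_cases) auto
        have "f \<in> \<F> G" using tree_path(1)[of v] v p by simp
        moreover have "head G f = v" using tree_path(2)[of v] v p by (auto simp: cas_append_ex)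
        ultimately show "v \<in> head G ` \<F> G" by blast
      qed
    qed
  qed
  from bij_betw_same_card[OF this] show ?thesis using root card_Suc_Diff1[OF finite_verts root] by simp
qed

text \<open>Count the arcs by their sources: one tree arc enters each vertex except
  \<open>r\<close>, and \<open>nu G\<close> arcs lie outside the tree.\<close>

lemma sum_out_degree: "(\<Sum>v\<in>verts G. real (out_degree G v) - 1) = real (nu G) - 1"
proof -
  have "arcs G = (\<Union>v\<in>verts G. out_arcs G v)" by auto
  then have "card (arcs G) = card (\<Union>v\<in>verts G. out_arcs G v)" by simp
  also have "\<dots> = (\<Sum>v\<in>verts G. out_degree G v)"
    unfolding out_degree_def by (rule card_UN_disjoint) auto
  finally have 1: "card (arcs G) = (\<Sum>v\<in>verts G. out_degree G v)" .
  have "\<F> G \<subseteq> arcs G" using sole_arc_in_arcs by blast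
  then have "card (arcs G) = card (\<F> G) + nu G"
    unfolding nu_def using card_Diff_subset[of "\<F> G" "arcs G"] card_mono[of "arcs G" "\<F> G"]
    by (simp add: finite_subset)
  then have "real (card (arcs G)) + 1 = real (card (verts G)) + real (nu G)" using card_sole_arcs by linarith
  moreover have "(\<Sum>v\<in>verts G. real (out_degree G v) - 1) = real (card (arcs G)) - real (card (verts G))"
    unfolding 1 by (simp add: sum_subtractf)
  ultimately show ?thesis by linarith
qed

text \<open>The circuit of \<open>e\<close> already accounts for the whole sum over all vertices,
  and the remaining terms are nonnegative because every out-degree is positive.\<close>

lemma out_degree_off_circuit:
  assumes e: "e \<in> arcs G - \<F> G" and \<Delta>: "Delta G e = int (nu G) - 1"
    and v: "v \<in> verts G" "\<And>a. a < length (circuit e) \<Longrightarrow> tail G (circuit e ! a) \<noteq> v"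
  shows "out_degree G v = 1"
proof -
  let ?d = "\<lambda>v. real (out_degree G v) - 1"
  let ?S = "(\<lambda>a. tail G (circuit e ! a)) ` {..<length (circuit e)}"
  have inj: "inj_on (\<lambda>a. tail G (circuit e ! a)) {..<length (circuit e)}"
  proof (rule inj_onI)
    fix a b assume ab: "a \<in> {..<length (circuit e)}" "b \<in> {..<length (circuit e)}"
      "tail G (circuit e ! a) = tail G (circuit e ! b)"
    then have "take a (circuit e) = take b (circuit e)"
      using tree_path_circuit_nth[of e a] tree_path_circuit_nth[of e b] e by simp
    from arg_cong[OF this, of length] show "a = b" using ab by simp
  qed
  have sub: "?S \<subseteq> verts G"
  proof
    fix u assume "u \<in> ?S"
    then obtain a where "a < length (circuit e)" "u = tail G (circuit e ! a)" by blast
    then show "u \<in> verts G" using set_circuit[of e] e nth_mem by (metis DiffD1 subsetD tail_in_verts)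
  qed
  have "sum ?d ?S = real_of_int (Delta G e)" unfolding Delta_eq[OF e] by (simp add: sum.reindex[OF inj])
  then have "sum ?d ?S = sum ?d (verts G)" using sum_out_degree \<Delta> by simp
  moreover have "sum ?d (verts G) = sum ?d ?S + sum ?d (verts G - ?S)"
    using sub by (simp add: sum.subset_diff add.commute)
  ultimately have 0: "sum ?d (verts G - ?S) = 0" by simp
  have nn: "0 \<le> ?d u" if "u \<in> verts G - ?S" for u
    using out_degree_pos[of u] that by (simp add: Suc_le_eq)
  have "v \<in> verts G - ?S" using v by auto
  then have "?d v = 0" using 0 sum_nonneg_eq_0_iff[of "verts G - ?S" ?d] nn by simp
  then show ?thesis by simp
qed

end

section \<open>Power series along a spine\<close>

text \<open>The excursion series of a vertex of out-degree one whose successor has the series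
  \<open>a\<close>.\<close>

definition pass_fps :: "real fps \<Rightarrow> real fps" where
  "pass_fps a = inverse (1 - fps_X * a)"

lemma pass_fps_mult: "pass_fps a * (1 - fps_X * a) = 1"
  unfolding pass_fps_def by (rule inverse_mult_eq_1) simp

lemma pass_fps_rec: "pass_fps a = 1 + fps_X * (a * pass_fps a)"
  using pass_fps_mult[of a] by (simp add: algebra_simps)

lemma pass_fps_eqI: "c * (1 - fps_X * a) = 1 \<Longrightarrow> c = pass_fps a"
  unfolding pass_fps_def using fps_inverse_unique[of "1 - fps_X * a" c] by (simp add: mult.commute)

lemma pass_fps_nth [simp]: "fps_nth (pass_fps a) 0 = 1" "fps_nth (pass_fps a) (Suc 0) = fps_nth a 0"
  by (simp_all add: pass_fps_def) (subst pass_fps_rec[unfolded pass_fps_def], simp)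

lemma pass_fps_funpow_nth_0: "fps_nth a 0 = 1 \<Longrightarrow> fps_nth ((pass_fps ^^ k) a) 0 = 1"
  by (cases k) simp_all

lemma pass_fps_diff: "pass_fps a - pass_fps b = (a - b) * (fps_X * pass_fps a * pass_fps b)"
proof -
  have "pass_fps a - pass_fps b =
      pass_fps a * (pass_fps b * (1 - fps_X * b)) - pass_fps b * (pass_fps a * (1 - fps_X * a))"
    by (simp only: pass_fps_mult mult_1_right)
  then show ?thesis by (simp add: algebra_simps)
qed

lemma prod_pass_fps_Suc:
  "(\<Prod>k<Suc n. (pass_fps ^^ k) a) = a * (\<Prod>k<n. (pass_fps ^^ k) (pass_fps a))"
  by (simp add: prod.lessThan_Suc_shift funpow_swap1 del: prod.lessThan_Suc)

text \<open>The first factor contributes \<open>a - b\<close> times a series with constant term 1.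
  Each use of \<open>pass_fps\<close> multiplies the difference by \<open>fps_X\<close>, so the
  later factors do not disturb this constant term.\<close>

lemma prod_pass_fps_diff:
  assumes "fps_nth a 0 = 1" "fps_nth b 0 = 1" "0 < n"
  shows "\<exists>w. fps_nth w 0 = 1 \<and> (\<Prod>k<n. (pass_fps ^^ k) a) - (\<Prod>k<n. (pass_fps ^^ k) b) = (a - b) * w"
  using assms
proof (induction n arbitrary: a b)
  case (Suc n)
  show ?case
  proof (cases "n = 0")
    case True
    then show ?thesis by (intro exI[of _ 1]) simp
  next
    case False
    let ?P = "\<lambda>a. \<Prod>k<n. (pass_fps ^^ k) a"
    obtain w where w: "fps_nth w 0 = 1" "?P (pass_fps a) - ?P (pass_fps b) = (pass_fps a - pass_fps b) * w"
      using Suc.IH[of "pass_fps a" "pass_fps b"] False by auto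
    have P0: "fps_nth (?P (pass_fps a)) 0 = 1"
      by (rule fps_prod_nth_1[THEN conjunct1]) (simp add: pass_fps_funpow_nth_0)
    let ?w = "?P (pass_fps a) + b * (fps_X * pass_fps a * pass_fps b) * w"
    have "a * ?P (pass_fps a) - b * ?P (pass_fps b) =
        (a - b) * ?P (pass_fps a) + b * (?P (pass_fps a) - ?P (pass_fps b))" by (simp add: algebra_simps)
    also have "\<dots> = (a - b) * ?w" unfolding w(2) pass_fps_diff by (simp add: algebra_simps)
    finally have "(\<Prod>k<Suc n. (pass_fps ^^ k) a) - (\<Prod>k<Suc n. (pass_fps ^^ k) b) = (a - b) * ?w"
      unfolding prod_pass_fps_Suc .
    moreover have "fps_nth ?w 0 = 1" using P0 by simp
    ultimately show ?thesis by blast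
  qed
qed simp

lemma prod_pass_fps_inject:
  assumes "fps_nth a 0 = 1" "fps_nth b 0 = 1" "0 < n"
    and eq: "(\<Prod>k<n. (pass_fps ^^ k) a) = (\<Prod>k<n. (pass_fps ^^ k) b)"
  shows "a = b"
proof -
  obtain w where w: "fps_nth w 0 = 1" "(\<Prod>k<n. (pass_fps ^^ k) a) - (\<Prod>k<n. (pass_fps ^^ k) b) = (a - b) * w"
    using prod_pass_fps_diff[OF assms(1-3)] by blast
  then have "(a - b) * w = 0" using eq by simp
  moreover have "w \<noteq> 0" using w(1) by auto
  ultimately show ?thesis by simp
qed

text \<open>
  \<open>c j\<close> is the excursion series of the vertex at depth \<open>j\<close> of the spine of length \<open>\<Lambda>\<close>, and each
  \<open>g \<in> N\<close> is a circuit that leaves the spine at depth \<open>lev g\<close> for good.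
\<close>

locale level_data =
  fixes N :: "'g set" and len lev :: "'g \<Rightarrow> nat" and c :: "nat \<Rightarrow> real fps" and \<Lambda> :: nat and W :: "'g \<Rightarrow> real fps"
  assumes finite_N: "finite N" and N_ne: "N \<noteq> {}"
    and lev_len: "\<And>g. g \<in> N \<Longrightarrow> lev g < len g" and lev_spine: "\<And>g. g \<in> N \<Longrightarrow> lev g < \<Lambda>"
    and c_rec: "\<And>j. j < \<Lambda> \<Longrightarrow>
      c j * (1 - fps_X * (c (Suc j) + (\<Sum>g\<in>{g \<in> N. lev g = j}. (pass_fps ^^ (len g - j - 1)) (c 0)))) = 1"
    and c_nth_0: "\<And>j. fps_nth (c j) 0 = 1"
    and W_eq: "\<And>g. g \<in> N \<Longrightarrow>
      W g = (\<Prod>j<Suc (lev g). c j) * (\<Prod>k<len g - lev g - 1. (pass_fps ^^ Suc k) (c 0))"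
begin

definition count_le :: "nat \<Rightarrow> nat" where
  "count_le t = card {g \<in> N. lev g \<le> t}"

definition base :: nat where
  "base = Min (lev ` N)"

lemma base_le: "g \<in> N \<Longrightarrow> base \<le> lev g"
  using finite_N by (simp add: base_def)

lemma ex_base: "\<exists>g\<in>N. lev g = base"
proof -
  have "base \<in> lev ` N" unfolding base_def using finite_N N_ne by (intro Min_in) auto
  then show ?thesis by auto
qed

lemma count_le_mono: "s \<le> t \<Longrightarrow> count_le s \<le> count_le t"
  unfolding count_le_def using finite_N by (intro card_mono) auto

lemma count_le_strict: "g \<in> N \<Longrightarrow> s < lev g \<Longrightarrow> count_le s < count_le (lev g)"
proof -
  assume g: "g \<in> N" "s < lev g"
  have "{h \<in> N. lev h \<le> s} \<subseteq> {h \<in> N. lev h \<le> lev g}" using g(2) by auto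
  moreover have "g \<in> {h \<in> N. lev h \<le> lev g}" "g \<notin> {h \<in> N. lev h \<le> s}" using g by auto
  ultimately have "{h \<in> N. lev h \<le> s} \<subset> {h \<in> N. lev h \<le> lev g}" by blast
  then show ?thesis unfolding count_le_def using finite_N by (intro psubset_card_mono) auto
qed

lemma count_le_split: "count_le t = card {g \<in> N. lev g < t} + card {g \<in> N. lev g = t}"
proof -
  have "{g \<in> N. lev g \<le> t} = {g \<in> N. lev g < t} \<union> {g \<in> N. lev g = t}" by auto
  moreover have "{g \<in> N. lev g < t} \<inter> {g \<in> N. lev g = t} = {}" by auto
  ultimately show ?thesis unfolding count_le_def using finite_N by (simp add: card_Un_disjoint)
qed

lemma c_nth_1:
  assumes "j < \<Lambda>" shows "fps_nth (c j) 1 = 1 + real (card {g \<in> N. lev g = j})"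
proof -
  let ?S = "c (Suc j) + (\<Sum>g\<in>{g \<in> N. lev g = j}. (pass_fps ^^ (len g - j - 1)) (c 0))"
  have "c j = pass_fps ?S" using c_rec[OF assms] by (rule pass_fps_eqI)
  then have "fps_nth (c j) 1 = fps_nth ?S 0" using pass_fps_nth(2)[of ?S] by simp
  also have "\<dots> = 1 + real (card {g \<in> N. lev g = j})"
    by (simp add: fps_sum_nth c_nth_0 pass_fps_funpow_nth_0)
  finally show ?thesis .
qed

lemma sum_card_levels: "(\<Sum>j<Suc t. card {g \<in> N. lev g = j}) = count_le t"
proof -
  have "{g \<in> N. lev g \<le> t} = (\<Union>j\<in>{..<Suc t}. {g \<in> N. lev g = j})" by auto
  then have "count_le t = card (\<Union>j\<in>{..<Suc t}. {g \<in> N. lev g = j})" unfolding count_le_def by simp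
  also have "\<dots> = (\<Sum>j<Suc t. card {g \<in> N. lev g = j})" using finite_N by (intro card_UN_disjoint) auto
  finally show ?thesis by simp
qed

text \<open>The linear coefficients add up: each vertex of the circuit contributes 1, and a spine
  vertex in addition the number of circuits that leave there.\<close>

lemma W_nth_1:
  assumes "g \<in> N" shows "fps_nth (W g) 1 = real (len g) + real (count_le (lev g))"
proof -
  let ?A = "\<Prod>j<Suc (lev g). c j" and ?B = "\<Prod>k<len g - lev g - 1. (pass_fps ^^ Suc k) (c 0)"
  have A: "fps_nth ?A 0 = 1 \<and> fps_nth ?A 1 = (\<Sum>j<Suc (lev g). fps_nth (c j) 1)"
    by (rule fps_prod_nth_1) (rule c_nth_0)
  have B: "fps_nth ?B 0 = 1 \<and> fps_nth ?B 1 = (\<Sum>k<len g - lev g - 1. fps_nth ((pass_fps ^^ Suc k) (c 0)) 1)"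
    by (rule fps_prod_nth_1) simp
  have "(\<Sum>j<Suc (lev g). fps_nth (c j) 1) = (\<Sum>j<Suc (lev g). 1 + real (card {h \<in> N. lev h = j}))"
  proof (rule sum.cong[OF refl])
    fix j assume "j \<in> {..<Suc (lev g)}"
    then have "j < \<Lambda>" using lev_spine[OF assms] by simp
    then show "fps_nth (c j) 1 = 1 + real (card {h \<in> N. lev h = j})" by (rule c_nth_1)
  qed
  also have "\<dots> = real (Suc (lev g)) + real (count_le (lev g))"
    unfolding sum.distrib using sum_card_levels[of "lev g"] by (simp flip: of_nat_sum)
  finally have A1: "fps_nth ?A 1 = real (Suc (lev g)) + real (count_le (lev g))" using A by simp
  have "fps_nth ?B 1 = real (len g - lev g - 1)"
    using B by (simp add: pass_fps_funpow_nth_0 c_nth_0)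
  then show ?thesis unfolding W_eq[OF assms] using A A1 B lev_len[OF assms]
    by (simp add: fps_mult_nth of_nat_diff)
qed

lemma c_below_base: "j \<le> base \<Longrightarrow> c j = (pass_fps ^^ (base - j)) (c base)"
proof (induction "base - j" arbitrary: j)
  case 0
  then show ?case by simp
next
  case (Suc k)
  then have j: "j < base" by simp
  have "base < \<Lambda>" using ex_base lev_spine by metis
  have empty: "{g \<in> N. lev g = j} = {}" using base_le j by fastforce
  have "j < \<Lambda>" using j \<open>base < \<Lambda>\<close> by simp
  from c_rec[OF this] have "c j * (1 - fps_X * c (Suc j)) = 1" unfolding empty by simp
  then have "c j = pass_fps (c (Suc j))" by (rule pass_fps_eqI)
  also have "c (Suc j) = (pass_fps ^^ (base - Suc j)) (c base)" using Suc j by simp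
  also have "pass_fps \<dots> = (pass_fps ^^ (base - j)) (c base)"
    using j by (simp add: Suc_diff_Suc flip: funpow.simps(2)[THEN fun_cong, unfolded o_apply])
  finally show ?case .
qed

lemma c_0: "c 0 = (pass_fps ^^ base) (c base)"
  using c_below_base[of 0] by simp

text \<open>Such a circuit branches only at depth \<open>base\<close>. Going backwards around it
  from there, first down to the root and then along the branch, each step applies
  \<open>pass_fps\<close> once more.\<close>

lemma W_base:
  assumes "g \<in> N" "lev g = base"
  shows "W g = (\<Prod>k<len g. (pass_fps ^^ k) (c base))"
proof -
  have "(\<Prod>j<Suc base. c j) = (\<Prod>j<Suc base. (pass_fps ^^ (base - j)) (c base))"
    by (rule prod.cong[OF refl], rule c_below_base) simp
  also have "\<dots> = (\<Prod>k<Suc base. (pass_fps ^^ k) (c base))"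
    by (rule prod.reindex_bij_witness[of _ "\<lambda>k. base - k" "\<lambda>k. base - k"]) auto
  finally have 1: "(\<Prod>j<Suc base. c j) = (\<Prod>k<Suc base. (pass_fps ^^ k) (c base))" .
  have 2: "(pass_fps ^^ Suc k) (c 0) = (pass_fps ^^ (Suc base + k)) (c base)" for k
  proof -
    have "Suc base + k = Suc k + base" by simp
    then show ?thesis unfolding c_0 by (simp only: funpow_add o_apply)
  qed
  have "len g = Suc base + (len g - base - 1)" using lev_len[OF assms(1)] assms(2) by simp
  then have "(\<Prod>k<len g. (pass_fps ^^ k) (c base)) =
      (\<Prod>k<Suc base. (pass_fps ^^ k) (c base)) * (\<Prod>k<len g - base - 1. (pass_fps ^^ (Suc base + k)) (c base))"
    using prod_lessThan_add[of "\<lambda>k. (pass_fps ^^ k) (c base)" "Suc base" "len g - base - 1"] by metis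
  then show ?thesis unfolding W_eq[OF assms(1)] assms(2) 1 2 ..
qed

text \<open>Relative to \<open>base\<close> the exponents no longer contain \<open>base\<close>, so
  systems of levels that differ by a translation obey the same equations.\<close>

lemma c_rec_base:
  assumes "base + t < \<Lambda>"
  shows "c (base + t) * (1 - fps_X * (c (base + Suc t) +
    (\<Sum>g\<in>{g \<in> N. lev g = base + t}. (pass_fps ^^ (len g - t - 1)) (c base)))) = 1"
proof -
  have "(pass_fps ^^ (len g - (base + t) - 1)) (c 0) = (pass_fps ^^ (len g - t - 1)) (c base)"
    if "g \<in> {g \<in> N. lev g = base + t}" for g
  proof -
    have "base + t < len g" using lev_len[of g] that by simp
    then have "len g - t - 1 = (len g - (base + t) - 1) + base" by simp
    then show ?thesis unfolding c_0 by (simp only: funpow_add o_apply)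
  qed
  then have "(\<Sum>g\<in>{g \<in> N. lev g = base + t}. (pass_fps ^^ (len g - (base + t) - 1)) (c 0)) =
      (\<Sum>g\<in>{g \<in> N. lev g = base + t}. (pass_fps ^^ (len g - t - 1)) (c base))" by (rule sum.cong[OF refl])
  then show ?thesis using c_rec[OF assms] by simp
qed

end

text \<open>Length and weight determine \<open>count_le (lev g)\<close>, and this number is strictly
  larger at any occupied level above the base.\<close>

lemma level_data_base_le:
  assumes D: "level_data N len lev c \<Lambda> W" and D': "level_data N' len' lev' c' \<Lambda>' W'"
    and \<sigma>: "bij_betw \<sigma> N N'" and len: "\<And>g. g \<in> N \<Longrightarrow> len' (\<sigma> g) = len g" and W: "\<And>g. g \<in> N \<Longrightarrow> W' (\<sigma> g) = W g"
    and g: "g \<in> N" "lev g = level_data.base N lev"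
  shows "lev' (\<sigma> g) = level_data.base N' lev'"
proof (rule ccontr)
  interpret D: level_data N len lev c \<Lambda> W by (rule D)
  interpret D': level_data N' len' lev' c' \<Lambda>' W' by (rule D')
  have count: "D'.count_le (lev' (\<sigma> h)) = D.count_le (lev h)" if h: "h \<in> N" for h
    using D.W_nth_1[OF h] D'.W_nth_1[OF bij_betw_apply[OF \<sigma> h]] len[OF h] W[OF h] by simp
  assume "lev' (\<sigma> g) \<noteq> D'.base"
  then have lt: "D'.base < lev' (\<sigma> g)" using D'.base_le[OF bij_betw_apply[OF \<sigma> g(1)]] by simp
  obtain h' where h': "h' \<in> N'" "lev' h' = D'.base" using D'.ex_base by blast
  then obtain h where h: "h \<in> N" "h' = \<sigma> h" using bij_betw_imp_surj_on[OF \<sigma>] by blast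
  have "D.count_le (lev g) \<le> D.count_le (lev h)" using D.base_le[OF h(1)] g(2) by (intro D.count_le_mono) simp
  then have "D'.count_le (lev' (\<sigma> g)) \<le> D'.count_le D'.base" using count[OF g(1)] count[OF h(1)] h h' by simp
  moreover have "D'.count_le D'.base < D'.count_le (lev' (\<sigma> g))"
    by (rule D'.count_le_strict[OF bij_betw_apply[OF \<sigma> g(1)] lt])
  ultimately show False by simp
qed

text \<open>Climb the spine from the base. The series at a depth and the circuits leaving there give
  the next series by the recursion; its linear coefficient tells how many circuits leave next, and
  the values of \<open>count_le\<close> tell which ones.\<close>

lemma level_data_unique:
  assumes D: "level_data N len lev c \<Lambda> W" and D': "level_data N' len' lev' c' \<Lambda>' W'"
    and \<sigma>: "bij_betw \<sigma> N N'" and len: "\<And>g. g \<in> N \<Longrightarrow> len' (\<sigma> g) = len g" and W: "\<And>g. g \<in> N \<Longrightarrow> W' (\<sigma> g) = W g"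
    and g: "g \<in> N"
  shows "lev g - level_data.base N lev = lev' (\<sigma> g) - level_data.base N' lev'"
proof -
  interpret D: level_data N len lev c \<Lambda> W by (rule D)
  interpret D': level_data N' len' lev' c' \<Lambda>' W' by (rule D')
  let ?m = D.base and ?m' = D'.base
  have \<sigma>N: "\<sigma> h \<in> N'" if "h \<in> N" for h using bij_betw_apply[OF \<sigma> that] .
  have inj: "inj_on \<sigma> N" using \<sigma> by (rule bij_betw_imp_inj_on)
  have count: "D'.count_le (lev' (\<sigma> h)) = D.count_le (lev h)" if h: "h \<in> N" for h
    using D.W_nth_1[OF h] D'.W_nth_1[OF \<sigma>N[OF h]] len[OF h] W[OF h] by simp
  have cm: "c ?m = c' ?m'"
  proof -
    obtain g0 where g0: "g0 \<in> N" "lev g0 = ?m" using D.ex_base by blast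
    have g0': "lev' (\<sigma> g0) = ?m'" by (rule level_data_base_le[OF D D' \<sigma> len W g0])
    have "(\<Prod>k<len g0. (pass_fps ^^ k) (c ?m)) = (\<Prod>k<len g0. (pass_fps ^^ k) (c' ?m'))"
      using D.W_base[OF g0] D'.W_base[OF \<sigma>N[OF g0(1)] g0'] len[OF g0(1)] W[OF g0(1)] by simp
    moreover have "0 < len g0" using D.lev_len[OF g0(1)] by linarith
    ultimately show ?thesis by (intro prod_pass_fps_inject[OF D.c_nth_0 D'.c_nth_0])
  qed
  have image: "\<sigma> ` {h \<in> N. P h} = {h' \<in> N'. P' h'}" if "\<And>h. h \<in> N \<Longrightarrow> P h \<longleftrightarrow> P' (\<sigma> h)" for P P'
    using that bij_betw_imp_surj_on[OF \<sigma>] by blast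
  have card_image': "card {h' \<in> N'. P' h'} = card {h \<in> N. P h}" if "\<And>h. h \<in> N \<Longrightarrow> P h \<longleftrightarrow> P' (\<sigma> h)" for P P'
  proof -
    have "inj_on \<sigma> {h \<in> N. P h}" using inj by (rule inj_on_subset) auto
    from card_image[OF this] show ?thesis by (simp only: image[of P P', OF that])
  qed
  \<comment> \<open>The series are compared only as long as some circuit leaves at this depth or
    above, for the recursion is available on the spine alone.\<close>
  have main: "(\<forall>h\<in>N. lev h = ?m + t \<longleftrightarrow> lev' (\<sigma> h) = ?m' + t) \<and>
      ((\<exists>h\<in>N. ?m + t \<le> lev h) \<longrightarrow> c (?m + t) = c' (?m' + t))" for t
  proof (induction t rule: less_induct)
    case (less t)
    have IH: "lev h = ?m + s \<longleftrightarrow> lev' (\<sigma> h) = ?m' + s" if "s < t" "h \<in> N" for s h using less that by blast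
    have ge: "?m + t \<le> lev h \<longleftrightarrow> ?m' + t \<le> lev' (\<sigma> h)" if h: "h \<in> N" for h
    proof
      assume a: "?m + t \<le> lev h"
      show "?m' + t \<le> lev' (\<sigma> h)"
      proof (rule ccontr)
        assume "\<not> ?m' + t \<le> lev' (\<sigma> h)"
        moreover have "?m' \<le> lev' (\<sigma> h)" by (rule D'.base_le[OF \<sigma>N[OF h]])
        ultimately have "lev' (\<sigma> h) - ?m' < t" "lev' (\<sigma> h) = ?m' + (lev' (\<sigma> h) - ?m')" by linarith+
        then have "lev h = ?m + (lev' (\<sigma> h) - ?m')" using IH[OF _ h] by blast
        then show False using a \<open>lev' (\<sigma> h) - ?m' < t\<close> by linarith
      qed
    next
      assume a: "?m' + t \<le> lev' (\<sigma> h)"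
      show "?m + t \<le> lev h"
      proof (rule ccontr)
        assume "\<not> ?m + t \<le> lev h"
        moreover have "?m \<le> lev h" by (rule D.base_le[OF h])
        ultimately have "lev h - ?m < t" "lev h = ?m + (lev h - ?m)" by linarith+
        then have "lev' (\<sigma> h) = ?m' + (lev h - ?m)" using IH[OF _ h] by blast
        then show False using a \<open>lev h - ?m < t\<close> by linarith
      qed
    qed
    have R: "c (?m + t) = c' (?m' + t)" if ex: "\<exists>h\<in>N. ?m + t \<le> lev h"
    proof (cases t)
      case 0
      then show ?thesis using cm by simp
    next
      case (Suc s)
      obtain h where h: "h \<in> N" "?m + t \<le> lev h" using ex by blast
      have s: "?m + s < \<Lambda>" "?m' + s < \<Lambda>'"
        using D.lev_spine[OF h(1)] D'.lev_spine[OF \<sigma>N[OF h(1)]] h(2) ge[OF h(1)] Suc by linarith+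
      have "s < t" using Suc by simp
      have "?m + s \<le> lev h" using h(2) Suc by linarith
      then have cs: "c (?m + s) = c' (?m' + s)" using less[OF \<open>s < t\<close>] h(1) by blast
      let ?S = "\<Sum>h\<in>{h \<in> N. lev h = ?m + s}. (pass_fps ^^ (len h - s - 1)) (c ?m)"
      let ?S' = "\<Sum>h\<in>{h \<in> N'. lev' h = ?m' + s}. (pass_fps ^^ (len' h - s - 1)) (c' ?m')"
      have inj': "inj_on \<sigma> {h \<in> N. lev h = ?m + s}" using inj by (rule inj_on_subset) auto
      have im: "{h \<in> N'. lev' h = ?m' + s} = \<sigma> ` {h \<in> N. lev h = ?m + s}"
        using image[of "\<lambda>h. lev h = ?m + s" "\<lambda>h. lev' h = ?m' + s"] IH[OF \<open>s < t\<close>] by simp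
      have "?S' = ?S" unfolding im sum.reindex[OF inj'] using len cm by (intro sum.cong) auto
      have e1: "c (?m + s) * (1 - fps_X * (c (?m + t) + ?S)) = 1" using D.c_rec_base[OF s(1)] Suc by simp
      have e2: "c (?m + s) * (1 - fps_X * (c' (?m' + t) + ?S)) = 1"
        using D'.c_rec_base[OF s(2)] Suc cs \<open>?S' = ?S\<close> by simp
      have "c (?m + s) \<noteq> 0" using D.c_nth_0[of "?m + s"] by auto
      moreover have "c (?m + s) * (1 - fps_X * (c (?m + t) + ?S)) = c (?m + s) * (1 - fps_X * (c' (?m' + t) + ?S))"
        by (rule trans[OF e1 e2[symmetric]])
      ultimately have "1 - fps_X * (c (?m + t) + ?S) = 1 - fps_X * (c' (?m' + t) + ?S)"
        by (simp only: mult_cancel_left simp_thms)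
      then show ?thesis by simp
    qed
    have Q: "lev h = ?m + t \<longleftrightarrow> lev' (\<sigma> h) = ?m' + t" if h: "h \<in> N" for h
    proof (cases "?m + t \<le> lev h")
      case False
      then show ?thesis using ge[OF h] by auto
    next
      case True
      then have True': "?m' + t \<le> lev' (\<sigma> h)" using ge[OF h] by simp
      have s: "?m + t < \<Lambda>" "?m' + t < \<Lambda>'"
        using D.lev_spine[OF h] D'.lev_spine[OF \<sigma>N[OF h]] True True' by linarith+
      have "c (?m + t) = c' (?m' + t)" using R True h by blast
      then have "fps_nth (c (?m + t)) 1 = fps_nth (c' (?m' + t)) 1" by (rule arg_cong)
      \<comment> \<open>The linear coefficient of the series at this depth exceeds the number of
        circuits that leave there by one.\<close>
      then have eq: "card {g \<in> N. lev g = ?m + t} = card {g \<in> N'. lev' g = ?m' + t}"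
        using D.c_nth_1[OF s(1)] D'.c_nth_1[OF s(2)] by simp
      have lt: "card {g \<in> N'. lev' g < ?m' + t} = card {g \<in> N. lev g < ?m + t}"
      proof (rule card_image')
        fix h assume "h \<in> N"
        from ge[OF this] show "lev h < ?m + t \<longleftrightarrow> lev' (\<sigma> h) < ?m' + t" by linarith
      qed
      have D1: "D.count_le (?m + t) = card {g \<in> N. lev g < ?m + t} + card {g \<in> N. lev g = ?m + t}"
        by (rule D.count_le_split)
      have D2: "D'.count_le (?m' + t) = card {g \<in> N'. lev' g < ?m' + t} + card {g \<in> N'. lev' g = ?m' + t}"
        by (rule D'.count_le_split)
      \<comment> \<open>The circuits of this level are now recognised by their common value of
        \<open>count_le\<close>, which both sides share.\<close>
      have Deq: "D.count_le (?m + t) = D'.count_le (?m' + t)" using D1 D2 eq lt by simp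
      show ?thesis
      proof
        assume a: "lev h = ?m + t"
        show "lev' (\<sigma> h) = ?m' + t"
        proof (rule ccontr)
          assume "lev' (\<sigma> h) \<noteq> ?m' + t"
          then have "D'.count_le (?m' + t) < D'.count_le (lev' (\<sigma> h))"
            using True' by (intro D'.count_le_strict[OF \<sigma>N[OF h]]) simp
          then show False using count[OF h] a Deq by simp
        qed
      next
        assume a: "lev' (\<sigma> h) = ?m' + t"
        show "lev h = ?m + t"
        proof (rule ccontr)
          assume "lev h \<noteq> ?m + t"
          then have "D.count_le (?m + t) < D.count_le (lev h)"
            using True by (intro D.count_le_strict[OF h]) simp
          then show False using count[OF h] a Deq by simp
        qed
      qed
    qed
    show ?case using Q R by blast
  qed
  have "lev g = ?m + (lev g - ?m)" using D.base_le[OF g] by simp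
  then have "lev' (\<sigma> g) = ?m' + (lev g - ?m)" using main[of "lev g - ?m"] g by blast
  then show ?thesis by simp
qed

section \<open>Reconstructing the graph\<close>

text \<open>Two pushes or two pops in succession come from a closed path of length 2; a push and a
  pop must belong to the same arc and occur in two phases. Since closed paths are counted
  invariantly, this yields the number of arcs.\<close>

lemma card_period_2:
  assumes "tree_digraph G r"
  shows "card {x \<in> markov_dyck G. shiftn 2 x = x} = 2 * card (arcs G) + 2 * card (periodic_paths G 2)"
proof -
  interpret tree_digraph G r by (rule assms)
  let ?X = "{x \<in> markov_dyck G. shiftn 2 x = x}"
  let ?P = "periodic_paths G 2"
  define u where "u f = periodic_ext [Minus f, Plus f]" for f :: 'b
  have u0: "u f 0 = Minus f" "u f 1 = Plus f" for f by (simp_all add: u_def periodic_ext_def)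
  have up: "shiftn 2 (u f) = u f" for f
    using shiftn_periodic_ext[of "[Minus f, Plus f]"] by (simp add: u_def numeral_2_eq_2 del: shiftn_apply)
  have eqI: "x = z" if "shiftn 2 x = x" "shiftn 2 z = z" "x 0 = z 0" "x 1 = z 1" for x z :: "int \<Rightarrow> 'c"
  proof (rule periodic_eqI[of 2])
    show "window x 0 2 = window z 0 2" using that by (simp add: numeral_2_eq_2 window_Suc)
  qed (use that in simp_all)
  have P2: "y \<in> biinf_paths G" "shiftn 2 y = y" if "y \<in> ?P" for y
    using that by (auto simp: periodic_paths_def simp del: shiftn_apply)
  have fin: "finite ?P" by (rule finite_periodic_paths[OF fin_digraph_axioms]) simp
  let ?A = "(\<lambda>y. Minus \<circ> y) ` ?P" and ?B = "rev_plus ` ?P" and ?C = "u ` arcs G"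
    and ?D = "(\<lambda>f. shiftn 1 (u f)) ` arcs G"
  have X: "?X = (?A \<union> ?B) \<union> (?C \<union> ?D)"
  proof (intro set_eqI iffI)
    fix x assume "x \<in> ?X"
    then have x: "x \<in> markov_dyck G" "shiftn 2 x = x" by auto
    have x2: "x (i + 2) = x i" for i by (rule shiftn_period[OF x(2)])
    have mem: "x i \<in> signed_arcs G" for i using markov_dyckD(1)[OF x(1)] by blast
    have even_odd: "x i = x 0 \<or> x i = x 1" for i
      using apply_mod[OF x(2), of i] by (metis mod2_eq_if)
    have r0: "reduce [x 0, x 1] \<noteq> None" using markov_dyckD(3)[OF x(1), of 0 2] by (simp add: numeral_2_eq_2 window_Suc)
    have "x 2 = x 0" using x2[of 0] by simp
    then have r1: "reduce [x 1, x 0] \<noteq> None" using markov_dyckD(3)[OF x(1), of 1 2] by (simp add: numeral_2_eq_2 window_Suc)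
    define y where "y i = arc_of (x i)" for i
    have y2: "y (i + 2) = y i" for i using x2 by (simp add: y_def)
    have yarc: "y i \<in> arcs G" for i using mem[of i] by (auto simp: y_def signed_arcs_def)
    consider (mm) f g where "x 0 = Minus f" "x 1 = Minus g" | (pp) f g where "x 0 = Plus f" "x 1 = Plus g"
      | (mp) f g where "x 0 = Minus f" "x 1 = Plus g" | (pm) f g where "x 0 = Plus f" "x 1 = Minus g"
      by (cases "x 0"; cases "x 1") auto
    then show "x \<in> (?A \<union> ?B) \<union> (?C \<union> ?D)"
    proof cases
      case mm
      then have xy: "x i = Minus (y i)" for i using even_odd[of i] by (auto simp: y_def)
      then have "x = Minus \<circ> y" by (auto simp: fun_eq_iff)
      moreover have "y \<in> biinf_paths G" using x(1) Minus_path_iff \<open>x = Minus \<circ> y\<close> by simp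
      moreover have "shiftn 2 y = y" using y2 by (auto simp: fun_eq_iff)
      ultimately show ?thesis by (auto simp: periodic_paths_def simp del: shiftn_apply)
    next
      case pp
      then have xy: "x i = Plus (y i)" for i using even_odd[of i] by (auto simp: y_def)
      define z where "z i = y (- i)" for i
      have "x = rev_plus z" using xy by (auto simp: fun_eq_iff rev_plus_def z_def)
      moreover have "z \<in> biinf_paths G"
      proof -
        have "head G (z i) = tail G (z (i + 1))" for i
          using markov_dyckD(2)[OF x(1), of "- i - 1"] xy by (simp add: z_def)
        then show ?thesis using yarc by (auto simp: biinf_paths_def z_def)
      qed
      moreover have "shiftn 2 z = z"
      proof
        fix i show "shiftn 2 z i = z i" using y2[of "- i - 2"] by (simp add: z_def)
      qed
      ultimately show ?thesis by (auto simp: periodic_paths_def simp del: shiftn_apply)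
    next
      case mp
      then have "f = g" using r0 by (auto split: if_splits)
      then have "x = u f" using mp u0 by (intro eqI[OF x(2) up]) simp_all
      then show ?thesis using yarc[of 0] mp by (auto simp: y_def)
    next
      case pm
      then have "f = g" using r1 by (auto split: if_splits)
      have "x = shiftn 1 (u f)"
      proof (rule eqI[OF x(2) shiftn_period_shiftn[OF up]])
        show "x 0 = shiftn 1 (u f) 0" using pm u0 by simp
        show "x 1 = shiftn 1 (u f) 1" using pm u0 shiftn_period[OF up, of f 0] \<open>f = g\<close> by simp
      qed
      then show ?thesis using yarc[of 0] pm by (auto simp: y_def simp del: shiftn_apply)
    qed
  next
    fix x assume "x \<in> (?A \<union> ?B) \<union> (?C \<union> ?D)"
    then consider y where "y \<in> ?P" "x = Minus \<circ> y" | y where "y \<in> ?P" "x = rev_plus y"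
      | f where "f \<in> arcs G" "x = u f" | f where "f \<in> arcs G" "x = shiftn 1 (u f)" by blast
    then show "x \<in> ?X"
    proof cases
      case (1 y)
      have "shiftn 2 (Minus \<circ> y) = Minus \<circ> shiftn 2 y" by (auto simp: fun_eq_iff)
      then show ?thesis using 1 P2[OF 1(1)] Minus_path_in_markov_dyck by simp
    next
      case (2 y)
      have "shiftn 2 (rev_plus y) = rev_plus y"
      proof
        fix i show "shiftn 2 (rev_plus y) i = rev_plus y i"
          using shiftn_period[OF P2(2)[OF 2(1)], of "- i - 2"] by (simp add: rev_plus_def)
      qed
      then show ?thesis using 2 P2[OF 2(1)] rev_plus_in_markov_dyck by simp
    next
      case (3 f)
      have "u f \<in> markov_dyck G" unfolding u_def
        using 3 by (intro periodic_ext_in_markov_dyck[of _ "tail G f"]) (auto simp: signed_arcs_def)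
      then show ?thesis using 3 up by simp
    next
      case (4 f)
      have "u f \<in> markov_dyck G" unfolding u_def
        using 4 by (intro periodic_ext_in_markov_dyck[of _ "tail G f"]) (auto simp: signed_arcs_def)
      then show ?thesis using 4 shiftn_period_shiftn[OF up, of 1 f] by (simp del: shiftn_apply)
    qed
  qed
  have "card ?A = card ?P" by (rule card_image) (auto intro!: inj_onI dest: inj_Minus_comp)
  moreover have "card ?B = card ?P"
  proof (rule card_image, rule inj_onI)
    fix y z :: "int \<Rightarrow> 'b" assume "rev_plus y = rev_plus z"
    then have "rev_plus y (- i) = rev_plus z (- i)" for i by simp
    then show "y = z" by (auto simp: rev_plus_def)
  qed
  moreover have "card ?C = card (arcs G)"
    by (rule card_image) (metis inj_onI signed_arc.inject(1) u0(1))
  moreover have "card ?D = card (arcs G)"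
  proof (rule card_image, rule inj_onI)
    fix f g assume "shiftn 1 (u f) = shiftn 1 (u g)"
    then have "shiftn 1 (u f) 0 = shiftn 1 (u g) 0" by (simp only:)
    then show "f = g" using u0(2) by simp
  qed
  moreover have "card ((?A \<union> ?B) \<union> (?C \<union> ?D)) = (card ?A + card ?B) + (card ?C + card ?D)"
  proof -
    have 0: "(Minus \<circ> y) 0 = Minus (y 0)" "(Minus \<circ> y) 1 = Minus (y 1)" "rev_plus y 0 = Plus (y 0)"
      "rev_plus y 1 = Plus (y (-1))" "shiftn 1 (u f) 0 = Plus f" for y :: "int \<Rightarrow> 'b" and f
      using u0 by (simp_all add: rev_plus_def)
    have 1: "shiftn 1 (u f) 1 = Minus f" for f using u0(1) shiftn_period[OF up, of f 0] by simp
    have "Minus \<circ> y \<noteq> rev_plus z" "Minus \<circ> y \<noteq> u f" "Minus \<circ> y \<noteq> shiftn 1 (u f)" "rev_plus y \<noteq> u f"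
      "rev_plus y \<noteq> shiftn 1 (u f)" "u g \<noteq> shiftn 1 (u f)" for y z f g
      using 0 1 u0 by (metis signed_arc.distinct(1))+
    then have "?A \<inter> ?B = {}" "?C \<inter> ?D = {}" "(?A \<union> ?B) \<inter> (?C \<union> ?D) = {}" by blast+
    then show ?thesis using fin by (simp add: card_Un_disjoint)
  qed
  ultimately show ?thesis unfolding X by simp
qed

text \<open>The picture: every other circuit leaves the spine once and then runs back to
  \<open>r\<close> without branching.\<close>

locale spine_digraph = tree_digraph +
  fixes e
  assumes spine: "e \<in> arcs G - \<F> G"
    and off_spine: "\<And>v. v \<in> verts G \<Longrightarrow> (\<And>a. a < length (circuit e) \<Longrightarrow> tail G (circuit e ! a) \<noteq> v) \<Longrightarrow>
      out_degree G v = 1"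
begin

text \<open>For a back arc \<open>g\<close> other than \<open>e\<close> the two circuits differ at a
  position inside both lists, so the entries beyond the ends of the lists have no influence.\<close>

definition level :: "'b \<Rightarrow> nat" where
  "level g = (LEAST a. circuit g ! a \<noteq> circuit e ! a)"

text \<open>The convention for \<open>e\<close> itself makes \<open>min (split_level g) (split_level h)\<close> the length of the
  common prefix of the circuits of distinct \<open>g\<close> and \<open>h\<close>.\<close>

definition split_level :: "'b \<Rightarrow> nat" where
  "split_level g = (if g = e then length (circuit e) else level g)"

abbreviation branches :: "'b set" where
  "branches \<equiv> arcs G - \<F> G - {e}"

lemma circuit_nth_back_arc:
  assumes "g \<in> arcs G - \<F> G" "a < length (circuit g)" "circuit g ! a \<notin> \<F> G"
  shows "circuit g ! a = g \<and> a = length (circuit g) - 1"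
proof -
  have "a = length (circuit g) - 1" using nth_circuit_sole[of g a] assms by fastforce
  then show ?thesis using back_arc_in_circuit[OF assms(1) _ assms(3)] assms(2) by simp
qed

text \<open>Otherwise the shorter circuit is a prefix of the other one. Its last arc is a back arc,
  and a circuit contains a back arc only at its end.\<close>

lemma circuits_differ:
  assumes g: "g \<in> arcs G - \<F> G" and h: "h \<in> arcs G - \<F> G"
    and eq: "\<And>a. a < length (circuit g) \<Longrightarrow> a < length (circuit h) \<Longrightarrow> circuit g ! a = circuit h ! a"
  shows "g = h"
proof -
  have *: "g = h" if g: "g \<in> arcs G - \<F> G" and h: "h \<in> arcs G - \<F> G"
      and le: "length (circuit g) \<le> length (circuit h)"
      and eq: "\<And>a. a < length (circuit g) \<Longrightarrow> circuit g ! a = circuit h ! a" for g h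
  proof -
    let ?a = "length (circuit g) - 1"
    have a: "?a < length (circuit g)" using circuit_pos[of g] by linarith
    have "circuit g ! ?a = g" using last_conv_nth[OF circuit_ne[of g]] by simp
    then have "circuit h ! ?a = g" using eq[OF a] by simp
    moreover have "?a < length (circuit h)" using a le by linarith
    ultimately have "circuit h ! ?a = h" using circuit_nth_back_arc[OF h, of ?a] g by (metis DiffD2)
    then show ?thesis using \<open>circuit h ! ?a = g\<close> by simp
  qed
  show ?thesis
  proof (cases "length (circuit g) \<le> length (circuit h)")
    case True
    then show ?thesis using eq by (intro *[OF g h]) auto
  next
    case False
    then have "h = g" using eq by (intro *[OF h g]) auto
    then show ?thesis ..
  qed
qed

lemma level:
  assumes "g \<in> branches"
  shows "level g < length (circuit g)" "level g < length (circuit e)"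
    "circuit g ! level g \<noteq> circuit e ! level g" "\<And>a. a < level g \<Longrightarrow> circuit g ! a = circuit e ! a"
proof -
  obtain a where a: "a < length (circuit g)" "a < length (circuit e)" "circuit g ! a \<noteq> circuit e ! a"
    using circuits_differ[of g e] assms spine by blast
  show "circuit g ! level g \<noteq> circuit e ! level g" unfolding level_def by (rule LeastI[of "\<lambda>a. circuit g ! a \<noteq> circuit e ! a", OF a(3)])
  have "level g \<le> a" unfolding level_def by (rule Least_le[of "\<lambda>a. circuit g ! a \<noteq> circuit e ! a", OF a(3)])
  then show "level g < length (circuit g)" "level g < length (circuit e)" using a by auto
  show "circuit g ! b = circuit e ! b" if "b < level g" for b
    using not_less_Least[of b "\<lambda>a. circuit g ! a \<noteq> circuit e ! a", OF that[unfolded level_def]] by blast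
qed

lemma level_eqI:
  assumes "\<And>a. a < j \<Longrightarrow> circuit g ! a = circuit e ! a" "circuit g ! j \<noteq> circuit e ! j"
  shows "level g = j"
  unfolding level_def using assms by (intro Least_equality) (blast, metis not_le)

lemma nth_in_arcs: "g \<in> arcs G - \<F> G \<Longrightarrow> a < length (circuit g) \<Longrightarrow> circuit g ! a \<in> arcs G"
  using set_circuit[of g] nth_mem by blast

lemma circuit_head:
  assumes "g \<in> arcs G - \<F> G" "a < length (circuit g)"
  shows "head G (circuit g ! a) = (if Suc a < length (circuit g) then tail G (circuit g ! Suc a) else r)"
proof (cases "Suc a < length (circuit g)")
  case True
  then show ?thesis using cas_step[OF cas_circuit[OF assms(1)]] by simp
next
  case False
  then have "a = length (circuit g) - 1" using assms(2) by simp
  then have "circuit g ! a = g" using last_conv_nth[OF circuit_ne[of g]] by simp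
  then show ?thesis using False head_back_arc assms(1) by simp
qed

lemma circuit_vertex_eqD:
  assumes "g \<in> arcs G - \<F> G" "h \<in> arcs G - \<F> G" "a < length (circuit g)" "b < length (circuit h)"
    and eq: "tail G (circuit g ! a) = tail G (circuit h ! b)"
  shows "a = b" "\<And>i. i < a \<Longrightarrow> circuit g ! i = circuit h ! i"
proof -
  have tk: "take a (circuit g) = take b (circuit h)"
    using tree_path_circuit_nth[of g a] tree_path_circuit_nth[of h b] assms by simp
  from arg_cong[OF this, of length] show ab: "a = b" using assms by simp
  show "circuit g ! i = circuit h ! i" if "i < a" for i
    using tk ab that by (metis nth_take)
qed

text \<open>A vertex of the spine determines the circuit up to it through its tree path; a return to
  the spine would contradict the arc at which the circuit left.\<close>

lemma out_degree_above_level: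
  assumes "g \<in> branches" "level g < a" "a < length (circuit g)"
  shows "out_arcs G (tail G (circuit g ! a)) = {circuit g ! a}"
proof -
  have g: "g \<in> arcs G - \<F> G" using assms by simp
  have arc: "circuit g ! a \<in> arcs G" by (rule nth_in_arcs[OF g assms(3)])
  have "tail G (circuit e ! b) \<noteq> tail G (circuit g ! a)" if "b < length (circuit e)" for b
  proof
    assume "tail G (circuit e ! b) = tail G (circuit g ! a)"
    then have "circuit g ! level g = circuit e ! level g"
      using circuit_vertex_eqD(2)[OF g spine assms(3) that _ assms(2)] by simp
    then show False using level(3)[OF assms(1)] by simp
  qed
  then have "out_degree G (tail G (circuit g ! a)) = 1" using arc by (intro off_spine) auto
  moreover have "circuit g ! a \<in> out_arcs G (tail G (circuit g ! a))" using arc by simp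
  ultimately show ?thesis unfolding out_degree_def by (metis card_1_singletonE singletonD)
qed

text \<open>After the common departing arc all out-degrees are one, so the two circuits have no
  occasion to separate.\<close>

lemma same_branch:
  assumes g: "g \<in> branches" and h: "h \<in> branches" and l: "level g = j" "level h = j"
    and eq: "circuit g ! j = circuit h ! j"
  shows "g = h"
proof (rule circuits_differ)
  show gh: "g \<in> arcs G - \<F> G" "h \<in> arcs G - \<F> G" using g h by auto
  have above: "circuit g ! (j + k) = circuit h ! (j + k)" if "j + k < length (circuit g)" "j + k < length (circuit h)" for k
    using that
  proof (induction k)
    case 0
    then show ?case using eq by simp
  next
    case (Suc k)
    then have lt: "j + k < length (circuit g)" "j + k < length (circuit h)" by auto
    have "circuit g ! (j + k) = circuit h ! (j + k)" using Suc.IH lt by blast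
    then have v: "tail G (circuit g ! (j + Suc k)) = tail G (circuit h ! (j + Suc k))"
      using circuit_head[OF gh(1) lt(1)] circuit_head[OF gh(2) lt(2)] Suc.prems by simp
    have "level g < j + Suc k" "level h < j + Suc k" using l by auto
    from out_degree_above_level[OF g this(1) Suc.prems(1)] out_degree_above_level[OF h this(2) Suc.prems(2)]
    have "{circuit g ! (j + Suc k)} = {circuit h ! (j + Suc k)}" unfolding v by (rule trans[OF sym])
    then show ?case by (rule singleton_inject)
  qed
  show "circuit g ! a = circuit h ! a" if "a < length (circuit g)" "a < length (circuit h)" for a
  proof (cases "a < j")
    case True
    then show ?thesis using level(4)[OF g] level(4)[OF h] l by simp
  next
    case False
    then show ?thesis using above[of "a - j"] that by simp
  qed
qed

text \<open>All coincidences of arcs between circuits are expressed through split levels; this is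
  what makes lengths and levels sufficient to rebuild the graph.\<close>

lemma circuit_arc_eq_iff:
  assumes g: "g \<in> arcs G - \<F> G" and h: "h \<in> arcs G - \<F> G" and a: "a < length (circuit g)" and b: "b < length (circuit h)"
  shows "circuit g ! a = circuit h ! b \<longleftrightarrow> a = b \<and> (g = h \<or> a < min (split_level g) (split_level h))"
proof
  assume eq: "circuit g ! a = circuit h ! b"
  then have veq: "tail G (circuit g ! a) = tail G (circuit h ! b)" by simp
  note ab = circuit_vertex_eqD[OF g h a b veq]
  have below: "circuit g ! i = circuit h ! i" if "i \<le> a" for i
    using ab(2)[of i] eq ab(1) that by (cases "i = a") auto
  have "a < split_level g \<and> a < split_level h" if ne: "g \<noteq> h"
  proof -
    \<comment> \<open>By symmetry \<open>g'\<close> has the smaller split level. Had it left the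
      spine at or before position \<open>a\<close>, then \<open>h'\<close> would share the departing
      arc, which is impossible on the spine, before its own departure, and by
      \<open>same_branch\<close> also at it.\<close>
    have *: "a < split_level g'" if g': "g' \<in> branches" "h' \<in> arcs G - \<F> G" "g' \<noteq> h'"
      "split_level g' \<le> split_level h'" "\<And>i. i \<le> a \<Longrightarrow> circuit g' ! i = circuit h' ! i" for g' h'
    proof (rule ccontr)
      assume "\<not> a < split_level g'"
      then have ja: "level g' \<le> a" using g' by (simp add: split_level_def)
      then have eqj: "circuit g' ! level g' = circuit h' ! level g'" using g'(5) by blast
      show False
      proof (cases "h' = e")
        case True
        then show False using eqj level(3)[OF g'(1)] by simp
      next
        case False
        then have h': "h' \<in> branches" using g'(2) by simp
        have le: "level g' \<le> level h'" using g'(1,4) False by (simp add: split_level_def)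
        show False
        proof (cases "level g' = level h'")
          case True
          then show False using same_branch[OF g'(1) h' refl True[symmetric] eqj] g'(3) by blast
        next
          case False
          then have "circuit h' ! level g' = circuit e ! level g'" using level(4)[OF h'] le by simp
          then show False using eqj level(3)[OF g'(1)] by simp
        qed
      qed
    qed
    have spl: "split_level g' < split_level e" if "g' \<in> branches" for g'
      using level(2)[OF that] that by (simp add: split_level_def)
    show ?thesis
    proof (cases "split_level g \<le> split_level h")
      case True
      have "g \<in> branches"
      proof (rule ccontr)
        assume "g \<notin> branches"
        then have "g = e" using g by simp
        then have "h \<in> branches" using h ne by simp
        then show False using spl True \<open>g = e\<close> by fastforce
      qed
      then have "a < split_level g" using h ne True below by (intro *) auto
      then show ?thesis using True by simp
    next
      case False
      then have hg: "split_level h \<le> split_level g" by simp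
      have "h \<in> branches"
      proof (rule ccontr)
        assume "h \<notin> branches"
        then have "h = e" using h by simp
        then have "g \<in> branches" using g ne by simp
        then show False using spl hg \<open>h = e\<close> by fastforce
      qed
      then have "a < split_level h" using g ne hg below by (intro *[of h g]) auto
      then show ?thesis using hg by simp
    qed
  qed
  then show "a = b \<and> (g = h \<or> a < min (split_level g) (split_level h))" using ab(1) by auto
next
  assume as: "a = b \<and> (g = h \<or> a < min (split_level g) (split_level h))"
  have *: "circuit g' ! a = circuit e ! a" if "g' \<in> arcs G - \<F> G" "a < split_level g'" for g'
    using level(4)[of g' a] that by (cases "g' = e") (auto simp: split_level_def)
  show "circuit g ! a = circuit h ! b" using as *[OF g] *[OF h] by auto
qed

text \<open>Tree paths are unique, so a common vertex means a common initial stretch, and the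
  coincidences of vertices reduce to those of arcs.\<close>

lemma circuit_vertex_eq_iff:
  assumes g: "g \<in> arcs G - \<F> G" and h: "h \<in> arcs G - \<F> G" and a: "a < length (circuit g)" and b: "b < length (circuit h)"
  shows "tail G (circuit g ! a) = tail G (circuit h ! b) \<longleftrightarrow> a = b \<and> (\<forall>i<a. circuit g ! i = circuit h ! i)"
proof
  assume "tail G (circuit g ! a) = tail G (circuit h ! b)"
  from circuit_vertex_eqD[OF g h a b this] show "a = b \<and> (\<forall>i<a. circuit g ! i = circuit h ! i)" by blast
next
  assume as: "a = b \<and> (\<forall>i<a. circuit g ! i = circuit h ! i)"
  show "tail G (circuit g ! a) = tail G (circuit h ! b)"
  proof (cases a)
    case 0
    then show ?thesis using as tail_circuit_nth[OF g a] tail_circuit_nth[OF h b] by simp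
  next
    case (Suc i)
    then show ?thesis using as circuit_head[OF g, of i] circuit_head[OF h, of i] a b by auto
  qed
qed

text \<open>Every arc lies on the spine or, from the departure on, on exactly one branch;
  \<open>lo\<close> is the position from which a circuit counts its arcs.\<close>

lemma card_arcs: "card (arcs G) = length (circuit e) + (\<Sum>g\<in>branches. length (circuit g) - level g)"
proof -
  define lo where "lo g = (if g = e then 0 else level g)" for g
  let ?I = "SIGMA g:arcs G - \<F> G. {lo g..<length (circuit g)}"
  have "bij_betw (\<lambda>(g, a). circuit g ! a) ?I (arcs G)"
    unfolding bij_betw_def
  proof
    show "inj_on (\<lambda>(g, a). circuit g ! a) ?I"
    proof (rule inj_onI)
      fix x y assume xy: "x \<in> ?I" "y \<in> ?I" "(\<lambda>(g, a). circuit g ! a) x = (\<lambda>(g, a). circuit g ! a) y"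
      obtain g a where x: "x = (g, a)" by (cases x)
      obtain h b where y: "y = (h, b)" by (cases y)
      have *: "g \<in> arcs G - \<F> G" "h \<in> arcs G - \<F> G" "a < length (circuit g)" "b < length (circuit h)" "lo g \<le> a" "lo h \<le> b"
        "circuit g ! a = circuit h ! b" using xy x y by auto
      have ab: "a = b \<and> (g = h \<or> a < min (split_level g) (split_level h))" using circuit_arc_eq_iff[OF *(1-4)] *(7) by blast
      have "g = h"
      proof (rule ccontr)
        assume "g \<noteq> h"
        then have "a < split_level g" "a < split_level h" "a = b" using ab by auto
        then show False using *(5,6) \<open>g \<noteq> h\<close> by (cases "g = e") (auto simp: lo_def split_level_def)
      qed
      then show "x = y" using ab x y by simp
    qed
    show "(\<lambda>(g, a). circuit g ! a) ` ?I = arcs G"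
    proof (intro set_eqI iffI)
      fix f assume "f \<in> (\<lambda>(g, a). circuit g ! a) ` ?I"
      then show "f \<in> arcs G" using nth_in_arcs by auto
    next
      fix f assume "f \<in> arcs G"
      then obtain g a where ga: "g \<in> arcs G - \<F> G" "a < length (circuit g)" "circuit g ! a = f"
        using ex_circuit_through by blast
      show "f \<in> (\<lambda>(g, a). circuit g ! a) ` ?I"
      proof (cases "lo g \<le> a")
        case True
        then have "(g, a) \<in> ?I" using ga by simp
        then show ?thesis using ga(3) by force
      next
        case False
        then have "g \<noteq> e" "a < level g" by (auto simp: lo_def split: if_splits)
        then have gb: "g \<in> branches" using ga by simp
        have "circuit e ! a = f" using level(4)[OF gb \<open>a < level g\<close>] ga(3) by simp
        moreover have "(e, a) \<in> ?I" using spine level(2)[OF gb] \<open>a < level g\<close> by (simp add: lo_def)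
        ultimately show ?thesis by force
      qed
    qed
  qed
  from bij_betw_same_card[OF this] have "card (arcs G) = card ?I" by simp
  also have "\<dots> = (\<Sum>g\<in>arcs G - \<F> G. length (circuit g) - lo g)"
    by (subst card_SigmaI) auto
  also have "\<dots> = (length (circuit e) - lo e) + (\<Sum>g\<in>branches. length (circuit g) - lo g)"
    using spine by (intro sum.remove) auto
  also have "(\<Sum>g\<in>branches. length (circuit g) - lo g) = (\<Sum>g\<in>branches. length (circuit g) - level g)"
    by (rule sum.cong) (auto simp: lo_def)
  finally show ?thesis by (simp add: lo_def)
qed

text \<open>The spine closes up at \<open>r\<close>; this supplies the value that the recursion
  needs at its last vertex.\<close>

definition spine_fps :: "nat \<Rightarrow> real fps" where
  "spine_fps j = (if j < length (circuit e) then excursion_fps G (tail G (circuit e ! j)) else excursion_fps G r)"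

lemma spine_fps_0: "spine_fps 0 = excursion_fps G r"
  using tail_circuit_nth[OF spine, of 0] by (simp add: spine_fps_def)

lemma excursion_fps_mult:
  assumes "v \<in> verts G"
  shows "excursion_fps G v * (1 - fps_X * (\<Sum>f\<in>out_arcs G v. excursion_fps G (head G f))) = 1"
proof -
  let ?c = "excursion_fps G v" and ?s = "\<Sum>f\<in>out_arcs G v. excursion_fps G (head G f)"
  have "?c - fps_X * (?s * ?c) = 1" using excursion_fps_rec[OF assms] by (metis add_diff_cancel_right')
  then show ?thesis by (simp add: algebra_simps)
qed

text \<open>Going back from the end of the circuit, where the successor is \<open>r\<close>, each
  vertex has out-degree one and applies \<open>pass_fps\<close> once.\<close>

lemma excursion_above_level:
  assumes g: "g \<in> branches" and a: "level g < a" "a < length (circuit g)"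
  shows "excursion_fps G (tail G (circuit g ! a)) = (pass_fps ^^ (length (circuit g) - a)) (excursion_fps G r)"
  using a
proof (induction "length (circuit g) - a" arbitrary: a)
  case 0
  then show ?case by simp
next
  case (Suc k)
  have gN: "g \<in> arcs G - \<F> G" using g by simp
  let ?v = "tail G (circuit g ! a)"
  have "?v \<in> verts G" using nth_in_arcs[OF gN Suc.prems(2)] by simp
  from excursion_fps_mult[OF this]
  have "excursion_fps G ?v * (1 - fps_X * excursion_fps G (head G (circuit g ! a))) = 1"
    unfolding out_degree_above_level[OF g Suc.prems] by simp
  then have 1: "excursion_fps G ?v = pass_fps (excursion_fps G (head G (circuit g ! a)))" by (rule pass_fps_eqI)
  have 2: "excursion_fps G (head G (circuit g ! a)) = (pass_fps ^^ k) (excursion_fps G r)"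
  proof (cases "Suc a < length (circuit g)")
    case True
    have k: "k = length (circuit g) - Suc a" using Suc.hyps(2) by simp
    show ?thesis using Suc.hyps(1)[OF k] circuit_head[OF gN Suc.prems(2)] True Suc.prems(1) k by simp
  next
    case False
    then have "k = 0" using Suc.hyps(2) Suc.prems by simp
    then show ?thesis using circuit_head[OF gN Suc.prems(2)] False by simp
  qed
  have "length (circuit g) - a = Suc k" using Suc.hyps(2) by simp
  then show ?case unfolding 1 2 by simp
qed

text \<open>An arc that starts on the spine lies on some circuit, which up to there agrees with the
  spine; the arc either continues the spine or is the departure of that circuit.\<close>

lemma out_arcs_spine:
  assumes j: "j < length (circuit e)"
  shows "out_arcs G (tail G (circuit e ! j)) = insert (circuit e ! j) ((\<lambda>g. circuit g ! j) ` {g \<in> branches. level g = j})"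
proof (intro set_eqI iffI)
  fix f assume f: "f \<in> out_arcs G (tail G (circuit e ! j))"
  then have farc: "f \<in> arcs G" "tail G f = tail G (circuit e ! j)" by auto
  obtain g a where ga: "g \<in> arcs G - \<F> G" "a < length (circuit g)" "circuit g ! a = f"
    using ex_circuit_through[OF farc(1)] by blast
  have veq: "tail G (circuit g ! a) = tail G (circuit e ! j)" using ga farc by simp
  note aj = circuit_vertex_eqD[OF ga(1) spine ga(2) j veq]
  show "f \<in> insert (circuit e ! j) ((\<lambda>g. circuit g ! j) ` {g \<in> branches. level g = j})"
  proof (cases "f = circuit e ! j")
    case False
    then have ne: "circuit g ! j \<noteq> circuit e ! j" using ga(3) aj(1) by simp
    then have "g \<noteq> e" by auto
    moreover have "level g = j" using aj ne by (intro level_eqI) auto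
    ultimately have "g \<in> {g \<in> branches. level g = j}" using ga(1) by simp
    then show ?thesis using ga(3) aj(1) by blast
  qed simp
next
  fix f assume "f \<in> insert (circuit e ! j) ((\<lambda>g. circuit g ! j) ` {g \<in> branches. level g = j})"
  then consider "f = circuit e ! j" | g where "g \<in> branches" "level g = j" "f = circuit g ! j" by blast
  then show "f \<in> out_arcs G (tail G (circuit e ! j))"
  proof cases
    case 1
    then show ?thesis using nth_in_arcs[OF spine j] by simp
  next
    case (2 g)
    have gN: "g \<in> arcs G - \<F> G" and jg: "j < length (circuit g)" using 2 level(1)[OF 2(1)] by auto
    have "tail G (circuit g ! j) = tail G (circuit e ! j)"
      using circuit_vertex_eq_iff[OF gN spine jg j] level(4)[OF 2(1)] 2(2) by simp
    then show ?thesis using 2(3) nth_in_arcs[OF gN jg] by simp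
  qed
qed

lemma spine_fps_rec:
  assumes j: "j < length (circuit e)"
  shows "spine_fps j * (1 - fps_X * (spine_fps (Suc j) +
    (\<Sum>g\<in>{g \<in> branches. level g = j}. (pass_fps ^^ (length (circuit g) - j - 1)) (spine_fps 0)))) = 1"
proof -
  let ?B = "{g \<in> branches. level g = j}"
  have inj: "inj_on (\<lambda>g. circuit g ! j) ?B"
    using same_branch by (intro inj_onI) blast
  have notin: "circuit e ! j \<notin> (\<lambda>g. circuit g ! j) ` ?B"
  proof
    assume "circuit e ! j \<in> (\<lambda>g. circuit g ! j) ` ?B"
    then obtain g where "g \<in> branches" "level g = j" "circuit e ! j = circuit g ! j" by blast
    then show False using level(3)[of g] by simp
  qed
  have fin: "finite ((\<lambda>g. circuit g ! j) ` ?B)" by simp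
  have "(\<Sum>f\<in>out_arcs G (tail G (circuit e ! j)). excursion_fps G (head G f)) =
      excursion_fps G (head G (circuit e ! j)) + (\<Sum>g\<in>?B. excursion_fps G (head G (circuit g ! j)))"
    unfolding out_arcs_spine[OF j] sum.insert[OF fin notin] sum.reindex[OF inj] by simp
  also have "excursion_fps G (head G (circuit e ! j)) = spine_fps (Suc j)"
    using circuit_head[OF spine j] by (simp add: spine_fps_def)
  also have "(\<Sum>g\<in>?B. excursion_fps G (head G (circuit g ! j))) =
      (\<Sum>g\<in>?B. (pass_fps ^^ (length (circuit g) - j - 1)) (spine_fps 0))"
  proof (rule sum.cong[OF refl])
    fix g assume "g \<in> ?B"
    then have g: "g \<in> branches" "level g = j" by auto
    have gN: "g \<in> arcs G - \<F> G" and jg: "j < length (circuit g)" using g level(1)[OF g(1)] by auto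
    show "excursion_fps G (head G (circuit g ! j)) = (pass_fps ^^ (length (circuit g) - j - 1)) (spine_fps 0)"
      unfolding spine_fps_0
      using circuit_head[OF gN jg] excursion_above_level[OF g(1), of "Suc j"] g(2) jg
      by (cases "Suc j < length (circuit g)") auto
  qed
  finally have S: "(\<Sum>f\<in>out_arcs G (tail G (circuit e ! j)). excursion_fps G (head G f)) =
      spine_fps (Suc j) + (\<Sum>g\<in>?B. (pass_fps ^^ (length (circuit g) - j - 1)) (spine_fps 0))" .
  have "tail G (circuit e ! j) \<in> verts G" using nth_in_arcs[OF spine j] by simp
  from excursion_fps_mult[OF this] show ?thesis unfolding S using j by (simp add: spine_fps_def)
qed

lemma circuit_weight_branch:
  assumes g: "g \<in> branches"
  shows "circuit_weight g = (\<Prod>j<Suc (level g). spine_fps j) *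
    (\<Prod>k<length (circuit g) - level g - 1. (pass_fps ^^ Suc k) (spine_fps 0))"
proof -
  let ?c = "\<lambda>a. excursion_fps G (tail G (circuit g ! a))"
  let ?n = "length (circuit g) - level g - 1"
  have gN: "g \<in> arcs G - \<F> G" using g by simp
  have len: "length (circuit g) = Suc (level g) + ?n" using level(1)[OF g] by simp
  have "circuit_weight g = (\<Prod>a<Suc (level g) + ?n. ?c a)" unfolding circuit_weight_eq using len by simp
  also have "\<dots> = (\<Prod>a<Suc (level g). ?c a) * (\<Prod>k<?n. ?c (Suc (level g) + k))" by (rule prod_lessThan_add)
  also have "(\<Prod>a<Suc (level g). ?c a) = (\<Prod>j<Suc (level g). spine_fps j)"
  proof (rule prod.cong[OF refl])
    fix a assume "a \<in> {..<Suc (level g)}"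
    then have a: "a \<le> level g" by simp
    have lt: "a < length (circuit g)" "a < length (circuit e)" using a level(1,2)[OF g] by auto
    have "tail G (circuit g ! a) = tail G (circuit e ! a)"
      using circuit_vertex_eq_iff[OF gN spine lt] level(4)[OF g] a by simp
    then show "?c a = spine_fps a" using lt by (simp add: spine_fps_def)
  qed
  also have "(\<Prod>k<?n. ?c (Suc (level g) + k)) = (\<Prod>k<?n. (pass_fps ^^ Suc (?n - Suc k)) (spine_fps 0))"
  proof (rule prod.cong[OF refl])
    fix k assume "k \<in> {..<?n}"
    then have k: "k < ?n" by simp
    then have "Suc (level g) + k < length (circuit g)" using len by linarith
    moreover have "length (circuit g) - (Suc (level g) + k) = Suc (?n - Suc k)" using k len by linarith
    ultimately show "?c (Suc (level g) + k) = (pass_fps ^^ Suc (?n - Suc k)) (spine_fps 0)"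
      unfolding spine_fps_0 using excursion_above_level[OF g, of "Suc (level g) + k"] by simp
  qed
  also have "\<dots> = (\<Prod>k<?n. (pass_fps ^^ Suc k) (spine_fps 0))"
    by (rule prod.nat_diff_reindex)
  finally show ?thesis .
qed

lemma branches_ne: "branches \<noteq> {}"
  using two_back_arcs[OF spine] by blast

lemma level_data: "level_data branches (\<lambda>g. length (circuit g)) level spine_fps (length (circuit e)) circuit_weight"
proof
  show "finite branches" by simp
  show "branches \<noteq> {}" by (rule branches_ne)
  show "fps_nth (spine_fps j) 0 = 1" for j by (simp add: spine_fps_def)
qed (use level(1,2) spine_fps_rec circuit_weight_branch in blast)+

end

lemma spine_digraph_if_Delta:
  assumes "tree_digraph G r" "e \<in> arcs G - \<F> G" "Delta G e = int (nu G) - 1"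
  shows "spine_digraph G r e"
  using assms tree_digraph.out_degree_off_circuit[OF assms]
  by (auto intro!: spine_digraph.intro spine_digraph_axioms.intro)

text \<open>The weights leave a common translation of the levels. It changes the number of arcs by
  its amount times the number of branches, so equal numbers of arcs force it to vanish.\<close>

lemma level_bijection:
  assumes G: "spine_digraph G r e" and G': "spine_digraph G' r' e'"
    and \<sigma>: "bij_betw \<sigma> (arcs G - \<F> G) (arcs G' - \<F> G')" "\<sigma> e = e'"
    and len: "\<And>g. g \<in> arcs G - \<F> G \<Longrightarrow> length (tree_digraph.circuit G' r' (\<sigma> g)) = length (tree_digraph.circuit G r g)"
    and wt: "\<And>g. g \<in> arcs G - \<F> G \<Longrightarrow> tree_digraph.circuit_weight G' r' (\<sigma> g) = tree_digraph.circuit_weight G r g"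
    and arcs: "card (arcs G) = card (arcs G')"
    and g: "g \<in> arcs G - \<F> G"
  shows "spine_digraph.split_level G' r' e' (\<sigma> g) = spine_digraph.split_level G r e g"
proof -
  interpret G: spine_digraph G r e by (rule G)
  interpret G': spine_digraph G' r' e' by (rule G')
  have inj: "inj_on \<sigma> (arcs G - \<F> G)" using \<sigma>(1) by (rule bij_betw_imp_inj_on)
  have \<sigma>b: "bij_betw \<sigma> G.branches G'.branches"
    by (rule bij_betw_DiffI[OF \<sigma>(1)]) (use \<sigma>(2) G.spine G'.spine in \<open>auto simp: bij_betw_def\<close>)
  interpret D: level_data G.branches "\<lambda>g. length (G.circuit g)" G.level G.spine_fps "length (G.circuit e)" G.circuit_weight
    by (rule G.level_data)
  interpret D': level_data G'.branches "\<lambda>g. length (G'.circuit g)" G'.level G'.spine_fps "length (G'.circuit e')" G'.circuit_weight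
    by (rule G'.level_data)
  have diff: "G.level h - D.base = G'.level (\<sigma> h) - D'.base" if "h \<in> G.branches" for h
    by (rule level_data_unique[OF G.level_data G'.level_data \<sigma>b _ _ that]) (use len wt in auto)
  have le: "D.base \<le> G.level h" "D'.base \<le> G'.level (\<sigma> h)" if "h \<in> G.branches" for h
    using D.base_le[OF that] D'.base_le[OF bij_betw_apply[OF \<sigma>b that]] .
  have lene: "length (G'.circuit e') = length (G.circuit e)" using len[OF G.spine] \<sigma>(2) by simp
  let ?S = "\<Sum>h\<in>G.branches. length (G.circuit h) - G.level h"
  let ?S' = "\<Sum>h\<in>G.branches. length (G.circuit h) - G'.level (\<sigma> h)"
  have "(\<Sum>h\<in>G'.branches. length (G'.circuit h) - G'.level h) =
      (\<Sum>h\<in>G.branches. length (G'.circuit (\<sigma> h)) - G'.level (\<sigma> h))"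
    by (rule sum.reindex_bij_betw[OF \<sigma>b, symmetric])
  also have "\<dots> = ?S'" using len by (intro sum.cong) auto
  finally have S: "?S = ?S'" using G.card_arcs G'.card_arcs arcs lene by simp
  have real_le: "real (length (G.circuit h) - G.level h) - real (length (G.circuit h) - G'.level (\<sigma> h)) =
      real D'.base - real D.base" if h: "h \<in> G.branches" for h
  proof -
    have "G.level h < length (G.circuit h)" by (rule G.level(1)[OF h])
    moreover have "G'.level (\<sigma> h) < length (G.circuit h)"
      using G'.level(1)[OF bij_betw_apply[OF \<sigma>b h]] len[of h] h by simp
    ultimately show ?thesis using diff[OF h] le[OF h] by linarith
  qed
  \<comment> \<open>Every branch contributes the same difference of the two bases.\<close>
  have "real ?S - real ?S' = (\<Sum>h\<in>G.branches. real D'.base - real D.base)"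
    unfolding of_nat_sum sum_subtractf[symmetric] by (rule sum.cong[OF refl real_le])
  then have "real (card G.branches) * (real D'.base - real D.base) = 0" using S by simp
  moreover have "card G.branches \<noteq> 0" using D.finite_N D.N_ne by simp
  ultimately have base: "D'.base = D.base" by simp
  show ?thesis
  proof (cases "g = e")
    case True
    then show ?thesis using lene \<sigma>(2) by (simp add: G.split_level_def G'.split_level_def)
  next
    case False
    then have gb: "g \<in> G.branches" using g by simp
    then have "\<sigma> g \<in> G'.branches" by (rule bij_betw_apply[OF \<sigma>b])
    then have "\<sigma> g \<noteq> e'" by simp
    have "G'.level (\<sigma> g) = G.level g" using diff[OF gb] le[OF gb] base by linarith
    then show ?thesis using False \<open>\<sigma> g \<noteq> e'\<close> by (simp add: G.split_level_def G'.split_level_def)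
  qed
qed

text \<open>The graph is the disjoint union of its circuits with coinciding arcs and vertices
  identified. The coincidences depend on lengths and split levels only, so \<open>(g, a)\<close> to
  \<open>(\<sigma> g, a)\<close> descends to an isomorphism.\<close>

lemma digraph_iso_if_levels:
  assumes G: "spine_digraph G r e" and G': "spine_digraph G' r' e'"
    and \<sigma>: "bij_betw \<sigma> (arcs G - \<F> G) (arcs G' - \<F> G')"
    and len: "\<And>g. g \<in> arcs G - \<F> G \<Longrightarrow> length (tree_digraph.circuit G' r' (\<sigma> g)) = length (tree_digraph.circuit G r g)"
    and spl: "\<And>g. g \<in> arcs G - \<F> G \<Longrightarrow> spine_digraph.split_level G' r' e' (\<sigma> g) = spine_digraph.split_level G r e g"
  shows "digraph_iso G G'"
proof -
  interpret G: spine_digraph G r e by (rule G)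
  interpret G': spine_digraph G' r' e' by (rule G')
  let ?N = "arcs G - \<F> G" and ?N' = "arcs G' - \<F> G'"
  have inj: "inj_on \<sigma> ?N" using \<sigma> by (rule bij_betw_imp_inj_on)
  have \<sigma>N: "\<sigma> g \<in> ?N'" if "g \<in> ?N" for g using bij_betw_apply[OF \<sigma> that] .
  have \<sigma>lt: "a < length (G'.circuit (\<sigma> g))" if "g \<in> ?N" "a < length (G.circuit g)" for g a
    using len[OF that(1)] that(2) by simp
  have arc_iff: "G.circuit g ! a = G.circuit h ! b \<longleftrightarrow> G'.circuit (\<sigma> g) ! a = G'.circuit (\<sigma> h) ! b"
    if "g \<in> ?N" "h \<in> ?N" "a < length (G.circuit g)" "b < length (G.circuit h)" for g h a b
    unfolding G.circuit_arc_eq_iff[OF that]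
      G'.circuit_arc_eq_iff[OF \<sigma>N[OF that(1)] \<sigma>N[OF that(2)] \<sigma>lt[OF that(1,3)] \<sigma>lt[OF that(2,4)]]
      spl[OF that(1)] spl[OF that(2)] inj_on_eq_iff[OF inj that(1,2)] ..
  have vert_iff: "tail G (G.circuit g ! a) = tail G (G.circuit h ! b) \<longleftrightarrow>
      tail G' (G'.circuit (\<sigma> g) ! a) = tail G' (G'.circuit (\<sigma> h) ! b)"
    if "g \<in> ?N" "h \<in> ?N" "a < length (G.circuit g)" "b < length (G.circuit h)" for g h a b
  proof -
    have "G.circuit g ! i = G.circuit h ! i \<longleftrightarrow> G'.circuit (\<sigma> g) ! i = G'.circuit (\<sigma> h) ! i" if "a = b" "i < a" for i
      by (rule arc_iff) (use \<open>g \<in> ?N\<close> \<open>h \<in> ?N\<close> \<open>a < length (G.circuit g)\<close> \<open>b < length (G.circuit h)\<close> that in \<open>assumption | linarith\<close>)+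
    then show ?thesis unfolding G.circuit_vertex_eq_iff[OF that]
      G'.circuit_vertex_eq_iff[OF \<sigma>N[OF that(1)] \<sigma>N[OF that(2)] \<sigma>lt[OF that(1,3)] \<sigma>lt[OF that(2,4)]] by blast
  qed
  have "\<exists>p. fst p \<in> ?N \<and> snd p < length (G.circuit (fst p)) \<and> G.circuit (fst p) ! snd p = f" if "f \<in> arcs G" for f
    using G.ex_circuit_through[OF that] by (metis fst_conv snd_conv)
  then obtain P where P: "\<And>f. f \<in> arcs G \<Longrightarrow>
      fst (P f) \<in> ?N \<and> snd (P f) < length (G.circuit (fst (P f))) \<and> G.circuit (fst (P f)) ! snd (P f) = f" by metis
  have "\<exists>p. fst p \<in> ?N \<and> snd p < length (G.circuit (fst p)) \<and> tail G (G.circuit (fst p) ! snd p) = v"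
    if "v \<in> verts G" for v
    using G.ex_out_arc[OF that] by (metis fst_conv snd_conv)
  then obtain Q where Q: "\<And>v. v \<in> verts G \<Longrightarrow>
      fst (Q v) \<in> ?N \<and> snd (Q v) < length (G.circuit (fst (Q v))) \<and> tail G (G.circuit (fst (Q v)) ! snd (Q v)) = v" by metis
  \<comment> \<open>\<open>P\<close> and \<open>Q\<close> choose a circuit and a position for each
    arc and each vertex; by \<open>arc_iff\<close> and \<open>vert_iff\<close> the images do not
    depend on the choice.\<close>
  define \<alpha> where "\<alpha> f = G'.circuit (\<sigma> (fst (P f))) ! snd (P f)" for f
  define \<beta> where "\<beta> v = tail G' (G'.circuit (\<sigma> (fst (Q v))) ! snd (Q v))" for v
  have \<alpha>: "\<alpha> (G.circuit g ! a) = G'.circuit (\<sigma> g) ! a" if ga: "g \<in> ?N" "a < length (G.circuit g)" for g a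
  proof -
    have arc: "G.circuit g ! a \<in> arcs G" by (rule G.nth_in_arcs[OF ga])
    note p = P[OF arc]
    show ?thesis unfolding \<alpha>_def using arc_iff[OF _ ga(1) _ ga(2)] p by blast
  qed
  have \<beta>: "\<beta> (tail G (G.circuit g ! a)) = tail G' (G'.circuit (\<sigma> g) ! a)" if ga: "g \<in> ?N" "a < length (G.circuit g)" for g a
  proof -
    have "tail G (G.circuit g ! a) \<in> verts G" using G.nth_in_arcs[OF ga] by simp
    note q = Q[OF this]
    show ?thesis unfolding \<beta>_def using vert_iff[OF _ ga(1) _ ga(2)] q by blast
  qed
  have \<alpha>_inj: "inj_on \<alpha> (arcs G)"
  proof (rule inj_onI)
    fix f h assume f: "f \<in> arcs G" and h: "h \<in> arcs G" and eq: "\<alpha> f = \<alpha> h"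
    note p = P[OF f] and q = P[OF h]
    have "G.circuit (fst (P f)) ! snd (P f) = G.circuit (fst (P h)) ! snd (P h)"
      using arc_iff[of "fst (P f)" "fst (P h)" "snd (P f)" "snd (P h)"] p q eq unfolding \<alpha>_def by blast
    then show "f = h" using p q by simp
  qed
  have \<beta>_inj: "inj_on \<beta> (verts G)"
  proof (rule inj_onI)
    fix u v assume u: "u \<in> verts G" and v: "v \<in> verts G" and eq: "\<beta> u = \<beta> v"
    note p = Q[OF u] and q = Q[OF v]
    have "tail G (G.circuit (fst (Q u)) ! snd (Q u)) = tail G (G.circuit (fst (Q v)) ! snd (Q v))"
      using vert_iff[of "fst (Q u)" "fst (Q v)" "snd (Q u)" "snd (Q v)"] p q eq unfolding \<beta>_def by blast
    then show "u = v" using p q by simp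
  qed
  have surj: "\<exists>g\<in>?N. \<sigma> g = g' \<and> length (G.circuit g) = length (G'.circuit g')" if "g' \<in> ?N'" for g'
  proof -
    have "g' \<in> \<sigma> ` ?N" unfolding bij_betw_imp_surj_on[OF \<sigma>] by (rule that)
    then obtain g where g: "g \<in> ?N" "g' = \<sigma> g" by (rule imageE)
    show ?thesis by (rule bexI[OF _ g(1)]) (simp only: g(2) len[OF g(1)])
  qed
  have \<alpha>_im: "\<alpha> ` arcs G = arcs G'"
  proof (intro set_eqI iffI)
    fix f' assume "f' \<in> \<alpha> ` arcs G"
    then obtain f where f: "f \<in> arcs G" "f' = \<alpha> f" by blast
    then show "f' \<in> arcs G'" unfolding f(2) \<alpha>_def using P[OF f(1)] by (intro G'.nth_in_arcs \<sigma>N \<sigma>lt) auto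
  next
    fix f' assume "f' \<in> arcs G'"
    then obtain g' a where g': "g' \<in> ?N'" "a < length (G'.circuit g')" "G'.circuit g' ! a = f'"
      using G'.ex_circuit_through by blast
    obtain g where g: "g \<in> ?N" "\<sigma> g = g'" "length (G.circuit g) = length (G'.circuit g')" using surj[OF g'(1)] by blast
    have a: "a < length (G.circuit g)" using g(3) g'(2) by simp
    have "\<alpha> (G.circuit g ! a) = f'" using \<alpha>[OF g(1) a] g(2) g'(3) by simp
    then show "f' \<in> \<alpha> ` arcs G" using G.nth_in_arcs[OF g(1) a] by blast
  qed
  have \<beta>_im: "\<beta> ` verts G = verts G'"
  proof (intro set_eqI iffI)
    fix v' assume "v' \<in> \<beta> ` verts G"
    then obtain v where v: "v \<in> verts G" "v' = \<beta> v" by blast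
    have "G'.circuit (\<sigma> (fst (Q v))) ! snd (Q v) \<in> arcs G'"
      using Q[OF v(1)] by (intro G'.nth_in_arcs \<sigma>N \<sigma>lt) auto
    then show "v' \<in> verts G'" unfolding v(2) \<beta>_def by simp
  next
    fix v' assume "v' \<in> verts G'"
    then obtain g' a where g': "g' \<in> ?N'" "a < length (G'.circuit g')" "tail G' (G'.circuit g' ! a) = v'"
      using G'.ex_out_arc by blast
    obtain g where g: "g \<in> ?N" "\<sigma> g = g'" "length (G.circuit g) = length (G'.circuit g')" using surj[OF g'(1)] by blast
    have a: "a < length (G.circuit g)" using g(3) g'(2) by simp
    have "\<beta> (tail G (G.circuit g ! a)) = v'" using \<beta>[OF g(1) a] g(2) g'(3) by simp
    moreover have "tail G (G.circuit g ! a) \<in> verts G" using G.nth_in_arcs[OF g(1) a] by simp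
    ultimately show "v' \<in> \<beta> ` verts G" by blast
  qed
  have tails: "\<beta> (tail G f) = tail G' (\<alpha> f)" if f: "f \<in> arcs G" for f
    using \<beta>[of "fst (P f)" "snd (P f)"] P[OF f] unfolding \<alpha>_def by simp
  have heads: "\<beta> (head G f) = head G' (\<alpha> f)" if f: "f \<in> arcs G" for f
  proof -
    define g where "g = fst (P f)"
    define a where "a = snd (P f)"
    have ga: "g \<in> ?N" "a < length (G.circuit g)" "G.circuit g ! a = f" using P[OF f] by (auto simp: g_def a_def)
    have \<alpha>f: "\<alpha> f = G'.circuit (\<sigma> g) ! a" using \<alpha>[OF ga(1,2)] ga(3) by simp
    have hd: "head G f = (if Suc a < length (G.circuit g) then tail G (G.circuit g ! Suc a) else r)"
      using G.circuit_head[OF ga(1,2)] ga(3) by simp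
    have hd': "head G' (\<alpha> f) = (if Suc a < length (G.circuit g) then tail G' (G'.circuit (\<sigma> g) ! Suc a) else r')"
      using G'.circuit_head[OF \<sigma>N[OF ga(1)] \<sigma>lt[OF ga(1,2)]] \<alpha>f len[OF ga(1)] by simp
    show ?thesis
    proof (cases "Suc a < length (G.circuit g)")
      case True
      then show ?thesis using hd hd' \<beta>[OF ga(1) True] by simp
    next
      case False
      \<comment> \<open>The last arc of a circuit ends at \<open>r\<close>, which is also the vertex
        at position 0; this is where the image of \<open>r\<close> is read off.\<close>
      have r: "tail G (G.circuit g ! 0) = r" using G.tail_circuit_nth[OF ga(1), of 0] by simp
      have r': "tail G' (G'.circuit (\<sigma> g) ! 0) = r'" using G'.tail_circuit_nth[OF \<sigma>N[OF ga(1)], of 0] by simp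
      have "\<beta> r = r'" using \<beta>[OF ga(1), of 0] r r' by simp
      then show ?thesis using hd hd' False by simp
    qed
  qed
  let ?f = "\<lparr>iso_verts = \<beta>, iso_arcs = \<alpha>, iso_head = head G', iso_tail = tail G'\<rparr>"
  have "pre_digraph.digraph_isomorphism G ?f"
    using G.wf_digraph_axioms \<alpha>_inj \<beta>_inj tails heads by (simp add: pre_digraph.digraph_isomorphism_def)
  moreover have "G' = app_iso ?f G"
    using \<alpha>_im \<beta>_im by (simp add: app_iso_def)
  ultimately show ?thesis unfolding digraph_iso_def by blast
qed

theorem theorem4p3:
  fixes G :: "('v, 'e) pre_digraph" and G' :: "('w, 'f) pre_digraph"
  assumes "fin_digraph G" "strongly_connected G" "\<not> is_cycle_graph G"
    and "fin_digraph G'" "strongly_connected G'" "\<not> is_cycle_graph G'"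
    and "rooted_directed_tree (sole_subgraph G)"
    and "rooted_directed_tree (sole_subgraph G')"
    and "\<exists>e \<in> arcs G - \<F> G. Delta G e = int (nu G) - 1"
    and "\<exists>e \<in> arcs G' - \<F> G'. Delta G' e = int (nu G') - 1"
    and "topologically_conjugate (markov_dyck G) (markov_dyck G')"
  shows "digraph_iso G G'"
proof -
  obtain e where e: "e \<in> arcs G - \<F> G" "Delta G e = int (nu G) - 1" using assms(9) by blast
  have ne': "arcs G' - \<F> G' \<noteq> {}" using assms(10) by blast
  obtain r where r: "tree_digraph G r"
    using tree_digraph_if_rooted_directed_tree[OF assms(1,2,7)] e by blast
  obtain r' where r': "tree_digraph G' r'"
    using tree_digraph_if_rooted_directed_tree[OF assms(4,5,8) ne'] by blast
  interpret G: tree_digraph G r by (rule r)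
  interpret G': tree_digraph G' r' by (rule r')
  note counts = conjugate_path_counts[OF G.branched_digraph_axioms G'.branched_digraph_axioms assms(11)]
  obtain \<sigma> where \<sigma>: "bij_betw \<sigma> (arcs G - \<F> G) (arcs G' - \<F> G')"
    and len: "\<And>g. g \<in> arcs G - \<F> G \<Longrightarrow> length (G'.circuit (\<sigma> g)) = length (G.circuit g)"
    and wt: "\<And>g. g \<in> arcs G - \<F> G \<Longrightarrow> G'.circuit_weight (\<sigma> g) = G.circuit_weight g"
    using circuit_bijection[OF r r' counts(1)] by blast
  have nu: "nu G' = nu G" unfolding nu_def using bij_betw_same_card[OF \<sigma>] by simp
  \<comment> \<open>The image of \<open>e\<close> becomes the spine of \<open>G'\<close>: it
    satisfies the same equation, as \<open>Delta\<close> is determined by length and weight and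
    \<open>nu\<close> by the number of circuits.\<close>
  have e': "\<sigma> e \<in> arcs G' - \<F> G'" by (rule bij_betw_apply[OF \<sigma> e(1)])
  have "Delta G' (\<sigma> e) = int (nu G') - 1"
  proof -
    have "real_of_int (Delta G' (\<sigma> e)) = real_of_int (Delta G e)"
      using G.Delta_eq[OF e(1)] G.circuit_weight_nth_1[of e] G'.Delta_eq[OF e'] G'.circuit_weight_nth_1[of "\<sigma> e"]
        e(1) e' len[OF e(1)] wt[OF e(1)] by (simp add: sum_subtractf)
    then show ?thesis using e(2) nu by simp
  qed
  then have S': "spine_digraph G' r' (\<sigma> e)" by (rule spine_digraph_if_Delta[OF r' e'])
  have S: "spine_digraph G r e" by (rule spine_digraph_if_Delta[OF r e])
  \<comment> \<open>Equality of the counts for every single weight gives equality of the total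
    number of closed paths of length 2.\<close>
  have "card (periodic_paths G 2) = card (periodic_paths G' 2)"
  proof -
    have "\<exists>\<tau>. bij_betw \<tau> (periodic_paths G 2) (periodic_paths G' 2) \<and>
        (\<forall>y\<in>periodic_paths G 2. path_weight G' (\<tau> y) 2 = path_weight G y 2)"
      by (rule bij_betw_from_fibres[OF finite_periodic_paths[OF G.fin_digraph_axioms]
          finite_periodic_paths[OF G'.fin_digraph_axioms] counts(1)]) simp_all
    then show ?thesis using bij_betw_same_card by blast
  qed
  moreover have "card {x \<in> markov_dyck G. shiftn 2 x = x} = card {x \<in> markov_dyck G'. shiftn 2 x = x}"
    using counts(2)[of 2] by simp
  ultimately have "card (arcs G) = card (arcs G')"
    using card_period_2[OF r] card_period_2[OF r'] by linarith
  from level_bijection[OF S S' \<sigma> refl len wt this] show ?thesis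
    by (intro digraph_iso_if_levels[OF S S' \<sigma> len])
qed

end
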